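(* Let $\mu\subset\lambda$ and $\nu$ be partitions, and let $r\ge\ell(\lambda)$ and $s\ge\ell(\mu)$ be integers. Then $$s_\nu(x)\,G_{\lambda/\mu}(x)\equiv G\bigl(s_\nu(\boldsymbol u_r/\boldsymbol U_s)\cdot(\lambda,\mu)\bigr)\mod I_{r-s}.$$
   Context: Symmetric functions. $k=\mathbb{C}(\beta)$; $\Lambda$ is the $k$-algebra of symmetric functions in $x=(x_1,x_2,\dots)$, with Schur functions $s_\lambda$ and Hall inner product $\langle s_\lambda,s_\mu\rangle=\delta_{\lambda,\mu}$. $I_n=\mathrm{span}_k\{s_\lambda:\ell(\lambda)>n\}$ and $\widehat\Lambda=\varprojlim\Lambda/I_n$; elements of $\widehat\Lambda$ are formal sums $\sum c_\lambda s_\lambda$ such that for every $n$ only finitely many $\lambda$ with $\ell(\lambda)\le n$ have $c_\lambda\neq0$. $I_n$ also denotes its closure in $\widehat\Lambda$, i.e. the set of $f$ with $f(x_1,\dots,x_n,0,0,\dots)=0$ (all of $\widehat\Lambda$ if $n<0$). The Hall product extends to $\widehat\Lambda\times\Lambda\to k$. For $f\in\Lambda$, $f^\perp:\widehat\Lambda\to\widehat\Lambda$ is defined by $\langle f^\perp g,h\rangle=\langle g,fh\rangle$ for all $h\in\Lambda$. The stable Grothendieck polynomial $G_\lambda(x)\in\widehat\Lambda$ is the unique element such that for all $n\ge\ell(\lambda)$, $G_\lambda(x_1,\dots,x_n,0,0,\dots)=\det\bigl(x_i^{\lambda_j+n-j}(1+\beta x_i)^{j-1}\bigr)_{1\le i,j\le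 n}/\prod_{1\le i<j\le n}(x_i-x_j)$. The dual stable Grothendieck polynomials $g_\mu\in\Lambda$ are determined by $\langle G_\lambda,g_\mu\rangle=\delta_{\lambda,\mu}$. Put $G_{\lambda/\!\!/\mu}=g_\mu^\perp G_\lambda$. A rook strip is a skew diagram with at most one box in any row or column. The skew stable Grothendieck polynomials $G_{\lambda/\mu}(x)\in\widehat\Lambda$ ($\mu\subset\lambda$) are the unique elements satisfying $G_{\lambda/\!\!/\mu}(x)=\sum_{\sigma:\ \mu/\sigma\text{ rook strip}}\beta^{|\mu/\sigma|}G_{\lambda/\sigma}(x)$ for all $\mu\subset\lambda$ (the sum includes $\sigma=\mu$). Operators. For a finite integer sequence $n=(n_1,\dots,n_r)$ put $|n|=\sum n_i$, $\overline n_i=\max(n_i,n_{i+1},\dots,n_r)$, $\underline n_i=\min(n_1,\dots,n_i)$. $\mathbf e_i$ is the $i$-th unit vector. On the free $\mathbb Q[\beta]$-module on partitions (padded with zeros as needed) define linear operators $u_i\cdot\lambda=(-\beta)^{|\overline{\lambda+\mathbf e_i}|-|\lambda+\mathbf e_i|}\,\overline{\lambda+\mathbf e_i}$, and $U_i\cdot\mu=(-\beta)^{|\mu-\mathbf e_i|-|\underline{\mu-\mathbf e_i}|}\,\underline{\mu-\mathbf e_i}$ if $\mu_i>0$, $U_i\cdot\mu=0$ if $\mu_i=0$. They act on the module $\bigoplus_{\mu\subset\lambda}\mathbb Q[\beta]\cdot(\lambda,\mu)$ by $u_i\cdot(\lambda,\mu)=(u_i\cdot\lambda,\mu)$, $U_i\cdot(\lambda,\mu)=(\lambda,U_i\cdot\mu)$.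 $G$ is the $\mathbb Q[\beta]$-linear map from this module to $\widehat\Lambda$ with $(\lambda,\mu)\mapsto G_{\lambda/\mu}(x)$. Noncommutative Schur functions. The column word of a skew semistandard tableau $T$ (rows weakly increasing left to right, columns strictly increasing top to bottom) is obtained by reading each column bottom to top, columns from left to right. $s_{\kappa/\rho}(\boldsymbol u_m)=\sum_T u_{w_1}u_{w_2}\cdots u_{w_N}$, over skew semistandard tableaux $T$ of shape $\kappa/\rho$ with entries in $\{1<2<\dots<m\}$ and column word $w_1\cdots w_N$. $s_{\kappa/\rho}(\boldsymbol U_n)=\sum_{T'} U_{w_1}\cdots U_{w_N}$, over skew semistandard tableaux $T'$ of shape $\kappa/\rho$ with entries in $\{1',\dots,n'\}$ ordered by $1'>2'>\dots>n'$ and column word $w_1'\cdots w_N'$. Finally $s_\nu(\boldsymbol u_m/\boldsymbol U_n)=\sum_{\kappa\subset\nu}(-1)^{|\nu/\kappa|}\,s_{(\nu/\kappa)'}(\boldsymbol U_n)\,s_\kappa(\boldsymbol u_m)$, where $(\nu/\kappa)'$ is the transposed skew shape. *)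

theory Defs
  imports
    "HOL-Library.Poly_Mapping"
    "HOL-Library.FuncSet"
    "HOL-Computational_Algebra.Fraction_Field"
    "HOL-Computational_Algebra.Polynomial"
    "Jordan_Normal_Form.Determinant"
begin

section \<open>Formal power series in the variables \<open>x\<^sub>0, x\<^sub>1, x\<^sub>2, \<dots>\<close>\<close>

text \<open>
  Everything is indexed from 0: the variables, the parts of a partition, the boxes of a
  diagram, the entries of a tableau and the operators.  What is usually called
  \<open>x\<^sub>1, \<dots>, x\<^sub>n\<close> is here \<open>x\<^sub>0, \<dots>, x\<^bsub>n-1\<^esub>\<close>, and so on.
\<close>

typedef 'a mfps = "UNIV :: ((nat \<Rightarrow>\<^sub>0 nat) \<Rightarrow> 'a) set"
  morphisms mcoeff Abs_mfps
  by simp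

setup_lifting type_definition_mfps

lemma mfps_eqI: "(\<And>m. mcoeff f m = mcoeff g m) \<Longrightarrow> f = g"
  by (metis ext mcoeff_inject)

lemma mcoeff_Abs_mfps [simp]: "mcoeff (Abs_mfps f) = f"
  by (simp add: Abs_mfps_inverse)

definition splits :: "(nat \<Rightarrow>\<^sub>0 nat) \<Rightarrow> ((nat \<Rightarrow>\<^sub>0 nat) \<times> (nat \<Rightarrow>\<^sub>0 nat)) set" where
  "splits m = {(a, b). a + b = m}"

lemma finite_splits [simp]: "finite (splits m)"
proof -
  let ?N = "Max (insert 0 (Poly_Mapping.lookup m ` Poly_Mapping.keys m))"
  let ?F = "{f. \<forall>i. (i \<in> Poly_Mapping.keys m \<longrightarrow> f i \<in> {..?N}) \<and>
                    (i \<notin> Poly_Mapping.keys m \<longrightarrow> f i = 0)}"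
  have fin: "finite ?F"
    by (rule finite_set_of_finite_funs) auto
  have "(Poly_Mapping.lookup \<circ> fst) ` splits m \<subseteq> ?F"
  proof (clarsimp simp: splits_def, intro conjI impI)
    fix a b :: "nat \<Rightarrow>\<^sub>0 nat" and i
    show "Poly_Mapping.lookup a i
        \<le> Max (insert 0 (Poly_Mapping.lookup (a + b) ` Poly_Mapping.keys (a + b)))"
      if "i \<in> Poly_Mapping.keys (a + b)"
    proof -
      have "Poly_Mapping.lookup a i \<le> Poly_Mapping.lookup (a + b) i"
        by (simp add: lookup_add)
      also have "\<dots> \<le> Max (insert 0 (Poly_Mapping.lookup (a + b) ` Poly_Mapping.keys (a + b)))"
        using that by (intro Max_ge) auto
      finally show ?thesis .
    qed
    show "Poly_Mapping.lookup a i = 0" if "i \<notin> Poly_Mapping.keys (a + b)"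
      using that by (simp add: in_keys_iff lookup_add)
  qed
  with fin have "finite ((Poly_Mapping.lookup \<circ> fst) ` splits m)"
    by (rule rev_finite_subset)
  moreover have "inj_on (Poly_Mapping.lookup \<circ> fst) (splits m)"
    by (auto simp: inj_on_def splits_def)
  ultimately show ?thesis
    by (rule finite_imageD)
qed

instantiation mfps :: (comm_ring_1) comm_ring_1
begin

lift_definition zero_mfps :: "'a mfps" is "\<lambda>_. 0" .

lift_definition one_mfps :: "'a mfps" is "\<lambda>m. if m = 0 then 1 else 0" .

lift_definition plus_mfps :: "'a mfps \<Rightarrow> 'a mfps \<Rightarrow> 'a mfps" is "\<lambda>f g m. f m + g m" .

lift_definition minus_mfps :: "'a mfps \<Rightarrow> 'a mfps \<Rightarrow> 'a mfps" is "\<lambda>f g m. f m - g m" .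

lift_definition uminus_mfps :: "'a mfps \<Rightarrow> 'a mfps" is "\<lambda>f m. - f m" .

lift_definition times_mfps :: "'a mfps \<Rightarrow> 'a mfps \<Rightarrow> 'a mfps"
  is "\<lambda>f g m. \<Sum>(a, b)\<in>splits m. f a * g b" .

instance
proof
  fix f g h :: "'a mfps"
  show "f * g * h = f * (g * h)"
  proof (transfer, rule ext)
    fix f g h :: "(nat \<Rightarrow>\<^sub>0 nat) \<Rightarrow> 'a" and m
    have "(\<Sum>(a, b)\<in>splits m. (\<Sum>(c, d)\<in>splits a. f c * g d) * h b)
        = (\<Sum>(a, b)\<in>splits m. \<Sum>(c, d)\<in>splits a. f c * g d * h b)"
      by (simp only: sum_distrib_right case_prod_unfold)
    also have "\<dots> = (\<Sum>x\<in>splits m. \<Sum>y\<in>splits (fst x). f (fst y) * g (snd y) * h (snd x))"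
      by (simp only: case_prod_unfold)
    also have "\<dots> = (\<Sum>(x, y)\<in>Sigma (splits m) (\<lambda>x. splits (fst x)).
        f (fst y) * g (snd y) * h (snd x))"
      by (rule sum.Sigma) simp_all
    also have "\<dots> = (\<Sum>(x, y)\<in>Sigma (splits m) (\<lambda>x. splits (snd x)).
        f (fst x) * (g (fst y) * h (snd y)))"
      by (rule sum.reindex_bij_witness
          [where i = "\<lambda>(x, y). ((fst x + fst y, snd y), (fst x, fst y))"
             and j = "\<lambda>(x, y). ((fst y, snd y + snd x), (snd y, snd x))"])
        (auto simp only: splits_def case_prod_unfold fst_conv snd_conv mem_Collect_eq mem_Sigma_iff
          prod.collapse add.assoc mult.assoc)
    also have "\<dots> = (\<Sum>x\<in>splits m. \<Sum>y\<in>splits (snd x). f (fst x) * (g (fst y) * h (snd y)))"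
      by (rule sum.Sigma [symmetric]) simp_all
    also have "\<dots> = (\<Sum>(a, b)\<in>splits m. f a * (\<Sum>(c, d)\<in>splits b. g c * h d))"
      by (simp only: sum_distrib_left case_prod_unfold)
    finally show "(\<Sum>(a, b)\<in>splits m. (\<Sum>(c, d)\<in>splits a. f c * g d) * h b)
        = (\<Sum>(a, b)\<in>splits m. f a * (\<Sum>(c, d)\<in>splits b. g c * h d))" .
  qed
  show "f * g = g * f"
  proof (transfer, rule ext)
    fix f g :: "(nat \<Rightarrow>\<^sub>0 nat) \<Rightarrow> 'a" and m
    show "(\<Sum>(a, b)\<in>splits m. f a * g b) = (\<Sum>(a, b)\<in>splits m. g a * f b)"
      by (rule sum.reindex_bij_witness [where i = prod.swap and j = prod.swap])
        (auto simp: splits_def ac_simps)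
  qed
  show "1 * f = f"
  proof (transfer, rule ext)
    fix f :: "(nat \<Rightarrow>\<^sub>0 nat) \<Rightarrow> 'a" and m
    have "(\<Sum>(a, b)\<in>splits m. (if a = 0 then 1 else 0) * f b)
        = (\<Sum>(a, b)\<in>{(0 :: nat \<Rightarrow>\<^sub>0 nat, m)}. (if a = 0 then 1 else 0) * f b)"
      by (rule sum.mono_neutral_right [OF finite_splits]) (auto simp: splits_def split: if_splits)
    then show "(\<Sum>(a, b)\<in>splits m. (if a = 0 then 1 else 0) * f b) = f m"
      by simp
  qed
  show "(f + g) * h = f * h + g * h"
    by transfer (simp add: fun_eq_iff sum.distrib [symmetric] distrib_right case_prod_unfold)
  show "(0 :: 'a mfps) \<noteq> 1"
    by transfer (auto simp: fun_eq_iff)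
  show "f + g + h = f + (g + h)"
    by transfer (simp add: add.assoc)
  show "f + g = g + f"
    by transfer (simp add: add.commute)
  show "0 + f = f"
    by transfer simp
  show "- f + f = 0"
    by transfer simp
  show "f - g = f + - g"
    by transfer simp
qed

end

definition mconst :: "'a::zero \<Rightarrow> 'a mfps" where
  "mconst c = Abs_mfps (\<lambda>m. if m = 0 then c else 0)"

definition mX :: "nat \<Rightarrow> 'a::comm_ring_1 mfps" where
  "mX i = Abs_mfps (\<lambda>m. if m = Poly_Mapping.single i 1 then 1 else 0)"

text \<open>\<open>first_vars n f\<close> is \<open>f(x\<^sub>0, \<dots>, x\<^bsub>n-1\<^esub>, 0, 0, \<dots>)\<close>.\<close>

definition first_vars :: "nat \<Rightarrow> 'a::zero mfps \<Rightarrow> 'a mfps" where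
  "first_vars n f = Abs_mfps (\<lambda>m. if Poly_Mapping.keys m \<subseteq> {..<n} then mcoeff f m else 0)"

section \<open>Partitions, diagrams and tableaux\<close>

text \<open>
  A partition is a weakly decreasing sequence of natural numbers with finitely many nonzero
  terms; padding with zeros is thus built in, and containment of partitions is the
  pointwise order \<open>\<le>\<close> on functions.
\<close>

type_synonym shape = "nat \<Rightarrow> nat"

definition is_partition :: "shape \<Rightarrow> bool" where
  "is_partition p \<longleftrightarrow> antimono p \<and> finite {i. p i \<noteq> 0}"

definition part_length :: "shape \<Rightarrow> nat" where
  "part_length p = card {i. p i \<noteq> 0}"

definition seq_size :: "shape \<Rightarrow> nat" where
  "seq_size p = (\<Sum>i | p i \<noteq> 0. p i)"

definition conj_part :: "shape \<Rightarrow> shape" where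
  "conj_part p = (\<lambda>j. card {i. j < p i})"

definition skew_diagram :: "shape \<Rightarrow> shape \<Rightarrow> (nat \<times> nat) set" where
  "skew_diagram p q = {(i, j). q i \<le> j \<and> j < p i}"

definition skew_size :: "shape \<Rightarrow> shape \<Rightarrow> nat" where
  "skew_size p q = card (skew_diagram p q)"

definition rook_strip :: "shape \<Rightarrow> shape \<Rightarrow> bool" where
  "rook_strip p q \<longleftrightarrow> is_partition p \<and> is_partition q \<and> q \<le> p \<and>
     (\<forall>a\<in>skew_diagram p q. \<forall>b\<in>skew_diagram p q. a \<noteq> b \<longrightarrow> fst a \<noteq> fst b \<and> snd a \<noteq> snd b)"

text \<open>
  Semistandard tableaux of shape \<open>p/q\<close> with entries in \<open>A\<close>, where \<open>A\<close> is totally ordered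
  by the strict order \<open>lt\<close>.
\<close>

definition ssyt ::
  "(nat \<Rightarrow> nat \<Rightarrow> bool) \<Rightarrow> nat set \<Rightarrow> shape \<Rightarrow> shape \<Rightarrow> (nat \<times> nat \<Rightarrow> nat) set" where
  "ssyt lt A p q = {T \<in> skew_diagram p q \<rightarrow>\<^sub>E A.
     (\<forall>i j j'. (i, j) \<in> skew_diagram p q \<and> (i, j') \<in> skew_diagram p q \<and> j < j'
        \<longrightarrow> lt (T (i, j)) (T (i, j')) \<or> T (i, j) = T (i, j')) \<and>
     (\<forall>i i' j. (i, j) \<in> skew_diagram p q \<and> (i', j) \<in> skew_diagram p q \<and> i < i'
        \<longrightarrow> lt (T (i, j)) (T (i', j)))}"

definition column_word :: "shape \<Rightarrow> shape \<Rightarrow> (nat \<times> nat \<Rightarrow> nat) \<Rightarrow> nat list" where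
  "column_word p q T =
     concat (map (\<lambda>j. map (\<lambda>i. T (i, j))
                        (rev (filter (\<lambda>i. (i, j) \<in> skew_diagram p q) [0..<part_length p])))
               [0..<p 0])"

section \<open>Symmetric functions\<close>

type_synonym K = "complex poly fract"

definition beta :: K where
  "beta = Fraction_Field.Fract [:0, 1:] 1"

definition tableau_weight :: "shape \<Rightarrow> (nat \<times> nat \<Rightarrow> nat) \<Rightarrow> (nat \<Rightarrow>\<^sub>0 nat)" where
  "tableau_weight p T = (\<Sum>b\<in>skew_diagram p (\<lambda>_. 0). Poly_Mapping.single (T b) 1)"

definition schur :: "shape \<Rightarrow> K mfps" where
  "schur p = Abs_mfps (\<lambda>m. of_nat (card {T \<in> ssyt (<) UNIV p (\<lambda>_. 0). tableau_weight p T = m}))"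

text \<open>\<open>Lam\<close> consists of the symmetric power series of bounded degree.\<close>

definition Lam :: "K mfps set" where
  "Lam = {f. (\<forall>\<pi> m. bij \<pi> \<longrightarrow> mcoeff f (Poly_Mapping.map_key \<pi> m) = mcoeff f m) \<and>
             (\<exists>d. \<forall>m. mcoeff f m \<noteq> 0 \<longrightarrow> (\<Sum>i\<in>Poly_Mapping.keys m. Poly_Mapping.lookup m i) \<le> d)}"

text \<open>
  \<open>Lam_hat\<close> is the completion of \<open>Lam\<close>: the formal sums \<open>\<Sum> c\<^sub>p s\<^sub>p\<close> such that, for each \<open>n\<close>,
  only finitely many \<open>p\<close> of length at most \<open>n\<close> occur.  A formal sum is identified with the power
  series it represents; each coefficient of that series is a finite sum because \<open>s\<^sub>p\<close> is
  homogeneous of degree \<open>|p|\<close>.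
\<close>

definition schur_coeffs_ok :: "(shape \<Rightarrow> K) \<Rightarrow> bool" where
  "schur_coeffs_ok c \<longleftrightarrow> (\<forall>p. c p \<noteq> 0 \<longrightarrow> is_partition p) \<and>
     (\<forall>n. finite {p. c p \<noteq> 0 \<and> part_length p \<le> n})"

definition schur_sum :: "(shape \<Rightarrow> K) \<Rightarrow> K mfps" where
  "schur_sum c = Abs_mfps (\<lambda>m. Sum_any (\<lambda>p. c p * mcoeff (schur p) m))"

definition Lam_hat :: "K mfps set" where
  "Lam_hat = schur_sum ` {c. schur_coeffs_ok c}"

definition schur_coeff :: "K mfps \<Rightarrow> shape \<Rightarrow> K" where
  "schur_coeff f = (THE c. schur_coeffs_ok c \<and> f = schur_sum c)"

text \<open>The Hall product, meaningful on \<open>Lam_hat \<times> Lam\<close>.\<close>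

definition hall :: "K mfps \<Rightarrow> K mfps \<Rightarrow> K" where
  "hall f g = Sum_any (\<lambda>p. schur_coeff f p * schur_coeff g p)"

definition perp :: "K mfps \<Rightarrow> K mfps \<Rightarrow> K mfps" where
  "perp f g = (THE g'. g' \<in> Lam_hat \<and> (\<forall>h\<in>Lam. hall g' h = hall g (f * h)))"

definition I_hat :: "int \<Rightarrow> K mfps set" where
  "I_hat n = {f \<in> Lam_hat. 0 \<le> n \<longrightarrow> first_vars (nat n) f = 0}"

section \<open>Stable Grothendieck polynomials\<close>

definition groth_num :: "nat \<Rightarrow> shape \<Rightarrow> K mfps" where
  "groth_num n p = Determinant.det
     (mat n n (\<lambda>(i, j). mX i ^ (p j + (n - 1 - j)) * (1 + mconst beta * mX i) ^ j))"

definition vandermonde :: "nat \<Rightarrow> K mfps" where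
  "vandermonde n = (\<Prod>(i, j)\<in>{(i, j). i < j \<and> j < n}. mX i - mX j)"

text \<open>
  The defining quotient of alternants is written with the denominator multiplied out.
\<close>

definition Groth :: "shape \<Rightarrow> K mfps" where
  "Groth p = (THE f. f \<in> Lam_hat \<and>
     (\<forall>n\<ge>part_length p. first_vars n f * vandermonde n = groth_num n p))"

definition dual_Groth :: "shape \<Rightarrow> K mfps" where
  "dual_Groth q = (THE g. g \<in> Lam \<and>
     (\<forall>p. is_partition p \<longrightarrow> hall (Groth p) g = (if p = q then 1 else 0)))"

text \<open>\<open>Groth_dskew p q\<close> is \<open>G\<close> with the double-slash index \<open>p//q\<close>.\<close>

definition Groth_dskew :: "shape \<Rightarrow> shape \<Rightarrow> K mfps" where
  "Groth_dskew p q = perp (dual_Groth q) (Groth p)"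

text \<open>
  The values outside the pairs \<open>q \<subseteq> p\<close> of partitions are irrelevant; they are fixed to be 0 to
  make the family unique.
\<close>

definition Groth_skew :: "shape \<Rightarrow> shape \<Rightarrow> K mfps" where
  "Groth_skew = (THE F.
     (\<forall>p q. is_partition p \<and> is_partition q \<and> q \<le> p \<longrightarrow>
        F p q \<in> Lam_hat \<and>
        Groth_dskew p q = (\<Sum>\<sigma> | rook_strip q \<sigma>. mconst (beta ^ skew_size q \<sigma>) * F p \<sigma>)) \<and>
     (\<forall>p q. \<not> (is_partition p \<and> is_partition q \<and> q \<le> p) \<longrightarrow> F p q = 0))"

section \<open>The operators on pairs of partitions\<close>

text \<open>
  \<open>rat poly\<close> is \<open>\<rat>[\<beta>]\<close>, and \<open>'a \<Rightarrow>\<^sub>0 rat poly\<close> is the free \<open>\<rat>[\<beta>]\<close>-module on \<open>'a\<close>.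
\<close>

definition scale :: "'c::comm_ring_1 \<Rightarrow> ('a \<Rightarrow>\<^sub>0 'c) \<Rightarrow> ('a \<Rightarrow>\<^sub>0 'c)" where
  "scale c v = Poly_Mapping.map ((*) c) v"

definition lin_ext ::
  "('a \<Rightarrow> 'b \<Rightarrow>\<^sub>0 'c::comm_ring_1) \<Rightarrow> ('a \<Rightarrow>\<^sub>0 'c) \<Rightarrow> ('b \<Rightarrow>\<^sub>0 'c)" where
  "lin_ext f v = (\<Sum>a\<in>Poly_Mapping.keys v. scale (Poly_Mapping.lookup v a) (f a))"

definition neg_beta_pow :: "nat \<Rightarrow> rat poly" where
  "neg_beta_pow d = (- [:0, 1:]) ^ d"

text \<open>
  The sequences that occur below have natural entries, so continuing them by zeros changes
  neither the maxima nor the minima.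
\<close>

definition over_seq :: "shape \<Rightarrow> shape" where
  "over_seq a = (\<lambda>i. Max (a ` {i..}))"

definition under_seq :: "shape \<Rightarrow> shape" where
  "under_seq a = (\<lambda>i. Min (a ` {..i}))"

definition u_part :: "nat \<Rightarrow> shape \<Rightarrow> shape \<Rightarrow>\<^sub>0 rat poly" where
  "u_part i p = (let a = p(i := p i + 1) in
     Poly_Mapping.single (over_seq a) (neg_beta_pow (seq_size (over_seq a) - seq_size a)))"

definition U_part :: "nat \<Rightarrow> shape \<Rightarrow> shape \<Rightarrow>\<^sub>0 rat poly" where
  "U_part i q = (if q i = 0 then 0 else let a = q(i := q i - 1) in
     Poly_Mapping.single (under_seq a) (neg_beta_pow (seq_size a - seq_size (under_seq a))))"

type_synonym pair_module = "(shape \<times> shape) \<Rightarrow>\<^sub>0 rat poly"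

definition u_op :: "nat \<Rightarrow> pair_module \<Rightarrow> pair_module" where
  "u_op i = lin_ext (\<lambda>(p, q). lin_ext (\<lambda>p'. Poly_Mapping.single (p', q) 1) (u_part i p))"

definition U_op :: "nat \<Rightarrow> pair_module \<Rightarrow> pair_module" where
  "U_op i = lin_ext (\<lambda>(p, q). lin_ext (\<lambda>q'. Poly_Mapping.single (p, q') 1) (U_part i q))"

text \<open>The composite \<open>F w\<^sub>1 \<circ> \<dots> \<circ> F w\<^sub>N\<close>, so the last letter acts first.\<close>

definition word_op :: "(nat \<Rightarrow> 'v \<Rightarrow> 'v) \<Rightarrow> nat list \<Rightarrow> 'v \<Rightarrow> 'v" where
  "word_op F w = foldr F w"

definition schur_u :: "nat \<Rightarrow> shape \<Rightarrow> shape \<Rightarrow> pair_module \<Rightarrow> pair_module" where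
  "schur_u m p q v = (\<Sum>T\<in>ssyt (<) {..<m} p q. word_op u_op (column_word p q T) v)"

text \<open>The alphabet of the \<open>U\<close> is ordered decreasingly.\<close>

definition schur_U :: "nat \<Rightarrow> shape \<Rightarrow> shape \<Rightarrow> pair_module \<Rightarrow> pair_module" where
  "schur_U n p q v = (\<Sum>T\<in>ssyt (>) {..<n} p q. word_op U_op (column_word p q T) v)"

definition super_schur :: "nat \<Rightarrow> nat \<Rightarrow> shape \<Rightarrow> pair_module \<Rightarrow> pair_module" where
  "super_schur m n p v = (\<Sum>q | is_partition q \<and> q \<le> p.
     scale ((-1) ^ skew_size p q)
       (schur_U n (conj_part p) (conj_part q) (schur_u m q (\<lambda>_. 0) v)))"

definition scalar_emb :: "rat poly \<Rightarrow> K" where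
  "scalar_emb c = Fraction_Field.Fract (map_poly of_rat c) 1"

definition G_map :: "pair_module \<Rightarrow> K mfps" where
  "G_map v = (\<Sum>(p, q)\<in>Poly_Mapping.keys v.
     mconst (scalar_emb (Poly_Mapping.lookup v (p, q))) * Groth_skew p q)"

end

theory Submission
  imports Defs "HOL-Combinatorics.Permutations"
begin

text \<open>
  Multiplying the alternant that defines \<open>G\<^sub>l\<close> by a skew Schur polynomial and straightening column by
  column lets each tableau act on \<open>l\<close> through its column word in the operators \<open>u\<close>: when \<open>a\<^bsub>k+1\<^esub> = a\<^sub>k + 1\<close>,
  multiplication of the summand by \<open>x\<^sub>k\<close> only divides its alternant by \<open>-\<beta>\<close>, provided that the cofactor is
  symmetric in \<open>x\<^sub>k, x\<^bsub>k+1\<^esub>\<close>, and a Bender-Knuth involution supplies this symmetry.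

  Split \<open>r\<close> variables \<open>z\<close> into \<open>r - s\<close> variables \<open>x\<close> and \<open>s\<close> variables \<open>y\<close>.  A sign-reversing involution
  writes \<open>s\<^sub>\<nu>(x)\<close> as \<open>\<Sum> (-1)\<^bsup>|\<nu>/\<kappa>|\<^esup> s\<^sub>\<kappa>(z) s\<^bsub>(\<nu>/\<kappa>)'\<^esub>(y)\<close>, and \<open>G\<^sub>\<lambda>(z) = \<Sum> G\<^bsub>\<lambda>//\<mu>\<^esub>(x) G\<^sub>\<mu>(y)\<close>.  In
  \<open>s\<^sub>\<nu>(x) G\<^sub>\<lambda>(z)\<close> the factors \<open>s\<^sub>\<kappa>(z)\<close> act on \<open>\<lambda>\<close>, and the factors in \<open>y\<close> act on \<open>\<mu>\<close>, through tableaux turned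
  by 180 degrees because of the reversed alphabet.  Comparing coefficients of \<open>G\<^sub>\<mu>(y)\<close> expresses
  \<open>s\<^sub>\<nu> G\<^bsub>\<lambda>//\<mu>\<^esub>\<close> by the transposes of the \<open>u\<close> in the index \<open>\<mu>\<close>.  The unitriangular sum over rook strips, which
  passes from \<open>G\<^bsub>\<lambda>/\<mu>\<^esub>\<close> to \<open>G\<^bsub>\<lambda>//\<mu>\<^esub>\<close>, conjugates these transposes to the operators \<open>U\<close>.
\<close>

text \<open>The words in the U come out right because two reversals cancel: a half-turn of a tableau
  reverses its column word, and transposing a composite reverses it again.

  The ideal I_(r-s) appears because only r - s variables x remain once s variables y are set aside
  to carry the index \<mu>. In fewer variables y than the length of \<mu>, G_\<mu>(y) is zero and
  its coefficient would be lost; hence the lower bound on s.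

  G_\<lambda>(x, y) has infinitely many terms G_\<mu>(y). To keep every sum finite, an exponent
  \<alpha> of x is fixed and monomials in y are compared degree by degree. Identities in the index
  \<mu> thereby become identities between \<open>K\<close>-valued functions on partitions, on which
  transposes and rook sums are plain finite sums.

  The alternants carry a parameter b: b = \<open>beta\<close> gives G and b = 0 gives Schur
  functions. The same straightening thus yields the bialternant formula, and on it rest the
  existence of G, the Pieri rule and, through it, the Hall product and the coproduct, all of which
  the definite descriptions in the definitions make it necessary to establish.\<close>

abbreviation (input) lk where "lk \<equiv> Poly_Mapping.lookup"
abbreviation (input) ks where "ks \<equiv> Poly_Mapping.keys"
abbreviation (input) sg where "sg \<equiv> Poly_Mapping.single"

subsection \<open>Coefficients and monomials\<close>

lemma mcoeff_zero [simp]: "mcoeff 0 m = 0"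
  and mcoeff_one: "mcoeff 1 m = (if m = 0 then 1 else 0)"
  and mcoeff_add [simp]: "mcoeff (f + g) m = mcoeff f m + mcoeff g m"
  and mcoeff_diff [simp]: "mcoeff (f - g) m = mcoeff f m - mcoeff g m"
  and mcoeff_uminus [simp]: "mcoeff (- f) m = - mcoeff f m"
  and mcoeff_mult: "mcoeff (f * g) m = (\<Sum>(a, b)\<in>splits m. mcoeff f a * mcoeff g b)"
  by (simp_all add: zero_mfps.rep_eq one_mfps.rep_eq plus_mfps.rep_eq minus_mfps.rep_eq
      uminus_mfps.rep_eq times_mfps.rep_eq)

lemma mcoeff_sum [simp]: "mcoeff (sum f A) m = (\<Sum>a\<in>A. mcoeff (f a) m)"
  by (induction A rule: infinite_finite_induct) auto

lemma mcoeff_mconst_mult [simp]: "mcoeff (mconst c * f) m = c * mcoeff f m"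
proof -
  have "mcoeff (mconst c * f) m = (\<Sum>(a, b)\<in>splits m. (if a = 0 then c else 0) * mcoeff f b)"
    by (simp add: mcoeff_mult mconst_def)
  also have "\<dots> = (\<Sum>(a, b)\<in>{(0 :: nat \<Rightarrow>\<^sub>0 nat, m)}. (if a = 0 then c else 0) * mcoeff f b)"
    by (rule sum.mono_neutral_right [OF finite_splits]) (auto simp: splits_def split: if_splits)
  finally show ?thesis by simp
qed

lemma mcoeff_mconst: "mcoeff (mconst c) m = (if m = 0 then c else 0)"
  by (simp add: mconst_def)

lemma mconst_1 [simp]: "mconst (1 :: 'a::comm_ring_1) = 1"
  and mconst_0 [simp]: "mconst (0 :: 'a::comm_ring_1) = 0"
  and mconst_mult: "mconst (c * d) = mconst c * mconst (d :: 'a::comm_ring_1)"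
  and mconst_add: "mconst (c + d) = mconst c + mconst (d :: 'a::comm_ring_1)"
  and mconst_uminus: "mconst (- c) = - mconst (c :: 'a::comm_ring_1)"
  by (auto intro!: mfps_eqI simp: mcoeff_one mcoeff_mconst)

lemma mconst_sum: "mconst (sum f A) = (\<Sum>a\<in>A. mconst (f a :: 'a::comm_ring_1))"
  by (induction A rule: infinite_finite_induct) (simp_all add: mconst_add)

lemma mconst_of_int: "mconst (of_int n :: 'a::comm_ring_1) = of_int n"
proof -
  have nat: "mconst (of_nat k :: 'a) = of_nat k" for k
    by (induction k) (simp_all add: mconst_add)
  have "mconst (of_int (- int k) :: 'a) = of_int (- int k)" for k
    by (simp add: nat mconst_uminus)
  then show ?thesis using nat by (cases n rule: int_cases2) auto
qed

section \<open>Monomials and their total degree\<close>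

definition xpow :: "(nat \<Rightarrow>\<^sub>0 nat) \<Rightarrow> 'a::comm_ring_1 mfps" where
  "xpow m = Abs_mfps (\<lambda>m'. if m' = m then 1 else 0)"

lemma mcoeff_xpow: "mcoeff (xpow m) m' = (if m' = m then 1 else 0)"
  by (simp add: xpow_def)

lemma xpow_0 [simp]: "xpow 0 = 1"
  by (auto intro!: mfps_eqI simp: mcoeff_one mcoeff_xpow)

lemma mcoeff_xpow_mult [simp]: "mcoeff (xpow a * f) (a + k) = mcoeff f k"
proof -
  have "mcoeff (xpow a * f) (a + k)
      = (\<Sum>(c, d)\<in>splits (a + k). (if c = a then 1 else 0) * mcoeff f d)"
    by (simp add: mcoeff_mult mcoeff_xpow)
  also have "\<dots> = (\<Sum>(c, d)\<in>{(a, k)}. (if c = a then 1 else 0) * mcoeff f d)"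
    by (rule sum.mono_neutral_right [OF finite_splits]) (auto simp: splits_def split: if_splits)
  finally show ?thesis by simp
qed

lemma mcoeff_xpow_mult_eq_0: "(\<And>k. m \<noteq> a + k) \<Longrightarrow> mcoeff (xpow a * f) m = 0"
  by (force simp: mcoeff_mult mcoeff_xpow splits_def intro!: sum.neutral)

lemma xpow_add: "xpow (a + b) = xpow a * xpow b"
proof (rule mfps_eqI)
  fix m
  show "mcoeff (xpow (a + b)) m = mcoeff (xpow a * xpow b :: 'a mfps) m"
  proof (cases "\<exists>k. m = a + k")
    case True
    then show ?thesis by (auto simp: mcoeff_xpow)
  next
    case False
    then show ?thesis by (subst mcoeff_xpow_mult_eq_0) (auto simp: mcoeff_xpow)
  qed
qed

lemma xpow_sum: "xpow (sum f A) = (\<Prod>a\<in>A. xpow (f a))"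
  by (induction A rule: infinite_finite_induct) (simp_all add: xpow_add)

lemma mX_eq_xpow: "mX i = xpow (sg i 1)"
  by (simp add: mX_def xpow_def)

lemma mX_power: "mX i ^ k = xpow (sg i k)"
  by (induction k) (simp_all add: mX_eq_xpow xpow_add [symmetric] single_add [symmetric])

definition mdeg :: "(nat \<Rightarrow>\<^sub>0 nat) \<Rightarrow> nat" where
  "mdeg m = (\<Sum>i\<in>ks m. lk m i)"

lemma mdeg_superset: "finite A \<Longrightarrow> ks m \<subseteq> A \<Longrightarrow> mdeg m = (\<Sum>i\<in>A. lk m i)"
  unfolding mdeg_def by (rule sum.mono_neutral_left) (auto simp: in_keys_iff)

lemma mdeg_add [simp]: "mdeg (a + b) = mdeg a + mdeg b"
proof -
  let ?A = "ks a \<union> ks b"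
  have "ks (a + b) \<subseteq> ?A" by (rule Poly_Mapping.keys_add)
  then show ?thesis
    by (simp add: mdeg_superset [of ?A] lookup_add sum.distrib)
qed

lemma mdeg_0 [simp]: "mdeg 0 = 0"
  and mdeg_single [simp]: "mdeg (sg i k) = k"
  by (simp_all add: mdeg_def)

lemma mdeg_sum: "mdeg (sum f A) = (\<Sum>a\<in>A. mdeg (f a))"
  by (induction A rule: infinite_finite_induct) auto

lemma keys_add_nat: "ks (a + b :: nat \<Rightarrow>\<^sub>0 nat) = ks a \<union> ks b"
  by (auto simp: in_keys_iff lookup_add)

lemma keys_bounded: obtains n where "ks (m :: nat \<Rightarrow>\<^sub>0 nat) \<subseteq> {..<n}"
  using finite_nat_bounded [OF finite_keys] by blast

lemma finite_mdeg_keys: "finite {m :: nat \<Rightarrow>\<^sub>0 nat. ks m \<subseteq> {..<n} \<and> mdeg m = d}"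
proof -
  have "finite {f. \<forall>i. (i \<in> {..<n} \<longrightarrow> f i \<in> {..d}) \<and> (i \<notin> {..<n} \<longrightarrow> f i = (0 :: nat))}"
    by (rule finite_set_of_finite_funs) auto
  moreover have "lk ` {m. ks m \<subseteq> {..<n} \<and> mdeg m = d} \<subseteq>
      {f. \<forall>i. (i \<in> {..<n} \<longrightarrow> f i \<in> {..d}) \<and> (i \<notin> {..<n} \<longrightarrow> f i = (0 :: nat))}"
  proof (clarsimp, intro conjI impI)
    fix m :: "nat \<Rightarrow>\<^sub>0 nat" and i
    assume "ks m \<subseteq> {..<n}"
    show "lk m i \<le> mdeg m" if "i < n"
      using \<open>ks m \<subseteq> {..<n}\<close> that by (auto simp: mdeg_superset [of "{..<n}"] intro!: member_le_sum)
    show "lk m i = 0" if "\<not> i < n"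
      using \<open>ks m \<subseteq> {..<n}\<close> that by (auto simp: in_keys_iff)
  qed
  ultimately have "finite (lk ` {m. ks m \<subseteq> {..<n} \<and> mdeg m = d})"
    by (rule finite_subset [rotated])
  then show ?thesis by (rule finite_imageD) (auto simp: inj_on_def)
qed

subsection \<open>Restriction to the first variables\<close>

lemma mcoeff_first_vars: "mcoeff (first_vars n f) m = (if ks m \<subseteq> {..<n} then mcoeff f m else 0)"
  by (simp add: first_vars_def)

lemma first_vars_mult: "first_vars n (f * g) = first_vars n f * first_vars n (g :: 'a::comm_ring_1 mfps)"
  by (rule mfps_eqI)
    (auto simp: mcoeff_first_vars mcoeff_mult splits_def keys_add_nat intro!: sum.cong sum.neutral
      split: if_splits)

lemma first_vars_add [simp]: "first_vars n (f + g :: 'a::comm_ring_1 mfps) = first_vars n f + first_vars n g"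
  and first_vars_diff [simp]: "first_vars n (f - g :: 'a::comm_ring_1 mfps) = first_vars n f - first_vars n g"
  and first_vars_0 [simp]: "first_vars n (0 :: 'a::comm_ring_1 mfps) = 0"
  and first_vars_1 [simp]: "first_vars n (1 :: 'a::comm_ring_1 mfps) = 1"
  and first_vars_mconst [simp]: "first_vars n (mconst c) = mconst (c :: 'a::comm_ring_1)"
  by (auto intro!: mfps_eqI simp: mcoeff_first_vars mcoeff_one mcoeff_mconst)

lemma first_vars_sum: "first_vars n (sum f A :: 'a::comm_ring_1 mfps) = (\<Sum>a\<in>A. first_vars n (f a))"
  by (induction A rule: infinite_finite_induct) auto

lemma first_vars_prod: "first_vars n (prod f A :: 'a::comm_ring_1 mfps) = (\<Prod>a\<in>A. first_vars n (f a))"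
  by (induction A rule: infinite_finite_induct) (auto simp: first_vars_mult)

lemma first_vars_power: "first_vars n (f ^ k :: 'a::comm_ring_1 mfps) = first_vars n f ^ k"
  by (induction k) (auto simp: first_vars_mult)

lemma first_vars_xpow: "first_vars n (xpow m) = (if ks m \<subseteq> {..<n} then xpow m else 0)"
  by (rule mfps_eqI) (simp add: mcoeff_first_vars mcoeff_xpow)

lemma first_vars_mX: "first_vars n (mX i) = (if i < n then mX i else 0)"
  by (simp add: mX_eq_xpow first_vars_xpow)

lemma first_vars_first_vars: "first_vars k (first_vars n f) = first_vars (min k n) f"
  by (auto intro!: mfps_eqI simp: mcoeff_first_vars lessThan_def subset_eq)

lemma first_vars_eqI: "(\<And>n. n \<ge> n0 \<Longrightarrow> first_vars n f = first_vars n g) \<Longrightarrow> f = g"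
proof (rule mfps_eqI)
  fix m :: "nat \<Rightarrow>\<^sub>0 nat"
  assume eq: "\<And>n. n \<ge> n0 \<Longrightarrow> first_vars n f = first_vars n g"
  obtain k where "ks m \<subseteq> {..<k}" using keys_bounded [of m] by blast
  then have "ks m \<subseteq> {..<max k n0}" by fastforce
  then show "mcoeff f m = mcoeff g m"
    using arg_cong [OF eq [of "max k n0"], of "\<lambda>h. mcoeff h m"] by (simp add: mcoeff_first_vars)
qed

subsection \<open>Permuting the variables\<close>

text \<open>Pulling exponents back along \<pi> amounts to substituting x_(\<pi> i) for x_i, and
  makes this a left action (\<open>permvars_mX\<close>, \<open>permvars_comp\<close>).\<close>

definition permvars :: "(nat \<Rightarrow> nat) \<Rightarrow> 'a mfps \<Rightarrow> 'a mfps" where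
  "permvars \<pi> f = Abs_mfps (\<lambda>m. mcoeff f (Poly_Mapping.map_key \<pi> m))"

lemma mcoeff_permvars: "mcoeff (permvars \<pi> f) m = mcoeff f (Poly_Mapping.map_key \<pi> m)"
  by (simp add: permvars_def)

lemma lookup_map_key: "inj \<pi> \<Longrightarrow> lk (Poly_Mapping.map_key \<pi> m) i = lk m (\<pi> i)"
  by (simp add: map_key.rep_eq)

lemma map_key_inv: "bij \<pi> \<Longrightarrow> Poly_Mapping.map_key \<pi> (Poly_Mapping.map_key (inv_into UNIV \<pi>) m) = m"
  "bij \<pi> \<Longrightarrow> Poly_Mapping.map_key (inv_into UNIV \<pi>) (Poly_Mapping.map_key \<pi> m) = m"
  by (auto intro!: poly_mapping_eqI simp: lookup_map_key bij_is_inj bij_imp_bij_inv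
      inv_f_f [OF bij_is_inj] surj_f_inv_f [OF bij_is_surj])

lemma map_key_eq_iff: "bij (\<pi> :: 'b \<Rightarrow> 'b) \<Longrightarrow> Poly_Mapping.map_key \<pi> m = m' \<longleftrightarrow> m = Poly_Mapping.map_key (inv_into UNIV \<pi>) m'"
  by (auto simp: map_key_inv)

lemma mdeg_map_key: "bij \<pi> \<Longrightarrow> mdeg (Poly_Mapping.map_key \<pi> m) = mdeg m"
  unfolding mdeg_def
  by (rule sum.reindex_bij_witness [where i = "inv_into UNIV \<pi>" and j = \<pi>])
    (auto simp: keys_map_key bij_is_inj lookup_map_key inv_f_f surj_f_inv_f bij_is_surj)

lemma map_key_add: "bij \<pi> \<Longrightarrow> Poly_Mapping.map_key \<pi> (a + b) = Poly_Mapping.map_key \<pi> a + Poly_Mapping.map_key \<pi> b"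
  by (simp add: map_key_plus bij_is_inj)

lemma permvars_mult:
  assumes "bij \<pi>"
  shows "permvars \<pi> (f * g) = permvars \<pi> f * permvars \<pi> (g :: 'a::comm_ring_1 mfps)"
proof (rule mfps_eqI)
  fix m
  let ?k = "Poly_Mapping.map_key \<pi>" and ?l = "Poly_Mapping.map_key (inv_into UNIV \<pi>)"
  have "mcoeff (permvars \<pi> (f * g)) m = (\<Sum>(a, b)\<in>splits (?k m). mcoeff f a * mcoeff g b)"
    by (simp add: mcoeff_permvars mcoeff_mult)
  also have "\<dots> = (\<Sum>(a, b)\<in>splits m. mcoeff f (?k a) * mcoeff g (?k b))"
    by (rule sum.reindex_bij_witness [where i = "\<lambda>(a, b). (?k a, ?k b)" and j = "\<lambda>(a, b). (?l a, ?l b)"])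
      (use assms in \<open>auto simp: splits_def map_key_inv map_key_add [symmetric] bij_imp_bij_inv\<close>)
  finally show "mcoeff (permvars \<pi> (f * g)) m = mcoeff (permvars \<pi> f * permvars \<pi> g) m"
    by (simp add: mcoeff_mult mcoeff_permvars)
qed

lemma permvars_add: "permvars \<pi> (f + g :: 'a::comm_ring_1 mfps) = permvars \<pi> f + permvars \<pi> g"
  and permvars_diff: "permvars \<pi> (f - g :: 'a::comm_ring_1 mfps) = permvars \<pi> f - permvars \<pi> g"
  and permvars_0: "permvars \<pi> (0 :: 'a::comm_ring_1 mfps) = 0"
  by (auto intro!: mfps_eqI simp: mcoeff_permvars)

lemma permvars_mconst: "bij \<pi> \<Longrightarrow> permvars \<pi> (mconst c) = mconst (c :: 'a::comm_ring_1)"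
  by (auto intro!: mfps_eqI simp: mcoeff_permvars mcoeff_mconst map_key_eq_iff map_key_zero
      bij_is_inj bij_imp_bij_inv)

lemma permvars_1: "bij \<pi> \<Longrightarrow> permvars \<pi> (1 :: 'a::comm_ring_1 mfps) = 1"
  using permvars_mconst [of \<pi> 1] by simp

lemma permvars_sum: "permvars \<pi> (sum f A :: 'a::comm_ring_1 mfps) = (\<Sum>a\<in>A. permvars \<pi> (f a))"
  by (induction A rule: infinite_finite_induct) (auto simp: permvars_add permvars_0)

lemma permvars_prod: "bij \<pi> \<Longrightarrow> permvars \<pi> (prod f A :: 'a::comm_ring_1 mfps) = (\<Prod>a\<in>A. permvars \<pi> (f a))"
  by (induction A rule: infinite_finite_induct) (auto simp: permvars_mult permvars_1)

lemma permvars_power: "bij \<pi> \<Longrightarrow> permvars \<pi> (f ^ k :: 'a::comm_ring_1 mfps) = permvars \<pi> f ^ k"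
  by (induction k) (auto simp: permvars_mult permvars_1)

lemma permvars_xpow: "bij \<pi> \<Longrightarrow> permvars \<pi> (xpow m) = xpow (Poly_Mapping.map_key (inv_into UNIV \<pi>) m)"
  by (auto intro!: mfps_eqI simp: mcoeff_permvars mcoeff_xpow map_key_eq_iff)

lemma permvars_mX: "bij \<pi> \<Longrightarrow> permvars \<pi> (mX i) = mX (\<pi> i)"
proof -
  assume "bij \<pi>"
  then have "Poly_Mapping.map_key (inv_into UNIV \<pi>) (sg i 1) = sg (\<pi> i) (1 :: nat)"
    using map_key_single [of "inv_into UNIV \<pi>" "\<pi> i" "1 :: nat"]
    by (simp add: bij_is_inj bij_imp_bij_inv inv_f_f)
  with \<open>bij \<pi>\<close> show ?thesis by (simp add: mX_eq_xpow permvars_xpow)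
qed

lemma permvars_comp: "bij \<pi> \<Longrightarrow> bij \<sigma> \<Longrightarrow> permvars \<pi> (permvars \<sigma> f) = permvars (\<pi> \<circ> \<sigma>) f"
  by (auto intro!: mfps_eqI simp: mcoeff_permvars map_key_compose bij_is_inj)

lemma permvars_id: "permvars id f = f"
  by (auto intro!: mfps_eqI simp: mcoeff_permvars id_def map_key_id)

text \<open>Conjugating the transposition of \<open>a\<close> and \<open>a + d\<close> by the
  adjacent one at \<open>a + d\<close> yields that of \<open>a\<close> and \<open>a + d + 1\<close>,
  so adjacent transpositions suffice by induction on the distance.\<close>

lemma adjacent_transpose_induct:
  assumes a: "a \<in> {..<n}" "b \<in> {..<n}"
    and id: "P id" and comp: "\<And>p q. p permutes {..<n} \<Longrightarrow> q permutes {..<n} \<Longrightarrow> P p \<Longrightarrow> P q \<Longrightarrow> P (p \<circ> q)"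
    and adj: "\<And>k. Suc k < n \<Longrightarrow> P (transpose k (Suc k))"
  shows "P (transpose a b)"
proof -
  have up: "P (transpose a (a + d))" if "a + d < n" for a d
    using that
  proof (induction d)
    case 0
    then show ?case using id by (simp only: add_0_right transpose_same)
  next
    case (Suc d)
    show ?case
    \<comment> \<open>For d = 0 the conjugate would be the identity, so distance 1 comes from
      \<open>adj\<close> itself.\<close>
    proof (cases "d = 0")
      case True
      then show ?thesis using adj [of a] Suc.prems by (simp del: id_apply)
    next
      case False
      let ?t = "transpose (a + d) (Suc (a + d))"
      have "transpose a (a + Suc d) = ?t \<circ> (transpose a (a + d) \<circ> ?t)"
        using False by (auto simp: fun_eq_iff transpose_def)
      moreover have t: "?t permutes {..<n}" "transpose a (a + d) permutes {..<n}"
        using Suc.prems by (auto intro!: permutes_swap_id)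
      moreover have "P ?t" "P (transpose a (a + d))"
        using Suc adj [of "a + d"] by simp_all
      ultimately show ?thesis
        using comp [OF t(1) permutes_compose [OF t(1,2)]] comp [OF t(2,1)] by (simp only:)
    qed
  qed
  show ?thesis
  proof (cases "a \<le> b")
    case True
    then show ?thesis using up [of a "b - a"] a by auto
  next
    case False
    then show ?thesis using up [of b "a - b"] a by (auto simp: transpose_commute)
  qed
qed

text \<open>A Bender-Knuth involution gives invariance under one adjacent transposition at a time;
  these generate all permutations of the first n variables.\<close>

lemma permvars_fixed_adjacent:
  assumes adj: "\<And>k. Suc k < n \<Longrightarrow> permvars (transpose k (Suc k)) f = f"
    and "\<pi> permutes {..<n}"
  shows "permvars \<pi> f = f"
proof -
  have comp: "permvars (p \<circ> q) f = f"
    if "p permutes {..<n}" "q permutes {..<n}" "permvars p f = f" "permvars q f = f" for p q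
    using that permvars_comp [of p q f] by (simp add: permutes_bij)
  have t: "permvars (transpose a b) f = f" if "a \<in> {..<n}" "b \<in> {..<n}" for a b
    using that by (rule adjacent_transpose_induct) (simp_all only: permvars_id comp adj)
  show ?thesis
    using assms(2) finite_lessThan
    by (induction rule: permutes_induct) (simp_all only: permvars_id, intro comp t permutes_swap_id)
qed

subsection \<open>Alternants\<close>

definition alt :: "nat \<Rightarrow> K mfps \<Rightarrow> K mfps" where
  "alt n f = (\<Sum>\<pi> | \<pi> permutes {..<n}. of_int (sign \<pi>) * permvars \<pi> f)"

lemma alt_add: "alt n (f + g) = alt n f + alt n g"
  by (simp add: alt_def permvars_add distrib_left sum.distrib)

lemma alt_0 [simp]: "alt n 0 = 0"
  by (simp add: alt_def permvars_0)

lemma alt_sum: "alt n (sum f A) = (\<Sum>a\<in>A. alt n (f a))"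
  by (induction A rule: infinite_finite_induct) (auto simp: alt_add)

lemma alt_symmetric_mult:
  assumes "\<And>\<pi>. \<pi> permutes {..<n} \<Longrightarrow> permvars \<pi> f = f"
  shows "alt n (f * g) = f * alt n g"
  using assms by (auto simp: alt_def permvars_mult permutes_bij sum_distrib_left algebra_simps intro!: sum.cong)

lemma alt_mconst_mult: "alt n (mconst c * g) = mconst c * alt n g"
  by (rule alt_symmetric_mult) (simp add: permvars_mconst permutes_bij)

lemma two_neq_zero_K: "(2 :: K) \<noteq> 0"
proof -
  have "(1 :: K) + 1 = Fraction_Field.Fract (1 * 1 + 1 * 1) (1 * 1)"
    unfolding One_fract_def by (rule add_fract) auto
  then have "(2 :: K) = Fraction_Field.Fract (1 + 1) 1"
    by (simp only: one_add_one mult_1_left)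
  moreover have "(1 + 1 :: complex poly) \<noteq> 0" by simp
  ultimately show ?thesis
    by (metis eq_fract(1) Zero_fract_def mult_1_right zero_neq_one mult_zero_left)
qed

text \<open>Sign-reversing arguments end in f = - f, and 2 is invertible in
  \<open>K\<close>.\<close>

lemma mfps_eq_neg_self: "f = - f \<Longrightarrow> f = (0 :: K mfps)"
proof (rule mfps_eqI)
  fix m
  assume "f = - f"
  then have "mcoeff f m = - mcoeff f m" by (metis mcoeff_uminus)
  then have "2 * mcoeff f m = 0" by (simp only: mult_2 eq_neg_iff_add_eq_0)
  with two_neq_zero_K show "mcoeff f m = mcoeff 0 m" by simp
qed

text \<open>Composing the summation index with the transposition of \<open>i\<close> and
  \<open>j\<close> changes the sign of every term but not its series, so the alternant equals its
  negative.\<close>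

lemma alt_eq_0_swap:
  assumes "i < n" "j < n" "i \<noteq> j" "permvars (transpose i j) f = f"
  shows "alt n f = 0"
proof (rule mfps_eq_neg_self)
  let ?t = "transpose i j"
  have t: "?t permutes {..<n}" using assms by (auto intro: permutes_swap_id)
  have "alt n f = (\<Sum>\<pi> | \<pi> permutes {..<n}. of_int (sign (\<pi> \<circ> ?t)) * permvars (\<pi> \<circ> ?t) f)"
    unfolding alt_def by (rule sum_permutations_compose_right [OF t])
  also have "\<dots> = (\<Sum>\<pi> | \<pi> permutes {..<n}. - (of_int (sign \<pi>) * permvars \<pi> f))"
  proof (rule sum.cong [OF refl])
    fix \<pi> assume "\<pi> \<in> {\<pi>. \<pi> permutes {..<n}}"
    then have p: "\<pi> permutes {..<n}" by simp
    then have "sign (\<pi> \<circ> ?t) = - sign \<pi>"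
      using assms(3) t by (subst sign_compose)
        (auto simp: sign_swap_id intro: permutation_permutes [THEN iffD2])
    moreover have "permvars (\<pi> \<circ> ?t) f = permvars \<pi> f"
      using permvars_comp [of \<pi> ?t f] assms(4) p by (simp add: permutes_bij)
    ultimately show "of_int (sign (\<pi> \<circ> ?t)) * permvars (\<pi> \<circ> ?t) f = - (of_int (sign \<pi>) * permvars \<pi> f)"
      by simp
  qed
  finally show "alt n f = - alt n f" by (simp add: alt_def sum_negf)
qed

text \<open>The diagonal product of the determinant \<open>groth_num\<close> with \<beta> replaced
  by a parameter: b = \<open>beta\<close> leads to Grothendieck polynomials, b = 0 to Schur
  polynomials and the Vandermonde product.\<close>

definition groth_mon :: "K \<Rightarrow> nat \<Rightarrow> shape \<Rightarrow> K mfps" where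
  "groth_mon b n p = (\<Prod>j<n. mX j ^ (p j + (n - 1 - j)) * (1 + mconst b * mX j) ^ j)"

lemma groth_num_eq_alt: "groth_num n p = alt n (groth_mon beta n p)"
proof -
  let ?A = "mat n n (\<lambda>(i, j). mX i ^ (p j + (n - 1 - j)) * (1 + mconst beta * mX i) ^ j) :: K mfps mat"
  have "groth_num n p = (\<Sum>\<pi> | \<pi> permutes {0..<n}. of_int (sign \<pi>) * (\<Prod>j<n. ?A $$ (\<pi> j, j)))"
    unfolding groth_num_def by (rule det_col [OF mat_carrier])
  also have "\<dots> = alt n (groth_mon beta n p)"
    unfolding alt_def lessThan_atLeast0 [symmetric]
  proof (rule sum.cong [OF refl], clarify)
    fix \<pi> assume p: "\<pi> permutes {..<n}"
    then have "permvars \<pi> (groth_mon beta n p)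
        = (\<Prod>j<n. mX (\<pi> j) ^ (p j + (n - 1 - j)) * (1 + mconst beta * mX (\<pi> j)) ^ j)"
      by (simp add: groth_mon_def permvars_prod permvars_mult permvars_power permvars_add permvars_1
          permvars_mconst permvars_mX permutes_bij)
    also have "\<dots> = (\<Prod>j<n. ?A $$ (\<pi> j, j))"
      using permutes_in_image [OF p] by (intro prod.cong) auto
    finally show "of_int (sign \<pi>) * (\<Prod>j<n. ?A $$ (\<pi> j, j))
        = of_int (sign \<pi>) * permvars \<pi> (groth_mon beta n p)" by simp
  qed
  finally show ?thesis .
qed

text \<open>Column operations prove it over any commutative ring: subtracting \<open>x n\<close>
  times the next column leaves a last row that is zero except for its final 1, and after expansion
  along it every other row \<open>i\<close> has the factor \<open>x i - x n\<close>.\<close>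

lemma det_vandermonde:
  fixes x :: "nat \<Rightarrow> 'a::comm_ring_1"
  shows "det (mat n n (\<lambda>(i, j). x i ^ (n - 1 - j))) = (\<Prod>(i, j)\<in>{(i, j). i < j \<and> j < n}. x i - x j)"
proof (induction n)
  case 0
  then show ?case by (simp add: det_def)
next
  case (Suc n)
  let ?A = "mat (Suc n) (Suc n) (\<lambda>(i, j). x i ^ (n - j))"
  let ?L = "mat (Suc n) (Suc n) (\<lambda>(i, j). if i = j then 1 else if i = Suc j then - x n else 0)"
  let ?B = "mat (Suc n) (Suc n) (\<lambda>(i, j). if j = n then 1 else x i ^ (n - 1 - j) * (x i - x n))"
  let ?C = "mat n n (\<lambda>(i, j). x i ^ (n - 1 - j))"
  let ?D = "mat n n (\<lambda>(i, j). x i ^ (n - 1 - j) * (x i - x n))"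
  have AL: "?A * ?L = ?B"
  proof (rule eq_matI)
    fix i j assume "i < dim_row ?B" "j < dim_col ?B"
    then have ij: "i \<le> n" "j \<le> n" by auto
    have "(?A * ?L) $$ (i, j)
        = (\<Sum>k = 0..<Suc n. x i ^ (n - k) * (if k = j then 1 else if k = Suc j then - x n else 0))"
      using ij by (simp add: scalar_prod_def)
    also have "\<dots> = (\<Sum>k = 0..<Suc n. (if k = j then x i ^ (n - k) else 0) + (if k = Suc j then - x n * x i ^ (n - k) else 0))"
      by (rule sum.cong) auto
    also have "\<dots> = x i ^ (n - j) + (if j < n then - x n * x i ^ (n - Suc j) else 0)"
      using ij by (simp only: sum.distrib sum.delta finite_atLeastLessThan) auto
    also have "\<dots> = ?B $$ (i, j)"
    proof (cases "j < n")
      case True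
      then have "n - j = Suc (n - 1 - j)" by simp
      then have "x i ^ (n - j) = x i * x i ^ (n - 1 - j)" by simp
      then show ?thesis using True ij by (simp add: algebra_simps)
    qed (use ij in auto)
    finally show "(?A * ?L) $$ (i, j) = ?B $$ (i, j)" .
  qed auto
  have "det ?L = prod_list (diag_mat ?L)"
    by (rule det_lower_triangular [of "Suc n"]) auto
  also have "diag_mat ?L = map (\<lambda>_. 1) [0..<Suc n]"
    unfolding diag_mat_def by (rule map_cong) auto
  also have "prod_list \<dots> = 1"
    by (induction n) auto
  finally have L: "det ?L = 1" .
  have "det ?B = (\<Sum>j<Suc n. ?B $$ (n, j) * cofactor ?B n j)"
    by (rule laplace_expansion_row) auto
  also have "\<dots> = cofactor ?B n n"
    by (simp add: sum.neutral)
  also have "\<dots> = det (mat_delete ?B n n)"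
    by (simp add: cofactor_def)
  also have "mat_delete ?B n n = ?D"
    by (rule eq_matI) (auto simp: mat_delete_def)
  also have "det ?D = (\<Sum>\<pi> | \<pi> permutes {0..<n}. of_int (sign \<pi>) * (\<Prod>j<n. ?D $$ (\<pi> j, j)))"
    by (rule det_col [OF mat_carrier])
  also have "\<dots> = (\<Sum>\<pi> | \<pi> permutes {0..<n}. of_int (sign \<pi>) * (\<Prod>j<n. ?C $$ (\<pi> j, j)) * (\<Prod>i<n. x i - x n))"
  proof (rule sum.cong [OF refl], clarify)
    fix \<pi> assume "\<pi> permutes {0..<n}"
    then have p: "\<pi> permutes {..<n}" by (simp add: lessThan_atLeast0)
    have "(\<Prod>j<n. ?D $$ (\<pi> j, j)) = (\<Prod>j<n. ?C $$ (\<pi> j, j) * (x (\<pi> j) - x n))"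
      using permutes_in_image [OF p] by (intro prod.cong) auto
    also have "\<dots> = (\<Prod>j<n. ?C $$ (\<pi> j, j)) * (\<Prod>i<n. x i - x n)"
      using prod.permute [OF p, of "\<lambda>i. x i - x n"] by (simp add: prod.distrib comp_def)
    finally show "of_int (sign \<pi>) * (\<Prod>j<n. ?D $$ (\<pi> j, j))
        = of_int (sign \<pi>) * (\<Prod>j<n. ?C $$ (\<pi> j, j)) * (\<Prod>i<n. x i - x n)"
      by (simp add: mult.assoc)
  qed
  also have "\<dots> = det ?C * (\<Prod>i<n. x i - x n)"
    by (simp add: det_col [OF mat_carrier] sum_distrib_right)
  finally have B: "det ?B = det ?C * (\<Prod>i<n. x i - x n)" .
  have "det ?B = det ?A * det ?L"
    unfolding AL [symmetric] by (rule det_mult) auto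
  then have "det ?A = det ?C * (\<Prod>i<n. x i - x n)"
    by (simp add: L B)
  also have "det ?C = (\<Prod>(i, j)\<in>{(i, j). i < j \<and> j < n}. x i - x j)"
    by (rule Suc.IH)
  also have "(\<Prod>i<n. x i - x n) = (\<Prod>(i, j)\<in>(\<lambda>i. (i, n)) ` {..<n}. x i - x j)"
    by (subst prod.reindex) (auto simp: inj_on_def)
  also have "(\<Prod>(i, j)\<in>{(i, j). i < j \<and> j < n}. x i - x j) * (\<Prod>(i, j)\<in>(\<lambda>i. (i, n)) ` {..<n}. x i - x j)
      = (\<Prod>(i, j)\<in>{(i, j). i < j \<and> j < n} \<union> (\<lambda>i. (i, n)) ` {..<n}. x i - x j)"
    by (rule prod.union_disjoint [symmetric]) (auto intro: finite_subset [of _ "{..<n} \<times> {..<n}"])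
  also have "{(i, j). i < j \<and> j < n} \<union> (\<lambda>i. (i, n)) ` {..<n} = {(i, j). i < j \<and> j < Suc n}"
    by auto
  finally show ?case by simp
qed

text \<open>The denominator is itself an alternant, of the empty partition at b = 0, so results
  about alternants apply to both halves of the quotient.\<close>

lemma vandermonde_eq_alt: "vandermonde n = alt n (groth_mon 0 n (\<lambda>_. 0))"
proof -
  let ?A = "mat n n (\<lambda>(i, j). mX i ^ (n - 1 - j)) :: K mfps mat"
  have "vandermonde n = det ?A"
    unfolding vandermonde_def by (rule det_vandermonde [symmetric])
  also have "\<dots> = (\<Sum>\<pi> | \<pi> permutes {0..<n}. of_int (sign \<pi>) * (\<Prod>j<n. ?A $$ (\<pi> j, j)))"
    by (rule det_col [OF mat_carrier])
  also have "\<dots> = alt n (groth_mon 0 n (\<lambda>_. 0))"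
    unfolding alt_def lessThan_atLeast0 [symmetric]
  proof (rule sum.cong [OF refl], clarify)
    fix \<pi> assume p: "\<pi> permutes {..<n}"
    then have "permvars \<pi> (groth_mon 0 n (\<lambda>_. 0)) = (\<Prod>j<n. mX (\<pi> j) ^ (n - 1 - j))"
      by (simp add: groth_mon_def permvars_prod permvars_mult permvars_power permvars_add permvars_1
          permvars_mconst permvars_mX permutes_bij)
    also have "\<dots> = (\<Prod>j<n. ?A $$ (\<pi> j, j))"
      using permutes_in_image [OF p] by (intro prod.cong) auto
    finally show "of_int (sign \<pi>) * (\<Prod>j<n. ?A $$ (\<pi> j, j))
        = of_int (sign \<pi>) * permvars \<pi> (groth_mon 0 n (\<lambda>_. 0))" by simp
  qed
  finally show ?thesis .
qed

text \<open>Equality of x_i f and x_j f says that trading a factor x_j for x_i does not change the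
  coefficients of f. Repeating the trade exhausts x_j, and then x_j f cannot contain x_i times the
  monomial.\<close>

lemma mX_diff_nonzero_divisor:
  assumes "i \<noteq> j" "(mX i - mX j) * f = (0 :: K mfps)"
  shows "f = 0"
proof (rule mfps_eqI)
  have eq: "mcoeff (mX i * f) m = mcoeff (mX j * f) m" for m
    using arg_cong [OF assms(2), of "\<lambda>h. mcoeff h m"] by (simp add: left_diff_distrib)
  have "mcoeff f m = 0" if "lk m j = d" for m d
    using that
  proof (induction d arbitrary: m)
    case 0
    have "mcoeff f m = mcoeff (mX i * f) (sg i 1 + m)"
      by (simp add: mX_eq_xpow)
    also have "\<dots> = mcoeff (mX j * f) (sg i 1 + m)"
      by (rule eq)
    also have "\<dots> = 0"
      unfolding mX_eq_xpow
    proof (rule mcoeff_xpow_mult_eq_0)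
      fix k show "sg i 1 + m \<noteq> sg j 1 + k"
        using 0 assms(1) by (metis add_is_0 lookup_add lookup_single_eq lookup_single_not_eq one_neq_zero)
    qed
    finally show ?case .
  next
    case (Suc d)
    let ?m = "m - sg j 1"
    have m: "m = sg j 1 + ?m"
      using Suc.prems by (auto intro!: poly_mapping_eqI simp: lookup_add lookup_minus lookup_single when_def)
    have "mcoeff f m = mcoeff (mX i * f) (sg i 1 + m)"
      by (simp add: mX_eq_xpow)
    also have "\<dots> = mcoeff (mX j * f) (sg i 1 + m)"
      by (rule eq)
    also have "sg i 1 + m = sg j 1 + (sg i 1 + ?m)"
      by (subst m) (simp add: ac_simps)
    also have "mcoeff (mX j * f) (sg j 1 + (sg i 1 + ?m)) = mcoeff f (sg i 1 + ?m)"
      by (simp add: mX_eq_xpow)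
    also have "\<dots> = 0"
      by (rule Suc.IH) (use Suc.prems assms(1) in \<open>auto simp: lookup_add lookup_minus lookup_single when_def\<close>)
    finally show ?case .
  qed
  then show "mcoeff f m = mcoeff 0 m" for m by simp
qed

text \<open>A finite product of non-zero-divisors can be cancelled; this turns identities of
  alternants into identities of symmetric polynomials.\<close>

lemma vandermonde_cancel:
  assumes "f * vandermonde n = g * vandermonde n"
  shows "f = g"
proof -
  have *: "finite A \<Longrightarrow> (\<forall>a\<in>A. fst a \<noteq> snd a) \<Longrightarrow> (\<Prod>a\<in>A. mX (fst a) - mX (snd a)) * h = (0 :: K mfps) \<Longrightarrow> h = 0"
    for h :: "K mfps" and A :: "(nat \<times> nat) set"
  proof (induction A rule: finite_induct)
    case (insert a A)
    then have "(mX (fst a) - mX (snd a)) * ((\<Prod>a\<in>A. mX (fst a) - mX (snd a)) * h) = 0"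
      by (simp add: mult.assoc)
    then have "(\<Prod>a\<in>A. mX (fst a) - mX (snd a)) * h = 0"
      by (rule mX_diff_nonzero_divisor [rotated]) (use insert.prems(1) in auto)
    with insert show ?case by blast
  qed simp
  have fin: "finite {(i, j). i < j \<and> j < n}"
  proof (rule finite_subset)
    show "{(i, j). i < j \<and> j < n} \<subseteq> {..<n} \<times> {..<n}" by auto
  qed simp
  have "(\<Prod>a\<in>{(i, j). i < j \<and> j < n}. mX (fst a) - mX (snd a)) * (f - g) = 0"
  proof -
    have "(\<Prod>a\<in>{(i, j). i < j \<and> j < n}. mX (fst a) - mX (snd a)) = vandermonde n"
      unfolding vandermonde_def by (rule prod.cong) auto
    moreover have "vandermonde n * (f - g) = 0"
      using assms by (simp only: right_diff_distrib mult.commute [of "vandermonde n"]) simp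
    ultimately show ?thesis by simp
  qed
  then have "f - g = 0"
    by (rule * [OF fin, rotated]) auto
  then show ?thesis by simp
qed

subsection \<open>Symmetric power series\<close>

definition symm :: "K mfps \<Rightarrow> bool" where
  "symm f \<longleftrightarrow> (\<forall>\<pi>. bij \<pi> \<longrightarrow> permvars \<pi> f = f)"

lemma symm_iff: "symm f \<longleftrightarrow> (\<forall>\<pi> m. bij \<pi> \<longrightarrow> mcoeff f (Poly_Mapping.map_key \<pi> m) = mcoeff f m)"
  unfolding symm_def by (metis mcoeff_permvars mfps_eqI)

lemma symm_mcoeff: "symm f \<Longrightarrow> bij \<pi> \<Longrightarrow> mcoeff f (Poly_Mapping.map_key \<pi> m) = mcoeff f m"
  by (simp add: symm_iff)

lemma extend_to_permutation:
  assumes "inj_on \<pi> A" "A \<subseteq> {..<n}" "\<pi> ` A \<subseteq> {..<n :: nat}"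
  obtains \<sigma> where "\<sigma> permutes {..<n}" "\<And>i. i \<in> A \<Longrightarrow> \<sigma> i = \<pi> i"
proof -
  have fin: "finite A" "finite (\<pi> ` A)" using assms finite_subset by blast+
  have "card ({..<n} - A) = card ({..<n} - \<pi> ` A)"
    using assms fin by (simp add: card_Diff_subset card_image)
  then obtain g where g: "bij_betw g ({..<n} - A) ({..<n} - \<pi> ` A)"
    using finite_same_card_bij [of "{..<n} - A" "{..<n} - \<pi> ` A"] by auto
  define \<sigma> where "\<sigma> = (\<lambda>i. if i \<in> A then \<pi> i else if i < n then g i else i)"
  have "bij_betw \<sigma> A (\<pi> ` A)"
    using assms(1) by (auto simp: \<sigma>_def bij_betw_def inj_on_def)
  moreover have "bij_betw \<sigma> ({..<n} - A) ({..<n} - \<pi> ` A)"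
    by (rule bij_betw_cong [THEN iffD1, OF _ g]) (auto simp: \<sigma>_def)
  ultimately have "bij_betw \<sigma> (A \<union> ({..<n} - A)) (\<pi> ` A \<union> ({..<n} - \<pi> ` A))"
    by (rule bij_betw_combine) auto
  moreover have "A \<union> ({..<n} - A) = {..<n}" "\<pi> ` A \<union> ({..<n} - \<pi> ` A) = {..<n}"
    using assms by auto
  ultimately have "\<sigma> permutes {..<n}"
    using assms(2) by (intro bij_imp_permutes) (auto simp: \<sigma>_def)
  then show ?thesis by (rule that) (auto simp: \<sigma>_def)
qed

text \<open>The coefficients compared involve finitely many variables, so a bijection of all
  naturals may be replaced by a permutation of an initial segment that agrees with it on the
  relevant ones.\<close>

lemma symm_finitary:
  assumes "\<And>n \<pi>. n \<ge> n0 \<Longrightarrow> \<pi> permutes {..<n} \<Longrightarrow> permvars \<pi> (first_vars n f) = first_vars n f"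
  shows "symm f"
  unfolding symm_iff
proof (intro allI impI)
  fix \<pi> :: "nat \<Rightarrow> nat" and m :: "nat \<Rightarrow>\<^sub>0 nat"
  assume \<pi>: "bij \<pi>"
  obtain a where a: "ks m \<subseteq> {..<a}" by (rule keys_bounded)
  obtain b where b: "ks (Poly_Mapping.map_key \<pi> m) \<subseteq> {..<b}" by (rule keys_bounded)
  define n where "n = max n0 (max a b)"
  have "{..<a} \<subseteq> {..<n}" "{..<b} \<subseteq> {..<n}" by (auto simp: n_def)
  with a b have n: "ks m \<subseteq> {..<n}" "ks (Poly_Mapping.map_key \<pi> m) \<subseteq> {..<n}" "n \<ge> n0"
    by (auto simp: n_def simp del: lessThan_subset_iff)
  have k: "ks (Poly_Mapping.map_key \<pi> m) = \<pi> -` ks m"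
    using \<pi> by (simp add: keys_map_key bij_is_inj)
  have img: "\<pi> ` (\<pi> -` ks m) = ks m"
    using \<pi> by (simp add: bij_is_surj surj_image_vimage_eq)
  obtain \<sigma> where \<sigma>: "\<sigma> permutes {..<n}" "\<And>i. i \<in> \<pi> -` ks m \<Longrightarrow> \<sigma> i = \<pi> i"
    using extend_to_permutation [of \<pi> "\<pi> -` ks m" n] n \<pi> img k
    by (metis bij_betw_imp_inj_on inj_on_subset subset_UNIV)
  have s: "bij \<sigma>" using \<sigma>(1) by (rule permutes_bij)
  \<comment> \<open>\<sigma> agrees with \<pi> only on the preimage of the support; injectivity
    keeps all other indices out of the support.\<close>
  have "\<sigma> i \<in> ks m \<longleftrightarrow> \<pi> i \<in> ks m" for i
  proof
    assume "\<sigma> i \<in> ks m"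
    then obtain j where j: "\<sigma> i = \<pi> j" "j \<in> \<pi> -` ks m" using img by (metis imageE)
    then have "\<sigma> i = \<sigma> j" using \<sigma>(2) by simp
    then show "\<pi> i \<in> ks m" using j s by (metis bij_is_inj injD vimageD)
  qed (use \<sigma>(2) in auto)
  then have "lk m (\<sigma> i) = lk m (\<pi> i)" for i
    using \<sigma>(2) by (metis in_keys_iff vimageI)
  then have eq: "Poly_Mapping.map_key \<sigma> m = Poly_Mapping.map_key \<pi> m"
    using \<pi> s by (intro poly_mapping_eqI) (simp add: lookup_map_key bij_is_inj)
  show "mcoeff f (Poly_Mapping.map_key \<pi> m) = mcoeff f m"
    using arg_cong [OF assms [OF n(3) \<sigma>(1)], of "\<lambda>h. mcoeff h m"] n eq
    by (simp add: mcoeff_permvars mcoeff_first_vars)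
qed

lemma symm_add: "symm f \<Longrightarrow> symm g \<Longrightarrow> symm (f + g)"
  and symm_mult: "symm f \<Longrightarrow> symm g \<Longrightarrow> symm (f * g)"
  and symm_mconst: "symm (mconst c)"
  and symm_0: "symm 0"
  by (simp_all add: symm_def permvars_add permvars_mult permvars_mconst permvars_0)

lemma permvars_first_vars_symm:
  assumes "symm f" "\<pi> permutes {..<n}"
  shows "permvars \<pi> (first_vars n f) = first_vars n f"
proof (rule mfps_eqI)
  fix m :: "nat \<Rightarrow>\<^sub>0 nat"
  have b: "bij \<pi>" using assms(2) by (rule permutes_bij)
  have "\<pi> -` ks m \<subseteq> {..<n} \<longleftrightarrow> ks m \<subseteq> {..<n}"
  proof
    assume "ks m \<subseteq> {..<n}"
    then show "\<pi> -` ks m \<subseteq> {..<n}"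
      using vimage_mono [of "ks m" "{..<n}" \<pi>] permutes_vimage [OF assms(2)] by simp
  next
    assume "\<pi> -` ks m \<subseteq> {..<n}"
    then have "\<pi> ` (\<pi> -` ks m) \<subseteq> \<pi> ` {..<n}" by (rule image_mono)
    then show "ks m \<subseteq> {..<n}"
      by (simp only: surj_image_vimage_eq [OF bij_is_surj [OF b]] permutes_image [OF assms(2)])
  qed
  then show "mcoeff (permvars \<pi> (first_vars n f)) m = mcoeff (first_vars n f) m"
    using assms(1) b by (simp add: mcoeff_permvars mcoeff_first_vars keys_map_key bij_is_inj symm_mcoeff)
qed

subsection \<open>Partitions\<close>

lemma partition_antimono: "is_partition p \<Longrightarrow> i \<le> j \<Longrightarrow> p j \<le> p i"
  by (auto simp: is_partition_def antimono_def)

lemma partition_finite: "is_partition p \<Longrightarrow> finite {i. p i \<noteq> 0}"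
  by (simp add: is_partition_def)

lemma partition_support: "is_partition p \<Longrightarrow> {i. p i \<noteq> 0} = {..<part_length p}"
proof -
  assume p: "is_partition p"
  obtain n where n: "{i. p i \<noteq> 0} \<subseteq> {..<n}"
    using finite_nat_bounded [OF partition_finite [OF p]] by auto
  define k where "k = (LEAST i. p i = 0)"
  have "p n = 0" using n by auto
  then have k: "p k = 0" unfolding k_def by (rule LeastI)
  have "{i. p i \<noteq> 0} = {..<k}"
  proof (intro Set.set_eqI iffI)
    fix i assume "i \<in> {..<k}"
    then show "i \<in> {i. p i \<noteq> 0}" using not_less_Least k_def by auto
  next
    fix i assume "i \<in> {i. p i \<noteq> 0}"
    then have "p i \<noteq> 0" by simp
    then show "i \<in> {..<k}" using k partition_antimono [OF p, of k i] by (cases "k \<le> i") auto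
  qed
  then show ?thesis by (simp add: part_length_def)
qed

lemma partition_nonzero_iff: "is_partition p \<Longrightarrow> p i \<noteq> 0 \<longleftrightarrow> i < part_length p"
  using partition_support [of p] by auto

lemma part_length_le_iff: "is_partition p \<Longrightarrow> part_length p \<le> n \<longleftrightarrow> p n = 0"
  using partition_nonzero_iff [of p n] by auto

lemma partition_beyond: "is_partition p \<Longrightarrow> part_length p \<le> n \<Longrightarrow> n \<le> i \<Longrightarrow> p i = 0"
  using partition_nonzero_iff [of p i] by auto

lemma is_partitionI:
  assumes "\<And>i. p (Suc i) \<le> p i" "p n = 0"
  shows "is_partition p"
proof -
  have "antimono p" unfolding antimono_iff_le_Suc using assms(1) by simp
  moreover have "{i. p i \<noteq> 0} \<subseteq> {..<n}"
  proof
    fix i assume "i \<in> {i. p i \<noteq> 0}"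
    then have "p i \<noteq> 0" by simp
    moreover have "p i = 0" if "n \<le> i" using antimonoD [OF \<open>antimono p\<close> that] assms(2) by simp
    ultimately show "i \<in> {..<n}" by (cases "n \<le> i") auto
  qed
  ultimately show ?thesis unfolding is_partition_def using finite_subset by blast
qed

lemma is_partition_0 [simp]: "is_partition (\<lambda>_. 0)"
  by (simp add: is_partition_def antimono_def)

lemma part_length_0 [simp]: "part_length (\<lambda>_. 0) = 0"
  and seq_size_0 [simp]: "seq_size (\<lambda>_. 0) = 0"
  by (simp_all add: part_length_def seq_size_def)

lemma seq_size_superset: "finite A \<Longrightarrow> {i. p i \<noteq> 0} \<subseteq> A \<Longrightarrow> seq_size p = sum p A"
  unfolding seq_size_def by (rule sum.mono_neutral_left) auto

lemma seq_size_lessThan: "is_partition p \<Longrightarrow> part_length p \<le> n \<Longrightarrow> seq_size p = (\<Sum>i<n. p i)"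
  using partition_support [of p] by (intro seq_size_superset) simp_all

lemma partition_le_length: "is_partition p \<Longrightarrow> is_partition q \<Longrightarrow> q \<le> p \<Longrightarrow> part_length q \<le> part_length p"
  using partition_beyond [of p "part_length p" "part_length p"] part_length_le_iff [of q "part_length p"]
    le_funD [of q p "part_length p"] by simp

lemma seq_size_mono: "is_partition p \<Longrightarrow> is_partition q \<Longrightarrow> q \<le> p \<Longrightarrow> seq_size q \<le> seq_size p"
  using seq_size_lessThan [of p "part_length p"] seq_size_lessThan [of q "part_length p"]
  by (auto simp: partition_le_length le_fun_def intro: sum_mono)

lemma seq_size_strict_mono:
  assumes "is_partition p" "is_partition q" "q \<le> p" "q \<noteq> p"
  shows "seq_size q < seq_size p"
proof -
  obtain i where "q i \<noteq> p i" using assms(4) by auto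
  then have i: "q i < p i" using le_funD [OF assms(3), of i] by simp
  then have "i < part_length p" using partition_nonzero_iff [OF assms(1), of i] by auto
  then have "(\<Sum>i<part_length p. q i) < (\<Sum>i<part_length p. p i)"
    using i assms(3) by (intro sum_strict_mono_ex1) (auto simp: le_fun_def)
  then show ?thesis
    using assms by (simp add: seq_size_lessThan [of p "part_length p"]
        seq_size_lessThan [of q "part_length p"] partition_le_length)
qed

lemma part_length_le_seq_size: "is_partition p \<Longrightarrow> part_length p \<le> seq_size p"
proof -
  assume p: "is_partition p"
  have "(\<Sum>i<part_length p. 1) \<le> (\<Sum>i<part_length p. p i)"
    using partition_nonzero_iff [OF p] by (intro sum_mono) (auto simp: Suc_le_eq)
  then show ?thesis using p by (simp add: seq_size_lessThan [of p "part_length p"])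
qed

definition parts :: "nat \<Rightarrow> shape set" where
  "parts d = {p. is_partition p \<and> seq_size p = d}"

definition parts_upto :: "nat \<Rightarrow> shape set" where
  "parts_upto d = {p. is_partition p \<and> seq_size p \<le> d}"

lemma finite_parts_upto [simp]: "finite (parts_upto d)"
proof -
  have "finite {f. \<forall>i. (i \<in> {..<d} \<longrightarrow> f i \<in> {..d}) \<and> (i \<notin> {..<d} \<longrightarrow> f i = (0 :: nat))}"
    by (rule finite_set_of_finite_funs) auto
  moreover have "parts_upto d \<subseteq> {f. \<forall>i. (i \<in> {..<d} \<longrightarrow> f i \<in> {..d}) \<and> (i \<notin> {..<d} \<longrightarrow> f i = (0 :: nat))}"
  proof (clarsimp simp: parts_upto_def, intro conjI impI)
    fix p i assume p: "is_partition p" "seq_size p \<le> d"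
    then have l: "part_length p \<le> d" using part_length_le_seq_size le_trans by blast
    show "p i = 0" if "\<not> i < d" using p l that partition_beyond by simp
    show "p i \<le> d" if "i < d"
    proof -
      have "p i \<le> (\<Sum>i<d. p i)" using that by (intro member_le_sum) auto
      then show ?thesis using p l by (simp add: seq_size_lessThan)
    qed
  qed
  ultimately show ?thesis by (rule finite_subset [rotated])
qed

lemma parts_subset: "parts d \<subseteq> parts_upto d"
  by (auto simp: parts_def parts_upto_def)

lemma finite_parts [simp]: "finite (parts d)"
  using finite_subset [OF parts_subset] by simp

lemma finite_partitions_le:
  assumes "is_partition p"
  shows "finite {q. is_partition q \<and> q \<le> p}"
proof (rule finite_subset)
  show "{q. is_partition q \<and> q \<le> p} \<subseteq> parts_upto (seq_size p)"
    using assms by (auto simp: parts_upto_def seq_size_mono)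
qed simp

definition part_mon :: "shape \<Rightarrow> (nat \<Rightarrow>\<^sub>0 nat)" where
  "part_mon p = Abs_poly_mapping p"

lemma lookup_part_mon [simp]: "is_partition p \<Longrightarrow> lk (part_mon p) = p"
  using partition_finite [of p] unfolding part_mon_def
  by (subst Abs_poly_mapping_inverse) simp_all

lemma keys_part_mon: "is_partition p \<Longrightarrow> ks (part_mon p) = {..<part_length p}"
  by (simp only: keys.rep_eq lookup_part_mon partition_support)

lemma mdeg_part_mon: "is_partition p \<Longrightarrow> mdeg (part_mon p) = seq_size p"
  by (simp add: mdeg_def keys_part_mon seq_size_lessThan [OF _ order_refl])

text \<open>Every orbit of exponents contains a partition; hence a symmetric series is determined by
  its coefficients at the \<open>part_mon p\<close>.\<close>

lemma sorted_monomial: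
  obtains p \<pi> where "is_partition p" "bij \<pi>" "m = Poly_Mapping.map_key \<pi> (part_mon p)"
    "seq_size p = mdeg m" "\<And>n. ks m \<subseteq> {..<n} \<Longrightarrow> part_length p \<le> n"
proof -
  obtain n where n: "ks m \<subseteq> {..<n}" by (rule keys_bounded)
  define xs where "xs = map (lk m) [0..<n]"
  define ys where "ys = rev (sort xs)"
  have "mset xs = mset ys" by (simp add: ys_def)
  then obtain f where f: "f permutes {..<length ys}" "permute_list f ys = xs"
    by (rule mset_eq_permutation)
  have len: "length ys = n" "length xs = n" by (simp_all add: ys_def xs_def)
  define p where "p = (\<lambda>i. if i < n then ys ! i else 0)"
  have dec: "ys ! j \<le> ys ! i" if "i \<le> j" "j < n" for i j
  proof -
    have "sorted (sort xs)" by simp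
    moreover have "n - Suc j \<le> n - Suc i" "n - Suc i < length (sort xs)" using that len by auto
    ultimately have "sort xs ! (n - Suc j) \<le> sort xs ! (n - Suc i)" by (rule sorted_nth_mono)
    then show ?thesis using that len by (simp add: ys_def rev_nth)
  qed
  have p: "is_partition p"
    by (rule is_partitionI [of _ n]) (auto simp: p_def intro: dec)
  have b: "bij f" using f(1) by (rule permutes_bij)
  have eq: "m = Poly_Mapping.map_key f (part_mon p)"
  proof (rule poly_mapping_eqI)
    fix i
    show "lk m i = lk (Poly_Mapping.map_key f (part_mon p)) i"
    proof (cases "i < n")
      case True
      then have "f i < n" using f(1) len permutes_in_image [of f "{..<n}" i] by simp
      moreover have "lk m i = ys ! f i"
        using True f len permute_list_nth [of f ys i] by (auto simp: xs_def)
      ultimately show ?thesis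
        using p b by (simp add: lookup_map_key bij_is_inj) (simp add: p_def)
    next
      case False
      then have "f i = i" using f(1) len by (simp add: permutes_def)
      moreover have "lk m i = 0" using n False by (auto simp: in_keys_iff)
      ultimately show ?thesis
        using p b False by (simp add: lookup_map_key bij_is_inj) (simp add: p_def)
    qed
  qed
  have size: "seq_size p = mdeg m"
    using p b by (simp add: eq mdeg_map_key mdeg_part_mon)
  have "part_length p \<le> k" if "ks m \<subseteq> {..<k}" for k
  proof -
    have "card (ks m) = part_length p"
    proof -
      have "ks m = f -` {..<part_length p}"
        using p b by (simp add: eq keys_map_key bij_is_inj keys_part_mon)
      then have "f ` ks m = {..<part_length p}" using b by (simp add: bij_is_surj surj_image_vimage_eq)
      then show ?thesis using b card_image [of f "ks m"] by (metis bij_is_inj card_lessThan inj_on_subset subset_UNIV)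
    qed
    then show ?thesis using that by (metis card_lessThan card_mono finite_lessThan)
  qed
  with p b eq size show ?thesis by (rule that)
qed

subsection \<open>Semistandard fillings and the Bender-Knuth involution\<close>

text \<open>The Bender-Knuth involution needs only this interval property of a skew diagram. Unlike
  the form p/q it passes at once to the first columns of a diagram and to a diagram turned by 180
  degrees.\<close>

definition convex_diag :: "(nat \<times> nat) set \<Rightarrow> bool" where
  "convex_diag D \<longleftrightarrow> finite D \<and> (\<forall>i j i' j' a b. (i, j) \<in> D \<and> (i', j') \<in> D \<and>
     i \<le> a \<and> a \<le> i' \<and> j \<le> b \<and> b \<le> j' \<longrightarrow> (a, b) \<in> D)"

lemma convex_diag_finite: "convex_diag D \<Longrightarrow> finite D"
  by (simp add: convex_diag_def)

lemma convex_diagD: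
  "convex_diag D \<Longrightarrow> (i, j) \<in> D \<Longrightarrow> (i', j') \<in> D \<Longrightarrow> i \<le> a \<Longrightarrow> a \<le> i' \<Longrightarrow> j \<le> b \<Longrightarrow> b \<le> j' \<Longrightarrow> (a, b) \<in> D"
  unfolding convex_diag_def by blast

lemma convex_diagI:
  assumes "finite D" "\<And>i j i' j' a b. (i, j) \<in> D \<Longrightarrow> (i', j') \<in> D \<Longrightarrow> i \<le> a \<Longrightarrow> a \<le> i' \<Longrightarrow>
    j \<le> b \<Longrightarrow> b \<le> j' \<Longrightarrow> (a, b) \<in> D"
  shows "convex_diag D"
  unfolding convex_diag_def by (intro conjI allI impI; (elim conjE)?) (rule assms, rule assms(2))

lemma skew_diagram_subset: "is_partition p \<Longrightarrow> skew_diagram p q \<subseteq> {..<part_length p} \<times> {..<p 0}"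
proof
  assume p: "is_partition p"
  fix b assume "b \<in> skew_diagram p q"
  then obtain i j where b: "b = (i, j)" "j < p i" by (auto simp: skew_diagram_def)
  then have "p i \<noteq> 0" "p i \<le> p 0" using partition_antimono [OF p, of 0 i] by auto
  then show "b \<in> {..<part_length p} \<times> {..<p 0}"
    using b partition_nonzero_iff [OF p, of i] by simp
qed

lemma finite_skew_diagram: "is_partition p \<Longrightarrow> finite (skew_diagram p q)"
  using finite_subset [OF skew_diagram_subset] by blast

lemma convex_skew_diagram: "is_partition p \<Longrightarrow> is_partition q \<Longrightarrow> convex_diag (skew_diagram p q)"
proof (rule convex_diagI)
  assume p: "is_partition p" and q: "is_partition q"
  show "finite (skew_diagram p q)" using p by (rule finite_skew_diagram)
  fix i j i' j' a b
  assume that: "(i, j) \<in> skew_diagram p q" "(i', j') \<in> skew_diagram p q" "i \<le> a" "a \<le> i'" "j \<le> b" "b \<le> j'"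
  then show "(a, b) \<in> skew_diagram p q"
    using partition_antimono [OF q that(3)] partition_antimono [OF p that(4)]
    by (simp add: skew_diagram_def)
qed

section \<open>Tableaux on sets of boxes\<close>

definition tab :: "nat set \<Rightarrow> (nat \<times> nat) set \<Rightarrow> (nat \<times> nat \<Rightarrow> nat) set" where
  "tab A D = {T \<in> D \<rightarrow>\<^sub>E A.
     (\<forall>i j j'. (i, j) \<in> D \<and> (i, j') \<in> D \<and> j < j' \<longrightarrow> T (i, j) \<le> T (i, j')) \<and>
     (\<forall>i i' j. (i, j) \<in> D \<and> (i', j) \<in> D \<and> i < i' \<longrightarrow> T (i, j) < T (i', j))}"

lemma ssyt_less_eq_tab: "ssyt (<) A p q = tab A (skew_diagram p q)"
  by (simp add: ssyt_def tab_def le_less)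

lemma tabI:
  assumes "T \<in> D \<rightarrow>\<^sub>E A"
    "\<And>i j j'. (i, j) \<in> D \<Longrightarrow> (i, j') \<in> D \<Longrightarrow> j < j' \<Longrightarrow> T (i, j) \<le> T (i, j')"
    "\<And>i i' j. (i, j) \<in> D \<Longrightarrow> (i', j) \<in> D \<Longrightarrow> i < i' \<Longrightarrow> T (i, j) < T (i', j)"
  shows "T \<in> tab A D"
  using assms by (simp add: tab_def)

lemma tab_row: "T \<in> tab A D \<Longrightarrow> (i, j) \<in> D \<Longrightarrow> (i, j') \<in> D \<Longrightarrow> j \<le> j' \<Longrightarrow> T (i, j) \<le> T (i, j')"
  by (cases "j = j'") (auto simp: tab_def)

lemma tab_col: "T \<in> tab A D \<Longrightarrow> (i, j) \<in> D \<Longrightarrow> (i', j) \<in> D \<Longrightarrow> i < i' \<Longrightarrow> T (i, j) < T (i', j)"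
  by (auto simp: tab_def)

lemma tab_in: "T \<in> tab A D \<Longrightarrow> b \<in> D \<Longrightarrow> T b \<in> A"
  by (auto simp: tab_def)

lemma tab_undefined: "T \<in> tab A D \<Longrightarrow> b \<notin> D \<Longrightarrow> T b = undefined"
  by (auto simp: tab_def)

lemma tab_extensional: "T \<in> tab A D \<Longrightarrow> T \<in> extensional D"
  by (auto simp: tab_def PiE_def)

lemma finite_tab [simp]: "finite D \<Longrightarrow> finite A \<Longrightarrow> finite (tab A D)"
  by (rule finite_subset [of _ "D \<rightarrow>\<^sub>E A"]) (auto simp: tab_def intro: finite_PiE)

definition content :: "(nat \<times> nat) set \<Rightarrow> (nat \<times> nat \<Rightarrow> nat) \<Rightarrow> (nat \<Rightarrow>\<^sub>0 nat)" where
  "content D T = (\<Sum>b\<in>D. sg (T b) 1)"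

lemma lookup_content: "finite D \<Longrightarrow> lk (content D T) v = card {b \<in> D. T b = v}"
proof -
  assume "finite D"
  have "lk (content D T) v = (\<Sum>b\<in>D. if T b = v then 1 else 0)"
    unfolding content_def lookup_sum by (rule sum.cong) (auto simp: lookup_single when_def)
  also have "\<dots> = card {b \<in> D. T b = v}"
    using \<open>finite D\<close> by (simp add: sum.If_cases Int_def)
  finally show ?thesis .
qed

lemma keys_content: "finite D \<Longrightarrow> ks (content D T) = T ` D"
  by (auto simp: in_keys_iff lookup_content card_eq_0_iff) blast+

lemma mdeg_content: "mdeg (content D T) = card D"
  by (simp add: content_def mdeg_sum)

context
  fixes D :: "(nat \<times> nat) set" and k :: nat
  assumes conv: "convex_diag D"
begin

text \<open>A column contains k and k + 1 at most once each, and if both occur they are vertical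
  neighbours, which the involution keeps. The free boxes are the unpaired ones.\<close>

definition bk_free :: "(nat \<times> nat \<Rightarrow> nat) \<Rightarrow> nat \<Rightarrow> nat \<Rightarrow> bool" where
  "bk_free T i j \<longleftrightarrow> (i, j) \<in> D \<and> T (i, j) \<in> {k, Suc k} \<and>
     \<not> ((Suc i, j) \<in> D \<and> T (Suc i, j) \<in> {k, Suc k}) \<and>
     \<not> (\<exists>a. i = Suc a \<and> (a, j) \<in> D \<and> T (a, j) \<in> {k, Suc k})"

text \<open>The free boxes of a row form a segment (\<open>bk_free_interval\<close>). Reflecting it,
  together with the exchange of letters, turns k^a (k+1)^b into k^b (k+1)^a without any need to
  count a and b.\<close>

definition bk_mirror :: "(nat \<times> nat \<Rightarrow> nat) \<Rightarrow> nat \<Rightarrow> nat \<Rightarrow> nat" where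
  "bk_mirror T i j = Min {j. bk_free T i j} + Max {j. bk_free T i j} - j"

text \<open>Reverse the free segment of each row and exchange the two letters.\<close>

definition bk :: "(nat \<times> nat \<Rightarrow> nat) \<Rightarrow> nat \<times> nat \<Rightarrow> nat" where
  "bk T = (\<lambda>(i, j). if bk_free T i j then (if T (i, bk_mirror T i j) = k then Suc k else k) else T (i, j))"

context
  fixes A T
  assumes T: "T \<in> tab A D" and kA: "k \<in> A" "Suc k \<in> A"
begin

lemma bk_free_finite: "finite {j. bk_free T i j}"
proof -
  have "{j. bk_free T i j} \<subseteq> snd ` D" by (auto simp: bk_free_def) force+
  then show ?thesis using conv finite_subset by (blast intro: convex_diag_finite)
qed

text \<open>Were a box between two free ones paired with its vertical neighbour, convexity would
  supply the corresponding neighbour of one of the free boxes, with an entry squeezed into {k, k +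
  1}.\<close>

lemma bk_free_convex:
  assumes "bk_free T i j1" "bk_free T i j2" "j1 \<le> j" "j \<le> j2"
  shows "bk_free T i j"
proof -
  have D1: "(i, j1) \<in> D" and D2: "(i, j2) \<in> D" using assms by (auto simp: bk_free_def)
  then have Dj: "(i, j) \<in> D" using convex_diagD [OF conv D1 D2] assms by simp
  have v: "k \<le> T (i, j1)" "T (i, j2) \<le> Suc k" using assms by (auto simp: bk_free_def)
  have "T (i, j1) \<le> T (i, j)" "T (i, j) \<le> T (i, j2)"
    using tab_row [OF T] D1 D2 Dj assms by auto
  then have in_k: "T (i, j) \<in> {k, Suc k}" using v by auto
  have below: "\<not> ((Suc i, j) \<in> D \<and> T (Suc i, j) \<in> {k, Suc k})"
  proof
    assume a: "(Suc i, j) \<in> D \<and> T (Suc i, j) \<in> {k, Suc k}"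
    then have D': "(Suc i, j1) \<in> D" using convex_diagD [OF conv D1, of "Suc i" j "Suc i" j1] assms by simp
    have "T (i, j1) < T (Suc i, j1)" using tab_col [OF T D1 D'] by simp
    moreover have "T (Suc i, j1) \<le> T (Suc i, j)" using tab_row [OF T D'] a assms by simp
    ultimately have "T (Suc i, j1) \<in> {k, Suc k}" using v a by auto
    then show False using assms(1) D' by (auto simp: bk_free_def)
  qed
  have above: "\<not> (\<exists>a. i = Suc a \<and> (a, j) \<in> D \<and> T (a, j) \<in> {k, Suc k})"
  proof
    assume "\<exists>a. i = Suc a \<and> (a, j) \<in> D \<and> T (a, j) \<in> {k, Suc k}"
    then obtain a where a: "i = Suc a" "(a, j) \<in> D" "T (a, j) \<in> {k, Suc k}" by auto
    then have D': "(a, j2) \<in> D" using convex_diagD [OF conv a(2) D2, of a j2] assms by simp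
    have "T (a, j2) < T (i, j2)" using tab_col [OF T D' D2] a by simp
    moreover have "T (a, j) \<le> T (a, j2)" using tab_row [OF T a(2) D'] assms by simp
    ultimately have "T (a, j2) \<in> {k, Suc k}" using v a by auto
    then show False using assms(2) D' a by (auto simp: bk_free_def)
  qed
  show ?thesis using Dj in_k below above by (simp add: bk_free_def)
qed

lemma bk_free_interval:
  assumes "bk_free T i j0"
  shows "bk_free T i j \<longleftrightarrow> Min {j. bk_free T i j} \<le> j \<and> j \<le> Max {j. bk_free T i j}"
proof -
  have ne: "{j. bk_free T i j} \<noteq> {}" using assms by auto
  have "bk_free T i (Min {j. bk_free T i j})" "bk_free T i (Max {j. bk_free T i j})"
    using Min_in [OF bk_free_finite ne] Max_in [OF bk_free_finite ne] by auto
  then show ?thesis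
    using bk_free_convex [of i "Min {j. bk_free T i j}" "Max {j. bk_free T i j}" j]
    by (auto intro: Min_le Max_ge bk_free_finite)
qed

lemma bk_mirror_free: "bk_free T i j \<Longrightarrow> bk_free T i (bk_mirror T i j)"
  using bk_free_interval [of i j j] bk_free_interval [of i j "bk_mirror T i j"]
  by (auto simp: bk_mirror_def)

lemma bk_mirror_mirror: "bk_free T i j \<Longrightarrow> bk_mirror T i (bk_mirror T i j) = j"
  using bk_free_interval [of i j j] by (auto simp: bk_mirror_def)

lemma bk_mirror_less: "bk_free T i j \<Longrightarrow> bk_free T i j' \<Longrightarrow> j < j' \<Longrightarrow> bk_mirror T i j' < bk_mirror T i j"
  using bk_free_interval [of i j j] bk_free_interval [of i j j'] by (auto simp: bk_mirror_def)

lemma bk_nonfree_cases: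
  assumes "(i, j) \<in> D" "T (i, j) \<in> {k, Suc k}" "\<not> bk_free T i j"
  shows "(T (i, j) = k \<and> (Suc i, j) \<in> D \<and> T (Suc i, j) = Suc k) \<or>
    (T (i, j) = Suc k \<and> (\<exists>a. i = Suc a \<and> (a, j) \<in> D \<and> T (a, j) = k))"
proof -
  consider "(Suc i, j) \<in> D" "T (Suc i, j) \<in> {k, Suc k}"
    | a where "i = Suc a" "(a, j) \<in> D" "T (a, j) \<in> {k, Suc k}"
    using assms by (auto simp: bk_free_def)
  then show ?thesis
  proof cases
    case 1
    then show ?thesis using tab_col [OF T assms(1) 1(1)] assms(2) by auto
  next
    case (2 a)
    then show ?thesis using tab_col [OF T 2(2) assms(1)] assms(2) by auto
  qed
qed

text \<open>A paired k + 1 has its k above it. To the left of a free box, this k would force an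
  entry k or k + 1 above the free box too. So paired letters k precede the free segment and, by
  \<open>bk_nonfree_right\<close>, paired letters k + 1 follow it.\<close>

lemma bk_nonfree_left:
  assumes "(i, j) \<in> D" "T (i, j) \<in> {k, Suc k}" "\<not> bk_free T i j" "bk_free T i j'" "j < j'"
  shows "T (i, j) = k"
proof (rule ccontr)
  assume "T (i, j) \<noteq> k"
  then obtain a where a: "i = Suc a" "(a, j) \<in> D" "T (a, j) = k"
    using bk_nonfree_cases [OF assms(1-3)] by auto
  have Dj': "(i, j') \<in> D" and v: "T (i, j') \<le> Suc k" using assms(4) by (auto simp: bk_free_def)
  have D': "(a, j') \<in> D" using convex_diagD [OF conv a(2) Dj', of a j'] a assms by simp
  have "T (a, j') < T (i, j')" using tab_col [OF T D' Dj'] a by simp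
  moreover have "T (a, j) \<le> T (a, j')" using tab_row [OF T a(2) D'] assms by simp
  ultimately have "T (a, j') \<in> {k, Suc k}" using a v by auto
  then show False using assms(4) D' a by (auto simp: bk_free_def)
qed

lemma bk_nonfree_right:
  assumes "(i, j) \<in> D" "T (i, j) \<in> {k, Suc k}" "\<not> bk_free T i j" "bk_free T i j'" "j' < j"
  shows "T (i, j) = Suc k"
proof (rule ccontr)
  assume "T (i, j) \<noteq> Suc k"
  then have a: "(Suc i, j) \<in> D" "T (Suc i, j) = Suc k"
    using bk_nonfree_cases [OF assms(1-3)] by auto
  have Dj': "(i, j') \<in> D" and v: "k \<le> T (i, j')" using assms(4) by (auto simp: bk_free_def)
  have D': "(Suc i, j') \<in> D" using convex_diagD [OF conv Dj' a(1), of "Suc i" j'] a assms by simp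
  have "T (i, j') < T (Suc i, j')" using tab_col [OF T Dj' D'] a by simp
  moreover have "T (Suc i, j') \<le> T (Suc i, j)" using tab_row [OF T D' a(1)] assms by simp
  ultimately have "T (Suc i, j') \<in> {k, Suc k}" using a v by auto
  then show False using assms(4) D' a by (auto simp: bk_free_def)
qed

lemma bk_free_bk: "bk T (i, j) \<in> {k, Suc k}" if "bk_free T i j"
  using that by (auto simp: bk_def)

lemma bk_nonfree: "bk T (i, j) = T (i, j)" if "\<not> bk_free T i j"
  using that by (auto simp: bk_def)

lemma bk_in_iff: "bk T (i, j) \<in> {k, Suc k} \<longleftrightarrow> T (i, j) \<in> {k, Suc k}" if "(i, j) \<in> D"
  by (cases "bk_free T i j") (auto simp: bk_def bk_free_def)

lemma bk_in_tab: "bk T \<in> tab A D"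
proof (rule tabI)
  show "bk T \<in> D \<rightarrow>\<^sub>E A"
  proof (rule PiE_I)
    fix b assume "b \<in> D"
    then show "bk T b \<in> A"
      using kA tab_in [OF T] by (cases b) (auto simp: bk_def)
  next
    fix b assume "b \<notin> D"
    then show "bk T b = undefined"
      using tab_undefined [OF T] by (cases b) (auto simp: bk_def bk_free_def)
  qed
next
  fix i j j'
  assume D: "(i, j) \<in> D" "(i, j') \<in> D" "j < j'"
  have le: "T (i, j) \<le> T (i, j')" using tab_row [OF T D(1,2)] D by simp
  consider "\<not> bk_free T i j" "\<not> bk_free T i j'" | "bk_free T i j" "\<not> bk_free T i j'"
    | "\<not> bk_free T i j" "bk_free T i j'" | "bk_free T i j" "bk_free T i j'" by blast
  then show "bk T (i, j) \<le> bk T (i, j')"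
  proof cases
    case 1
    then show ?thesis using le by (simp add: bk_nonfree)
  next
    case 2
    have "k \<le> T (i, j')" using le 2 by (auto simp: bk_free_def)
    moreover have "T (i, j') \<noteq> k" using bk_nonfree_right [OF D(2) _ 2(2,1) D(3)] by auto
    ultimately show ?thesis using bk_free_bk [OF 2(1)] bk_nonfree [OF 2(2)] by auto
  next
    case 3
    have "T (i, j) \<le> Suc k" using le 3 by (auto simp: bk_free_def)
    moreover have "T (i, j) \<noteq> Suc k" using bk_nonfree_left [OF D(1) _ 3 D(3)] by auto
    ultimately show ?thesis using bk_free_bk [OF 3(2)] bk_nonfree [OF 3(1)] by auto
  next
    \<comment> \<open>The reflection reverses the order of the two boxes and the exchange of letters
      reverses the inequality back.\<close>
    case 4
    have f: "bk_free T i (bk_mirror T i j)" "bk_free T i (bk_mirror T i j')"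
      using 4 by (simp_all add: bk_mirror_free)
    have "T (i, bk_mirror T i j') \<le> T (i, bk_mirror T i j)"
      using bk_mirror_less [OF 4 D(3)] f by (intro tab_row [OF T]) (auto simp: bk_free_def)
    moreover have "T (i, bk_mirror T i j) \<in> {k, Suc k}" "T (i, bk_mirror T i j') \<in> {k, Suc k}"
      using f by (simp_all add: bk_free_def)
    ultimately show ?thesis using 4 by (auto simp: bk_def)
  qed
next
  fix i i' j
  assume D: "(i, j) \<in> D" "(i', j) \<in> D" "i < i'"
  have lt: "T (i, j) < T (i', j)" using tab_col [OF T D] .
  have D1: "(Suc i, j) \<in> D" using convex_diagD [OF conv D(1,2)] D by simp
  obtain a where a: "i' = Suc a" using D by (cases i') auto
  then have D2: "(a, j) \<in> D" using convex_diagD [OF conv D(1,2)] D by simp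
  have le1: "T (Suc i, j) \<le> T (i', j)" using D tab_col [OF T D1 D(2)] by (cases "Suc i = i'") auto
  have le2: "T (i, j) \<le> T (a, j)" using D a tab_col [OF T D(1) D2] by (cases "i = a") auto
  show "bk T (i, j) < bk T (i', j)"
  proof (cases "bk_free T i j")
    case True
    have "T (i, j) < T (Suc i, j)" using tab_col [OF T D(1) D1] by simp
    then have "Suc k < T (i', j)" using True D1 le1 by (auto simp: bk_free_def)
    then show ?thesis using bk_free_bk [OF True] bk_nonfree [of i' j] by (auto simp: bk_free_def)
  next
    case False
    show ?thesis
    proof (cases "bk_free T i' j")
      case True
      have "T (a, j) < T (i', j)" using tab_col [OF T D2 D(2)] a by simp
      then have "T (i, j) < k" using True D2 a le2 by (auto simp: bk_free_def)
      then show ?thesis using bk_free_bk [OF True] bk_nonfree [OF False] by auto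
    next
      case nf: False
      then show ?thesis using lt False by (simp add: bk_nonfree)
    qed
  qed
qed

lemma bk_free_bk_iff: "bk_free (bk T) i j \<longleftrightarrow> bk_free T i j"
proof -
  have "(\<exists>a. i = Suc a \<and> (a, j) \<in> D \<and> bk T (a, j) \<in> {k, Suc k})
      \<longleftrightarrow> (\<exists>a. i = Suc a \<and> (a, j) \<in> D \<and> T (a, j) \<in> {k, Suc k})"
    using bk_in_iff by blast
  moreover have "((Suc i, j) \<in> D \<and> bk T (Suc i, j) \<in> {k, Suc k}) \<longleftrightarrow> ((Suc i, j) \<in> D \<and> T (Suc i, j) \<in> {k, Suc k})"
    using bk_in_iff by blast
  moreover have "((i, j) \<in> D \<and> bk T (i, j) \<in> {k, Suc k}) \<longleftrightarrow> ((i, j) \<in> D \<and> T (i, j) \<in> {k, Suc k})"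
    using bk_in_iff by blast
  ultimately show ?thesis unfolding bk_free_def by blast
qed

lemma bk_bk: "bk (bk T) = T"
proof (rule ext, clarify)
  fix i j
  have m: "bk_mirror (bk T) i j = bk_mirror T i j" by (simp add: bk_mirror_def bk_free_bk_iff)
  show "bk (bk T) (i, j) = T (i, j)"
  proof (cases "bk_free T i j")
    case True
    have v: "T (i, j) \<in> {k, Suc k}" using True by (simp add: bk_free_def)
    have "bk (bk T) (i, j) = (if bk T (i, bk_mirror T i j) = k then Suc k else k)"
      using True by (subst bk_def) (simp add: bk_free_bk_iff m)
    also have "bk T (i, bk_mirror T i j) = (if T (i, j) = k then Suc k else k)"
      using True by (simp add: bk_def bk_mirror_free bk_mirror_mirror)
    finally show ?thesis using v by auto
  next
    case False
    then have "bk (bk T) (i, j) = bk T (i, j)" by (subst bk_def) (simp add: bk_free_bk_iff)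
    then show ?thesis using False by (simp add: bk_nonfree)
  qed
qed

text \<open>Free boxes correspond through the mirror, and a paired k corresponds to the k + 1 in the
  box below it.\<close>

lemma card_bk: "card {b \<in> D. bk T b = k} = card {b \<in> D. T b = Suc k}"
proof (rule bij_betw_same_card)
  let ?g = "\<lambda>(i, j). if bk_free T i j then (i, bk_mirror T i j) else (Suc i, j)"
  let ?h = "\<lambda>(i, j). if bk_free T i j then (i, bk_mirror T i j) else (i - 1, j)"
  have cs: "\<exists>i j. b = (i, j) \<and> (i, j) \<in> D \<and>
      (bk_free T i j \<and> T (i, bk_mirror T i j) = Suc k \<or>
       \<not> bk_free T i j \<and> T (i, j) = k \<and> (Suc i, j) \<in> D \<and> T (Suc i, j) = Suc k \<and> \<not> bk_free T (Suc i) j)"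
    if "b \<in> {b \<in> D. bk T b = k}" for b
  proof -
    obtain i j where b: "b = (i, j)" by (cases b)
    then have D: "(i, j) \<in> D" and v: "bk T (i, j) = k" using that by auto
    show ?thesis
    proof (cases "bk_free T i j")
      case True
      then have "T (i, bk_mirror T i j) \<noteq> k" using v by (auto simp: bk_def split: if_splits)
      moreover have "T (i, bk_mirror T i j) \<in> {k, Suc k}"
        using bk_mirror_free [OF True] by (simp add: bk_free_def)
      ultimately show ?thesis using True b D by auto
    next
      case False
      then have "T (i, j) = k" using v by (simp add: bk_nonfree)
      then have "(Suc i, j) \<in> D" "T (Suc i, j) = Suc k" using bk_nonfree_cases [OF D _ False] by auto
      moreover from this have "\<not> bk_free T (Suc i) j" using D \<open>T (i, j) = k\<close> by (auto simp: bk_free_def)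
      ultimately show ?thesis using b D False \<open>T (i, j) = k\<close> by auto
    qed
  qed
  have cs': "\<exists>i j. b = (i, j) \<and> (i, j) \<in> D \<and> T (i, j) = Suc k \<and>
      (bk_free T i j \<or> \<not> bk_free T i j \<and> (\<exists>a. i = Suc a \<and> (a, j) \<in> D \<and> T (a, j) = k \<and> \<not> bk_free T a j))"
    if "b \<in> {b \<in> D. T b = Suc k}" for b
  proof -
    obtain i j where b: "b = (i, j)" by (cases b)
    then have D: "(i, j) \<in> D" and v: "T (i, j) = Suc k" using that by auto
    show ?thesis
    proof (cases "bk_free T i j")
      case False
      then obtain a where a: "i = Suc a" "(a, j) \<in> D" "T (a, j) = k"
        using bk_nonfree_cases [OF D _ False] v by auto
      then have "\<not> bk_free T a j" using D v by (auto simp: bk_free_def)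
      then show ?thesis using a b D v False by blast
    qed (use b D v in blast)
  qed
  show "bij_betw ?g {b \<in> D. bk T b = k} {b \<in> D. T b = Suc k}"
  proof (rule bij_betw_byWitness [where f' = ?h])
    show "\<forall>b\<in>{b \<in> D. bk T b = k}. ?h (?g b) = b"
    proof
      fix b assume "b \<in> {b \<in> D. bk T b = k}"
      from cs [OF this] show "?h (?g b) = b"
        by (elim exE conjE disjE) (simp_all add: bk_mirror_free bk_mirror_mirror)
    qed
    show "\<forall>b\<in>{b \<in> D. T b = Suc k}. ?g (?h b) = b"
    proof
      fix b assume "b \<in> {b \<in> D. T b = Suc k}"
      from cs' [OF this] show "?g (?h b) = b"
        by (elim exE conjE disjE) (simp_all add: bk_mirror_free bk_mirror_mirror)
    qed
    show "?g ` {b \<in> D. bk T b = k} \<subseteq> {b \<in> D. T b = Suc k}"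
    proof (rule image_subsetI)
      fix b assume "b \<in> {b \<in> D. bk T b = k}"
      from cs [OF this] show "?g b \<in> {b \<in> D. T b = Suc k}"
      proof (elim exE conjE disjE)
        fix i j assume "b = (i, j)" "bk_free T i j" "T (i, bk_mirror T i j) = Suc k"
        then show ?thesis using bk_mirror_free [of i j] by (simp add: bk_free_def)
      qed simp
    qed
    show "?h ` {b \<in> D. T b = Suc k} \<subseteq> {b \<in> D. bk T b = k}"
    proof (rule image_subsetI)
      fix b assume "b \<in> {b \<in> D. T b = Suc k}"
      from cs' [OF this] show "?h b \<in> {b \<in> D. bk T b = k}"
      proof (elim exE conjE disjE)
        fix i j assume b: "b = (i, j)" "bk_free T i j" "T (i, j) = Suc k"
        then have f: "bk_free T i (bk_mirror T i j)" using bk_mirror_free by blast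
        then have "(i, bk_mirror T i j) \<in> D" by (simp add: bk_free_def)
        then show ?thesis using b f by (simp add: bk_def bk_mirror_mirror)
      next
        fix i j a assume "b = (i, j)" "\<not> bk_free T i j" "i = Suc a" "(a, j) \<in> D" "T (a, j) = k"
          "\<not> bk_free T a j"
        then show ?thesis by (simp add: bk_nonfree)
      qed
    qed
  qed
qed

end

lemma content_bk:
  assumes T: "T \<in> tab A D" and kA: "k \<in> A" "Suc k \<in> A"
  shows "content D (bk T) = Poly_Mapping.map_key (transpose k (Suc k)) (content D T)"
proof (rule poly_mapping_eqI)
  fix v
  have fin: "finite D" using conv by (rule convex_diag_finite)
  have t: "bij (transpose k (Suc k))" by simp
  have 1: "card {b \<in> D. bk T b = k} = card {b \<in> D. T b = Suc k}"
    by (rule card_bk [OF T kA])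
  have 2: "card {b \<in> D. bk T b = Suc k} = card {b \<in> D. T b = k}"
    using card_bk [OF bk_in_tab [OF T kA] kA] bk_bk [OF T kA] by simp
  have 3: "{b \<in> D. bk T b = v} = {b \<in> D. T b = v}" if "v \<noteq> k" "v \<noteq> Suc k"
  proof (rule Collect_cong, rule conj_cong [OF refl])
    fix b assume "b \<in> D"
    then show "bk T b = v \<longleftrightarrow> T b = v"
      using that bk_in_iff [OF T kA, of "fst b" "snd b"] by (cases b) (auto simp: bk_def bk_free_def)
  qed
  show "lk (content D (bk T)) v = lk (Poly_Mapping.map_key (transpose k (Suc k)) (content D T)) v"
    using t fin 1 2 3 by (simp add: lookup_map_key bij_is_inj lookup_content transpose_def)
qed

lemma bij_betw_bk:
  assumes kA: "k \<in> A" "Suc k \<in> A" and P: "\<And>T. T \<in> tab A D \<Longrightarrow> P T \<Longrightarrow> P (bk T)"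
  shows "bij_betw bk {T \<in> tab A D. P T} {T \<in> tab A D. P T}"
proof (rule bij_betw_byWitness [where f' = bk])
  show *: "bk ` {T \<in> tab A D. P T} \<subseteq> {T \<in> tab A D. P T}"
    using bk_in_tab [OF _ kA] P by auto
  show "bk ` {T \<in> tab A D. P T} \<subseteq> {T \<in> tab A D. P T}" by (rule * )
qed (use bk_bk [OF _ kA] in auto)

text \<open>The predicate \<open>P\<close> admits any constraint that the involution preserves; it
  serves for bounds on the last column that come from a column already split off.\<close>

lemma bk_sum_symmetric:
  assumes kA: "k \<in> A" "Suc k \<in> A" and P: "\<And>T. T \<in> tab A D \<Longrightarrow> P T \<Longrightarrow> P (bk T)"
  shows "permvars (transpose k (Suc k)) (\<Sum>T | T \<in> tab A D \<and> P T. xpow (content D T))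
      = (\<Sum>T | T \<in> tab A D \<and> P T. xpow (content D T) :: K mfps)"
proof -
  have "permvars (transpose k (Suc k)) (\<Sum>T | T \<in> tab A D \<and> P T. xpow (content D T))
      = (\<Sum>T | T \<in> tab A D \<and> P T. xpow (content D (bk T)) :: K mfps)"
    unfolding permvars_sum
    by (rule sum.cong) (auto simp: permvars_xpow content_bk [OF _ kA])
  also have "\<dots> = (\<Sum>T | T \<in> tab A D \<and> P T. xpow (content D T))"
    by (rule sum.reindex_bij_betw) (rule bij_betw_bk [where P = P], use kA P in auto)
  finally show ?thesis .
qed

text \<open>Entries move only between k and k + 1, so a bound can be broken only when it equals
  k.\<close>

lemma bk_bounded:
  assumes "T \<in> tab A D" "(i, j) \<in> D" "T (i, j) \<le> B" "B \<noteq> k"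
  shows "bk T (i, j) \<le> B"
  using assms by (auto simp: bk_def bk_free_def)

end

subsection \<open>Straightening in alternants\<close>

text \<open>Adding a box to each row in \<open>C\<close> can leave an earlier row of equal length
  behind; these are the rows that straightening must raise as well.\<close>

definition raised :: "nat set \<Rightarrow> shape \<Rightarrow> nat set" where
  "raised C l = {k. \<exists>i\<in>C. k \<le> i \<and> l k = l i}"

definition raise :: "nat set \<Rightarrow> shape \<Rightarrow> shape" where
  "raise C l = (\<lambda>k. l k + (if k \<in> raised C l then 1 else 0))"

text \<open>\<open>up i\<close> is the shape produced by the operator \<open>u\<^sub>i\<close>, without its scalar.\<close>

abbreviation up :: "nat \<Rightarrow> shape \<Rightarrow> shape" where
  "up i \<equiv> raise {i}"

lemma subset_raised: "C \<subseteq> raised C l"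
  by (auto simp: raised_def)

lemma raised_bounded: "C \<subseteq> {..<n} \<Longrightarrow> raised C l \<subseteq> {..<n}"
  by (fastforce simp: raised_def)

lemma le_raise: "l \<le> raise C l"
  by (simp add: raise_def le_fun_def)

lemma partition_raise:
  assumes l: "is_partition l" and C: "C \<subseteq> {..<n}" "part_length l \<le> n"
  shows "is_partition (raise C l)" "part_length (raise C l) \<le> n"
proof -
  have z: "raise C l n = 0"
    using raised_bounded [OF C(1), of l] partition_beyond [OF l C(2)] by (auto simp: raise_def)
  show p: "is_partition (raise C l)"
  proof (rule is_partitionI [where p = "raise C l", OF _ z])
    fix k
    have le: "l (Suc k) \<le> l k" using partition_antimono [OF l] by simp
    show "raise C l (Suc k) \<le> raise C l k"
    proof (cases "l (Suc k) = l k \<and> Suc k \<in> raised C l")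
      case True
      then obtain i where "i \<in> C" "Suc k \<le> i" "l k = l i" by (auto simp: raised_def)
      then have "k \<in> raised C l" by (auto simp: raised_def intro!: bexI [of _ i])
      then show ?thesis using le by (simp add: raise_def)
    qed (use le in \<open>auto simp: raise_def\<close>)
  qed
  show "part_length (raise C l) \<le> n" using part_length_le_iff [OF p] z by simp
qed

lemma seq_size_raise:
  assumes l: "is_partition l" and C: "C \<subseteq> {..<n}" "part_length l \<le> n"
  shows "seq_size (raise C l) = seq_size l + card (raised C l)"
proof -
  have "seq_size (raise C l) = (\<Sum>k<n. l k) + (\<Sum>k<n. if k \<in> raised C l then 1 else 0)"
    using partition_raise [OF assms] by (simp add: seq_size_lessThan raise_def sum.distrib)
  also have "(\<Sum>k<n. if k \<in> raised C l then 1 else 0) = card ({..<n} \<inter> raised C l)"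
    by (simp add: sum.If_cases Int_def)
  also have "{..<n} \<inter> raised C l = raised C l" using raised_bounded [OF C(1), of l] by blast
  finally show ?thesis using l C by (simp add: seq_size_lessThan)
qed

text \<open>Column words list the letters of a column from the largest down and the last letter acts
  first, so these letters act in increasing order. A row already raised no longer ties with row
  \<open>x\<close>, so acting one letter at a time agrees with raising the whole set at
  once.\<close>

lemma raise_insert:
  assumes l: "is_partition l" and C: "\<And>c. c \<in> C \<Longrightarrow> c < x"
  shows "up x (raise C l) = raise (insert x C) l"
proof
  fix k
  have x: "x \<notin> raised C l" using C by (force simp: raised_def)
  have "k \<in> raised {x} (raise C l) \<longleftrightarrow> k \<le> x \<and> k \<notin> raised C l \<and> l k = l x"
    using x partition_antimono [OF l, of k x] by (auto simp: raised_def [of "{x}"] raise_def)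
  moreover have "k \<in> raised (insert x C) l \<longleftrightarrow> k \<in> raised C l \<or> (k \<le> x \<and> l k = l x)"
    by (auto simp: raised_def)
  ultimately show "up x (raise C l) k = raise (insert x C) l k"
    by (simp add: raise_def)
qed

lemma raise_empty [simp]: "raise {} l = l"
  by (simp add: raise_def raised_def)

lemma foldr_up_decreasing:
  assumes "is_partition l" "sorted_wrt (>) w"
  shows "foldr up w l = raise (set w) l"
  using assms(2)
proof (induction w)
  case (Cons x w)
  then show ?case using raise_insert [OF assms(1), of "set w" x] by simp
qed simp

lemma foldr_up_partition:
  assumes l: "is_partition l" "part_length l \<le> n" and w: "set w \<subseteq> {..<n}"
  shows "is_partition (foldr up w l) \<and> part_length (foldr up w l) \<le> n \<and>
     seq_size l + length w \<le> seq_size (foldr up w l) \<and> l \<le> foldr up w l"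
  using w
proof (induction w)
  case (Cons x w)
  let ?m = "foldr up w l"
  have IH: "is_partition ?m" "part_length ?m \<le> n" "seq_size l + length w \<le> seq_size ?m" "l \<le> ?m" and x: "{x} \<subseteq> {..<n}"
    using Cons by auto
  have "finite (raised {x} ?m)" using finite_subset [OF raised_bounded [OF x]] by blast
  then have "card {x} \<le> card (raised {x} ?m)" by (intro card_mono subset_raised)
  then show ?case
    using IH partition_raise [OF IH(1) x IH(2)] seq_size_raise [OF IH(1) x IH(2)] le_raise [of ?m "{x}"]
    by (auto intro: order_trans)
qed (use l in auto)

lemma groth_mon_add_set:
  assumes "S \<subseteq> {..<n}"
  shows "groth_mon b n (\<lambda>k. l k + (if k \<in> S then 1 else 0)) = (\<Prod>j\<in>S. mX j) * groth_mon b n l"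
proof -
  have "groth_mon b n (\<lambda>k. l k + (if k \<in> S then 1 else 0))
      = (\<Prod>j<n. (if j \<in> S then mX j else 1) * (mX j ^ (l j + (n - 1 - j)) * (1 + mconst b * mX j) ^ j))"
    unfolding groth_mon_def
  proof (rule prod.cong [OF refl])
    fix j
    have "l j + 1 + (n - 1 - j) = Suc (l j + (n - 1 - j))" by simp
    then show "mX j ^ (l j + (if j \<in> S then 1 else 0) + (n - 1 - j)) * (1 + mconst b * mX j) ^ j
      = (if j \<in> S then mX j else 1) * (mX j ^ (l j + (n - 1 - j)) * (1 + mconst b * mX j) ^ j)"
      by (cases "j \<in> S") (simp_all only: if_True if_False power_Suc mult.assoc mult_1_left add_0_right)
  qed
  also have "\<dots> = (\<Prod>j<n. if j \<in> S then mX j else 1) * groth_mon b n l"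
    by (simp add: prod.distrib groth_mon_def)
  also have "(\<Prod>j<n. if j \<in> S then mX j else 1) = (\<Prod>j\<in>S. mX j :: K mfps)"
  proof -
    have "{..<n} \<inter> {j. j \<in> S} = S" using assms by blast
    then show ?thesis by (simp add: prod.If_cases)
  qed
  finally show ?thesis .
qed

text \<open>
  Exchanging \<open>x\<^sub>k\<close> and \<open>x\<^bsub>k+1\<^esub>\<close> fixes \<open>F * (1 + b x\<^sub>k) * groth_mon b n a\<close>, so its alternant vanishes.
\<close>

lemma alt_straighten:
  assumes k: "Suc k < n" and F: "permvars (transpose k (Suc k)) F = F" and a: "a (Suc k) = Suc (a k)"
  shows "alt n (F * groth_mon b n a) = mconst (- b) * alt n (F * (mX k * groth_mon b n a))"
proof -
  let ?t = "transpose k (Suc k)"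
  define R where "R = (\<Prod>j\<in>{..<n} - {k, Suc k}. mX j ^ (a j + (n - 1 - j)) * (1 + mconst b * mX j) ^ j)"
  define e where "e = a k + (n - 1 - k)"
  define u where "u = (mX k * mX (Suc k) :: K mfps)"
  define v where "v = (1 + mconst b * mX k) * (1 + mconst b * mX (Suc k))"
  have t: "bij ?t" by simp
  have pR: "permvars ?t R = R"
    unfolding R_def using t
    by (subst permvars_prod) (auto intro!: prod.cong simp: permvars_mult permvars_power permvars_mX
        permvars_add permvars_1 permvars_mconst)
  have pu: "permvars ?t u = u" and pv: "permvars ?t v = v"
    using t by (simp_all add: u_def v_def permvars_mult permvars_mX permvars_add permvars_1
        permvars_mconst mult.commute)
  have "groth_mon b n a = R * (mX k ^ e * (1 + mconst b * mX k) ^ k *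
      (mX (Suc k) ^ e * (1 + mconst b * mX (Suc k)) ^ Suc k))"
  proof -
    have "{..<n} = insert k (insert (Suc k) ({..<n} - {k, Suc k}))" using k by auto
    then have "groth_mon b n a = (\<Prod>j\<in>insert k (insert (Suc k) ({..<n} - {k, Suc k})).
        mX j ^ (a j + (n - 1 - j)) * (1 + mconst b * mX j) ^ j)"
      unfolding groth_mon_def by (rule prod.cong) simp
    also have "\<dots> = mX k ^ e * (1 + mconst b * mX k) ^ k *
      (mX (Suc k) ^ (a (Suc k) + (n - 1 - Suc k)) * (1 + mconst b * mX (Suc k)) ^ Suc k * R)"
      by (simp add: R_def e_def)
    \<comment> \<open>The entry grows by one while the staircase shift n - 1 - j drops by one, so
      x_k and x_(k+1) have the same exponent and only the powers of 1 + b x differ.\<close>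
    also have "a (Suc k) + (n - 1 - Suc k) = e" using a k by (simp add: e_def)
    finally show ?thesis by (simp add: mult_ac)
  qed
  then have "groth_mon b n a * (1 + mconst b * mX k) = R * (u ^ e * v ^ Suc k)"
    by (simp only: u_def v_def power_mult_distrib power_Suc mult_ac)
  then have "permvars ?t (F * (groth_mon b n a * (1 + mconst b * mX k))) = F * (groth_mon b n a * (1 + mconst b * mX k))"
    using t by (simp only: permvars_mult permvars_power F pR pu pv)
  then have "alt n (F * (groth_mon b n a * (1 + mconst b * mX k))) = 0"
    using k by (intro alt_eq_0_swap [of k n "Suc k"]) auto
  also have "F * (groth_mon b n a * (1 + mconst b * mX k)) = F * groth_mon b n a + mconst b * (F * (mX k * groth_mon b n a))"
    by (simp add: distrib_left mult_ac)
  finally show ?thesis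
    by (simp only: alt_add alt_mconst_mult mconst_uminus minus_mult_left [symmetric] eq_neg_iff_add_eq_0)
qed

text \<open>Each row of \<open>raised C l\<close> outside \<open>C\<close> is supplied by one
  straightening step at the price of a factor - b. Taking the largest missing row k first ensures
  that row k + 1, of equal length, is already raised, which is the situation that
  \<open>alt_straighten\<close> requires; since k lies outside \<open>C\<close>, the cofactor is
  symmetric there.\<close>

lemma alt_column:
  assumes l: "is_partition l" and C: "C \<subseteq> {..<n}"
    and F: "\<And>k. Suc k < n \<Longrightarrow> k \<notin> C \<Longrightarrow> permvars (transpose k (Suc k)) F = F"
  shows "alt n (F * ((\<Prod>j\<in>C. mX j) * groth_mon b n l))
      = mconst ((- b) ^ card (raised C l - C)) * alt n (F * groth_mon b n (raise C l))"
proof -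
  have fin: "finite (raised C l)" using finite_subset [OF raised_bounded [OF C]] by blast
  have "alt n (F * ((\<Prod>j\<in>S. mX j) * groth_mon b n l))
      = mconst ((- b) ^ card (raised C l - S)) * alt n (F * groth_mon b n (raise C l))"
    if "C \<subseteq> S" "S \<subseteq> raised C l" for S
    using that
  proof (induction "card (raised C l - S)" arbitrary: S)
    case 0
    then have "S = raised C l" using fin by auto
    then show ?case
      using groth_mon_add_set [OF raised_bounded [OF C, of l], of b l] by (simp add: raise_def)
  next
    case (Suc d)
    have ne: "raised C l - S \<noteq> {}"
    proof
      assume "raised C l - S = {}"
      then show False using Suc.hyps(2) by (simp only: card.empty)
    qed
    have finS: "finite (raised C l - S)" using fin by simp
    define k where "k = Max (raised C l - S)"
    have k: "k \<in> raised C l" "k \<notin> S" using Max_in [OF finS ne] by (simp_all add: k_def)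
    then obtain i where i: "i \<in> C" "k \<le> i" "l k = l i" by (auto simp: raised_def)
    have "k \<noteq> i" using i k Suc.prems by blast
    then have ki: "Suc k \<le> i" using i by simp
    then have eq: "l (Suc k) = l k"
      using partition_antimono [OF l, of "Suc k" i] partition_antimono [OF l, of k "Suc k"] i by simp
    then have "Suc k \<in> raised C l" using ki i by (auto simp: raised_def intro!: bexI [of _ i])
    moreover have "Suc k \<notin> raised C l - S"
      using Max_ge [OF finS, of "Suc k"] unfolding k_def [symmetric] by auto
    ultimately have kS: "Suc k \<in> S" by blast
    have Sn: "S \<subseteq> {..<n}" using Suc.prems raised_bounded [OF C] by blast
    have finS': "finite S" using Sn finite_subset by blast
    let ?a = "\<lambda>k. l k + (if k \<in> S then 1 else 0)"
    have "alt n (F * ((\<Prod>j\<in>S. mX j) * groth_mon b n l)) = alt n (F * groth_mon b n ?a)"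
      using groth_mon_add_set [OF Sn] by simp
    also have "\<dots> = mconst (- b) * alt n (F * (mX k * groth_mon b n ?a))"
    proof (rule alt_straighten)
      show "Suc k < n" using kS Sn by blast
      then show "permvars (transpose k (Suc k)) F = F" using F Suc.prems k by blast
      show "?a (Suc k) = Suc (?a k)" using eq kS k by simp
    qed
    also have "mX k * groth_mon b n ?a = (\<Prod>j\<in>insert k S. mX j) * groth_mon b n l"
      using groth_mon_add_set [OF Sn, of b l] k finS' by (simp add: mult.assoc)
    also have "alt n (F * ((\<Prod>j\<in>insert k S. mX j) * groth_mon b n l))
        = mconst ((- b) ^ card (raised C l - insert k S)) * alt n (F * groth_mon b n (raise C l))"
    proof (rule Suc.hyps)
      have "raised C l - insert k S = (raised C l - S) - {k}" by auto
      then show "d = card (raised C l - insert k S)"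
        using Suc.hyps(2) k fin by simp
    qed (use Suc.prems k in auto)
    also have "card (raised C l - insert k S) = d"
    proof -
      have "raised C l - insert k S = (raised C l - S) - {k}" by auto
      then show ?thesis using Suc.hyps(2) k fin by simp
    qed
    finally show ?case
      unfolding Suc.hyps(2) [symmetric] by (simp only: power_Suc mconst_mult mult.assoc)
  qed
  from this [OF order_refl subset_raised] show ?thesis .
qed

subsection \<open>Multiplying alternants by skew Schur polynomials\<close>

definition tab_poly :: "nat \<Rightarrow> (nat \<times> nat) set \<Rightarrow> K mfps" where
  "tab_poly n D = (\<Sum>T\<in>tab {..<n} D. xpow (content D T))"

text \<open>The column word with the ranges of rows and columns made explicit, so that it also
  applies to cut and rotated sets of boxes.\<close>

definition cword :: "nat \<Rightarrow> nat \<Rightarrow> (nat \<times> nat) set \<Rightarrow> (nat \<times> nat \<Rightarrow> nat) \<Rightarrow> nat list" where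
  "cword L c D T = concat (map (\<lambda>j. map (\<lambda>i. T (i, j)) (rev (filter (\<lambda>i. (i, j) \<in> D) [0..<L]))) [0..<c])"

lemma column_word_eq_cword: "column_word p q T = cword (part_length p) (p 0) (skew_diagram p q) T"
  by (simp add: column_word_def cword_def)

lemma tab_poly_symmetric:
  assumes "convex_diag D" "\<pi> permutes {..<n}"
  shows "permvars \<pi> (tab_poly n D) = tab_poly n D"
proof (rule permvars_fixed_adjacent [OF _ assms(2)])
  fix k assume "Suc k < n"
  then show "permvars (transpose k (Suc k)) (tab_poly n D) = tab_poly n D"
    using bk_sum_symmetric [OF assms(1), of k "{..<n}" "\<lambda>_. True"] by (simp add: tab_poly_def)
qed

context
  fixes D :: "(nat \<times> nat) set" and n :: nat
  assumes conv: "convex_diag D"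
begin

definition Dcut :: "nat \<Rightarrow> (nat \<times> nat) set" where
  "Dcut c = {(i, j). (i, j) \<in> D \<and> j < c}"

definition Drow :: "nat \<Rightarrow> nat set" where
  "Drow c = {i. (i, c) \<in> D}"

text \<open>Splitting off column c leaves its row condition behind as a bound on column c - 1, so
  sums over fillings of the first c columns have to carry such a bound \<open>B\<close>.\<close>

definition Tabs :: "nat \<Rightarrow> (nat \<Rightarrow> nat) \<Rightarrow> (nat \<times> nat \<Rightarrow> nat) set" where
  "Tabs c B = {T \<in> tab {..<n} (Dcut c). \<forall>i j. (i, j) \<in> D \<and> Suc j = c \<longrightarrow> T (i, j) \<le> B i}"

definition Cols :: "nat \<Rightarrow> (nat \<Rightarrow> nat) \<Rightarrow> (nat \<Rightarrow> nat) set" where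
  "Cols c B = {C \<in> Drow c \<rightarrow>\<^sub>E {..<n}. (\<forall>i\<in>Drow c. \<forall>i'\<in>Drow c. i < i' \<longrightarrow> C i < C i') \<and> (\<forall>i\<in>Drow c. C i \<le> B i)}"

text \<open>The value n imposes nothing, as entries are below n; being larger than every k with k +
  1 < n, it never obstructs an involution either.\<close>

definition Cbound :: "nat \<Rightarrow> (nat \<Rightarrow> nat) \<Rightarrow> nat \<Rightarrow> nat" where
  "Cbound c C i = (if i \<in> Drow c then C i else n)"

definition glue :: "nat \<Rightarrow> (nat \<Rightarrow> nat) \<Rightarrow> (nat \<times> nat \<Rightarrow> nat) \<Rightarrow> nat \<times> nat \<Rightarrow> nat" where
  "glue c C T = (\<lambda>(i, j). if j = c \<and> (i, c) \<in> D then C i else T (i, j))"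

lemma finite_D: "finite D"
  using conv by (rule convex_diag_finite)

lemma finite_Drow: "finite (Drow c)"
proof -
  have "Drow c \<subseteq> fst ` D" by (force simp: Drow_def)
  then show ?thesis using finite_D finite_subset by blast
qed

lemma Dcut_subset: "Dcut c \<subseteq> D"
  by (auto simp: Dcut_def)

lemma convex_Dcut: "convex_diag (Dcut c)"
proof (rule convex_diagI)
  show "finite (Dcut c)" using finite_D Dcut_subset finite_subset by blast
  fix i j i' j' a b
  assume a: "(i, j) \<in> Dcut c" "(i', j') \<in> Dcut c" "i \<le> a" "a \<le> i'" "j \<le> b" "b \<le> j'"
  then have "(a, b) \<in> D" using convex_diagD [OF conv, of i j i' j' a b] by (auto simp: Dcut_def)
  then show "(a, b) \<in> Dcut c" using a by (auto simp: Dcut_def)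
qed

lemma finite_Dcut: "finite (Dcut c)"
  using convex_Dcut by (rule convex_diag_finite)

lemma Dcut_Suc: "Dcut (Suc c) = Dcut c \<union> (\<lambda>i. (i, c)) ` Drow c"
  by (auto simp: Dcut_def Drow_def less_Suc_eq)

lemma finite_Tabs: "finite (Tabs c B)"
  by (rule finite_subset [of _ "tab {..<n} (Dcut c)"]) (auto simp: Tabs_def finite_Dcut)

lemma Cols_inj: "C \<in> Cols c B \<Longrightarrow> inj_on C (Drow c)"
  unfolding Cols_def inj_on_def by (metis (mono_tags, lifting) mem_Collect_eq nat_neq_iff)

lemma Cols_range: "C \<in> Cols c B \<Longrightarrow> C ` Drow c \<subseteq> {..<n}"
  by (auto simp: Cols_def)

lemma finite_Cols: "finite (Cols c B)"
proof (rule finite_subset)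
  show "Cols c B \<subseteq> Drow c \<rightarrow>\<^sub>E {..<n}" by (auto simp: Cols_def)
qed (simp add: finite_PiE finite_Drow)

lemma glue_in_Tabs:
  assumes C: "C \<in> Cols c B" and T: "T \<in> Tabs c (Cbound c C)"
  shows "glue c C T \<in> Tabs (Suc c) B"
proof -
  have Tt: "T \<in> tab {..<n} (Dcut c)" using T by (simp add: Tabs_def)
  have "glue c C T \<in> tab {..<n} (Dcut (Suc c))"
  proof (rule tabI)
    show "glue c C T \<in> Dcut (Suc c) \<rightarrow>\<^sub>E {..<n}"
    proof (rule PiE_I)
      fix b assume "b \<in> Dcut (Suc c)"
      then consider i where "b = (i, c)" "(i, c) \<in> D" | i j where "b = (i, j)" "(i, j) \<in> Dcut c"
        by (cases b) (auto simp: Dcut_Suc Drow_def)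
      then show "glue c C T b \<in> {..<n}"
      proof cases
        case 1
        then show ?thesis using Cols_range [OF C] by (auto simp: glue_def Drow_def)
      next
        case 2
        then show ?thesis using tab_in [OF Tt 2(2)] by (auto simp: glue_def Dcut_def)
      qed
    next
      fix b assume "b \<notin> Dcut (Suc c)"
      then have "b \<notin> Dcut c" "\<not> (snd b = c \<and> b \<in> D)" by (auto simp: Dcut_def)
      then show "glue c C T b = undefined"
        using tab_undefined [OF Tt] by (cases b) (auto simp: glue_def)
    qed
  next
    fix i j j' assume a: "(i, j) \<in> Dcut (Suc c)" "(i, j') \<in> Dcut (Suc c)" "j < j'"
    show "glue c C T (i, j) \<le> glue c C T (i, j')"
    proof (cases "j' = c")
      case True
      obtain c' where c': "c = Suc c'" using a True by (cases c) auto
      have "(i, c') \<in> D" using convex_diagD [OF conv, of i j i c i c'] a True c' by (auto simp: Dcut_def)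
      then have "(i, c') \<in> Dcut c" "(i, j) \<in> Dcut c" using a True c' by (auto simp: Dcut_def)
      then have "T (i, j) \<le> T (i, c')" using tab_row [OF Tt] a True c' by auto
      also have "\<dots> \<le> C i" using T \<open>(i, c') \<in> D\<close> c' a True
        by (auto simp: Tabs_def Cbound_def Drow_def Dcut_def split: if_splits)
      finally show ?thesis using a True by (auto simp: glue_def Dcut_def)
    next
      case False
      then show ?thesis using tab_row [OF Tt, of i j j'] a by (auto simp: glue_def Dcut_def)
    qed
  next
    fix i i' j assume a: "(i, j) \<in> Dcut (Suc c)" "(i', j) \<in> Dcut (Suc c)" "i < i'"
    show "glue c C T (i, j) < glue c C T (i', j)"
    proof (cases "j = c")
      case True
      then show ?thesis using C a by (auto simp: glue_def Cols_def Drow_def Dcut_def)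
    next
      case False
      then show ?thesis using tab_col [OF Tt, of i j i'] a by (auto simp: glue_def Dcut_def)
    qed
  qed
  then show ?thesis using C by (auto simp: Tabs_def glue_def Cols_def Drow_def)
qed

lemma unglue:
  assumes T: "T \<in> Tabs (Suc c) B"
  defines "C \<equiv> restrict (\<lambda>i. T (i, c)) (Drow c)" and "T' \<equiv> restrict T (Dcut c)"
  shows "C \<in> Cols c B" "T' \<in> Tabs c (Cbound c C)" "glue c C T' = T"
proof -
  have Tt: "T \<in> tab {..<n} (Dcut (Suc c))" using T by (simp add: Tabs_def)
  have D1: "(i, c) \<in> Dcut (Suc c)" if "i \<in> Drow c" for i using that by (simp add: Dcut_Suc)
  have D2: "b \<in> Dcut (Suc c)" if "b \<in> Dcut c" for b using that by (simp add: Dcut_Suc)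
  show "C \<in> Cols c B"
    unfolding Cols_def C_def
  proof (intro CollectI conjI ballI impI)
    show "restrict (\<lambda>i. T (i, c)) (Drow c) \<in> Drow c \<rightarrow>\<^sub>E {..<n}"
      using tab_in [OF Tt D1] by auto
    fix i assume i: "i \<in> Drow c"
    then show "restrict (\<lambda>i. T (i, c)) (Drow c) i \<le> B i"
      using T by (simp add: Tabs_def Drow_def)
    fix i' assume "i' \<in> Drow c" "i < i'"
    then show "restrict (\<lambda>i. T (i, c)) (Drow c) i < restrict (\<lambda>i. T (i, c)) (Drow c) i'"
      using tab_col [OF Tt D1 [OF i] D1] i by simp
  qed
  show "T' \<in> Tabs c (Cbound c C)"
    unfolding Tabs_def
  proof (intro CollectI conjI allI impI; (elim conjE)?)
    show "T' \<in> tab {..<n} (Dcut c)"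
    proof (rule tabI)
      show "T' \<in> Dcut c \<rightarrow>\<^sub>E {..<n}" using tab_in [OF Tt D2] by (auto simp: T'_def)
    next
      fix i j j' assume "(i, j) \<in> Dcut c" "(i, j') \<in> Dcut c" "j < j'"
      then show "T' (i, j) \<le> T' (i, j')" using tab_row [OF Tt D2 D2] by (simp add: T'_def)
    next
      fix i i' j assume "(i, j) \<in> Dcut c" "(i', j) \<in> Dcut c" "i < i'"
      then show "T' (i, j) < T' (i', j)" using tab_col [OF Tt D2 D2] by (simp add: T'_def)
    qed
    fix i j assume a: "(i, j) \<in> D" "Suc j = c"
    then have d: "(i, j) \<in> Dcut c" by (auto simp: Dcut_def)
    show "T' (i, j) \<le> Cbound c C i"
    proof (cases "i \<in> Drow c")
      case True
      then have "T (i, j) \<le> T (i, c)" using tab_row [OF Tt D2 [OF d] D1] a by simp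
      then show ?thesis using True d by (simp add: T'_def Cbound_def C_def)
    next
      case False
      then show ?thesis using tab_in [OF Tt D2 [OF d]] d by (simp add: T'_def Cbound_def)
    qed
  qed
  show "glue c C T' = T"
  proof (rule ext, clarify)
    fix i j
    show "glue c C T' (i, j) = T (i, j)"
    proof (cases "(i, j) \<in> Dcut (Suc c)")
      case True
      then show ?thesis by (auto simp: glue_def C_def T'_def Dcut_Suc Drow_def)
    next
      case False
      then have "(i, j) \<notin> Dcut c" "\<not> (j = c \<and> (i, c) \<in> D)" by (auto simp: Dcut_def)
      then show ?thesis using tab_undefined [OF Tt False] by (auto simp: glue_def T'_def)
    qed
  qed
qed

lemma sum_Tabs_Suc:
  "(\<Sum>T\<in>Tabs (Suc c) B. f T) = (\<Sum>C\<in>Cols c B. \<Sum>T\<in>Tabs c (Cbound c C). f (glue c C T) :: K mfps)"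
proof -
  let ?S = "Sigma (Cols c B) (\<lambda>C. Tabs c (Cbound c C))"
  have "(\<Sum>C\<in>Cols c B. \<Sum>T\<in>Tabs c (Cbound c C). f (glue c C T)) = (\<Sum>(C, T)\<in>?S. f (glue c C T))"
    by (rule sum.Sigma) (auto simp: finite_Cols finite_Tabs)
  also have "\<dots> = (\<Sum>T\<in>Tabs (Suc c) B. f T)"
  proof (rule sum.reindex_bij_witness
      [where j = "\<lambda>(C, T). glue c C T" and i = "\<lambda>T. (restrict (\<lambda>i. T (i, c)) (Drow c), restrict T (Dcut c))"])
    fix x assume "x \<in> ?S"
    then obtain C T where x: "x = (C, T)" "C \<in> Cols c B" "T \<in> Tabs c (Cbound c C)" by auto
    have "restrict (\<lambda>i. glue c C T (i, c)) (Drow c) = C"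
      using x(2) by (auto simp: fun_eq_iff glue_def Drow_def Cols_def PiE_def extensional_def)
    moreover have "restrict (glue c C T) (Dcut c) = T"
      using x(3) by (auto simp: fun_eq_iff glue_def Dcut_def Tabs_def tab_def PiE_def extensional_def)
    ultimately show "(restrict (\<lambda>i. (case x of (C, T) \<Rightarrow> glue c C T) (i, c)) (Drow c),
        restrict (case x of (C, T) \<Rightarrow> glue c C T) (Dcut c)) = x"
      using x by simp
    show "(case x of (C, T) \<Rightarrow> glue c C T) \<in> Tabs (Suc c) B"
      using x glue_in_Tabs by simp
    show "f (case x of (C, T) \<Rightarrow> glue c C T) = (case x of (C, T) \<Rightarrow> f (glue c C T))"
      using x by simp
  next
    fix T assume T: "T \<in> Tabs (Suc c) B"
    show "(case (restrict (\<lambda>i. T (i, c)) (Drow c), restrict T (Dcut c)) of (C, T) \<Rightarrow> glue c C T) = T"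
      using unglue [OF T] by simp
    show "(restrict (\<lambda>i. T (i, c)) (Drow c), restrict T (Dcut c)) \<in> ?S"
      using unglue [OF T] by simp
  qed
  finally show ?thesis by simp
qed

lemma content_glue:
  assumes C: "C \<in> Cols c B"
  shows "xpow (content (Dcut (Suc c)) (glue c C T)) = (\<Prod>j\<in>C ` Drow c. mX j) * (xpow (content (Dcut c) T) :: K mfps)"
proof -
  have "content (Dcut (Suc c)) (glue c C T)
      = (\<Sum>b\<in>Dcut c. sg (glue c C T b) 1) + (\<Sum>b\<in>(\<lambda>i. (i, c)) ` Drow c. sg (glue c C T b) 1)"
    unfolding content_def Dcut_Suc
    by (rule sum.union_disjoint) (use finite_Dcut [of c] finite_Drow [of c] in \<open>auto simp: Dcut_def\<close>)
  also have "(\<Sum>b\<in>Dcut c. sg (glue c C T b) 1) = content (Dcut c) T"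
    unfolding content_def by (rule sum.cong) (auto simp: glue_def Dcut_def)
  also have "(\<Sum>b\<in>(\<lambda>i. (i, c)) ` Drow c. sg (glue c C T b) 1) = (\<Sum>i\<in>Drow c. sg (C i) 1)"
    by (subst sum.reindex) (auto simp: inj_on_def glue_def Drow_def intro!: sum.cong)
  also have "\<dots> = (\<Sum>j\<in>C ` Drow c. sg j 1)"
    by (subst sum.reindex [OF Cols_inj [OF C]]) simp
  finally show ?thesis
    by (simp add: xpow_add xpow_sum mX_eq_xpow mult.commute)
qed

text \<open>All bounds are entries of \<open>C\<close> or n, so none of them equals a k outside
  \<open>C\<close> with k + 1 < n, and the involution respects them.\<close>

lemma sum_Tabs_symmetric:
  assumes C: "C \<in> Cols c B" and k: "Suc k < n" "k \<notin> C ` Drow c"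
  shows "permvars (transpose k (Suc k)) (\<Sum>T\<in>Tabs c (Cbound c C). xpow (content (Dcut c) T))
    = (\<Sum>T\<in>Tabs c (Cbound c C). xpow (content (Dcut c) T) :: K mfps)"
  unfolding Tabs_def
proof (rule bk_sum_symmetric [OF convex_Dcut])
  fix T
  assume T: "T \<in> tab {..<n} (Dcut c)" and B: "\<forall>i j. (i, j) \<in> D \<and> Suc j = c \<longrightarrow> T (i, j) \<le> Cbound c C i"
  show "\<forall>i j. (i, j) \<in> D \<and> Suc j = c \<longrightarrow> bk (Dcut c) k T (i, j) \<le> Cbound c C i"
  proof (intro allI impI, elim conjE)
    fix i j assume ij: "(i, j) \<in> D" "Suc j = c"
    then have "(i, j) \<in> Dcut c" by (auto simp: Dcut_def)
    moreover have "Cbound c C i \<noteq> k" using k by (auto simp: Cbound_def)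
    ultimately show "bk (Dcut c) k T (i, j) \<le> Cbound c C i"
      using bk_bounded [OF convex_Dcut T] B ij by blast
  qed
qed (use k in auto)

text \<open>The sum over the remaining columns is the cofactor of \<open>alt_column\<close>, and
  \<open>sum_Tabs_symmetric\<close> is its symmetry condition. The single step is kept separate
  because the bialternant formula iterates it with special bounds.\<close>

lemma alt_Tabs_Suc:
  assumes l: "is_partition l"
  shows "(\<Sum>T\<in>Tabs (Suc c) B. alt n (xpow (content (Dcut (Suc c)) T) * groth_mon b n l))
    = (\<Sum>C\<in>Cols c B. mconst ((- b) ^ card (raised (C ` Drow c) l - C ` Drow c)) *
        (\<Sum>T\<in>Tabs c (Cbound c C). alt n (xpow (content (Dcut c) T) * groth_mon b n (raise (C ` Drow c) l))))"
  unfolding sum_Tabs_Suc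
proof (rule sum.cong [OF refl])
  fix C assume C: "C \<in> Cols c B"
  let ?F = "\<Sum>T\<in>Tabs c (Cbound c C). xpow (content (Dcut c) T) :: K mfps"
  have "(\<Sum>T\<in>Tabs c (Cbound c C). alt n (xpow (content (Dcut (Suc c)) (glue c C T)) * groth_mon b n l))
      = alt n (?F * ((\<Prod>j\<in>C ` Drow c. mX j) * groth_mon b n l))"
    unfolding content_glue [OF C] alt_sum [symmetric] sum_distrib_right
    by (intro arg_cong [where f = "alt n"] sum.cong refl) (simp only: mult_ac)
  also have "\<dots> = mconst ((- b) ^ card (raised (C ` Drow c) l - C ` Drow c)) * alt n (?F * groth_mon b n (raise (C ` Drow c) l))"
    by (rule alt_column [OF l Cols_range [OF C]]) (rule sum_Tabs_symmetric [OF C])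
  also have "alt n (?F * groth_mon b n (raise (C ` Drow c) l))
      = (\<Sum>T\<in>Tabs c (Cbound c C). alt n (xpow (content (Dcut c) T) * groth_mon b n (raise (C ` Drow c) l)))"
    by (simp add: alt_sum [symmetric] sum_distrib_right)
  finally show "(\<Sum>T\<in>Tabs c (Cbound c C). alt n (xpow (content (Dcut (Suc c)) (glue c C T)) * groth_mon b n l))
      = mconst ((- b) ^ card (raised (C ` Drow c) l - C ` Drow c)) *
        (\<Sum>T\<in>Tabs c (Cbound c C). alt n (xpow (content (Dcut c) T) * groth_mon b n (raise (C ` Drow c) l)))" .
qed

text \<open>The last column ends the word and so acts first, in agreement with its being
  straightened first.\<close>

lemma cword_glue:
  assumes l: "is_partition l" and C: "C \<in> Cols c B" and L: "D \<subseteq> {..<L} \<times> UNIV"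
  shows "foldr up (cword L (Suc c) D (glue c C T)) l = foldr up (cword L c D T) (raise (C ` Drow c) l)"
proof -
  let ?rows = "rev (filter (\<lambda>i. (i, c) \<in> D) [0..<L])"
  have set: "set ?rows = Drow c" using L by (auto simp: Drow_def)
  have "cword L c D (glue c C T) = cword L c D T"
    unfolding cword_def by (intro arg_cong [where f = concat] map_cong refl) (auto simp: glue_def)
  moreover have "map (\<lambda>i. glue c C T (i, c)) ?rows = map C ?rows"
    by (rule map_cong) (auto simp: glue_def)
  ultimately have "cword L (Suc c) D (glue c C T) = cword L c D T @ map C ?rows"
    by (simp add: cword_def)
  moreover have "sorted_wrt (>) (map C ?rows)"
    unfolding sorted_wrt_map
  proof (rule sorted_wrt_mono_rel)
    show "sorted_wrt (>) ?rows"
      by (simp add: sorted_wrt_rev sorted_wrt_filter)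
    fix x y assume "x \<in> set ?rows" "y \<in> set ?rows" "x > y"
    then show "C x > C y" using C unfolding set by (auto simp: Cols_def)
  qed
  then have "foldr up (map C ?rows) l = raise (C ` Drow c) l"
    using foldr_up_decreasing [OF l] set by simp
  ultimately show ?thesis by simp
qed

text \<open>
  Induction on columns: the last column is straightened first, because the sum of the other
  columns below a fixed last column \<open>C\<close> is symmetric in \<open>x\<^sub>k, x\<^bsub>k+1\<^esub>\<close> for all \<open>k\<close> outside \<open>C\<close>.
\<close>

lemma alt_Tabs:
  assumes "is_partition l" "part_length l \<le> n" and L: "D \<subseteq> {..<L} \<times> UNIV"
  shows "(\<Sum>T\<in>Tabs c B. alt n (xpow (content (Dcut c) T) * groth_mon b n l))
    = (\<Sum>T\<in>Tabs c B. mconst ((- b) ^ (seq_size (foldr up (cword L c D T) l) - seq_size l - card (Dcut c))) *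
        alt n (groth_mon b n (foldr up (cword L c D T) l)))"
  using assms(1,2)
proof (induction c arbitrary: B l)
  case 0
  have "Dcut 0 = {}" by (auto simp: Dcut_def)
  then show ?case by (simp add: content_def cword_def)
next
  case (Suc c)
  have "(\<Sum>T\<in>Tabs (Suc c) B. alt n (xpow (content (Dcut (Suc c)) T) * groth_mon b n l))
    = (\<Sum>C\<in>Cols c B. mconst ((- b) ^ card (raised (C ` Drow c) l - C ` Drow c)) *
        (\<Sum>T\<in>Tabs c (Cbound c C). alt n (xpow (content (Dcut c) T) * groth_mon b n (raise (C ` Drow c) l))))"
    by (rule alt_Tabs_Suc [OF Suc.prems(1)])
  also have "\<dots> = (\<Sum>C\<in>Cols c B. \<Sum>T\<in>Tabs c (Cbound c C).
      mconst ((- b) ^ (seq_size (foldr up (cword L (Suc c) D (glue c C T)) l) - seq_size l - card (Dcut (Suc c)))) *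
        alt n (groth_mon b n (foldr up (cword L (Suc c) D (glue c C T)) l)))"
  proof (rule sum.cong [OF refl])
    fix C assume C: "C \<in> Cols c B"
    let ?C = "C ` Drow c"
    let ?l = "raise ?C l"
    have l': "is_partition ?l" "part_length ?l \<le> n"
      using partition_raise [OF Suc.prems(1) Cols_range [OF C] Suc.prems(2)] by auto
    have fin: "finite (raised ?C l)"
      using finite_subset [OF raised_bounded [OF Cols_range [OF C]]] by blast
    have cC: "card ?C = card (Drow c)" using Cols_inj [OF C] by (rule card_image)
    have card1: "card (raised ?C l - ?C) = card (raised ?C l) - card (Drow c)"
      by (simp add: card_Diff_subset finite_Drow subset_raised cC)
    have le: "card (Drow c) \<le> card (raised ?C l)"
      using card_mono [OF fin subset_raised] cC by simp
    have size: "seq_size ?l = seq_size l + card (raised ?C l)"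
      by (rule seq_size_raise [OF Suc.prems(1) Cols_range [OF C] Suc.prems(2)])
    have card2: "card (Dcut (Suc c)) = card (Dcut c) + card (Drow c)"
    proof -
      have "card (Dcut (Suc c)) = card (Dcut c) + card ((\<lambda>i. (i, c)) ` Drow c)"
        unfolding Dcut_Suc by (rule card_Un_disjoint) (use finite_Dcut [of c] finite_Drow [of c] in \<open>auto simp: Dcut_def\<close>)
      then show ?thesis by (simp add: card_image inj_on_def)
    qed
    have "mconst ((- b) ^ card (raised ?C l - ?C)) *
        (\<Sum>T\<in>Tabs c (Cbound c C). alt n (xpow (content (Dcut c) T) * groth_mon b n ?l))
      = (\<Sum>T\<in>Tabs c (Cbound c C). mconst ((- b) ^ card (raised ?C l - ?C)) *
          (mconst ((- b) ^ (seq_size (foldr up (cword L c D T) ?l) - seq_size ?l - card (Dcut c))) *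
        alt n (groth_mon b n (foldr up (cword L c D T) ?l))))"
      by (simp only: Suc.IH [OF l'] sum_distrib_left)
    also have "\<dots> = (\<Sum>T\<in>Tabs c (Cbound c C).
      mconst ((- b) ^ (seq_size (foldr up (cword L (Suc c) D (glue c C T)) l) - seq_size l - card (Dcut (Suc c)))) *
        alt n (groth_mon b n (foldr up (cword L (Suc c) D (glue c C T)) l)))"
    proof (rule sum.cong [OF refl])
      fix T assume T: "T \<in> Tabs c (Cbound c C)"
      let ?w = "cword L c D T"
      have dis: "length ?w = card (Dcut c)"
      proof -
        have len: "length (cword L c' D T) = card (Dcut c')" for c'
        proof (induction c')
          case 0
          have "Dcut 0 = {}" by (auto simp: Dcut_def)
          then show ?case by (simp add: cword_def)
        next
          case (Suc d)
          have "card (Dcut (Suc d)) = card (Dcut d) + card ((\<lambda>i. (i, d)) ` Drow d)"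
            unfolding Dcut_Suc by (rule card_Un_disjoint) (use finite_Dcut [of d] finite_Drow [of d] in \<open>auto simp: Dcut_def\<close>)
          also have "card ((\<lambda>i. (i, d)) ` Drow d) = card (Drow d)"
            by (simp add: card_image inj_on_def)
          also have "Drow d = set (filter (\<lambda>i. (i, d) \<in> D) [0..<L])"
            using L by (auto simp: Drow_def)
          also have "card \<dots> = length (filter (\<lambda>i. (i, d) \<in> D) [0..<L])"
            by (rule distinct_card) simp
          finally show ?case using Suc by (simp add: cword_def)
        qed
        show ?thesis by (rule len)
      qed
      have "set ?w \<subseteq> {..<n}"
      proof -
        have "T (i, j) < n" if "(i, j) \<in> D" "j < c" for i j
          using T tab_in [of T "{..<n}" "Dcut c" "(i, j)"] that by (auto simp: Tabs_def Dcut_def)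
        then show ?thesis by (auto simp: cword_def)
      qed
      \<comment> \<open>Each letter adds at least one box, so the truncated differences in the
        exponents are genuine and add up.\<close>
      then have "seq_size ?l + card (Dcut c) \<le> seq_size (foldr up ?w ?l)"
        using foldr_up_partition [OF l', of ?w] dis by simp
      then have "card (raised ?C l - ?C) + (seq_size (foldr up ?w ?l) - seq_size ?l - card (Dcut c))
          = seq_size (foldr up ?w ?l) - seq_size l - card (Dcut (Suc c))"
        using size card1 card2 le by simp
      then show "mconst ((- b) ^ card (raised ?C l - ?C)) *
          (mconst ((- b) ^ (seq_size (foldr up ?w ?l) - seq_size ?l - card (Dcut c))) * alt n (groth_mon b n (foldr up ?w ?l)))
        = mconst ((- b) ^ (seq_size (foldr up (cword L (Suc c) D (glue c C T)) l) - seq_size l - card (Dcut (Suc c)))) *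
          alt n (groth_mon b n (foldr up (cword L (Suc c) D (glue c C T)) l))"
        unfolding cword_glue [OF Suc.prems(1) C L]
        by (simp only: mult.assoc [symmetric] mconst_mult [symmetric] power_add [symmetric])
    qed
    finally show "mconst ((- b) ^ card (raised ?C l - ?C)) *
        (\<Sum>T\<in>Tabs c (Cbound c C). alt n (xpow (content (Dcut c) T) * groth_mon b n ?l))
      = (\<Sum>T\<in>Tabs c (Cbound c C).
      mconst ((- b) ^ (seq_size (foldr up (cword L (Suc c) D (glue c C T)) l) - seq_size l - card (Dcut (Suc c)))) *
        alt n (groth_mon b n (foldr up (cword L (Suc c) D (glue c C T)) l)))" .
  qed
  finally show ?case unfolding sum_Tabs_Suc .
qed

lemma Dcut_all: "D \<subseteq> UNIV \<times> {..<c} \<Longrightarrow> Dcut c = D"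
  by (auto simp: Dcut_def)

lemma Tabs_all: "D \<subseteq> UNIV \<times> {..<c} \<Longrightarrow> Tabs c (\<lambda>_. n) = tab {..<n} D"
  using Dcut_all [of c] tab_in [of _ "{..<n}" D] by (force simp: Tabs_def intro: less_imp_le)

text \<open>The symmetric factor moves into the alternant, where it can be expanded over tableaux.
  The exponent of - b counts the boxes gained beyond one per letter.\<close>

theorem alt_tab_poly:
  assumes l: "is_partition l" "part_length l \<le> n" and D: "D \<subseteq> {..<L} \<times> {..<c}"
  shows "tab_poly n D * alt n (groth_mon b n l)
    = (\<Sum>T\<in>tab {..<n} D. mconst ((- b) ^ (seq_size (foldr up (cword L c D T) l) - seq_size l - card D)) *
        alt n (groth_mon b n (foldr up (cword L c D T) l)))"
proof -
  have D': "D \<subseteq> {..<L} \<times> UNIV" "D \<subseteq> UNIV \<times> {..<c}" using D by auto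
  have "tab_poly n D * alt n (groth_mon b n l) = alt n (tab_poly n D * groth_mon b n l)"
    by (rule alt_symmetric_mult [symmetric]) (rule tab_poly_symmetric [OF conv])
  also have "\<dots> = (\<Sum>T\<in>tab {..<n} D. alt n (xpow (content D T) * groth_mon b n l))"
    by (simp add: tab_poly_def sum_distrib_right alt_sum)
  finally show ?thesis
    using alt_Tabs [OF l D'(1), where B = "\<lambda>_. n" and c = c and b = b]
    unfolding Tabs_all [OF D'(2)] Dcut_all [OF D'(2)] by simp
qed

end

subsection \<open>The bialternant formula\<close>

text \<open>At b = 0 a column survives straightening only if it raises no rows but its own. Adding
  the columns of p from right to left to the empty partition leaves a single tableau, whose row i
  consists of letters i. Here \<open>l c\<close> holds the boxes of p in the columns from c on, and
  \<open>B c\<close> is the bound that the surviving column c imposes on column c - 1.\<close>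

lemma tab_poly_eq_alt:
  assumes p: "is_partition p" "part_length p \<le> n"
  shows "tab_poly n (skew_diagram p (\<lambda>_. 0)) * vandermonde n = alt n (groth_mon 0 n p)"
proof -
  let ?D = "skew_diagram p (\<lambda>_. 0)"
  have conv: "convex_diag ?D" using p by (intro convex_skew_diagram) auto
  define l where "l c = (\<lambda>i. p i - c)" for c :: nat
  define B where "B c = (\<lambda>i. if c < p i then i else n)" for c :: nat
  have row: "Drow ?D c = {i. c < p i}" for c
    unfolding Drow_def [OF conv] by (simp add: skew_diagram_def)
  have l: "is_partition (l c)" "part_length (l c) \<le> n" for c
  proof -
    have z: "l c n = 0" using partition_beyond [OF p order_refl] by (simp add: l_def)
    show pl: "is_partition (l c)"
      by (rule is_partitionI [where p = "l c", OF _ z]) (use partition_antimono [OF p(1)] in \<open>simp add: l_def diff_le_mono\<close>)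
    show "part_length (l c) \<le> n" using part_length_le_iff [OF pl] z by simp
  qed
  have main: "(\<Sum>T\<in>Tabs ?D n c (B c). alt n (xpow (content (Dcut ?D c) T) * groth_mon 0 n (l c))) = alt n (groth_mon 0 n p)" for c
  proof (induction c)
    case 0
    have "Dcut ?D 0 = {}" by (auto simp: Dcut_def [OF conv])
    moreover have "l 0 = p" by (auto simp: l_def)
    moreover have "Tabs ?D n 0 (B 0) = {\<lambda>_. undefined}"
      by (auto simp: Tabs_def [OF conv] tab_def Dcut_def [OF conv])
    ultimately show ?case by (simp add: content_def)
  next
    case (Suc c)
    define C0 where "C0 = restrict (\<lambda>i. i) {i. c < p i}"
    have C0: "C0 \<in> Cols ?D n c (B (Suc c))"
    proof -
      have lt: "i < n" if "c < p i" for i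
      proof -
        have "p i \<noteq> 0" using that by simp
        then show ?thesis using partition_nonzero_iff [OF p(1), of i] p(2) by simp
      qed
      then have "i \<le> B (Suc c) i" if "c < p i" for i
        using that less_imp_le [OF lt [OF that]] by (simp add: B_def)
      then show ?thesis
        unfolding Cols_def [OF conv] row C0_def using lt by auto
    qed
    \<comment> \<open>At the first row i with C i \<noteq> i, monotonicity gives C i > i and the
      bound gives p i = c + 1. From row i on \<open>l (Suc c)\<close> is zero, so row C i - 1 is
      raised together with row C i although it is not an entry of the column.\<close>
    have van: "raised (C ` Drow ?D c) (l (Suc c)) - C ` Drow ?D c \<noteq> {}"
      if C: "C \<in> Cols ?D n c (B (Suc c))" "C \<noteq> C0" for C
    proof -
      have "\<exists>i. c < p i \<and> C i \<noteq> i"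
      proof (rule ccontr)
        assume "\<not> (\<exists>i. c < p i \<and> C i \<noteq> i)"
        then have "C = C0"
          using C(1) by (auto simp: C0_def Cols_def [OF conv] row PiE_def extensional_def fun_eq_iff)
        then show False using C(2) by simp
      qed
      then obtain i where i: "c < p i" "C i \<noteq> i" "\<And>j. j < i \<Longrightarrow> \<not> (c < p j \<and> C j \<noteq> j)"
        using exists_least_iff [of "\<lambda>i. c < p i \<and> C i \<noteq> i"] by auto
      have below: "c < p j" if "j \<le> i" for j using partition_antimono [OF p(1) that] i by simp
      have mono: "C j < C j'" if "j < j'" "c < p j'" "c < p j" for j j'
        using C(1) that by (auto simp: Cols_def [OF conv] row)
      have "i \<le> C i"
      proof (cases i)
        case (Suc i')
        have "C i' = i'" using i(3) [of i'] below [of i'] Suc by auto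
        then show ?thesis using mono [of i' i] below [of i'] i Suc by simp
      qed simp
      then have lt: "i < C i" using i by simp
      have "C i \<le> B (Suc c) i" using C(1) i by (auto simp: Cols_def [OF conv] row)
      then have pi: "p i = Suc c" using lt i(1) by (auto simp: B_def split: if_splits)
      have z: "l (Suc c) j = 0" if "i \<le> j" for j
        using partition_antimono [OF p(1) that] pi by (simp add: l_def)
      let ?k = "C i - 1"
      have "?k \<in> raised (C ` Drow ?D c) (l (Suc c))"
        unfolding raised_def row
      proof (intro CollectI bexI conjI)
        show "C i - 1 \<le> C i" by simp
        show "l (Suc c) (C i - 1) = l (Suc c) (C i)" using lt z by simp
        show "C i \<in> C ` {i. c < p i}" using i by blast
      qed
      moreover have "?k \<notin> C ` Drow ?D c"
      proof
        assume "?k \<in> C ` Drow ?D c"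
        then obtain j where j: "c < p j" "C j = C i - 1" by (auto simp: row)
        then have "C j < C i" using lt by simp
        then have "\<not> i < j" "i \<noteq> j" using mono [of i j, OF _ j(1) i(1)] by (blast dest: less_asym, blast)
        then have ji: "j < i" by (simp only: not_less le_neq_implies_less)
        then have "C j = j" using i(3) j(1) by blast
        then show False using j(2) ji lt by linarith
      qed
      ultimately show ?thesis by blast
    qed
    have img0: "C0 ` Drow ?D c = {i. c < p i}" by (auto simp: C0_def row)
    have r0: "raised {i. c < p i} (l (Suc c)) = {i. c < p i}"
      using partition_antimono [OF p(1)] by (auto simp: raised_def l_def intro: less_le_trans)
    have l0: "raise {i. c < p i} (l (Suc c)) = l c"
      unfolding raise_def r0 by (auto simp: l_def fun_eq_iff)
    have b0: "Cbound ?D n c C0 = B c"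
      by (auto simp: Cbound_def [OF conv] row C0_def B_def fun_eq_iff)
    have fin: "finite (Cols ?D n c (B (Suc c)))" by (rule finite_Cols [OF conv])
    let ?t = "\<lambda>C. mconst ((- 0) ^ card (raised (C ` Drow ?D c) (l (Suc c)) - C ` Drow ?D c)) *
        (\<Sum>T\<in>Tabs ?D n c (Cbound ?D n c C). alt n (xpow (content (Dcut ?D c) T) * groth_mon 0 n (raise (C ` Drow ?D c) (l (Suc c)))))"
    have "(\<Sum>T\<in>Tabs ?D n (Suc c) (B (Suc c)). alt n (xpow (content (Dcut ?D (Suc c)) T) * groth_mon 0 n (l (Suc c))))
      = (\<Sum>C\<in>Cols ?D n c (B (Suc c)). ?t C)"
      by (rule alt_Tabs_Suc [OF conv l(1)])
    also have "\<dots> = (\<Sum>C\<in>{C0}. ?t C)"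
    proof (rule sum.mono_neutral_right [OF fin])
      show "\<forall>C\<in>Cols ?D n c (B (Suc c)) - {C0}. ?t C = 0"
      proof
        fix C assume C: "C \<in> Cols ?D n c (B (Suc c)) - {C0}"
        have "finite (raised (C ` Drow ?D c) (l (Suc c)))"
          using C finite_subset [OF raised_bounded [OF Cols_range [OF conv]]] by blast
        then have "card (raised (C ` Drow ?D c) (l (Suc c)) - C ` Drow ?D c) \<noteq> 0"
          using van [of C] C by simp
        then show "?t C = 0" by (simp add: power_0_left)
      qed
    qed (use C0 in simp)
    also have "\<dots> = (\<Sum>T\<in>Tabs ?D n c (B c). alt n (xpow (content (Dcut ?D c) T) * groth_mon 0 n (l c)))"
      by (simp add: img0 r0 l0 b0)
    finally show ?case using Suc by simp
  qed
  have sub: "?D \<subseteq> UNIV \<times> {..<p 0}" using skew_diagram_subset [OF p(1)] by blast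
  have "B (p 0) = (\<lambda>_. n)" "l (p 0) = (\<lambda>_. 0)"
    using partition_antimono [OF p(1), of 0] by (auto simp: B_def l_def fun_eq_iff not_less [symmetric])
  then have "alt n (groth_mon 0 n p) = (\<Sum>T\<in>tab {..<n} ?D. alt n (xpow (content ?D T) * groth_mon 0 n (\<lambda>_. 0)))"
    using main [of "p 0"] Tabs_all [OF conv sub] Dcut_all [OF conv sub] by simp
  also have "\<dots> = alt n (tab_poly n ?D * groth_mon 0 n (\<lambda>_. 0))"
    by (simp add: tab_poly_def sum_distrib_right alt_sum)
  also have "\<dots> = tab_poly n ?D * vandermonde n"
    unfolding vandermonde_eq_alt by (rule alt_symmetric_mult) (rule tab_poly_symmetric [OF conv])
  finally show ?thesis by simp
qed

subsection \<open>Schur functions\<close>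

abbreviation diag :: "shape \<Rightarrow> (nat \<times> nat) set" where
  "diag p \<equiv> skew_diagram p (\<lambda>_. 0)"

lemma mem_diag: "(i, j) \<in> diag p \<longleftrightarrow> j < p i"
  by (simp add: skew_diagram_def)

lemma finite_diag: "is_partition p \<Longrightarrow> finite (diag p)"
  by (rule finite_skew_diagram)

lemma convex_diag_diag: "is_partition p \<Longrightarrow> convex_diag (diag p)"
  by (rule convex_skew_diagram) simp_all

lemma mcoeff_schur: "mcoeff (schur p) m = of_nat (card {T \<in> tab UNIV (diag p). content (diag p) T = m})"
  by (simp add: schur_def ssyt_less_eq_tab tableau_weight_def content_def)

lemma tab_mono: "A \<subseteq> B \<Longrightarrow> tab A D \<subseteq> tab B D"
  by (auto simp: tab_def)

lemma tab_restrict: "T \<in> tab UNIV D \<Longrightarrow> T ` D \<subseteq> A \<Longrightarrow> T \<in> tab A D"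
  by (auto simp: tab_def)

lemma tab_UNIV_content:
  assumes "finite D" "ks m \<subseteq> {..<n}"
  shows "{T \<in> tab UNIV D. content D T = m} = {T \<in> tab {..<n} D. content D T = m}"
  using assms tab_mono [of "{..<n}" UNIV D] tab_restrict [of _ D "{..<n}"] keys_content [of D]
  by auto

lemma mcoeff_tab_poly: "finite D \<Longrightarrow> mcoeff (tab_poly n D) m = of_nat (card {T \<in> tab {..<n} D. content D T = m})"
proof -
  assume "finite D"
  then have "finite (tab {..<n} D)" by simp
  moreover have "mcoeff (tab_poly n D) m = (\<Sum>T\<in>tab {..<n} D. if content D T = m then 1 else 0)"
    unfolding tab_poly_def mcoeff_sum by (rule sum.cong) (auto simp: mcoeff_xpow)
  ultimately show ?thesis by (simp add: sum.If_cases Int_def)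
qed

lemma first_vars_schur:
  assumes "is_partition p"
  shows "first_vars n (schur p) = tab_poly n (diag p)"
proof (rule mfps_eqI)
  fix m
  have fin: "finite (diag p)" using assms by (rule finite_diag)
  show "mcoeff (first_vars n (schur p)) m = mcoeff (tab_poly n (diag p)) m"
  proof (cases "ks m \<subseteq> {..<n}")
    case True
    then show ?thesis by (simp add: mcoeff_first_vars mcoeff_schur mcoeff_tab_poly fin tab_UNIV_content)
  next
    case False
    have "{T \<in> tab {..<n} (diag p). content (diag p) T = m} = {}"
    proof -
      have "ks (content (diag p) T) \<subseteq> {..<n}" if "T \<in> tab {..<n} (diag p)" for T
        using tab_in [OF that] by (auto simp: keys_content fin)
      then show ?thesis using False by blast
    qed
    then have "mcoeff (tab_poly n (diag p)) m = 0"
      unfolding mcoeff_tab_poly [OF fin] by (simp only: card.empty of_nat_0)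
    then show ?thesis using False by (simp add: mcoeff_first_vars)
  qed
qed

lemma symm_schur: "is_partition p \<Longrightarrow> symm (schur p)"
  by (rule symm_finitary) (simp add: first_vars_schur tab_poly_symmetric convex_diag_diag)

lemma mcoeff_schur_nonzeroE:
  assumes "mcoeff (schur p) m \<noteq> 0"
  obtains T where "T \<in> tab UNIV (diag p)" "content (diag p) T = m"
proof -
  have "{T \<in> tab UNIV (diag p). content (diag p) T = m} \<noteq> {}"
  proof
    assume "{T \<in> tab UNIV (diag p). content (diag p) T = m} = {}"
    then have "mcoeff (schur p) m = 0"
      unfolding mcoeff_schur by (simp only: card.empty of_nat_0)
    then show False using assms by contradiction
  qed
  then show ?thesis using that by blast
qed

lemma sum_skew_diagram:
  assumes "is_partition p"
  shows "(\<Sum>b\<in>skew_diagram p q. f b) = (\<Sum>i<part_length p. \<Sum>j\<in>{q i..<p i}. f (i, j) :: 'a::comm_monoid_add)"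
proof -
  have "skew_diagram p q = Sigma {..<part_length p} (\<lambda>i. {q i..<p i})"
    using skew_diagram_subset [OF assms, of q] by (auto simp: skew_diagram_def)
  then show ?thesis by (simp add: sum.Sigma)
qed

lemma card_skew_diagram:
  assumes "is_partition p" "is_partition q" "q \<le> p"
  shows "card (skew_diagram p q) = seq_size p - seq_size q"
proof -
  have "card (skew_diagram p q) = (\<Sum>b\<in>skew_diagram p q. 1)" by simp
  also have "\<dots> = (\<Sum>i<part_length p. p i - q i)"
    unfolding sum_skew_diagram [OF assms(1)] by simp
  also have "\<dots> = (\<Sum>i<part_length p. p i) - (\<Sum>i<part_length p. q i)"
    using assms(3) by (intro sum_subtractf_nat) (auto simp: le_fun_def)
  also have "\<dots> = seq_size p - seq_size q"
    using assms by (simp add: seq_size_lessThan [of p "part_length p"]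
      seq_size_lessThan [of q "part_length p"] partition_le_length)
  finally show ?thesis .
qed

lemma skew_size_eq: "is_partition p \<Longrightarrow> is_partition q \<Longrightarrow> q \<le> p \<Longrightarrow> skew_size p q = seq_size p - seq_size q"
  by (simp add: skew_size_def card_skew_diagram)

lemma card_diag: "is_partition p \<Longrightarrow> card (diag p) = seq_size p"
  using card_skew_diagram [of p "\<lambda>_. 0"] by (simp add: le_fun_def)

lemma schur_homogeneous: "is_partition p \<Longrightarrow> mcoeff (schur p) m \<noteq> 0 \<Longrightarrow> mdeg m = seq_size p"
  by (erule mcoeff_schur_nonzeroE) (auto simp: mdeg_content card_diag)

lemma tab_ge_row:
  assumes T: "T \<in> tab A (diag p)" and p: "is_partition p" and b: "(i, j) \<in> diag p"
  shows "i \<le> T (i, j)"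
  using b
proof (induction i)
  case (Suc i)
  have "(i, j) \<in> diag p" using Suc.prems partition_antimono [OF p, of i "Suc i"] by (simp add: mem_diag)
  then show ?case using Suc tab_col [OF T, of i j "Suc i"] by fastforce
qed simp

text \<open>A numerical substitute for the dominance order of contents: larger letters weigh
  more.\<close>

definition mstat :: "(nat \<Rightarrow>\<^sub>0 nat) \<Rightarrow> nat" where
  "mstat m = (\<Sum>i\<in>ks m. i * lk m i)"

lemma mstat_superset: "finite A \<Longrightarrow> ks m \<subseteq> A \<Longrightarrow> mstat m = (\<Sum>i\<in>A. i * lk m i)"
  unfolding mstat_def by (rule sum.mono_neutral_left) (auto simp: in_keys_iff)

lemma mstat_add: "mstat (a + b) = mstat a + mstat b"
proof -
  have "ks a \<union> ks b \<supseteq> ks (a + b)" by (simp add: keys_add_nat)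
  then show ?thesis
    by (simp add: mstat_superset [of "ks a \<union> ks b"] lookup_add sum.distrib distrib_left)
qed

lemma mstat_content: "mstat (content D T) = (\<Sum>b\<in>D. T b)"
  unfolding content_def
  by (induction D rule: infinite_finite_induct) (simp_all add: mstat_add, simp_all add: mstat_def)

lemma content_rows: "is_partition p \<Longrightarrow> content (diag p) fst = part_mon p"
proof (rule poly_mapping_eqI)
  fix v
  assume p: "is_partition p"
  have "{b \<in> diag p. fst b = v} = Pair v ` {..<p v}" by (auto simp: skew_diagram_def)
  then show "lk (content (diag p) fst) v = lk (part_mon p) v"
    using p by (simp add: lookup_content finite_diag card_image inj_on_def)
qed

abbreviation pstat :: "shape \<Rightarrow> nat" where
  "pstat p \<equiv> mstat (part_mon p)"

text \<open>
  The statistic \<open>\<Sum>i * m\<^sub>i\<close> of the content is smallest for the filling of each row \<open>i\<close> by \<open>i\<close>.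
  This makes the transition from monomials to Schur functions unitriangular.
\<close>

lemma tab_content_stat:
  assumes T: "T \<in> tab A (diag p)" and p: "is_partition p"
  shows "pstat p \<le> mstat (content (diag p) T)"
    and "mstat (content (diag p) T) \<le> pstat p \<Longrightarrow> b \<in> diag p \<Longrightarrow> T b = fst b"
proof -
  have ge: "fst b \<le> T b" if "b \<in> diag p" for b
    using tab_ge_row [OF T p] that by (cases b) auto
  have s: "pstat p = (\<Sum>b\<in>diag p. fst b)"
    using mstat_content [of "diag p" fst] content_rows [OF p] by simp
  show "pstat p \<le> mstat (content (diag p) T)"
    unfolding s mstat_content by (rule sum_mono) (rule ge)
  show "T b = fst b" if "mstat (content (diag p) T) \<le> pstat p" "b \<in> diag p"
  proof (rule ccontr)
    assume "T b \<noteq> fst b"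
    then have "fst b < T b" using ge [OF that(2)] by simp
    then have "(\<Sum>b\<in>diag p. fst b) < (\<Sum>b\<in>diag p. T b)"
      using that(2) ge finite_diag [OF p] by (intro sum_strict_mono_ex1) auto
    then show False using that(1) unfolding s mstat_content by simp
  qed
qed

lemma schur_triangular:
  assumes p: "is_partition p" and nz: "mcoeff (schur p) m \<noteq> 0"
  shows "pstat p \<le> mstat m" "mstat m \<le> pstat p \<Longrightarrow> m = part_mon p"
proof -
  obtain T where T: "T \<in> tab UNIV (diag p)" "content (diag p) T = m"
    using nz by (rule mcoeff_schur_nonzeroE)
  show "pstat p \<le> mstat m" using tab_content_stat(1) [OF T(1) p] T(2) by simp
  assume "mstat m \<le> pstat p"
  then have "T b = fst b" if "b \<in> diag p" for b
    using tab_content_stat(2) [OF T(1) p] T(2) that by simp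
  then have "content (diag p) T = content (diag p) fst"
    unfolding content_def by (intro sum.cong) auto
  then show "m = part_mon p" using T(2) content_rows [OF p] by simp
qed

lemma schur_leading:
  assumes p: "is_partition p"
  shows "mcoeff (schur p) (part_mon p) = 1"
proof -
  have "{T \<in> tab UNIV (diag p). content (diag p) T = part_mon p} = {restrict fst (diag p)}"
  proof (intro equalityI subsetI)
    fix T assume "T \<in> {T \<in> tab UNIV (diag p). content (diag p) T = part_mon p}"
    then have T: "T \<in> tab UNIV (diag p)" "content (diag p) T = part_mon p" by auto
    have "T b = fst b" if "b \<in> diag p" for b
      using tab_content_stat(2) [OF T(1) p _ that] T(2) by simp
    then have "T = restrict fst (diag p)"
      using tab_undefined [OF T(1)] by (auto simp: fun_eq_iff restrict_def)
    then show "T \<in> {restrict fst (diag p)}" by simp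
  next
    fix T assume "T \<in> {restrict fst (diag p)}"
    then have T: "T = restrict fst (diag p)" by simp
    have "T \<in> tab UNIV (diag p)" unfolding T by (rule tabI) auto
    moreover have "content (diag p) T = content (diag p) fst"
      unfolding content_def T by (rule sum.cong) auto
    ultimately show "T \<in> {T \<in> tab UNIV (diag p). content (diag p) T = part_mon p}"
      using content_rows [OF p] by simp
  qed
  then show ?thesis by (simp add: mcoeff_schur)
qed

lemma schur_nonzero_length:
  assumes p: "is_partition p" and nz: "mcoeff (schur p) m \<noteq> 0" and m: "ks m \<subseteq> {..<n}"
  shows "part_length p \<le> n"
proof (rule ccontr)
  assume n: "\<not> part_length p \<le> n"
  obtain T where T: "T \<in> tab UNIV (diag p)" "content (diag p) T = m"
    using nz by (rule mcoeff_schur_nonzeroE)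
  have "p n \<noteq> 0" using n partition_nonzero_iff [OF p, of n] by simp
  then have b: "(n, 0) \<in> diag p" by (simp add: mem_diag)
  then have "T (n, 0) \<in> ks m" using T(2) keys_content [OF finite_diag [OF p], of T] by blast
  then show False using tab_ge_row [OF T(1) p b] m by auto
qed

lemma first_vars_schur_eq_0:
  assumes p: "is_partition p" and n: "n < part_length p"
  shows "first_vars n (schur p) = 0"
proof (rule mfps_eqI)
  fix m
  show "mcoeff (first_vars n (schur p)) m = mcoeff 0 m"
    using schur_nonzero_length [OF p, of m n] n
    unfolding mcoeff_first_vars by (cases "mcoeff (schur p) m = 0"; cases "ks m \<subseteq> {..<n}") auto
qed

lemma schur_0: "schur (\<lambda>_. 0) = 1"
proof (rule mfps_eqI)
  fix m :: "nat \<Rightarrow>\<^sub>0 nat"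
  have "diag (\<lambda>_. 0) = {}" by (simp add: skew_diagram_def)
  then have "{T \<in> tab UNIV (diag (\<lambda>_. 0)). content (diag (\<lambda>_. 0)) T = m} = (if m = 0 then {\<lambda>_. undefined} else {})"
    by (auto simp: content_def tab_def)
  then show "mcoeff (schur (\<lambda>_. 0)) m = mcoeff 1 m"
    by (simp add: mcoeff_schur mcoeff_one)
qed

lemma schur_alternant:
  "is_partition p \<Longrightarrow> part_length p \<le> n \<Longrightarrow> first_vars n (schur p) * vandermonde n = alt n (groth_mon 0 n p)"
  by (simp add: first_vars_schur tab_poly_eq_alt)

subsection \<open>The Pieri rule\<close>

text \<open>The complete homogeneous symmetric function h_k. Pairing with products of these extracts
  coefficients (\<open>hall_hom_prod\<close>), which makes skewing explicit.\<close>

definition hom :: "nat \<Rightarrow> K mfps" where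
  "hom k = Abs_mfps (\<lambda>m. if mdeg m = k then 1 else 0)"

lemma mcoeff_hom: "mcoeff (hom k) m = (if mdeg m = k then 1 else 0)"
  by (simp add: hom_def)

lemma symm_hom: "symm (hom k)"
  by (simp add: symm_iff mcoeff_hom mdeg_map_key)

lemma hom_first_vars_Suc:
  "first_vars (Suc i) (hom k) = (\<Sum>a\<le>k. mX i ^ a * first_vars i (hom (k - a)))"
proof (rule mfps_eqI)
  fix m :: "nat \<Rightarrow>\<^sub>0 nat"
  let ?f = "\<lambda>a. mcoeff (xpow (sg i a) * first_vars i (hom (k - a))) m"
  show "mcoeff (first_vars (Suc i) (hom k)) m = mcoeff (\<Sum>a\<le>k. mX i ^ a * first_vars i (hom (k - a))) m"
  proof -
    define a0 where "a0 = lk m i"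
    define m' where "m' = m - sg i a0"
    have m: "m = sg i a0 + m'"
      by (auto intro!: poly_mapping_eqI simp: m'_def a0_def lookup_add lookup_minus lookup_single when_def)
    have z: "lk m' i = 0" by (simp add: m'_def a0_def lookup_minus)
    have other: "?f a = 0" if "a \<noteq> a0" for a
    proof (cases "\<exists>k'. m = sg i a + k'")
      case True
      then obtain k' where k': "m = sg i a + k'" by blast
      have "lk k' i \<noteq> 0"
        using arg_cong [OF k', of "\<lambda>m. lk m i"] that by (simp add: a0_def lookup_add)
      then have "i \<in> ks k'" by (simp add: in_keys_iff)
      then have "\<not> ks k' \<subseteq> {..<i}" by blast
      then show ?thesis unfolding k' by (simp add: mcoeff_first_vars)
    next
      case False
      then show ?thesis by (intro mcoeff_xpow_mult_eq_0) blast
    qed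
    have keys: "ks m \<subseteq> {..<Suc i} \<longleftrightarrow> ks m' \<subseteq> {..<i}"
    proof -
      have "ks m = (if a0 = 0 then {} else {i}) \<union> ks m'" by (subst m) (simp add: keys_add_nat)
      moreover have "i \<notin> ks m'" using z by (simp add: in_keys_iff)
      ultimately show ?thesis by (auto simp: less_Suc_eq)
    qed
    have "mdeg m = a0 + mdeg m'" by (subst m) simp
    then have a0: "?f a0 = mcoeff (first_vars (Suc i) (hom k)) m" if "a0 \<le> k"
      using that keys by (subst m) (auto simp: mcoeff_first_vars mcoeff_hom)
    have "mcoeff (\<Sum>a\<le>k. mX i ^ a * first_vars i (hom (k - a))) m = (\<Sum>a\<le>k. ?f a)"
      by (simp add: mX_power)
    also have "\<dots> = (\<Sum>a\<le>k. if a = a0 then mcoeff (first_vars (Suc i) (hom k)) m else 0)"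
      by (rule sum.cong) (use other a0 in auto)
    also have "\<dots> = (if a0 \<le> k then mcoeff (first_vars (Suc i) (hom k)) m else 0)" by simp
    also have "\<dots> = mcoeff (first_vars (Suc i) (hom k)) m"
      using \<open>mdeg m = a0 + mdeg m'\<close> by (auto simp: mcoeff_first_vars mcoeff_hom)
    finally show ?thesis by simp
  qed
qed

lemma groth_mon_upd:
  assumes "i < n"
  shows "groth_mon b n (l(i := l i + a)) = mX i ^ a * groth_mon b n l"
proof -
  have "groth_mon b n (l(i := l i + a))
      = (\<Prod>j<n. (if j = i then mX i ^ a else 1) * (mX j ^ (l j + (n - 1 - j)) * (1 + mconst b * mX j) ^ j))"
    unfolding groth_mon_def
  proof (rule prod.cong [OF refl])
    fix j
    have "l i + a + (n - 1 - i) = a + (l i + (n - 1 - i))" by simp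
    then show "mX j ^ ((l(i := l i + a)) j + (n - 1 - j)) * (1 + mconst b * mX j) ^ j
      = (if j = i then mX i ^ a else 1) * (mX j ^ (l j + (n - 1 - j)) * (1 + mconst b * mX j) ^ j)"
      by (cases "j = i") (simp_all only: fun_upd_same fun_upd_other if_True if_False power_add mult.assoc
        mult_1_left simp_thms)
  qed
  then show ?thesis using assms by (simp add: prod.distrib groth_mon_def)
qed

text \<open>An intermediate stage of a horizontal strip: rows from i on are final, and interlacing
  is imposed only between rows that can still grow.\<close>

definition hstrips :: "nat \<Rightarrow> shape \<Rightarrow> nat \<Rightarrow> shape set" where
  "hstrips i l k = {p. (\<forall>j\<ge>i. p j = l j) \<and> l \<le> p \<and> (\<forall>j. Suc j < i \<longrightarrow> p (Suc j) \<le> l j) \<and>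
     (\<Sum>j<i. p j) = (\<Sum>j<i. l j) + k}"

lemma hstrips_Suc:
  "hstrips (Suc i) l k
    = (\<Union>a\<in>{a. a \<le> k \<and> (i = 0 \<or> l i + a \<le> l (i - 1))}. hstrips i (l(i := l i + a)) (k - a))"
proof (intro equalityI subsetI)
  fix p assume p: "p \<in> hstrips (Suc i) l k"
  define a where "a = p i - l i"
  have pi: "p i = l i + a" using p by (simp add: a_def hstrips_def le_fun_def)
  have sums: "(\<Sum>j<i. p j) + a = (\<Sum>j<i. l j) + k" using p pi by (simp add: hstrips_def)
  moreover have "(\<Sum>j<i. l j) \<le> (\<Sum>j<i. p j)" using p by (intro sum_mono) (auto simp: hstrips_def le_fun_def)
  ultimately have ak: "a \<le> k" by simp
  have "i = 0 \<or> l i + a \<le> l (i - 1)" using p pi by (cases i) (auto simp: hstrips_def)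
  moreover have "p \<in> hstrips i (l(i := l i + a)) (k - a)"
    unfolding hstrips_def
  proof (intro CollectI conjI allI impI)
    fix j assume "i \<le> j"
    then show "p j = (l(i := l i + a)) j" using p pi by (cases "j = i") (auto simp: hstrips_def)
  next
    show "l(i := l i + a) \<le> p" using p pi by (auto simp: hstrips_def le_fun_def)
  next
    fix j assume "Suc j < i"
    then show "p (Suc j) \<le> (l(i := l i + a)) j" using p by (simp add: hstrips_def)
  next
    have "(\<Sum>j<i. (l(i := l i + a)) j) = (\<Sum>j<i. l j)" by (rule sum.cong) auto
    then show "(\<Sum>j<i. p j) = (\<Sum>j<i. (l(i := l i + a)) j) + (k - a)" using sums ak by simp
  qed
  ultimately show "p \<in> (\<Union>a\<in>{a. a \<le> k \<and> (i = 0 \<or> l i + a \<le> l (i - 1))}. hstrips i (l(i := l i + a)) (k - a))"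
    using ak by blast
next
  fix p assume "p \<in> (\<Union>a\<in>{a. a \<le> k \<and> (i = 0 \<or> l i + a \<le> l (i - 1))}. hstrips i (l(i := l i + a)) (k - a))"
  then obtain a where a: "a \<le> k" "i = 0 \<or> l i + a \<le> l (i - 1)" and p: "p \<in> hstrips i (l(i := l i + a)) (k - a)"
    by blast
  have pi: "p i = l i + a" using p by (simp add: hstrips_def)
  have "(\<Sum>j<i. p j) = (\<Sum>j<i. l j) + (k - a)"
    using p by (simp add: hstrips_def)
  then have "(\<Sum>j<Suc i. p j) = (\<Sum>j<Suc i. l j) + k" using pi a(1) by simp
  moreover have "\<forall>j\<ge>Suc i. p j = l j" using p by (simp add: hstrips_def)
  moreover have "l \<le> p" using p unfolding hstrips_def le_fun_def by (auto split: if_splits)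
  moreover have "p (Suc j) \<le> l j" if "Suc j < Suc i" for j
  proof (cases "Suc j = i")
    case True
    then show ?thesis using a(2) pi by auto
  next
    case False
    then have "p (Suc j) \<le> (l(i := l i + a)) j" using p that by (simp add: hstrips_def)
    then show ?thesis using that False by simp
  qed
  ultimately show "p \<in> hstrips (Suc i) l k" by (simp add: hstrips_def)
qed

lemma hstrips_0: "hstrips 0 l k = (if k = 0 then {l} else {})"
  by (auto simp: hstrips_def)

lemma finite_hstrips: "finite (hstrips i l k)"
proof (induction i arbitrary: l k)
  case (Suc i)
  have "finite {a. a \<le> k \<and> (i = 0 \<or> l i + a \<le> l (i - 1))}" by simp
  then show ?case unfolding hstrips_Suc using Suc by blast
qed (simp add: hstrips_0)

text \<open>Row i receives x_i^a from the expansion of h_k by its last variable. The terms in which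
  row i would outgrow row i - 1 reassemble into one alternant whose first factor is a complete
  function of the variables up to x_i, hence symmetric in x_(i-1) and x_i, and that alternant
  vanishes.\<close>

lemma alt_pieri:
  assumes "i \<le> n" "\<And>j. Suc j < i \<Longrightarrow> l (Suc j) \<le> l j"
  shows "alt n (first_vars i (hom k) * groth_mon 0 n l) = (\<Sum>p\<in>hstrips i l k. alt n (groth_mon 0 n p))"
  using assms
proof (induction i arbitrary: l k)
  case 0
  have "first_vars 0 (hom k) = (if k = 0 then 1 else 0)"
  proof (rule mfps_eqI)
    fix m :: "nat \<Rightarrow>\<^sub>0 nat"
    show "mcoeff (first_vars 0 (hom k)) m = mcoeff (if k = 0 then 1 else 0) m"
      by (cases "m = 0") (auto simp: mcoeff_first_vars mcoeff_hom mcoeff_one)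
  qed
  then show ?case by (simp add: hstrips_0)
next
  case (Suc i)
  let ?A = "{a. a \<le> k \<and> (i = 0 \<or> l i + a \<le> l (i - 1))}"
  let ?f = "\<lambda>a. alt n (mX i ^ a * first_vars i (hom (k - a)) * groth_mon 0 n l)"
  have split: "{..k} = ?A \<union> ({..k} - ?A)" by auto
  have van: "(\<Sum>a\<in>{..k} - ?A. ?f a) = 0"
  proof (cases "{..k} - ?A = {}")
    case True
    then show ?thesis by (simp only: sum.empty)
  next
    case False
    then have i: "i \<noteq> 0" by auto
    \<comment> \<open>The least forbidden a: then l i + d = l (i - 1) + 1, at which straightening
      with b = 0 gives zero.\<close>
    define d where "d = Suc (l (i - 1) - l i)"
    have le: "l i \<le> l (i - 1)" using Suc.prems(2) [of "i - 1"] i by simp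
    have eq: "{..k} - ?A = {d..k}" using i le by (auto simp: d_def)
    then have dk: "d \<le> k" using False by auto
    have "(\<Sum>a\<in>{..k} - ?A. ?f a) = (\<Sum>a\<le>k - d. ?f (d + a))"
      unfolding eq using dk
      by (intro sum.reindex_bij_witness [where i = "\<lambda>a. d + a" and j = "\<lambda>a. a - d"]) auto
    also have "\<dots> = alt n ((\<Sum>a\<le>k - d. mX i ^ a * first_vars i (hom (k - d - a))) * (mX i ^ d * groth_mon 0 n l))"
      unfolding alt_sum [symmetric] sum_distrib_right
      by (intro arg_cong [where f = "alt n"] sum.cong refl) (simp add: power_add mult_ac)
    also have "\<dots> = alt n (first_vars (Suc i) (hom (k - d)) * groth_mon 0 n (l(i := l i + d)))"
      using Suc.prems(1) by (simp add: hom_first_vars_Suc groth_mon_upd)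
    also have "\<dots> = 0"
    proof -
      obtain i' where i': "i = Suc i'" using i by (cases i) auto
      have F: "permvars (transpose i' (Suc i')) (first_vars (Suc i) (hom (k - d))) = first_vars (Suc i) (hom (k - d))"
        using i' by (intro permvars_first_vars_symm symm_hom permutes_swap_id) auto
      have "(l(i := l i + d)) (Suc i') = Suc ((l(i := l i + d)) i')" using le by (simp add: i' d_def)
      then show ?thesis
        using alt_straighten [OF _ F, of n "l(i := l i + d)" 0] Suc.prems(1) i' by simp
    qed
    finally show ?thesis .
  qed
  have "alt n (first_vars (Suc i) (hom k) * groth_mon 0 n l) = (\<Sum>a\<le>k. ?f a)"
    by (simp add: hom_first_vars_Suc sum_distrib_right alt_sum)
  also have "\<dots> = (\<Sum>a\<in>?A. ?f a) + (\<Sum>a\<in>{..k} - ?A. ?f a)"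
    by (subst split, rule sum.union_disjoint) auto
  also have "\<dots> = (\<Sum>a\<in>?A. ?f a)" using van by simp
  also have "\<dots> = (\<Sum>a\<in>?A. \<Sum>p\<in>hstrips i (l(i := l i + a)) (k - a). alt n (groth_mon 0 n p))"
  proof (rule sum.cong [OF refl])
    fix a
    have "?f a = alt n (first_vars i (hom (k - a)) * groth_mon 0 n (l(i := l i + a)))"
      using Suc.prems(1) by (simp add: groth_mon_upd mult_ac)
    also have "\<dots> = (\<Sum>p\<in>hstrips i (l(i := l i + a)) (k - a). alt n (groth_mon 0 n p))"
      using Suc.prems by (intro Suc.IH) auto
    finally show "?f a = (\<Sum>p\<in>hstrips i (l(i := l i + a)) (k - a). alt n (groth_mon 0 n p))" .
  qed
  also have "\<dots> = (\<Sum>p\<in>hstrips (Suc i) l k. alt n (groth_mon 0 n p))"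
    unfolding hstrips_Suc
  proof (rule sum.UNION_disjoint [symmetric])
    show "\<forall>a\<in>?A. \<forall>a'\<in>?A. a \<noteq> a' \<longrightarrow> hstrips i (l(i := l i + a)) (k - a) \<inter> hstrips i (l(i := l i + a')) (k - a') = {}"
    proof (intro ballI impI, rule ccontr)
      fix a a' assume "a \<noteq> a'" "hstrips i (l(i := l i + a)) (k - a) \<inter> hstrips i (l(i := l i + a')) (k - a') \<noteq> {}"
      then obtain p where "p i = (l(i := l i + a)) i" "p i = (l(i := l i + a')) i"
        by (auto simp: hstrips_def)
      then show False using \<open>a \<noteq> a'\<close> by simp
    qed
  qed (auto simp: finite_hstrips)
  finally show ?case .
qed

definition HS :: "shape \<Rightarrow> nat \<Rightarrow> shape set" where
  "HS l k = {p. is_partition p \<and> l \<le> p \<and> (\<forall>j. p (Suc j) \<le> l j) \<and> seq_size p = seq_size l + k}"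

lemma finite_HS [simp]: "finite (HS l k)"
  by (rule finite_subset [of _ "parts (seq_size l + k)"]) (auto simp: HS_def parts_def finite_parts [unfolded parts_def])

lemma hstrips_eq_HS:
  assumes l: "is_partition l" "part_length l \<le> n"
  shows "hstrips n l k = {p \<in> HS l k. part_length p \<le> n}"
proof (intro equalityI subsetI)
  fix p assume p: "p \<in> hstrips n l k"
  have z: "p n = 0" using p partition_beyond [OF l order_refl] by (simp add: hstrips_def)
  have le: "p (Suc j) \<le> l j" for j
    using p partition_beyond [OF l, of "Suc j"] by (cases "Suc j < n") (auto simp: hstrips_def)
  have lp: "l j \<le> p j" for j using p by (simp add: hstrips_def le_fun_def)
  have pp: "is_partition p"
    by (rule is_partitionI [where p = p, OF _ z]) (rule le_trans [OF le lp])
  moreover have len: "part_length p \<le> n" using part_length_le_iff [OF pp] z by simp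
  ultimately show "p \<in> {p \<in> HS l k. part_length p \<le> n}"
    using p le lp l by (simp add: HS_def hstrips_def seq_size_lessThan le_fun_def)
next
  fix p assume "p \<in> {p \<in> HS l k. part_length p \<le> n}"
  then have p: "is_partition p" "part_length p \<le> n" and q: "p \<in> HS l k" by (auto simp: HS_def)
  have "p j = l j" if "j \<ge> n" for j
    using partition_beyond [OF p that] partition_beyond [OF l that] by simp
  then show "p \<in> hstrips n l k"
    using q p l by (simp add: HS_def hstrips_def seq_size_lessThan)
qed

theorem pieri:
  assumes l: "is_partition l"
  shows "hom k * schur l = (\<Sum>p\<in>HS l k. schur p)"
proof (rule first_vars_eqI [of "part_length l"])
  fix n assume n: "part_length l \<le> n"
  have "first_vars n (hom k * schur l) * vandermonde n = first_vars n (hom k) * alt n (groth_mon 0 n l)"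
    using schur_alternant [OF l n] by (simp add: first_vars_mult mult.assoc)
  also have "\<dots> = alt n (first_vars n (hom k) * groth_mon 0 n l)"
    by (rule alt_symmetric_mult [symmetric]) (rule permvars_first_vars_symm [OF symm_hom])
  also have "\<dots> = (\<Sum>p\<in>hstrips n l k. alt n (groth_mon 0 n p))"
    using partition_antimono [OF l] by (intro alt_pieri) auto
  also have "\<dots> = (\<Sum>p\<in>{p \<in> HS l k. part_length p \<le> n}. first_vars n (schur p) * vandermonde n)"
    unfolding hstrips_eq_HS [OF l n] by (rule sum.cong) (auto simp: HS_def schur_alternant)
  \<comment> \<open>A strip may open a row beyond the first n; such shapes vanish in n variables, so
    the range of summation can be freed from n.\<close>
  also have "\<dots> = (\<Sum>p\<in>HS l k. first_vars n (schur p) * vandermonde n)"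
  proof (rule sum.mono_neutral_left [OF finite_HS])
    show "\<forall>p\<in>HS l k - {p \<in> HS l k. part_length p \<le> n}. first_vars n (schur p) * vandermonde n = 0"
    proof
      fix p assume "p \<in> HS l k - {p \<in> HS l k. part_length p \<le> n}"
      then have "is_partition p" "n < part_length p" by (auto simp: HS_def)
      then show "first_vars n (schur p) * vandermonde n = 0" by (simp add: first_vars_schur_eq_0)
    qed
  qed blast
  also have "\<dots> = first_vars n (\<Sum>p\<in>HS l k. schur p) * vandermonde n"
    by (simp add: first_vars_sum sum_distrib_right)
  finally show "first_vars n (hom k * schur l) = first_vars n (\<Sum>p\<in>HS l k. schur p)"
    by (rule vandermonde_cancel)
qed

subsection \<open>Branching\<close>

definition row_cut :: "nat \<Rightarrow> shape \<Rightarrow> (nat \<times> nat \<Rightarrow> nat) \<Rightarrow> shape" where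
  "row_cut l p T = (\<lambda>i. card {j. j < p i \<and> T (i, j) < l})"

definition extend_tab :: "nat \<Rightarrow> shape \<Rightarrow> shape \<Rightarrow> (nat \<times> nat \<Rightarrow> nat) \<Rightarrow> nat \<times> nat \<Rightarrow> nat" where
  "extend_tab l p q T = (\<lambda>b. if b \<in> diag q then T b else if b \<in> diag p then l else undefined)"

lemma row_cut_iff:
  assumes T: "T \<in> tab A (diag p)"
  shows "j < row_cut l p T i \<longleftrightarrow> j < p i \<and> T (i, j) < l"
proof -
  let ?S = "{j. j < p i \<and> T (i, j) < l}"
  have down: "j' \<in> ?S" if "j \<in> ?S" "j' \<le> j" for j j'
    using that tab_row [OF T, of i j' j] by (auto simp: mem_diag)
  have "?S = {..<card ?S}"
  proof (cases "?S = {}")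
    case False
    have fin: "finite ?S" by simp
    have "?S = {..Max ?S}"
      using down [OF Max_in [OF fin False]] Max_ge [OF fin] by blast
    then show ?thesis by (metis card_atMost lessThan_Suc_atMost)
  next
    case True
    then show ?thesis by (simp only: card.empty lessThan_0)
  qed
  then show ?thesis unfolding row_cut_def by blast
qed

lemma content_split:
  assumes p: "is_partition p" and qp: "q \<le> p" and T: "\<And>b. b \<in> diag p \<Longrightarrow> b \<notin> diag q \<Longrightarrow> T b = l"
  shows "content (diag p) T = content (diag q) T + sg l (card (diag p - diag q))"
proof -
  have sub: "diag q \<subseteq> diag p" using qp by (auto simp: skew_diagram_def le_fun_def intro: less_le_trans)
  have "content (diag p) T = (\<Sum>b\<in>diag p - diag q. sg (T b) 1) + content (diag q) T"
    unfolding content_def by (rule sum.subset_diff [OF sub finite_diag [OF p]])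
  also have "(\<Sum>b\<in>diag p - diag q. sg (T b) 1) = (\<Sum>b\<in>diag p - diag q. sg l (1 :: nat))"
    using T by (intro sum.cong) auto
  also have "\<dots> = sg l (card (diag p - diag q))"
  proof (rule poly_mapping_eqI)
    fix k
    have "lk (\<Sum>b\<in>diag p - diag q. sg l (1 :: nat)) k = (\<Sum>b\<in>diag p - diag q. if l = k then 1 else 0)"
      by (simp only: lookup_sum lookup_single when_def)
    then show "lk (\<Sum>b\<in>diag p - diag q. sg l (1 :: nat)) k = lk (sg l (card (diag p - diag q))) k"
      by (simp add: lookup_single when_def)
  qed
  finally show ?thesis by (simp add: add.commute)
qed

text \<open>The boxes carrying the largest letter l form a horizontal strip, and removing them
  leaves an arbitrary tableau with smaller letters. These are the strips \<open>HS\<close> of the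
  Pieri rule, which is why coefficient extraction is adjoint to multiplication by complete
  functions.\<close>

lemma branching:
  assumes p: "is_partition p" and m: "ks m \<subseteq> {..<l}"
  shows "mcoeff (schur p) (m + sg l a) = (\<Sum>q\<in>{q. is_partition q \<and> p \<in> HS q a}. mcoeff (schur q) m)"
proof -
  let ?Q = "{q. is_partition q \<and> p \<in> HS q a}"
  let ?X = "{T \<in> tab UNIV (diag p). content (diag p) T = m + sg l a}"
  let ?Y = "\<lambda>q. {T \<in> tab UNIV (diag q). content (diag q) T = m}"
  have finQ: "finite ?Q"
    by (rule finite_subset [OF _ finite_partitions_le [OF p]]) (auto simp: HS_def)
  have finY: "finite (?Y q)" if "is_partition q" for q
    using tab_UNIV_content [OF finite_diag [OF that] m] finite_diag [OF that] by simp
  have ml: "lk m l = 0" using m by (auto simp: in_keys_iff)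
  have XQ: "row_cut l p T \<in> ?Q" "restrict T (diag (row_cut l p T)) \<in> ?Y (row_cut l p T)"
    "extend_tab l p (row_cut l p T) (restrict T (diag (row_cut l p T))) = T" if "T \<in> ?X" for T
  proof -
    have T: "T \<in> tab UNIV (diag p)" and c: "content (diag p) T = m + sg l a" using that by auto
    let ?q = "row_cut l p T"
    have q: "j < ?q i \<longleftrightarrow> j < p i \<and> T (i, j) < l" for i j by (rule row_cut_iff [OF T])
    have ent: "T b \<le> l" if "b \<in> diag p" for b
    proof -
      have "T b \<in> ks (m + sg l a)" using that c keys_content [OF finite_diag [OF p], of T] by auto
      then show ?thesis using m by (auto simp: keys_add_nat split: if_splits)
    qed
    have sub: "j < p i" if "j < p (Suc i)" for i j using that partition_antimono [OF p, of i "Suc i"] by simp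
    have col: "T (i, j) < T (Suc i, j)" if "j < p (Suc i)" for i j
      using that sub by (intro tab_col [OF T]) (auto simp: mem_diag)
    have dec: "?q (Suc i) \<le> ?q i" for i
    proof (rule leI, rule notI)
      assume "?q i < ?q (Suc i)"
      then have "?q i < p (Suc i)" "T (Suc i, ?q i) < l" using q by auto
      then have "?q i < ?q i" using q [of "?q i" i] col [of "?q i" i] sub [of "?q i" i] by simp
      then show False by simp
    qed
    have strip: "p (Suc i) \<le> ?q i" for i
    proof (rule leI, rule notI)
      assume a: "?q i < p (Suc i)"
      then have "T (Suc i, ?q i) \<le> l" by (intro ent) (simp add: mem_diag)
      then have "?q i < ?q i" using q [of "?q i" i] col [OF a] sub [OF a] by simp
      then show False by simp
    qed
    have le: "?q \<le> p" unfolding le_fun_def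
    proof (intro allI leI notI)
      fix i assume "p i < ?q i" then show False using q [of "p i" i] by simp
    qed
    have z: "?q (part_length p) = 0"
      using le_funD [OF le, of "part_length p"] partition_beyond [OF p order_refl order_refl] by simp
    have qpart: "is_partition ?q" by (rule is_partitionI [where p = ?q, OF dec z])
    have rest: "T b = l" if "b \<in> diag p" "b \<notin> diag ?q" for b
      using that ent [OF that(1)] q by (cases b) (auto simp: mem_diag)
    have cs: "content (diag ?q) T + sg l (card (diag p - diag ?q)) = m + sg l a"
      using content_split [OF p le rest] c by simp
    have "lk (content (diag ?q) T) l = 0"
      unfolding lookup_content [OF finite_diag [OF qpart]] using q by (auto simp: mem_diag card_eq_0_iff)
    then have "card (diag p - diag ?q) = a"
      using arg_cong [OF cs, of "\<lambda>m. lk m l"] ml by (simp add: lookup_add)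
    then have cq: "content (diag ?q) T = m" using cs by simp
    have "seq_size p = mdeg m + a" using mdeg_content [of "diag p" T] c card_diag [OF p] by simp
    moreover have "seq_size ?q = mdeg m" using mdeg_content [of "diag ?q" T] cq card_diag [OF qpart] by simp
    ultimately show "?q \<in> ?Q" using p qpart le strip by (simp add: HS_def)
    have sub': "diag ?q \<subseteq> diag p" using le by (auto simp: skew_diagram_def le_fun_def intro: less_le_trans)
    have "restrict T (diag ?q) \<in> tab UNIV (diag ?q)"
    proof (rule tabI)
      fix i j j' assume "(i, j) \<in> diag ?q" "(i, j') \<in> diag ?q" "j < j'"
      then show "restrict T (diag ?q) (i, j) \<le> restrict T (diag ?q) (i, j')"
        using tab_row [OF T, of i j j'] sub' by (simp add: subset_eq)
    next
      fix i i' j assume "(i, j) \<in> diag ?q" "(i', j) \<in> diag ?q" "i < i'"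
      then show "restrict T (diag ?q) (i, j) < restrict T (diag ?q) (i', j)"
        using tab_col [OF T, of i j i'] sub' by (simp add: subset_eq)
    qed auto
    moreover have "content (diag ?q) (restrict T (diag ?q)) = m"
      unfolding cq [symmetric] content_def by (rule sum.cong) auto
    ultimately show "restrict T (diag ?q) \<in> ?Y ?q" by simp
    show "extend_tab l p ?q (restrict T (diag ?q)) = T"
      using rest tab_undefined [OF T] by (auto simp: extend_tab_def fun_eq_iff)
  qed
  have YX: "extend_tab l p q T \<in> ?X" "row_cut l p (extend_tab l p q T) = q"
    "restrict (extend_tab l p q T) (diag q) = T" if q: "q \<in> ?Q" and T: "T \<in> ?Y q" for q T
  proof -
    have qp: "is_partition q" "q \<le> p" and strip: "\<And>i. p (Suc i) \<le> q i" and size: "seq_size p = seq_size q + a"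
      using q by (auto simp: HS_def)
    have T': "T \<in> tab UNIV (diag q)" and c: "content (diag q) T = m" using T by auto
    let ?E = "extend_tab l p q T"
    have ent: "T b < l" if "b \<in> diag q" for b
      using that c keys_content [OF finite_diag [OF qp(1)], of T] m by auto
    have sub: "diag q \<subseteq> diag p" using qp(2) by (auto simp: skew_diagram_def le_fun_def intro: less_le_trans)
    have Et: "?E \<in> tab UNIV (diag p)"
    proof (rule tabI)
      show "?E \<in> diag p \<rightarrow>\<^sub>E UNIV" using sub by (auto simp: extend_tab_def)
    next
      fix i j j' assume "(i, j) \<in> diag p" "(i, j') \<in> diag p" "j < j'"
      then show "?E (i, j) \<le> ?E (i, j')"
        using tab_row [OF T', of i j j'] ent [of "(i, j)"] by (auto simp: extend_tab_def mem_diag)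
    next
      fix i i' j assume b: "(i, j) \<in> diag p" "(i', j) \<in> diag p" "i < i'"
      then have "j < p (Suc i)" using partition_antimono [OF p, of "Suc i" i'] by (simp add: mem_diag)
      then have jq: "(i, j) \<in> diag q" using strip [of i] by (simp add: mem_diag)
      then show "?E (i, j) < ?E (i', j)"
        using tab_col [OF T', of i j i'] ent [OF jq] b by (auto simp: extend_tab_def)
    qed
    have Eq: "content (diag q) ?E = m"
      unfolding c [symmetric] content_def by (rule sum.cong) (auto simp: extend_tab_def)
    have "card (diag p - diag q) = a"
      using sub finite_diag [OF qp(1)] size by (simp add: card_Diff_subset card_diag p qp)
    then have "content (diag p) ?E = m + sg l a"
      using content_split [OF p qp(2), of ?E l] Eq by (simp add: extend_tab_def)
    then show "?E \<in> ?X" using Et by simp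
    have "j < row_cut l p ?E i \<longleftrightarrow> j < q i" for i j
    proof -
      have "j < q i \<Longrightarrow> j < p i" using le_funD [OF qp(2), of i] by simp
      then show ?thesis
        using row_cut_iff [OF Et, of j l i] ent [of "(i, j)"]
        by (auto simp: extend_tab_def mem_diag split: if_splits)
    qed
    then show "row_cut l p ?E = q" by (metis ext linorder_neqE_nat less_irrefl_nat)
    show "restrict ?E (diag q) = T"
      using tab_undefined [OF T'] by (auto simp: extend_tab_def fun_eq_iff)
  qed
  have "bij_betw (\<lambda>T. (row_cut l p T, restrict T (diag (row_cut l p T)))) ?X (Sigma ?Q ?Y)"
    by (rule bij_betw_byWitness [where f' = "\<lambda>(q, T). extend_tab l p q T"])
      (use XQ YX in \<open>fastforce+\<close>)
  then have "card ?X = card (Sigma ?Q ?Y)" by (rule bij_betw_same_card)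
  also have "\<dots> = (\<Sum>q\<in>?Q. card (?Y q))" using finQ finY by (intro card_SigmaI) auto
  finally show ?thesis by (simp add: mcoeff_schur)
qed

section \<open>Products of complete homogeneous functions\<close>

definition hom_prod :: "nat list \<Rightarrow> K mfps" where
  "hom_prod a = prod_list (map hom a)"

definition mon :: "nat list \<Rightarrow> (nat \<Rightarrow>\<^sub>0 nat)" where
  "mon a = (\<Sum>i<length a. sg i (a ! i))"

lemma mon_snoc: "mon (a @ [k]) = mon a + sg (length a) k"
proof -
  have "(\<Sum>i<length a. sg i ((a @ [k]) ! i)) = mon a"
    unfolding mon_def by (rule sum.cong) (auto simp: nth_append)
  then show ?thesis by (simp add: mon_def)
qed

lemma mon_Nil [simp]: "mon [] = 0"
  by (simp add: mon_def)

lemma mdeg_mon: "mdeg (mon a) = sum_list a"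
  by (induction a rule: rev_induct) (simp_all add: mon_snoc)

lemma lookup_mon: "lk (mon a) i = (if i < length a then a ! i else 0)"
proof -
  have "lk (mon a) i = (\<Sum>j<length a. if j = i then a ! j else 0)"
    unfolding mon_def lookup_sum by (rule sum.cong) (auto simp: lookup_single when_def)
  then show ?thesis by simp
qed

lemma keys_mon: "ks (mon a) \<subseteq> {..<length a}"
  by (auto simp: in_keys_iff lookup_mon split: if_splits)

text \<open>The Pieri rule and branching sum over the same strips, so both sides obey one recursion
  in the last factor; the coefficients are the Kostka numbers.\<close>

lemma hom_prod_expansion:
  "hom_prod a = (\<Sum>p\<in>parts (sum_list a). mconst (mcoeff (schur p) (mon a)) * schur p)"
proof (induction a rule: rev_induct)
  case Nil
  have "parts 0 = {\<lambda>_. 0}"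
  proof -
    have "p = (\<lambda>_. 0)" if "is_partition p" "seq_size p = 0" for p
      using part_length_le_seq_size [OF that(1)] that(2) partition_beyond [OF that(1), of 0] by auto
    then show ?thesis by (auto simp: parts_def)
  qed
  then show ?case by (simp add: hom_prod_def schur_0 mcoeff_one)
next
  case (snoc k a)
  let ?d = "sum_list a"
  have "hom_prod (a @ [k]) = hom k * hom_prod a" by (simp add: hom_prod_def mult.commute)
  also have "\<dots> = (\<Sum>q\<in>parts ?d. \<Sum>p\<in>HS q k. mconst (mcoeff (schur q) (mon a)) * schur p)"
    unfolding snoc.IH sum_distrib_left
  proof (rule sum.cong [OF refl])
    fix q assume "q \<in> parts ?d"
    then have q: "is_partition q" by (simp add: parts_def)
    show "hom k * (mconst (mcoeff (schur q) (mon a)) * schur q)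
        = (\<Sum>p\<in>HS q k. mconst (mcoeff (schur q) (mon a)) * schur p)"
      unfolding sum_distrib_left [symmetric] pieri [OF q, symmetric] by (simp add: mult_ac)
  qed
  also have "\<dots> = (\<Sum>q\<in>parts ?d. \<Sum>p\<in>parts (?d + k). if p \<in> HS q k then mconst (mcoeff (schur q) (mon a)) * schur p else 0)"
  proof (rule sum.cong [OF refl])
    fix q assume q: "q \<in> parts ?d"
    have "HS q k = {p \<in> parts (?d + k). p \<in> HS q k}" using q by (auto simp: HS_def parts_def)
    then show "(\<Sum>p\<in>HS q k. mconst (mcoeff (schur q) (mon a)) * schur p)
      = (\<Sum>p\<in>parts (?d + k). if p \<in> HS q k then mconst (mcoeff (schur q) (mon a)) * schur p else 0)"
      by (simp only: sum.inter_filter [OF finite_parts, symmetric])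
  qed
  also have "\<dots> = (\<Sum>p\<in>parts (?d + k). \<Sum>q\<in>parts ?d. if p \<in> HS q k then mconst (mcoeff (schur q) (mon a)) * schur p else 0)"
    by (rule sum.swap)
  also have "\<dots> = (\<Sum>p\<in>parts (?d + k). mconst (mcoeff (schur p) (mon (a @ [k]))) * schur p)"
  proof (rule sum.cong [OF refl])
    fix p assume p: "p \<in> parts (?d + k)"
    have Q: "{q. is_partition q \<and> p \<in> HS q k} = {q \<in> parts ?d. p \<in> HS q k}"
      using p by (auto simp: HS_def parts_def)
    have "mcoeff (schur p) (mon (a @ [k])) = (\<Sum>q\<in>{q. is_partition q \<and> p \<in> HS q k}. mcoeff (schur q) (mon a))"
      unfolding mon_snoc using p by (intro branching keys_mon) (simp add: parts_def)
    also have "\<dots> = (\<Sum>q\<in>parts ?d. if p \<in> HS q k then mcoeff (schur q) (mon a) else 0)"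
      unfolding Q by (simp only: sum.inter_filter [OF finite_parts])
    finally show "(\<Sum>q\<in>parts ?d. if p \<in> HS q k then mconst (mcoeff (schur q) (mon a)) * schur p else 0)
        = mconst (mcoeff (schur p) (mon (a @ [k]))) * schur p"
      by (simp add: mconst_sum sum_distrib_right if_distrib cong: if_cong)
        (rule sum.cong, auto)
  qed
  finally show ?case by simp
qed

subsection \<open>Schur coefficients\<close>

lemma part_mon_inject: "is_partition p \<Longrightarrow> is_partition q \<Longrightarrow> part_mon p = part_mon q \<Longrightarrow> p = q"
  using lookup_part_mon by metis

lemma schur_part_mon_eq_0:
  assumes "is_partition p" "is_partition q" "p \<noteq> q" "pstat p \<le> pstat q"
  shows "mcoeff (schur q) (part_mon p) = 0"
proof (rule ccontr)
  assume nz: "mcoeff (schur q) (part_mon p) \<noteq> 0"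
  have "part_mon p = part_mon q" by (rule schur_triangular(2) [OF assms(2) nz assms(4)])
  then show False using assms(3) part_mon_inject [OF assms(1,2)] by blast
qed

text \<open>Forward substitution in the unitriangular system formed by the coefficients at the
  \<open>part_mon p\<close>. It is linear in the series and serves as an explicit form of
  \<open>schur_coeff\<close>, which is a definite description.\<close>

function (domintros) schur_scf :: "K mfps \<Rightarrow> shape \<Rightarrow> K" where
  "schur_scf f p = (if is_partition p then mcoeff f (part_mon p) -
     (\<Sum>q\<in>{q \<in> parts (seq_size p). pstat q < pstat p}. schur_scf f q * mcoeff (schur q) (part_mon p)) else 0)"
  by auto
termination
  by (relation "measure (\<lambda>(f, p). pstat p)") auto

declare schur_scf.simps [simp del]

lemma schur_scf_non_partition: "\<not> is_partition p \<Longrightarrow> schur_scf f p = 0"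
  by (simp add: schur_scf.simps)

lemma sum_parts_split:
  assumes p: "is_partition p"
  shows "(\<Sum>q\<in>parts (seq_size p). c q * mcoeff (schur q) (part_mon p))
    = c p + (\<Sum>q\<in>{q \<in> parts (seq_size p). pstat q < pstat p}. c q * mcoeff (schur q) (part_mon p))"
proof -
  let ?f = "\<lambda>q. c q * mcoeff (schur q) (part_mon p)"
  let ?A = "{q \<in> parts (seq_size p). pstat q < pstat p}"
  have "(\<Sum>q\<in>parts (seq_size p). ?f q) = (\<Sum>q\<in>insert p ?A. ?f q)"
  proof (rule sum.mono_neutral_right)
    show "insert p ?A \<subseteq> parts (seq_size p)" using p by (auto simp: parts_def)
    show "\<forall>q\<in>parts (seq_size p) - insert p ?A. ?f q = 0"
    proof
      fix q assume q: "q \<in> parts (seq_size p) - insert p ?A"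
      then have "mcoeff (schur q) (part_mon p) = 0"
        using p by (intro schur_part_mon_eq_0) (auto simp: parts_def)
      then show "?f q = 0" by simp
    qed
  qed simp
  also have "\<dots> = ?f p + (\<Sum>q\<in>?A. ?f q)" by (rule sum.insert) auto
  finally show ?thesis using schur_leading [OF p] by simp
qed

lemma schur_scf_unique:
  assumes c: "\<And>p. c p \<noteq> 0 \<Longrightarrow> is_partition p"
    and eq: "\<And>p. is_partition p \<Longrightarrow> mcoeff f (part_mon p) = (\<Sum>q\<in>parts (seq_size p). c q * mcoeff (schur q) (part_mon p))"
  shows "schur_scf f = c"
proof
  fix p show "schur_scf f p = c p"
  proof (induction p rule: measure_induct_rule [of pstat])
    case (less p)
    show ?case
    proof (cases "is_partition p")
      case True
      have "schur_scf f p = mcoeff f (part_mon p) -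
        (\<Sum>q\<in>{q \<in> parts (seq_size p). pstat q < pstat p}. c q * mcoeff (schur q) (part_mon p))"
        using True less by (simp add: schur_scf.simps [of f p])
      then show ?thesis using eq [OF True] sum_parts_split [OF True, of c] by simp
    next
      case False
      then show ?thesis using c [of p] by (auto simp: schur_scf_non_partition)
    qed
  qed
qed

lemma schur_scf_part_mon:
  assumes "is_partition p"
  shows "mcoeff f (part_mon p) = (\<Sum>q\<in>parts (seq_size p). schur_scf f q * mcoeff (schur q) (part_mon p))"
  unfolding sum_parts_split [OF assms] using assms by (simp add: schur_scf.simps [of f p])

lemma symm_expand:
  assumes "symm f"
  shows "mcoeff f m = (\<Sum>q\<in>parts (mdeg m). schur_scf f q * mcoeff (schur q) m)"
proof (rule sorted_monomial [of m])
  fix p \<pi> assume p: "is_partition p" "bij \<pi>" "m = Poly_Mapping.map_key \<pi> (part_mon p)" "seq_size p = mdeg m"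
  have "mcoeff f m = mcoeff f (part_mon p)" unfolding p(3) by (rule symm_mcoeff [OF assms p(2)])
  also have "\<dots> = (\<Sum>q\<in>parts (mdeg m). schur_scf f q * mcoeff (schur q) (part_mon p))"
    unfolding p(4) [symmetric] by (rule schur_scf_part_mon [OF p(1)])
  also have "\<dots> = (\<Sum>q\<in>parts (mdeg m). schur_scf f q * mcoeff (schur q) m)"
    unfolding p(3) by (rule sum.cong) (auto simp: parts_def symm_mcoeff [OF symm_schur p(2)])
  finally show ?thesis .
qed

lemma schur_scf_add: "schur_scf (f + g) = (\<lambda>p. schur_scf f p + schur_scf g p)"
proof (rule schur_scf_unique)
  fix p assume "schur_scf f p + schur_scf g p \<noteq> 0"
  then show "is_partition p" by (cases "is_partition p") (auto simp: schur_scf_non_partition)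
next
  fix p assume "is_partition p"
  then show "mcoeff (f + g) (part_mon p) = (\<Sum>q\<in>parts (seq_size p). (schur_scf f q + schur_scf g q) * mcoeff (schur q) (part_mon p))"
    by (simp add: schur_scf_part_mon [of p f] schur_scf_part_mon [of p g] distrib_right sum.distrib)
qed

lemma schur_scf_mconst: "schur_scf (mconst a * f) = (\<lambda>p. a * schur_scf f p)"
proof (rule schur_scf_unique)
  fix p assume "a * schur_scf f p \<noteq> 0"
  then show "is_partition p" by (cases "is_partition p") (auto simp: schur_scf_non_partition)
next
  fix p assume "is_partition p"
  then show "mcoeff (mconst a * f) (part_mon p) = (\<Sum>q\<in>parts (seq_size p). a * schur_scf f q * mcoeff (schur q) (part_mon p))"
    by (simp add: schur_scf_part_mon [of p f] sum_distrib_left mult.assoc)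
qed

lemma schur_scf_0: "schur_scf 0 = (\<lambda>_. 0)"
  by (rule schur_scf_unique) auto

lemma schur_scf_schur:
  assumes "is_partition r"
  shows "schur_scf (schur r) = (\<lambda>p. if p = r then 1 else 0)"
proof (rule schur_scf_unique)
  fix p assume p: "is_partition p"
  have "(\<Sum>q\<in>parts (seq_size p). (if q = r then 1 else 0) * mcoeff (schur q) (part_mon p))
    = (\<Sum>q\<in>parts (seq_size p). if q = r then mcoeff (schur r) (part_mon p) else 0)"
    by (rule sum.cong) auto
  also have "\<dots> = mcoeff (schur r) (part_mon p)"
  proof (cases "r \<in> parts (seq_size p)")
    case False
    then have "mcoeff (schur r) (part_mon p) = 0"
      using schur_homogeneous [OF assms, of "part_mon p"] assms p by (auto simp: parts_def mdeg_part_mon)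
    then show ?thesis by simp
  qed simp
  finally show "mcoeff (schur r) (part_mon p)
    = (\<Sum>q\<in>parts (seq_size p). (if q = r then 1 else 0) * mcoeff (schur q) (part_mon p))" by simp
qed (use assms in \<open>auto split: if_splits\<close>)

text \<open>The recursion stays within degree |p|; this later lets \<open>Groth p\<close> be
  replaced by its lowest part \<open>schur p\<close>.\<close>

lemma schur_scf_cong_degree:
  assumes "\<And>m. mdeg m = seq_size p \<Longrightarrow> mcoeff f m = mcoeff g m"
  shows "schur_scf f p = schur_scf g p"
  using assms
proof (induction p rule: measure_induct_rule [of pstat])
  case (less p)
  show ?case
  proof (cases "is_partition p")
    case True
    then show ?thesis
      using less by (simp add: schur_scf.simps [of f p] schur_scf.simps [of g p] mdeg_part_mon parts_def)
  qed (simp add: schur_scf_non_partition)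
qed

subsection \<open>The rings of symmetric functions\<close>

text \<open>For symmetric series, the intrinsic form of the finiteness condition on Schur
  expansions: in any n variables f becomes a polynomial.\<close>

definition locally_bounded :: "K mfps \<Rightarrow> bool" where
  "locally_bounded f \<longleftrightarrow> (\<forall>n. \<exists>d. \<forall>m. ks m \<subseteq> {..<n} \<longrightarrow> mcoeff f m \<noteq> 0 \<longrightarrow> mdeg m \<le> d)"

lemma mcoeff_schur_sum:
  assumes "\<And>p. c p \<noteq> 0 \<Longrightarrow> is_partition p"
  shows "mcoeff (schur_sum c) m = (\<Sum>p\<in>parts (mdeg m). c p * mcoeff (schur p) m)"
proof -
  have "mcoeff (schur_sum c) m = Sum_any (\<lambda>p. c p * mcoeff (schur p) m)"
    by (simp add: schur_sum_def)
  also have "\<dots> = (\<Sum>p\<in>parts (mdeg m). c p * mcoeff (schur p) m)"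
  proof (rule Sum_any.expand_superset)
    show "{a. c a * mcoeff (schur a) m \<noteq> 0} \<subseteq> parts (mdeg m)"
    proof
      fix p assume "p \<in> {a. c a * mcoeff (schur a) m \<noteq> 0}"
      then have "c p \<noteq> 0" "mcoeff (schur p) m \<noteq> 0" by auto
      then show "p \<in> parts (mdeg m)" using assms schur_homogeneous [of p m] by (simp add: parts_def)
    qed
  qed simp
  finally show ?thesis .
qed

lemma schur_sum_schur_scf:
  assumes "schur_coeffs_ok c"
  shows "schur_scf (schur_sum c) = c"
proof (rule schur_scf_unique)
  show c: "\<And>p. c p \<noteq> 0 \<Longrightarrow> is_partition p" using assms by (simp add: schur_coeffs_ok_def)
  show "mcoeff (schur_sum c) (part_mon p) = (\<Sum>q\<in>parts (seq_size p). c q * mcoeff (schur q) (part_mon p))"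
    if "is_partition p" for p
    unfolding mdeg_part_mon [OF that, symmetric] by (rule mcoeff_schur_sum) (rule c)
qed

lemma symm_eq_schur_sum: "symm f \<Longrightarrow> f = schur_sum (schur_scf f)"
  using schur_scf_non_partition by (intro mfps_eqI) (subst mcoeff_schur_sum, auto simp: symm_expand)

text \<open>A Schur function survives in n variables just when its partition has length at most n,
  so finitely many such partitions means bounded degree there. For the converse, the substitution
  that computes the coefficient at a p of length at most n meets only q of length at most n. Closure
  under products becomes a matter of degrees.\<close>

lemma Lam_hat_iff: "f \<in> Lam_hat \<longleftrightarrow> symm f \<and> locally_bounded f"
proof
  assume "f \<in> Lam_hat"
  then obtain c where c: "schur_coeffs_ok c" and f: "f = schur_sum c" by (auto simp: Lam_hat_def)
  have cp: "\<And>p. c p \<noteq> 0 \<Longrightarrow> is_partition p" using c by (simp add: schur_coeffs_ok_def)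
  have coeff: "mcoeff (schur_sum c) m = (\<Sum>p\<in>parts (mdeg m). c p * mcoeff (schur p) m)" for m
    by (rule mcoeff_schur_sum) (rule cp)
  have "symm f" unfolding symm_iff f
  proof (intro allI impI)
    fix \<pi> :: "nat \<Rightarrow> nat" and m assume \<pi>: "bij \<pi>"
    show "mcoeff (schur_sum c) (Poly_Mapping.map_key \<pi> m) = mcoeff (schur_sum c) m"
      unfolding coeff mdeg_map_key [OF \<pi>]
      by (rule sum.cong) (auto simp: parts_def symm_mcoeff [OF symm_schur \<pi>])
  qed
  moreover have "locally_bounded f"
    unfolding locally_bounded_def
  proof
    fix n
    define S where "S = {p. c p \<noteq> 0 \<and> part_length p \<le> n}"
    have S: "finite S" using c by (simp add: schur_coeffs_ok_def S_def)
    have "mdeg m \<le> Max (insert 0 (seq_size ` S))" if m: "ks m \<subseteq> {..<n}" "mcoeff f m \<noteq> 0" for m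
    proof -
      have "\<exists>p\<in>parts (mdeg m). c p * mcoeff (schur p) m \<noteq> 0"
        using m(2) unfolding f coeff by (meson sum.neutral)
      then obtain p where p: "p \<in> parts (mdeg m)" "c p \<noteq> 0" "mcoeff (schur p) m \<noteq> 0" by auto
      then have "p \<in> S" using schur_nonzero_length [OF _ p(3) m(1)] by (simp add: S_def parts_def)
      moreover have "mdeg m = seq_size p" using p(1) by (simp add: parts_def)
      ultimately have "mdeg m \<in> insert 0 (seq_size ` S)" by blast
      then show ?thesis using S by (intro Max_ge) auto
    qed
    then show "\<exists>d. \<forall>m. ks m \<subseteq> {..<n} \<longrightarrow> mcoeff f m \<noteq> 0 \<longrightarrow> mdeg m \<le> d" by blast
  qed
  ultimately show "symm f \<and> locally_bounded f" by simp
next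
  assume f: "symm f \<and> locally_bounded f"
  have "schur_coeffs_ok (schur_scf f)"
    unfolding schur_coeffs_ok_def
  proof (intro conjI allI impI)
    fix p assume "schur_scf f p \<noteq> 0" then show "is_partition p" using schur_scf_non_partition by blast
  next
    fix n
    obtain d where d: "\<And>m. ks m \<subseteq> {..<n} \<Longrightarrow> mcoeff f m \<noteq> 0 \<Longrightarrow> mdeg m \<le> d"
      using f unfolding locally_bounded_def by blast
    have "schur_scf f p = 0" if "is_partition p" "part_length p \<le> n" "d < seq_size p" for p
      using that
    proof (induction p rule: measure_induct_rule [of pstat])
      case (less p)
      have kp: "ks (part_mon p) \<subseteq> {..<n}" using less.prems by (simp add: keys_part_mon)
      have "mcoeff f (part_mon p) = 0"
        using d [OF kp] less.prems by (auto simp: mdeg_part_mon)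
      moreover have "(\<Sum>q\<in>{q \<in> parts (seq_size p). pstat q < pstat p}. schur_scf f q * mcoeff (schur q) (part_mon p)) = 0"
      proof (rule sum.neutral, rule ballI)
        fix q assume "q \<in> {q \<in> parts (seq_size p). pstat q < pstat p}"
        then have q: "is_partition q" "seq_size q = seq_size p" "pstat q < pstat p" by (auto simp: parts_def)
        show "schur_scf f q * mcoeff (schur q) (part_mon p) = 0"
        proof (cases "mcoeff (schur q) (part_mon p) = 0")
          case False
          then have "part_length q \<le> n" using schur_nonzero_length [OF q(1) _ kp] by simp
          then show ?thesis using less.IH [OF q(3,1)] q less.prems by simp
        qed simp
      qed
      ultimately show ?case by (simp add: schur_scf.simps [of f p])
    qed
    note van = this
    have "{p. schur_scf f p \<noteq> 0 \<and> part_length p \<le> n} \<subseteq> parts_upto d"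
    proof
      fix p assume p: "p \<in> {p. schur_scf f p \<noteq> 0 \<and> part_length p \<le> n}"
      then have "is_partition p" using schur_scf_non_partition [of p f] by blast
      moreover from this have "\<not> d < seq_size p" using van [of p] p by blast
      ultimately show "p \<in> parts_upto d" by (simp add: parts_upto_def)
    qed
    then show "finite {p. schur_scf f p \<noteq> 0 \<and> part_length p \<le> n}" by (rule finite_subset) (rule finite_parts_upto)
  qed
  then show "f \<in> Lam_hat"
    using f symm_eq_schur_sum [of f] unfolding Lam_hat_def by blast
qed

lemma schur_coeff_eq: "f \<in> Lam_hat \<Longrightarrow> schur_coeff f = schur_scf f"
proof -
  assume "f \<in> Lam_hat"
  then obtain c where c: "schur_coeffs_ok c" "f = schur_sum c" by (auto simp: Lam_hat_def)
  show ?thesis unfolding schur_coeff_def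
  proof (rule the_equality)
    show "schur_coeffs_ok (schur_scf f) \<and> f = schur_sum (schur_scf f)" using c schur_sum_schur_scf by simp
    show "c' = schur_scf f" if "schur_coeffs_ok c' \<and> f = schur_sum c'" for c'
      using that schur_sum_schur_scf [of c'] by simp
  qed
qed

lemma Lam_hatI: "symm f \<Longrightarrow> locally_bounded f \<Longrightarrow> f \<in> Lam_hat"
  by (simp add: Lam_hat_iff)

section \<open>Closure properties of \<open>Lam\<close> and \<open>Lam_hat\<close>\<close>

lemma Lam_iff: "f \<in> Lam \<longleftrightarrow> symm f \<and> (\<exists>d. \<forall>m. mcoeff f m \<noteq> 0 \<longrightarrow> mdeg m \<le> d)"
  by (simp add: Lam_def symm_iff mdeg_def)

lemma Lam_subset: "f \<in> Lam \<Longrightarrow> f \<in> Lam_hat"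
  unfolding Lam_iff Lam_hat_iff locally_bounded_def by blast

lemma Lam_hat_add: "f \<in> Lam_hat \<Longrightarrow> g \<in> Lam_hat \<Longrightarrow> f + g \<in> Lam_hat"
proof (rule Lam_hatI)
  assume f: "f \<in> Lam_hat" and g: "g \<in> Lam_hat"
  then show "symm (f + g)" by (simp add: Lam_hat_iff symm_add)
  show "locally_bounded (f + g)" unfolding locally_bounded_def
  proof
    fix n
    obtain d where d: "\<And>m. ks m \<subseteq> {..<n} \<Longrightarrow> mcoeff f m \<noteq> 0 \<Longrightarrow> mdeg m \<le> d"
      using f unfolding Lam_hat_iff locally_bounded_def by blast
    obtain e where e: "\<And>m. ks m \<subseteq> {..<n} \<Longrightarrow> mcoeff g m \<noteq> 0 \<Longrightarrow> mdeg m \<le> e"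
      using g unfolding Lam_hat_iff locally_bounded_def by blast
    have "mdeg m \<le> max d e" if "ks m \<subseteq> {..<n}" "mcoeff (f + g) m \<noteq> 0" for m
    proof -
      have "mcoeff f m \<noteq> 0 \<or> mcoeff g m \<noteq> 0" using that(2) by auto
      then show ?thesis using d [OF that(1)] e [OF that(1)] by (auto simp: le_max_iff_disj)
    qed
    then show "\<exists>d. \<forall>m. ks m \<subseteq> {..<n} \<longrightarrow> mcoeff (f + g) m \<noteq> 0 \<longrightarrow> mdeg m \<le> d" by blast
  qed
qed

lemma Lam_hat_mult: "f \<in> Lam_hat \<Longrightarrow> g \<in> Lam_hat \<Longrightarrow> f * g \<in> Lam_hat"
proof (rule Lam_hatI)
  assume f: "f \<in> Lam_hat" and g: "g \<in> Lam_hat"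
  then show "symm (f * g)" by (simp add: Lam_hat_iff symm_mult)
  show "locally_bounded (f * g)" unfolding locally_bounded_def
  proof
    fix n
    obtain d where d: "\<And>m. ks m \<subseteq> {..<n} \<Longrightarrow> mcoeff f m \<noteq> 0 \<Longrightarrow> mdeg m \<le> d"
      using f unfolding Lam_hat_iff locally_bounded_def by blast
    obtain e where e: "\<And>m. ks m \<subseteq> {..<n} \<Longrightarrow> mcoeff g m \<noteq> 0 \<Longrightarrow> mdeg m \<le> e"
      using g unfolding Lam_hat_iff locally_bounded_def by blast
    have "mdeg m \<le> d + e" if m: "ks m \<subseteq> {..<n}" "mcoeff (f * g) m \<noteq> 0" for m
    proof -
      have "\<exists>x\<in>splits m. (case x of (a, b) \<Rightarrow> mcoeff f a * mcoeff g b) \<noteq> 0"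
        using m(2) unfolding mcoeff_mult by (meson sum.neutral)
      then obtain a b where ab: "a + b = m" "mcoeff f a \<noteq> 0" "mcoeff g b \<noteq> 0"
        by (auto simp: splits_def)
      then have "ks a \<subseteq> {..<n}" "ks b \<subseteq> {..<n}" using m(1) by (auto simp: keys_add_nat)
      then show ?thesis using d ab e by (fastforce intro: add_mono)
    qed
    then show "\<exists>d. \<forall>m. ks m \<subseteq> {..<n} \<longrightarrow> mcoeff (f * g) m \<noteq> 0 \<longrightarrow> mdeg m \<le> d" by blast
  qed
qed

lemma Lam_mult: "f \<in> Lam \<Longrightarrow> g \<in> Lam \<Longrightarrow> f * g \<in> Lam"
proof -
  assume f: "f \<in> Lam" and g: "g \<in> Lam"
  obtain d where d: "\<And>m. mcoeff f m \<noteq> 0 \<Longrightarrow> mdeg m \<le> d" using f unfolding Lam_iff by blast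
  obtain e where e: "\<And>m. mcoeff g m \<noteq> 0 \<Longrightarrow> mdeg m \<le> e" using g unfolding Lam_iff by blast
  have "mdeg m \<le> d + e" if m: "mcoeff (f * g) m \<noteq> 0" for m
  proof -
    have "\<exists>x\<in>splits m. (case x of (a, b) \<Rightarrow> mcoeff f a * mcoeff g b) \<noteq> 0"
      using m unfolding mcoeff_mult by (meson sum.neutral)
    then obtain a b where ab: "a + b = m" "mcoeff f a \<noteq> 0" "mcoeff g b \<noteq> 0"
      by (auto simp: splits_def)
    then show ?thesis using d [OF ab(2)] e [OF ab(3)] by auto
  qed
  then show ?thesis using f g unfolding Lam_iff by (blast intro: symm_mult)
qed

lemma Lam_add: "f \<in> Lam \<Longrightarrow> g \<in> Lam \<Longrightarrow> f + g \<in> Lam"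
proof -
  assume f: "f \<in> Lam" and g: "g \<in> Lam"
  obtain d where d: "\<And>m. mcoeff f m \<noteq> 0 \<Longrightarrow> mdeg m \<le> d" using f unfolding Lam_iff by blast
  obtain e where e: "\<And>m. mcoeff g m \<noteq> 0 \<Longrightarrow> mdeg m \<le> e" using g unfolding Lam_iff by blast
  have "mdeg m \<le> max d e" if "mcoeff (f + g) m \<noteq> 0" for m
  proof -
    have "mcoeff f m \<noteq> 0 \<or> mcoeff g m \<noteq> 0" using that by auto
    then show ?thesis using d [of m] e [of m] by (auto simp: le_max_iff_disj)
  qed
  then show ?thesis using f g unfolding Lam_iff by (blast intro: symm_add)
qed

lemma Lam_mconst: "mconst c \<in> Lam"
  unfolding Lam_iff by (auto simp: symm_mconst mcoeff_mconst intro!: exI [of _ 0])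

lemma Lam_mconst_mult: "f \<in> Lam \<Longrightarrow> mconst c * f \<in> Lam"
  by (simp add: Lam_mult Lam_mconst)

lemma Lam_hat_mconst_mult: "f \<in> Lam_hat \<Longrightarrow> mconst c * f \<in> Lam_hat"
  by (simp add: Lam_hat_mult Lam_mconst Lam_subset)

lemma Lam_0: "0 \<in> Lam" using Lam_mconst [of 0] by simp

lemma Lam_sum: "(\<And>a. a \<in> A \<Longrightarrow> f a \<in> Lam) \<Longrightarrow> sum f A \<in> Lam"
  by (induction A rule: infinite_finite_induct) (auto simp: Lam_0 Lam_add)

lemma Lam_hat_0: "0 \<in> Lam_hat" by (rule Lam_subset [OF Lam_0])

lemma Lam_hat_sum: "(\<And>a. a \<in> A \<Longrightarrow> f a \<in> Lam_hat) \<Longrightarrow> sum f A \<in> Lam_hat"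
  by (induction A rule: infinite_finite_induct) (auto simp: Lam_hat_0 Lam_hat_add)

lemma Lam_hat_diff: "f \<in> Lam_hat \<Longrightarrow> g \<in> Lam_hat \<Longrightarrow> f - g \<in> Lam_hat"
proof -
  assume "f \<in> Lam_hat" "g \<in> Lam_hat"
  then have "f + mconst (- 1) * g \<in> Lam_hat" by (intro Lam_hat_add Lam_hat_mconst_mult)
  then show ?thesis by (simp add: mconst_uminus)
qed

lemma schur_Lam: "is_partition p \<Longrightarrow> schur p \<in> Lam"
  unfolding Lam_iff using schur_homogeneous by (auto intro!: symm_schur exI [of _ "seq_size p"])

lemma hom_Lam: "hom k \<in> Lam"
  unfolding Lam_iff by (auto intro!: symm_hom exI [of _ k] simp: mcoeff_hom split: if_splits)

lemma hom_prod_Lam: "hom_prod a \<in> Lam"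
proof (induction a)
  case Nil
  show ?case using Lam_mconst [of 1] by (simp add: hom_prod_def)
next
  case (Cons k a)
  then show ?case using Lam_mult [OF hom_Lam, of "hom_prod a" k] by (simp add: hom_prod_def)
qed

lemma Lam_schur_scf_bounded:
  assumes "\<And>m. mcoeff g m \<noteq> 0 \<Longrightarrow> mdeg m \<le> d" "schur_scf g p \<noteq> 0"
  shows "p \<in> parts_upto d"
proof -
  have p: "is_partition p" using assms(2) schur_scf_non_partition by blast
  have "seq_size p \<le> d"
  proof (rule ccontr)
    assume "\<not> seq_size p \<le> d"
    then have "schur_scf g p = schur_scf 0 p"
      using assms(1) by (intro schur_scf_cong_degree) fastforce
    then show False using assms(2) by (simp add: schur_scf_0)
  qed
  then show ?thesis using p by (simp add: parts_upto_def)
qed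

section \<open>The Hall product\<close>

lemma hall_eq:
  assumes f: "f \<in> Lam_hat" and g: "g \<in> Lam" and A: "finite A" "\<And>p. schur_scf g p \<noteq> 0 \<Longrightarrow> p \<in> A"
  shows "hall f g = (\<Sum>p\<in>A. schur_scf f p * schur_scf g p)"
proof -
  have "hall f g = Sum_any (\<lambda>p. schur_scf f p * schur_scf g p)"
    by (simp add: hall_def schur_coeff_eq f Lam_subset [OF g])
  also have "\<dots> = (\<Sum>p\<in>A. schur_scf f p * schur_scf g p)"
    by (rule Sum_any.expand_superset) (use A in auto)
  finally show ?thesis .
qed

lemma hall_eq_parts:
  assumes "f \<in> Lam_hat" "g \<in> Lam" "\<And>m. mcoeff g m \<noteq> 0 \<Longrightarrow> mdeg m \<le> d"
  shows "hall f g = (\<Sum>p\<in>parts_upto d. schur_scf f p * schur_scf g p)"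
  using assms by (intro hall_eq) (auto intro: Lam_schur_scf_bounded)

lemma hall_add_right:
  assumes f: "f \<in> Lam_hat" and g: "g \<in> Lam" "h \<in> Lam"
  shows "hall f (g + h) = hall f g + hall f h"
proof -
  obtain d where d: "\<And>p. schur_scf g p \<noteq> 0 \<Longrightarrow> p \<in> parts_upto d"
    using g(1) unfolding Lam_iff using Lam_schur_scf_bounded by blast
  obtain e where e: "\<And>p. schur_scf h p \<noteq> 0 \<Longrightarrow> p \<in> parts_upto e"
    using g(2) unfolding Lam_iff using Lam_schur_scf_bounded by blast
  let ?A = "parts_upto d \<union> parts_upto e"
  have "hall f (g + h) = (\<Sum>p\<in>?A. schur_scf f p * schur_scf (g + h) p)"
  proof (rule hall_eq [OF f Lam_add [OF g]])
    fix p assume "schur_scf (g + h) p \<noteq> 0"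
    then have "schur_scf g p \<noteq> 0 \<or> schur_scf h p \<noteq> 0" by (auto simp: schur_scf_add)
    then show "p \<in> ?A" using d e by blast
  qed simp
  moreover have "hall f g = (\<Sum>p\<in>?A. schur_scf f p * schur_scf g p)" by (rule hall_eq [OF f g(1)]) (use d in auto)
  moreover have "hall f h = (\<Sum>p\<in>?A. schur_scf f p * schur_scf h p)" by (rule hall_eq [OF f g(2)]) (use e in auto)
  ultimately show ?thesis by (simp add: schur_scf_add distrib_left sum.distrib)
qed

lemma hall_mconst_right:
  assumes f: "f \<in> Lam_hat" and g: "g \<in> Lam"
  shows "hall f (mconst c * g) = c * hall f g"
proof -
  obtain d where d: "\<And>p. schur_scf g p \<noteq> 0 \<Longrightarrow> p \<in> parts_upto d"
    using g unfolding Lam_iff using Lam_schur_scf_bounded by blast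
  have "hall f (mconst c * g) = (\<Sum>p\<in>parts_upto d. schur_scf f p * schur_scf (mconst c * g) p)"
    by (rule hall_eq [OF f Lam_mconst_mult [OF g]]) (use d in \<open>auto simp: schur_scf_mconst\<close>)
  moreover have "hall f g = (\<Sum>p\<in>parts_upto d. schur_scf f p * schur_scf g p)" by (rule hall_eq [OF f g]) (use d in auto)
  ultimately show ?thesis by (simp only: schur_scf_mconst sum_distrib_left mult.left_commute)
qed

lemma hall_0_right: "f \<in> Lam_hat \<Longrightarrow> hall f 0 = 0"
  using hall_mconst_right [OF _ Lam_0, of f 0] by simp

lemma hall_sum_right:
  assumes "f \<in> Lam_hat" "\<And>a. a \<in> A \<Longrightarrow> h a \<in> Lam"
  shows "hall f (\<Sum>a\<in>A. mconst (c a) * h a) = (\<Sum>a\<in>A. c a * hall f (h a))"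
  using assms(2)
proof (induction A rule: infinite_finite_induct)
  case (insert a A)
  have "(\<Sum>a\<in>A. mconst (c a) * h a) \<in> Lam" using insert by (intro Lam_sum Lam_mconst_mult) auto
  then show ?case using insert assms(1) by (simp add: hall_add_right hall_mconst_right Lam_mconst_mult)
qed (simp_all add: hall_0_right assms)

lemma hall_add_left:
  assumes "f \<in> Lam_hat" "g \<in> Lam_hat" "h \<in> Lam"
  shows "hall (f + g) h = hall f h + hall g h"
proof -
  obtain d where "\<And>m. mcoeff h m \<noteq> 0 \<Longrightarrow> mdeg m \<le> d" using assms(3) unfolding Lam_iff by blast
  then show ?thesis
    using assms by (simp add: hall_eq_parts [of _ h d] Lam_hat_add schur_scf_add distrib_right sum.distrib)
qed

lemma hall_mconst_left:
  assumes "f \<in> Lam_hat" "h \<in> Lam"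
  shows "hall (mconst c * f) h = c * hall f h"
proof -
  obtain d where "\<And>m. mcoeff h m \<noteq> 0 \<Longrightarrow> mdeg m \<le> d" using assms(2) unfolding Lam_iff by blast
  then show ?thesis
    using assms by (simp add: hall_eq_parts [of _ h d] Lam_hat_mconst_mult schur_scf_mconst sum_distrib_left mult.assoc)
qed

lemma hall_schur:
  assumes "f \<in> Lam_hat" "is_partition p"
  shows "hall f (schur p) = schur_scf f p"
proof -
  have "hall f (schur p) = (\<Sum>q\<in>{p}. schur_scf f q * schur_scf (schur p) q)"
    by (rule hall_eq [OF assms(1) schur_Lam [OF assms(2)]]) (auto simp: schur_scf_schur [OF assms(2)] split: if_splits)
  then show ?thesis by (simp add: schur_scf_schur [OF assms(2)])
qed

text \<open>Duality of complete functions and monomials: the Schur coefficients of h_a are the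
  coefficients of x^a in the Schur functions.\<close>

lemma hall_hom_prod:
  assumes "f \<in> Lam_hat"
  shows "hall f (hom_prod a) = mcoeff f (mon a)"
proof -
  have "hall f (hom_prod a) = (\<Sum>p\<in>parts (sum_list a). mcoeff (schur p) (mon a) * hall f (schur p))"
    unfolding hom_prod_expansion by (rule hall_sum_right [OF assms]) (auto simp: parts_def schur_Lam)
  also have "\<dots> = (\<Sum>p\<in>parts (mdeg (mon a)). schur_scf f p * mcoeff (schur p) (mon a))"
    unfolding mdeg_mon by (rule sum.cong) (auto simp: parts_def hall_schur assms mult.commute)
  also have "\<dots> = mcoeff f (mon a)"
    using assms symm_expand [of f "mon a"] by (simp add: Lam_hat_iff)
  finally show ?thesis .
qed

lemma Lam_expand:
  assumes "g \<in> Lam" "\<And>m. mcoeff g m \<noteq> 0 \<Longrightarrow> mdeg m \<le> d"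
  shows "g = (\<Sum>p\<in>parts_upto d. mconst (schur_scf g p) * schur p)"
proof (rule mfps_eqI)
  fix m
  have "mcoeff g m = (\<Sum>p\<in>parts (mdeg m). schur_scf g p * mcoeff (schur p) m)"
    using assms(1) by (intro symm_expand) (simp add: Lam_iff)
  also have "\<dots> = (\<Sum>p\<in>parts_upto (max d (mdeg m)). schur_scf g p * mcoeff (schur p) m)"
    by (rule sum.mono_neutral_left [OF finite_parts_upto])
      (use schur_homogeneous in \<open>auto simp: parts_def parts_upto_def\<close>)
  also have "\<dots> = (\<Sum>p\<in>parts_upto d. schur_scf g p * mcoeff (schur p) m)"
    by (rule sum.mono_neutral_right [OF finite_parts_upto])
      (use Lam_schur_scf_bounded [OF assms(2)] in \<open>auto simp: parts_upto_def\<close>)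
  finally show "mcoeff g m = mcoeff (\<Sum>p\<in>parts_upto d. mconst (schur_scf g p) * schur p) m" by simp
qed

lemma mon_parts: "is_partition p \<Longrightarrow> mon (map p [0..<part_length p]) = part_mon p"
  using partition_beyond [of p "part_length p"]
  by (intro poly_mapping_eqI) (auto simp: lookup_mon)

text \<open>Products of complete functions span: with a the list of parts of p, the expansion of
  \<open>hom_prod a\<close> is \<open>schur p\<close> plus Schur functions of smaller
  \<open>pstat\<close>.\<close>

lemma Lam_induct [consumes 1, case_names hom_prod add mconst]:
  assumes g: "g \<in> Lam" and hom_prod: "\<And>a. P (hom_prod a)"
    and add: "\<And>f g. f \<in> Lam \<Longrightarrow> g \<in> Lam \<Longrightarrow> P f \<Longrightarrow> P g \<Longrightarrow> P (f + g)"
    and mc: "\<And>c f. f \<in> Lam \<Longrightarrow> P f \<Longrightarrow> P (mconst c * f)"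
  shows "P g"
proof -
  have P0: "P 0" using mc [OF hom_prod_Lam hom_prod, of 0 "[]"] by simp
  have Psum: "P (\<Sum>a\<in>A. mconst (c a) * h a)" if "\<And>a. a \<in> A \<Longrightarrow> h a \<in> Lam \<and> P (h a)" for A :: "shape set" and c h
    using that
  proof (induction A rule: infinite_finite_induct)
    case (insert a A)
    have "(\<Sum>a\<in>A. mconst (c a) * h a) \<in> Lam" using insert.prems by (intro Lam_sum Lam_mconst_mult) auto
    moreover have "P (\<Sum>a\<in>A. mconst (c a) * h a)" using insert by simp
    moreover have "mconst (c a) * h a \<in> Lam" "P (mconst (c a) * h a)"
      using insert.prems by (auto intro: Lam_mconst_mult mc)
    ultimately show ?case using insert.hyps by (simp add: add)
  qed (simp_all add: P0)
  have Ps: "P (schur p)" if "is_partition p" for p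
    using that
  proof (induction p rule: measure_induct_rule [of pstat])
    case (less p)
    let ?A = "{q \<in> parts (seq_size p). pstat q < pstat p}"
    let ?R = "\<Sum>q\<in>?A. mconst (mcoeff (schur q) (part_mon p)) * schur q"
    let ?a = "map p [0..<part_length p]"
    have sl: "sum_list ?a = seq_size p"
      using mdeg_mon [of ?a] mon_parts [OF less.prems] mdeg_part_mon [OF less.prems] by simp
    have "hom_prod ?a = (\<Sum>q\<in>parts (seq_size p). mconst (mcoeff (schur q) (part_mon p)) * schur q)"
      unfolding hom_prod_expansion sl mon_parts [OF less.prems] ..
    also have "\<dots> = (\<Sum>q\<in>insert p ?A. mconst (mcoeff (schur q) (part_mon p)) * schur q)"
    proof (rule sum.mono_neutral_right)
      show "insert p ?A \<subseteq> parts (seq_size p)" using less.prems by (auto simp: parts_def)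
      show "\<forall>q\<in>parts (seq_size p) - insert p ?A. mconst (mcoeff (schur q) (part_mon p)) * schur q = 0"
      proof
        fix q assume q: "q \<in> parts (seq_size p) - insert p ?A"
        then have "mcoeff (schur q) (part_mon p) = 0"
          using less.prems by (intro schur_part_mon_eq_0) (auto simp: parts_def)
        then show "mconst (mcoeff (schur q) (part_mon p)) * schur q = 0" by simp
      qed
    qed simp
    also have "\<dots> = schur p + ?R"
      by (subst sum.insert) (auto simp: schur_leading less.prems)
    finally have eq: "schur p = hom_prod ?a + mconst (- 1) * ?R" by (simp add: mconst_uminus)
    have "P ?R" "?R \<in> Lam"
      using less.IH by (auto intro!: Psum Lam_sum Lam_mconst_mult schur_Lam simp: parts_def)
    then show ?case
      unfolding eq by (intro add mc hom_prod hom_prod_Lam Lam_mconst_mult)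
  qed
  obtain d where d: "\<And>m. mcoeff g m \<noteq> 0 \<Longrightarrow> mdeg m \<le> d" using g unfolding Lam_iff by blast
  show ?thesis
    by (subst Lam_expand [OF g d]) (auto intro!: Psum schur_Lam Ps simp: parts_upto_def)
qed

subsection \<open>Skewing operators\<close>

text \<open>Renames x_i to x_(N+i), making room for a first alphabet of N variables in front of a
  second one.\<close>

definition shiftm :: "nat \<Rightarrow> (nat \<Rightarrow>\<^sub>0 nat) \<Rightarrow> (nat \<Rightarrow>\<^sub>0 nat)" where
  "shiftm N m = Abs_poly_mapping (\<lambda>i. if i < N then 0 else lk m (i - N))"

lemma lookup_shiftm: "lk (shiftm N m) i = (if i < N then 0 else lk m (i - N))"
proof -
  have "finite {i. (if i < N then 0 else lk m (i - N)) \<noteq> 0}"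
  proof (rule finite_subset)
    show "{i. (if i < N then 0 else lk m (i - N)) \<noteq> 0} \<subseteq> (\<lambda>i. i + N) ` ks m"
    proof
      fix i assume i: "i \<in> {i. (if i < N then 0 else lk m (i - N)) \<noteq> 0}"
      then have "\<not> i < N" "lk m (i - N) \<noteq> 0" by (auto split: if_splits)
      then have "i - N \<in> ks m" "i = i - N + N" by (auto simp: in_keys_iff)
      then show "i \<in> (\<lambda>i. i + N) ` ks m" by blast
    qed
  qed simp
  then show ?thesis unfolding shiftm_def by (subst Abs_poly_mapping_inverse) simp_all
qed

lemma shiftm_add: "shiftm N (a + b) = shiftm N a + shiftm N b"
  by (rule poly_mapping_eqI) (simp add: lookup_shiftm lookup_add)

lemma keys_shiftm: "ks (shiftm N m) = (\<lambda>i. i + N) ` ks m"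
proof (intro equalityI subsetI)
  fix i assume "i \<in> ks (shiftm N m)"
  then have "\<not> i < N" "i - N \<in> ks m" by (auto simp: in_keys_iff lookup_shiftm split: if_splits)
  then show "i \<in> (\<lambda>i. i + N) ` ks m" by (intro image_eqI [of _ _ "i - N"]) auto
qed (auto simp: in_keys_iff lookup_shiftm)

lemma mdeg_shiftm: "mdeg (shiftm N m) = mdeg m"
  unfolding mdeg_def keys_shiftm by (subst sum.reindex) (auto simp: inj_on_def lookup_shiftm)

lemma mon_append: "mon (c @ a) = mon c + shiftm (length c) (mon a)"
  by (rule poly_mapping_eqI) (auto simp: lookup_mon lookup_add lookup_shiftm nth_append)

lemma hom_prod_append: "hom_prod (c @ a) = hom_prod c * hom_prod a"
  by (simp add: hom_prod_def)

definition shift_perm :: "nat \<Rightarrow> (nat \<Rightarrow> nat) \<Rightarrow> nat \<Rightarrow> nat" where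
  "shift_perm N \<pi> i = (if i < N then i else \<pi> (i - N) + N)"

lemma bij_shift_perm:
  assumes "bij \<pi>"
  shows "bij (shift_perm N \<pi>)"
proof (rule o_bij [of "shift_perm N (inv_into UNIV \<pi>)"])
  show "shift_perm N (inv_into UNIV \<pi>) \<circ> shift_perm N \<pi> = id"
    using assms by (auto simp: fun_eq_iff shift_perm_def bij_is_inj)
  show "shift_perm N \<pi> \<circ> shift_perm N (inv_into UNIV \<pi>) = id"
    using assms by (auto simp: fun_eq_iff shift_perm_def bij_is_surj surj_f_inv_f)
qed

text \<open>A permutation of the second alphabet extends by the identity on the first, so the
  symmetry of g passes to each coefficient.\<close>

lemma coefficient_in_Lam_hat:
  assumes "g \<in> Lam_hat"
  shows "Abs_mfps (\<lambda>m. mcoeff g (mon c + shiftm (length c) m)) \<in> Lam_hat"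
proof (rule Lam_hatI)
  let ?N = "length c"
  show "symm (Abs_mfps (\<lambda>m. mcoeff g (mon c + shiftm ?N m)))"
    unfolding symm_iff
  proof (intro allI impI)
    fix \<pi> :: "nat \<Rightarrow> nat" and m assume \<pi>: "bij \<pi>"
    have b: "bij (shift_perm ?N \<pi>)" by (rule bij_shift_perm [OF \<pi>])
    have "mon c + shiftm ?N (Poly_Mapping.map_key \<pi> m) = Poly_Mapping.map_key (shift_perm ?N \<pi>) (mon c + shiftm ?N m)"
      using \<pi> b by (intro poly_mapping_eqI)
        (auto simp: lookup_add lookup_map_key bij_is_inj lookup_shiftm lookup_mon shift_perm_def)
    then show "mcoeff (Abs_mfps (\<lambda>m. mcoeff g (mon c + shiftm ?N m))) (Poly_Mapping.map_key \<pi> m)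
      = mcoeff (Abs_mfps (\<lambda>m. mcoeff g (mon c + shiftm ?N m))) m"
      using assms b by (simp add: Lam_hat_iff symm_mcoeff)
  qed
  show "locally_bounded (Abs_mfps (\<lambda>m. mcoeff g (mon c + shiftm ?N m)))"
    unfolding locally_bounded_def
  proof
    fix n
    obtain d where d: "\<And>m. ks m \<subseteq> {..<n + ?N} \<Longrightarrow> mcoeff g m \<noteq> 0 \<Longrightarrow> mdeg m \<le> d"
      using assms unfolding Lam_hat_iff locally_bounded_def by blast
    have "mdeg m \<le> d" if "ks m \<subseteq> {..<n}" "mcoeff g (mon c + shiftm ?N m) \<noteq> 0" for m
    proof -
      have "ks (mon c + shiftm ?N m) \<subseteq> {..<n + ?N}"
        using keys_mon [of c] that(1) by (auto simp: keys_add_nat keys_shiftm)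
      then have "mdeg (mon c + shiftm ?N m) \<le> d" using that(2) by (rule d)
      then show ?thesis by (simp add: mdeg_shiftm)
    qed
    then show "\<exists>d. \<forall>m. ks m \<subseteq> {..<n} \<longrightarrow> mcoeff (Abs_mfps (\<lambda>m. mcoeff g (mon c + shiftm ?N m))) m \<noteq> 0 \<longrightarrow> mdeg m \<le> d"
      by auto
  qed
qed

text \<open>For a product h_c of complete functions the skewed series is the coefficient of x^c in
  g(x, y), viewed as a series in y; linearity does the rest.\<close>

lemma perp_exists:
  assumes "f \<in> Lam" "g \<in> Lam_hat"
  shows "\<exists>g'\<in>Lam_hat. \<forall>h\<in>Lam. hall g' h = hall g (f * h)"
  using assms(1)
proof (induction f rule: Lam_induct)
  case (hom_prod c)
  let ?g = "Abs_mfps (\<lambda>m. mcoeff g (mon c + shiftm (length c) m))"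
  have g': "?g \<in> Lam_hat" by (rule coefficient_in_Lam_hat [OF assms(2)])
  have "hall ?g h = hall g (hom_prod c * h)" if "h \<in> Lam" for h
    using that
  proof (induction h rule: Lam_induct)
    case (hom_prod a)
    have "hall ?g (hom_prod a) = mcoeff g (mon (c @ a))" by (simp add: hall_hom_prod [OF g'] mon_append)
    then show ?case by (simp add: hall_hom_prod [OF assms(2), symmetric] hom_prod_append)
  next
    case (add h k)
    then show ?case
      using g' assms(2) by (simp add: distrib_left hall_add_right Lam_mult hom_prod_Lam)
  next
    case (mconst b h)
    have "hom_prod c * (mconst b * h) = mconst b * (hom_prod c * h)" by (simp add: mult_ac)
    then show ?case
      using mconst g' assms(2) by (simp only: hall_mconst_right Lam_mult hom_prod_Lam)
  qed
  then show ?case using g' by blast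
next
  case (add f1 f2)
  then obtain g1 g2 where g: "g1 \<in> Lam_hat" "\<And>h. h \<in> Lam \<Longrightarrow> hall g1 h = hall g (f1 * h)"
    "g2 \<in> Lam_hat" "\<And>h. h \<in> Lam \<Longrightarrow> hall g2 h = hall g (f2 * h)" by blast
  have "hall (g1 + g2) h = hall g ((f1 + f2) * h)" if "h \<in> Lam" for h
    using g that add assms(2) by (simp add: hall_add_left distrib_right hall_add_right Lam_mult)
  then show ?case using g by (intro bexI [of _ "g1 + g2"]) (auto intro: Lam_hat_add)
next
  case (mconst c f1)
  then obtain g1 where g: "g1 \<in> Lam_hat" "\<And>h. h \<in> Lam \<Longrightarrow> hall g1 h = hall g (f1 * h)" by blast
  have "hall (mconst c * g1) h = hall g (mconst c * f1 * h)" if "h \<in> Lam" for h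
    using g that mconst assms(2) by (simp add: hall_mconst_left mult.assoc hall_mconst_right Lam_mult)
  then show ?case using g by (intro bexI [of _ "mconst c * g1"]) (auto intro: Lam_hat_mconst_mult)
qed

lemma Lam_hat_eqI:
  assumes "f \<in> Lam_hat" "g \<in> Lam_hat" "\<And>h. h \<in> Lam \<Longrightarrow> hall f h = hall g h"
  shows "f = g"
proof -
  have "schur_scf f p = schur_scf g p" for p
    using assms hall_schur schur_Lam schur_scf_non_partition by (cases "is_partition p") metis+
  then have "schur_scf f = schur_scf g" by (rule ext)
  then show ?thesis using assms symm_eq_schur_sum [of f] symm_eq_schur_sum [of g] by (simp add: Lam_hat_iff)
qed

lemma perp_props:
  assumes "f \<in> Lam" "g \<in> Lam_hat"
  shows "perp f g \<in> Lam_hat" "\<And>h. h \<in> Lam \<Longrightarrow> hall (perp f g) h = hall g (f * h)"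
proof -
  obtain g' where g': "g' \<in> Lam_hat" "\<forall>h\<in>Lam. hall g' h = hall g (f * h)"
    using perp_exists [OF assms] by blast
  have "perp f g = g'" unfolding perp_def
  proof (rule the_equality)
    fix k assume "k \<in> Lam_hat \<and> (\<forall>h\<in>Lam. hall k h = hall g (f * h))"
    then show "k = g'" using g' by (intro Lam_hat_eqI) auto
  qed (use g' in blast)
  then show "perp f g \<in> Lam_hat" "\<And>h. h \<in> Lam \<Longrightarrow> hall (perp f g) h = hall g (f * h)"
    using g' by auto
qed

lemma mcoeff_perp: "f \<in> Lam \<Longrightarrow> g \<in> Lam_hat \<Longrightarrow> mcoeff (perp f g) (mon a) = hall g (f * hom_prod a)"
  using hall_hom_prod [OF perp_props(1), of f g a] perp_props(2) [OF _ _ hom_prod_Lam, of f g a] by simp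

subsection \<open>Division of alternants by the Vandermonde product\<close>

definition polyn :: "nat \<Rightarrow> K mfps \<Rightarrow> bool" where
  "polyn n f \<longleftrightarrow> finite {m. mcoeff f m \<noteq> 0} \<and> (\<forall>m. mcoeff f m \<noteq> 0 \<longrightarrow> ks m \<subseteq> {..<n})"

lemma polyn_mult: "polyn n f \<Longrightarrow> polyn n g \<Longrightarrow> polyn n (f * g)"
proof -
  assume f: "polyn n f" and g: "polyn n g"
  let ?A = "{m. mcoeff f m \<noteq> 0}" and ?B = "{m. mcoeff g m \<noteq> 0}"
  have *: "\<exists>a b. m = a + b \<and> mcoeff f a \<noteq> 0 \<and> mcoeff g b \<noteq> 0" if "mcoeff (f * g) m \<noteq> 0" for m
  proof -
    have "\<exists>x\<in>splits m. (case x of (a, b) \<Rightarrow> mcoeff f a * mcoeff g b) \<noteq> 0"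
      using that unfolding mcoeff_mult by (meson sum.neutral)
    then show ?thesis by (auto simp: splits_def)
  qed
  have "{m. mcoeff (f * g) m \<noteq> 0} \<subseteq> (\<lambda>(a, b). a + b) ` (?A \<times> ?B)"
    using * by fast
  moreover have "finite ((\<lambda>(a, b). a + b) ` (?A \<times> ?B))"
    using f g by (intro finite_imageI finite_cartesian_product) (auto simp: polyn_def)
  ultimately have "finite {m. mcoeff (f * g) m \<noteq> 0}" by (rule finite_subset)
  moreover have "ks m \<subseteq> {..<n}" if nz: "mcoeff (f * g) m \<noteq> 0" for m
  proof -
    obtain a b where "m = a + b" "mcoeff f a \<noteq> 0" "mcoeff g b \<noteq> 0" using * [OF nz] by blast
    then show ?thesis using f g unfolding polyn_def by (simp add: keys_add_nat)
  qed
  ultimately show ?thesis by (simp add: polyn_def)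
qed

lemma polyn_add: "polyn n f \<Longrightarrow> polyn n g \<Longrightarrow> polyn n (f + g)"
proof -
  assume f: "polyn n f" and g: "polyn n g"
  have sub: "{m. mcoeff (f + g) m \<noteq> 0} \<subseteq> {m. mcoeff f m \<noteq> 0} \<union> {m. mcoeff g m \<noteq> 0}" by auto
  then have "finite {m. mcoeff (f + g) m \<noteq> 0}"
    by (rule finite_subset) (use f g in \<open>simp add: polyn_def\<close>)
  then show ?thesis using sub f g unfolding polyn_def by blast
qed

lemma polyn_mconst: "polyn n (mconst c)"
proof -
  have "{m. mcoeff (mconst c) m \<noteq> 0} \<subseteq> {0}" by (auto simp: mcoeff_mconst)
  then have "finite {m. mcoeff (mconst c) m \<noteq> 0}" by (rule finite_subset) simp
  then show ?thesis by (auto simp: polyn_def mcoeff_mconst)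
qed

lemma polyn_1: "polyn n 1"
  using polyn_mconst [of n 1] by simp

lemma polyn_mX: "i < n \<Longrightarrow> polyn n (mX i)"
proof -
  assume i: "i < n"
  have "{m. mcoeff (mX i :: K mfps) m \<noteq> 0} \<subseteq> {sg i 1}" by (auto simp: mX_eq_xpow mcoeff_xpow)
  then have "finite {m. mcoeff (mX i :: K mfps) m \<noteq> 0}" by (rule finite_subset) simp
  then show ?thesis using i by (auto simp: polyn_def mX_eq_xpow mcoeff_xpow)
qed

lemma polyn_power: "polyn n f \<Longrightarrow> polyn n (f ^ k)"
  by (induction k) (auto intro: polyn_mult polyn_1)

lemma polyn_prod: "(\<And>a. a \<in> A \<Longrightarrow> polyn n (f a)) \<Longrightarrow> polyn n (prod f A)"
  by (induction A rule: infinite_finite_induct) (auto intro: polyn_mult polyn_1)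

lemma polyn_expand:
  assumes "polyn n f"
  shows "f = (\<Sum>m\<in>{m. mcoeff f m \<noteq> 0}. mconst (mcoeff f m) * xpow m)"
proof (rule mfps_eqI)
  fix m
  have "finite {m. mcoeff f m \<noteq> 0}" using assms by (simp add: polyn_def)
  then have "(\<Sum>k\<in>{m. mcoeff f m \<noteq> 0}. if k = m then mcoeff f k else 0) = mcoeff f m"
    by simp
  moreover have "mcoeff (\<Sum>k\<in>{m. mcoeff f m \<noteq> 0}. mconst (mcoeff f k) * xpow k) m
    = (\<Sum>k\<in>{m. mcoeff f m \<noteq> 0}. if k = m then mcoeff f k else 0)"
    unfolding mcoeff_sum by (rule sum.cong) (auto simp: mcoeff_xpow)
  ultimately show "mcoeff f m = mcoeff (\<Sum>m\<in>{m. mcoeff f m \<noteq> 0}. mconst (mcoeff f m) * xpow m) m"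
    by simp
qed

lemma alt_permvars:
  assumes s: "\<sigma> permutes {..<n}"
  shows "alt n (permvars \<sigma> F) = of_int (sign \<sigma>) * alt n F"
proof -
  have "alt n F = (\<Sum>\<pi> | \<pi> permutes {..<n}. of_int (sign (\<pi> \<circ> \<sigma>)) * permvars (\<pi> \<circ> \<sigma>) F)"
    unfolding alt_def by (rule sum_permutations_compose_right [OF s])
  also have "\<dots> = (\<Sum>\<pi> | \<pi> permutes {..<n}. of_int (sign \<sigma>) * (of_int (sign \<pi>) * permvars \<pi> (permvars \<sigma> F)))"
  proof (rule sum.cong [OF refl])
    fix \<pi> assume "\<pi> \<in> {\<pi>. \<pi> permutes {..<n}}"
    then have p: "\<pi> permutes {..<n}" by simp
    have "sign (\<pi> \<circ> \<sigma>) = sign \<pi> * sign \<sigma>"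
      using p s finite_lessThan by (intro sign_compose) (auto simp: permutation_permutes)
    then show "of_int (sign (\<pi> \<circ> \<sigma>)) * permvars (\<pi> \<circ> \<sigma>) F
        = of_int (sign \<sigma>) * (of_int (sign \<pi>) * permvars \<pi> (permvars \<sigma> F))"
      using p s by (simp add: permvars_comp permutes_bij mult_ac)
  qed
  also have "\<dots> = of_int (sign \<sigma>) * alt n (permvars \<sigma> F)"
    by (simp add: alt_def sum_distrib_left)
  finally have "of_int (sign \<sigma>) * alt n F = of_int (sign \<sigma> * sign \<sigma>) * alt n (permvars \<sigma> F)"
    by (simp only: of_int_mult mult.assoc)
  then show ?thesis by (simp only: sign_idempotent of_int_1 mult_1_left)
qed

lemma groth_mon_0: "groth_mon 0 n p = (\<Prod>j<n. mX j ^ (p j + (n - 1 - j)))"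
  by (simp add: groth_mon_def)

text \<open>An exponent with a repeated entry is fixed by a transposition; one with distinct entries
  is, up to sorting, a partition plus the staircase, and the quotient is a signed Schur polynomial.
  Its degree is recorded in order to locate the lowest part of \<open>Groth\<close>.\<close>

lemma alt_xpow:
  assumes m: "ks m \<subseteq> {..<n}"
  shows "\<exists>P. alt n (xpow m) = P * vandermonde n \<and> (\<forall>\<pi>. \<pi> permutes {..<n} \<longrightarrow> permvars \<pi> P = P) \<and>
    (\<forall>m'. mcoeff P m' \<noteq> 0 \<longrightarrow> ks m' \<subseteq> {..<n} \<and> mdeg m' + (\<Sum>j<n. n - 1 - j) = mdeg m)"
proof (cases "inj_on (lk m) {..<n}")
  case False
  then obtain i j where ij: "i < n" "j < n" "i \<noteq> j" "lk m i = lk m j" by (auto simp: inj_on_def)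
  let ?t = "transpose i j"
  have t: "bij ?t" by simp
  have "Poly_Mapping.map_key ?t m = m"
    using ij(4) t by (intro poly_mapping_eqI) (auto simp: lookup_map_key bij_is_inj transpose_def)
  then have "permvars ?t (xpow m) = (xpow m :: K mfps)"
    by (simp add: permvars_xpow)
  then have "alt n (xpow m) = 0" using ij by (intro alt_eq_0_swap [of i n j]) auto
  then show ?thesis by (intro exI [of _ 0]) (auto simp: permvars_0)
next
  case True
  define xs where "xs = map (lk m) [0..<n]"
  define ys where "ys = rev (sort xs)"
  have len: "length xs = n" "length ys = n" by (simp_all add: xs_def ys_def)
  have "mset xs = mset ys" by (simp add: ys_def)
  then obtain f where f: "f permutes {..<length ys}" "permute_list f ys = xs"
    by (rule mset_eq_permutation)
  have f': "f permutes {..<n}" using f len by simp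
  have val: "lk m i = ys ! f i" if "i < n" for i
    using that f len permute_list_nth [of f ys i] by (auto simp: xs_def)
  have "distinct xs" using True by (simp add: xs_def distinct_map lessThan_atLeast0)
  then have "distinct ys" by (simp add: ys_def)
  have dec: "ys ! j < ys ! i" if "i < j" "j < n" for i j
  proof -
    have "sorted (sort xs)" by simp
    moreover have "n - Suc j \<le> n - Suc i" "n - Suc i < length (sort xs)" using that len by auto
    ultimately have "sort xs ! (n - Suc j) \<le> sort xs ! (n - Suc i)" by (rule sorted_nth_mono)
    then have "ys ! j \<le> ys ! i" using that len by (simp add: ys_def rev_nth)
    moreover have "ys ! j \<noteq> ys ! i" using \<open>distinct ys\<close> that len by (simp add: nth_eq_iff_index_eq)
    ultimately show ?thesis by simp
  qed
  \<comment> \<open>Strict decrease makes the exponents dominate the staircase, so subtracting it is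
    exact and leaves a partition.\<close>
  have ge: "n - 1 - j \<le> ys ! j" if "j < n" for j
    using that
  proof (induction "n - 1 - j" arbitrary: j)
    case (Suc d)
    then have "Suc j < n" "d = n - 1 - Suc j" by auto
    then have "d \<le> ys ! Suc j" "ys ! Suc j < ys ! j"
      using Suc.hyps(1) [of "Suc j"] dec [of j "Suc j"] by auto
    then show ?case using Suc.hyps(2) by simp
  qed simp
  define q where "q = (\<lambda>j. if j < n then ys ! j - (n - 1 - j) else 0)"
  have q: "is_partition q"
  proof (rule is_partitionI [where p = q and n = n])
    fix i show "q (Suc i) \<le> q i"
      using dec [of i "Suc i"] ge [of i] ge [of "Suc i"] by (auto simp: q_def)
  qed (simp add: q_def)
  have ql: "part_length q \<le> n" using part_length_le_iff [OF q] by (simp add: q_def)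
  define g where "g = inv_into UNIV f"
  have g: "g permutes {..<n}" unfolding g_def using f' by (rule permutes_inv)
  have gf: "g (f i) = i" for i unfolding g_def using permutes_inj [OF f'] by simp
  have "xpow m = (\<Prod>i<n. mX i ^ (ys ! f i) :: K mfps)"
  proof -
    have "m = (\<Sum>i<n. sg i (lk m i))"
    proof (rule poly_mapping_eqI)
      fix k
      have "lk (\<Sum>i<n. sg i (lk m i)) k = (\<Sum>i<n. if i = k then lk m i else 0)"
        unfolding lookup_sum by (rule sum.cong) (auto simp: lookup_single when_def)
      also have "\<dots> = lk m k" using m by (auto simp: in_keys_iff)
      finally show "lk m k = lk (\<Sum>i<n. sg i (lk m i)) k" ..
    qed
    then have "xpow m = (\<Prod>i<n. xpow (sg i (lk m i)) :: K mfps)" by (metis xpow_sum)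
    then show ?thesis by (simp add: mX_power val)
  qed
  also have "\<dots> = (\<Prod>i<n. mX (g (f i)) ^ (ys ! f i))" by (simp add: gf)
  also have "\<dots> = (\<Prod>j<n. mX (g j) ^ (ys ! j))"
    using prod.permute [OF f', of "\<lambda>j. mX (g j) ^ (ys ! j) :: K mfps"] by (simp add: comp_def)
  also have "\<dots> = permvars g (groth_mon 0 n q)"
  proof -
    have "permvars g (groth_mon 0 n q) = (\<Prod>j<n. mX (g j) ^ (q j + (n - 1 - j)))"
      using g by (simp add: groth_mon_0 permvars_prod permvars_power permvars_mX permutes_bij)
    also have "\<dots> = (\<Prod>j<n. mX (g j) ^ (ys ! j))"
    proof (rule prod.cong [OF refl])
      fix j assume "j \<in> {..<n}"
      then have "q j + (n - 1 - j) = ys ! j" using ge [of j] by (simp add: q_def)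
      then show "mX (g j) ^ (q j + (n - 1 - j)) = (mX (g j) ^ (ys ! j) :: K mfps)" by (simp only:)
    qed
    finally show ?thesis by simp
  qed
  finally have "alt n (xpow m) = of_int (sign g) * alt n (groth_mon 0 n q)"
    using alt_permvars [OF g] by simp
  also have "\<dots> = mconst (of_int (sign g)) * first_vars n (schur q) * vandermonde n"
    unfolding schur_alternant [OF q ql, symmetric] by (simp add: mconst_of_int mult.assoc)
  finally have eq: "alt n (xpow m) = mconst (of_int (sign g)) * first_vars n (schur q) * vandermonde n" .
  have deg: "seq_size q + (\<Sum>j<n. n - 1 - j) = mdeg m"
  proof -
    have "seq_size q + (\<Sum>j<n. n - 1 - j) = (\<Sum>j<n. q j + (n - 1 - j))"
      by (simp only: seq_size_lessThan [OF q ql] sum.distrib)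
    also have "\<dots> = (\<Sum>j<n. ys ! j)"
    proof (rule sum.cong [OF refl])
      fix j assume "j \<in> {..<n}"
      then show "q j + (n - 1 - j) = ys ! j" using ge [of j] by (simp add: q_def)
    qed
    also have "\<dots> = (\<Sum>i<n. ys ! f i)"
      using sum.permute [OF f', of "\<lambda>j. ys ! j"] by (simp add: comp_def)
    also have "\<dots> = (\<Sum>i<n. lk m i)" by (rule sum.cong) (auto simp: val)
    also have "\<dots> = mdeg m" by (rule mdeg_superset [OF finite_lessThan m, symmetric])
    finally show ?thesis .
  qed
  show ?thesis
  proof (intro exI conjI allI impI)
    show "alt n (xpow m) = mconst (of_int (sign g)) * first_vars n (schur q) * vandermonde n" by (rule eq)
    show "permvars \<pi> (mconst (of_int (sign g)) * first_vars n (schur q)) = mconst (of_int (sign g)) * first_vars n (schur q)"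
      if "\<pi> permutes {..<n}" for \<pi>
      using that permvars_first_vars_symm [OF symm_schur [OF q] that]
      by (simp add: permvars_mult permvars_mconst permutes_bij)
    fix m' assume nz: "mcoeff (mconst (of_int (sign g)) * first_vars n (schur q)) m' \<noteq> 0"
    then show "ks m' \<subseteq> {..<n}" by (auto simp: mcoeff_first_vars split: if_splits)
    have "mcoeff (schur q) m' \<noteq> 0" using nz by (auto simp: mcoeff_first_vars split: if_splits)
    then show "mdeg m' + (\<Sum>j<n. n - 1 - j) = mdeg m"
      using schur_homogeneous [OF q] deg by simp
  qed
qed

subsection \<open>Existence of the stable Grothendieck polynomials\<close>

lemma mcoeff_mult_0: "mcoeff (f * g) 0 = mcoeff f 0 * mcoeff (g :: K mfps) 0"
proof -
  have z: "m = 0" if "\<And>i. lk m i = 0" for m :: "nat \<Rightarrow>\<^sub>0 nat"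
    by (rule poly_mapping_eqI) (simp add: that)
  have sp: "x = (0, 0)" if "x \<in> splits 0" for x :: "(nat \<Rightarrow>\<^sub>0 nat) \<times> (nat \<Rightarrow>\<^sub>0 nat)"
  proof -
    have "fst x + snd x = 0" using that by (cases x) (simp add: splits_def)
    then have "lk (fst x) i + lk (snd x) i = 0" for i by (metis lookup_add lookup_zero)
    then have "fst x = 0" "snd x = 0" by (intro z, simp)+
    then show ?thesis by (cases x) simp
  qed
  have "(0, 0) \<in> splits 0" by (simp add: splits_def)
  with sp have "splits 0 = {(0, 0)}" by blast
  then show ?thesis by (simp add: mcoeff_mult)
qed

lemma mcoeff_power_0: "mcoeff (f ^ k) 0 = mcoeff (f :: K mfps) 0 ^ k"
  by (induction k) (simp_all add: mcoeff_mult_0 mcoeff_one)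

lemma mcoeff_prod_0: "mcoeff (prod f A) 0 = (\<Prod>a\<in>A. mcoeff (f a :: K mfps) 0)"
  by (induction A rule: infinite_finite_induct) (simp_all add: mcoeff_mult_0 mcoeff_one)

text \<open>The product of the (1 + b x_j)^j has constant term 1; all its other terms raise the
  degree.\<close>

lemma groth_mon_lowest:
  assumes p: "is_partition p" "part_length p \<le> n"
    and nz: "mcoeff (groth_mon b n p - groth_mon 0 n p) m \<noteq> 0"
  shows "seq_size p + (\<Sum>j<n. n - 1 - j) < mdeg m"
proof -
  let ?m = "\<Sum>j<n. sg j (p j + (n - 1 - j)) :: nat \<Rightarrow>\<^sub>0 nat"
  define R where "R = (\<Prod>j<n. (1 + mconst b * mX j) ^ j) - (1 :: K mfps)"
  have 0: "groth_mon 0 n p = xpow ?m"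
    by (simp add: groth_mon_0 mX_power xpow_sum)
  have "groth_mon b n p = xpow ?m * (\<Prod>j<n. (1 + mconst b * mX j) ^ j)"
    by (simp add: groth_mon_def prod.distrib mX_power xpow_sum)
  then have eq: "groth_mon b n p - groth_mon 0 n p = xpow ?m * R"
    by (simp add: 0 R_def right_diff_distrib)
  have R0: "mcoeff R 0 = 0"
  proof -
    have s: "sg j (1 :: nat) \<noteq> 0" for j :: nat
    proof
      assume "sg j (1 :: nat) = 0"
      then have "lk (sg j (1 :: nat)) j = 0" by simp
      then show False by simp
    qed
    have "mcoeff (mX j :: K mfps) 0 = 0" for j
      unfolding mX_eq_xpow mcoeff_xpow using s [of j] by metis
    then show ?thesis by (simp add: R_def mcoeff_prod_0 mcoeff_power_0 mcoeff_one)
  qed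
  have "\<exists>k. m = ?m + k" using nz mcoeff_xpow_mult_eq_0 [of m ?m R] unfolding eq by blast
  then obtain k where k: "m = ?m + k" by blast
  then have "mcoeff R k \<noteq> 0" using nz unfolding eq by simp
  then have "k \<noteq> 0" using R0 by auto
  then obtain i where "lk k i \<noteq> 0" by (metis lookup_zero poly_mapping_eqI)
  then have "i \<in> ks k" "0 < lk k i" by (auto simp: in_keys_iff)
  then have "0 < mdeg k" unfolding mdeg_def by (metis finite_keys gr0I sum_eq_0_iff less_irrefl)
  moreover have "mdeg ?m = seq_size p + (\<Sum>j<n. n - 1 - j)"
  proof -
    have "mdeg ?m = (\<Sum>j<n. p j + (n - 1 - j))" by (simp only: mdeg_sum mdeg_single)
    then show ?thesis using p by (simp only: sum.distrib seq_size_lessThan)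
  qed
  ultimately show ?thesis using k by simp
qed

text \<open>The numerator is split at \<beta> = 0: that part gives the Schur polynomial by the
  bialternant formula, and the rest is divided monomial by monomial and contributes in higher degree
  only.\<close>

lemma groth_polynomial:
  assumes p: "is_partition p" "part_length p \<le> n"
  shows "\<exists>P. P * vandermonde n = groth_num n p \<and> (\<forall>\<pi>. \<pi> permutes {..<n} \<longrightarrow> permvars \<pi> P = P) \<and>
    polyn n P \<and> (\<forall>m. ks m \<subseteq> {..<n} \<longrightarrow> mdeg m \<le> seq_size p \<longrightarrow> mcoeff P m = mcoeff (schur p) m)"
proof -
  let ?F = "groth_mon beta n p - groth_mon 0 n p"
  let ?S = "{m. mcoeff ?F m \<noteq> 0}"
  have pm: "polyn n (groth_mon b n p)" for b
    unfolding groth_mon_def by (intro polyn_prod polyn_mult polyn_power polyn_add polyn_1 polyn_mconst polyn_mX) auto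
  have "polyn n (groth_mon beta n p + mconst (- 1) * groth_mon 0 n p)"
    by (intro polyn_add polyn_mult polyn_mconst pm)
  then have F: "polyn n ?F" by (simp add: mconst_uminus)
  then have finS: "finite ?S" and Sn: "\<And>m. m \<in> ?S \<Longrightarrow> ks m \<subseteq> {..<n}" by (auto simp: polyn_def)
  have "\<forall>m\<in>?S. \<exists>P. alt n (xpow m) = P * vandermonde n \<and> (\<forall>\<pi>. \<pi> permutes {..<n} \<longrightarrow> permvars \<pi> P = P) \<and>
    (\<forall>m'. mcoeff P m' \<noteq> 0 \<longrightarrow> ks m' \<subseteq> {..<n} \<and> mdeg m' + (\<Sum>j<n. n - 1 - j) = mdeg m)"
    using alt_xpow Sn by (intro ballI) simp
  from bchoice [OF this] obtain Q where Q0: "\<forall>m\<in>?S. alt n (xpow m) = Q m * vandermonde n \<and>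
    (\<forall>\<pi>. \<pi> permutes {..<n} \<longrightarrow> permvars \<pi> (Q m) = Q m) \<and>
    (\<forall>m'. mcoeff (Q m) m' \<noteq> 0 \<longrightarrow> ks m' \<subseteq> {..<n} \<and> mdeg m' + (\<Sum>j<n. n - 1 - j) = mdeg m)"
    by blast
  have Q: "\<And>m. m \<in> ?S \<Longrightarrow> alt n (xpow m) = Q m * vandermonde n"
    "\<And>m \<pi>. m \<in> ?S \<Longrightarrow> \<pi> permutes {..<n} \<Longrightarrow> permvars \<pi> (Q m) = Q m"
    "\<And>m m'. m \<in> ?S \<Longrightarrow> mcoeff (Q m) m' \<noteq> 0 \<Longrightarrow> ks m' \<subseteq> {..<n} \<and> mdeg m' + (\<Sum>j<n. n - 1 - j) = mdeg m"
    using Q0 by simp_all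
  define P where "P = first_vars n (schur p) + (\<Sum>m\<in>?S. mconst (mcoeff ?F m) * Q m)"
  have "alt n ?F = alt n (\<Sum>m\<in>?S. mconst (mcoeff ?F m) * xpow m)"
    by (rule arg_cong [OF polyn_expand [OF F]])
  also have "\<dots> = (\<Sum>m\<in>?S. mconst (mcoeff ?F m) * Q m) * vandermonde n"
    unfolding alt_sum alt_mconst_mult sum_distrib_right by (rule sum.cong) (auto simp: Q mult.assoc)
  finally have "alt n (groth_mon 0 n p + ?F) = P * vandermonde n"
    unfolding alt_add schur_alternant [OF p, symmetric] by (simp only: P_def distrib_right)
  then have 1: "P * vandermonde n = groth_num n p" by (simp add: groth_num_eq_alt)
  have 2: "permvars \<pi> P = P" if "\<pi> permutes {..<n}" for \<pi>
    using that permvars_first_vars_symm [OF symm_schur [OF p(1)] that] Q(2) [OF _ that]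
    by (auto simp: P_def permvars_add permvars_sum permvars_mult permvars_mconst permutes_bij intro!: sum.cong)
  have big: "seq_size p < mdeg m'" if "m \<in> ?S" "mcoeff (Q m) m' \<noteq> 0" for m m'
    using groth_mon_lowest [OF p, of beta m] Q(3) [OF that] that(1) by simp
  have 3: "mcoeff P m = mcoeff (schur p) m" if "ks m \<subseteq> {..<n}" "mdeg m \<le> seq_size p" for m
  proof -
    have "(\<Sum>k\<in>?S. mcoeff ?F k * mcoeff (Q k) m) = 0"
    proof (rule sum.neutral, rule ballI)
      fix k assume "k \<in> ?S"
      then have "mcoeff (Q k) m = 0" using big [of k m] that(2) by auto
      then show "mcoeff ?F k * mcoeff (Q k) m = 0" by simp
    qed
    then show ?thesis using that(1) by (simp add: P_def mcoeff_first_vars)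
  qed
  have 4: "polyn n P"
  proof -
    let ?D = "Max (insert (seq_size p) (mdeg ` ?S))"
    have nz: "ks m \<subseteq> {..<n} \<and> mdeg m \<le> ?D" if "mcoeff P m \<noteq> 0" for m
    proof -
      have "mcoeff (first_vars n (schur p)) m \<noteq> 0 \<or> (\<Sum>k\<in>?S. mcoeff ?F k * mcoeff (Q k) m) \<noteq> 0"
        using that by (auto simp: P_def)
      then consider "mcoeff (first_vars n (schur p)) m \<noteq> 0"
        | k where "k \<in> ?S" "mcoeff ?F k * mcoeff (Q k) m \<noteq> 0"
        by (meson sum.neutral)
      then show ?thesis
      proof cases
        case 1
        then have "ks m \<subseteq> {..<n}" "mcoeff (schur p) m \<noteq> 0" by (auto simp: mcoeff_first_vars split: if_splits)
        then show ?thesis using schur_homogeneous [OF p(1)] finS by simp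
      next
        case (2 k)
        then have "ks m \<subseteq> {..<n}" "mdeg m \<le> mdeg k" using Q(3) [OF 2(1), of m] by auto
        moreover have "mdeg k \<le> ?D" using finS 2(1) by (intro Max_ge) blast+
        ultimately show ?thesis by linarith
      qed
    qed
    have "{m. mcoeff P m \<noteq> 0} \<subseteq> (\<Union>d\<le>?D. {m. ks m \<subseteq> {..<n} \<and> mdeg m = d})"
      using nz by blast
    moreover have "finite (\<Union>d\<le>?D. {m. ks m \<subseteq> {..<n} \<and> mdeg m = d})"
      by (simp only: finite_UN finite_atMost finite_mdeg_keys ball_simps) simp
    ultimately have "finite {m. mcoeff P m \<noteq> 0}" by (rule finite_subset)
    then show ?thesis using nz unfolding polyn_def by blast
  qed
  show ?thesis using 1 2 3 4 by blast
qed

text \<open>A permutation that moves n gives x_n a positive exponent, so its term dies at x_n = 0;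
  each remaining term is the one in n variables times all the x_i. The Vandermonde product acquires
  the same extra factor, and this is the stability that makes \<open>Groth\<close> well
  defined.\<close>

lemma first_vars_alt_Suc:
  assumes "p n = 0"
  shows "first_vars n (alt (Suc n) (groth_mon b (Suc n) p)) = (\<Prod>i<n. mX i) * alt n (groth_mon b n p)"
proof -
  let ?g = "\<lambda>\<pi> j. mX (\<pi> j) ^ (p j + (n - j)) * (1 + mconst b * mX (\<pi> j)) ^ j :: K mfps"
  have fac: "permvars \<pi> (groth_mon b (Suc n) p) = (\<Prod>j<Suc n. ?g \<pi> j)" if "bij \<pi>" for \<pi>
    using that by (simp add: groth_mon_def permvars_prod permvars_mult permvars_power permvars_add permvars_1
          permvars_mconst permvars_mX del: prod.lessThan_Suc)
  have fvg: "first_vars n (?g \<pi> j) = first_vars n (mX (\<pi> j)) ^ (p j + (n - j)) * (1 + mconst b * first_vars n (mX (\<pi> j))) ^ j" for \<pi> j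
    by (simp add: first_vars_mult first_vars_power)
  have fint: "first_vars n (of_int k * f) = of_int k * first_vars n (f :: K mfps)" for k f
    unfolding mconst_of_int [symmetric] by (simp add: first_vars_mult)
  have van: "first_vars n (permvars \<pi> (groth_mon b (Suc n) p)) = 0"
    if "\<pi> permutes {..<Suc n}" "\<pi> n \<noteq> n" for \<pi>
  proof -
    have "n \<in> \<pi> ` {..<Suc n}" using permutes_image [OF that(1)] by simp
    then obtain j where j: "j < Suc n" "\<pi> j = n" by auto
    then have "j < n" using that(2) by (cases "j = n") auto
    then have "p j + (n - j) \<noteq> 0" by simp
    then have z: "first_vars n (?g \<pi> j) = 0"
      by (subst fvg) (simp only: j(2) first_vars_mX less_irrefl if_False power_0_left mult_zero_left)
    have "(\<Prod>j<Suc n. first_vars n (?g \<pi> j)) = 0"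
      by (rule prod_zero) (use j z in blast)+
    then show ?thesis unfolding fac [OF permutes_bij [OF that(1)]] first_vars_prod .
  qed
  have keep: "first_vars n (permvars \<pi> (groth_mon b (Suc n) p)) = (\<Prod>i<n. mX i) * permvars \<pi> (groth_mon b n p)"
    if p': "\<pi> permutes {..<n}" for \<pi>
  proof -
    have n: "\<pi> n = n" using p' by (simp add: permutes_def)
    have "first_vars n (permvars \<pi> (groth_mon b (Suc n) p)) = (\<Prod>j<n. first_vars n (?g \<pi> j)) * first_vars n (?g \<pi> n)"
      unfolding fac [OF permutes_bij [OF p']] first_vars_prod by simp
    also have "first_vars n (?g \<pi> n) = 1"
      by (subst fvg) (simp add: n first_vars_mX assms)
    also have "(\<Prod>j<n. first_vars n (?g \<pi> j)) = (\<Prod>j<n. mX (\<pi> j) * (mX (\<pi> j) ^ (p j + (n - 1 - j)) * (1 + mconst b * mX (\<pi> j)) ^ j))"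
    proof (rule prod.cong [OF refl])
      fix j assume j: "j \<in> {..<n}"
      then have "\<pi> j < n" using permutes_in_image [OF p', of j] by simp
      moreover have "p j + (n - j) = Suc (p j + (n - 1 - j))" using j by auto
      ultimately show "first_vars n (?g \<pi> j) = mX (\<pi> j) * (mX (\<pi> j) ^ (p j + (n - 1 - j)) * (1 + mconst b * mX (\<pi> j)) ^ j)"
        by (subst fvg) (simp only: first_vars_mX if_True power_Suc mult.assoc)
    qed
    also have "\<dots> = (\<Prod>j<n. mX (\<pi> j)) * permvars \<pi> (groth_mon b n p)"
      using permutes_bij [OF p'] by (simp add: prod.distrib groth_mon_def permvars_prod permvars_mult
          permvars_power permvars_add permvars_1 permvars_mconst permvars_mX)
    also have "(\<Prod>j<n. mX (\<pi> j)) = (\<Prod>i<n. mX i :: K mfps)"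
      using prod.permute [OF p', of "mX :: nat \<Rightarrow> K mfps"] by (simp add: comp_def)
    finally show ?thesis by simp
  qed
  have perms: "{\<pi>. \<pi> permutes {..<n}} = {\<pi>. \<pi> permutes {..<Suc n} \<and> \<pi> n = n}"
  proof (intro equalityI subsetI)
    fix \<pi> :: "nat \<Rightarrow> nat" assume "\<pi> \<in> {\<pi>. \<pi> permutes {..<n}}"
    then have "\<pi> permutes {..<n}" by simp
    then show "\<pi> \<in> {\<pi>. \<pi> permutes {..<Suc n} \<and> \<pi> n = n}"
      using permutes_subset [of \<pi> "{..<n}" "{..<Suc n}"] by (auto simp: permutes_def)
  next
    fix \<pi> :: "nat \<Rightarrow> nat" assume "\<pi> \<in> {\<pi>. \<pi> permutes {..<Suc n} \<and> \<pi> n = n}"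
    then show "\<pi> \<in> {\<pi>. \<pi> permutes {..<n}}"
      using permutes_superset [of \<pi> "{..<Suc n}" "{..<n}"] by (auto simp: less_Suc_eq)
  qed
  have "first_vars n (alt (Suc n) (groth_mon b (Suc n) p))
    = (\<Sum>\<pi> | \<pi> permutes {..<Suc n}. of_int (sign \<pi>) * first_vars n (permvars \<pi> (groth_mon b (Suc n) p)))"
    by (simp add: alt_def first_vars_sum fint)
  also have "\<dots> = (\<Sum>\<pi> | \<pi> permutes {..<n}. of_int (sign \<pi>) * first_vars n (permvars \<pi> (groth_mon b (Suc n) p)))"
    unfolding perms by (rule sum.mono_neutral_right) (auto simp: finite_permutations van)
  also have "\<dots> = (\<Prod>i<n. mX i) * alt n (groth_mon b n p)"
    unfolding alt_def sum_distrib_left by (rule sum.cong) (auto simp: keep mult_ac)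
  finally show ?thesis .
qed

lemma xpow_cancel: "xpow a * f = xpow a * g \<Longrightarrow> f = (g :: K mfps)"
  by (rule mfps_eqI) (metis mcoeff_xpow_mult)

lemma first_vars_quotient:
  assumes p: "is_partition p" "part_length p \<le> n"
    and P: "P * vandermonde (Suc n) = groth_num (Suc n) p" and Q: "Q * vandermonde n = groth_num n p"
  shows "first_vars n P = Q"
proof -
  have pn: "p n = 0" using partition_beyond [OF p order_refl] .
  have v: "first_vars n (vandermonde (Suc n)) = (\<Prod>i<n. mX i) * vandermonde n"
    unfolding vandermonde_eq_alt by (rule first_vars_alt_Suc) simp
  have "first_vars n P * ((\<Prod>i<n. mX i) * vandermonde n) = first_vars n (groth_num (Suc n) p)"
    using P by (simp add: v [symmetric] first_vars_mult [symmetric])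
  also have "\<dots> = (\<Prod>i<n. mX i) * (Q * vandermonde n)"
    unfolding Q groth_num_eq_alt by (rule first_vars_alt_Suc) (rule pn)
  finally have "xpow (\<Sum>i<n. sg i 1) * (first_vars n P * vandermonde n) = xpow (\<Sum>i<n. sg i 1) * (Q * vandermonde n)"
    by (simp add: xpow_sum mX_eq_xpow mult_ac)
  then have "first_vars n P * vandermonde n = Q * vandermonde n" by (rule xpow_cancel)
  then show ?thesis by (rule vandermonde_cancel)
qed

lemma Groth_exists:
  assumes p: "is_partition p"
  shows "\<exists>f\<in>Lam_hat. (\<forall>n\<ge>part_length p. first_vars n f * vandermonde n = groth_num n p) \<and>
    (\<forall>m. mdeg m \<le> seq_size p \<longrightarrow> mcoeff f m = mcoeff (schur p) m)"
proof -
  let ?l = "part_length p"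
  have "\<forall>n\<in>{?l..}. \<exists>P. P * vandermonde n = groth_num n p \<and> (\<forall>\<pi>. \<pi> permutes {..<n} \<longrightarrow> permvars \<pi> P = P) \<and>
    polyn n P \<and> (\<forall>m. ks m \<subseteq> {..<n} \<longrightarrow> mdeg m \<le> seq_size p \<longrightarrow> mcoeff P m = mcoeff (schur p) m)"
    using groth_polynomial [OF p] by auto
  from bchoice [OF this] obtain P where P0: "\<forall>n\<in>{?l..}. P n * vandermonde n = groth_num n p \<and>
    (\<forall>\<pi>. \<pi> permutes {..<n} \<longrightarrow> permvars \<pi> (P n) = P n) \<and> polyn n (P n) \<and>
    (\<forall>m. ks m \<subseteq> {..<n} \<longrightarrow> mdeg m \<le> seq_size p \<longrightarrow> mcoeff (P n) m = mcoeff (schur p) m)"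
    by blast
  have P: "\<And>n. n \<ge> ?l \<Longrightarrow> P n * vandermonde n = groth_num n p"
    "\<And>n \<pi>. n \<ge> ?l \<Longrightarrow> \<pi> permutes {..<n} \<Longrightarrow> permvars \<pi> (P n) = P n"
    "\<And>n. n \<ge> ?l \<Longrightarrow> polyn n (P n)"
    "\<And>n m. n \<ge> ?l \<Longrightarrow> ks m \<subseteq> {..<n} \<Longrightarrow> mdeg m \<le> seq_size p \<Longrightarrow> mcoeff (P n) m = mcoeff (schur p) m"
    using P0 by simp_all
  have self: "first_vars n (P n) = P n" if "n \<ge> ?l" for n
    using P(3) [OF that] by (intro mfps_eqI) (auto simp: mcoeff_first_vars polyn_def)
  have compat: "first_vars n (P (n + k)) = P n" if "n \<ge> ?l" for n k
  proof (induction k)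
    case 0
    show ?case using self [OF that] by simp
  next
    case (Suc k)
    have "first_vars (n + k) (P (Suc (n + k))) = P (n + k)"
      using that by (intro first_vars_quotient [OF p] P) auto
    then have "first_vars n (first_vars (n + k) (P (Suc (n + k)))) = P n" using Suc by simp
    then show ?case by (simp add: first_vars_first_vars)
  qed
  \<comment> \<open>The least admissible number of variables containing those of m; by
    \<open>compat\<close> every larger number gives the same coefficient.\<close>
  define bd where "bd m = (LEAST n. n \<ge> ?l \<and> ks m \<subseteq> {..<n})" for m :: "nat \<Rightarrow>\<^sub>0 nat"
  have bd: "bd m \<ge> ?l \<and> ks m \<subseteq> {..<bd m}" for m
    unfolding bd_def
  proof (rule LeastI_ex)
    obtain n where "ks m \<subseteq> {..<n}" by (rule keys_bounded)
    then show "\<exists>n. n \<ge> ?l \<and> ks m \<subseteq> {..<n}"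
      by (intro exI [of _ "max n ?l"]) fastforce
  qed
  have bd_le: "bd m \<le> n" if "n \<ge> ?l" "ks m \<subseteq> {..<n}" for m n
    unfolding bd_def using that by (intro Least_le) simp
  define f where "f = Abs_mfps (\<lambda>m. mcoeff (P (bd m)) m)"
  have coeff: "mcoeff f m = mcoeff (P n) m" if "n \<ge> ?l" "ks m \<subseteq> {..<n}" for m n
  proof -
    have "first_vars (bd m) (P (bd m + (n - bd m))) = P (bd m)" using bd compat by blast
    then have "first_vars (bd m) (P n) = P (bd m)" using bd_le [OF that] by simp
    then have "mcoeff (first_vars (bd m) (P n)) m = mcoeff (P (bd m)) m" by simp
    then show ?thesis using bd [of m] by (simp add: f_def mcoeff_first_vars)
  qed
  have fv: "first_vars n f = P n" if "n \<ge> ?l" for n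
    using P(3) [OF that] that by (intro mfps_eqI) (auto simp: mcoeff_first_vars coeff polyn_def)
  have "f \<in> Lam_hat"
  proof (rule Lam_hatI)
    show "symm f" by (rule symm_finitary [of ?l]) (simp add: fv P(2))
    show "locally_bounded f" unfolding locally_bounded_def
    proof
      fix n
      let ?n = "max n ?l"
      let ?A = "{m. mcoeff (P ?n) m \<noteq> 0}"
      have fin: "finite ?A" using P(3) [of ?n] by (simp add: polyn_def)
      have "mdeg m \<le> Max (mdeg ` ?A)" if "ks m \<subseteq> {..<n}" "mcoeff f m \<noteq> 0" for m
      proof -
        have "ks m \<subseteq> {..<?n}" using that(1) by (auto simp: subset_eq)
        then have "m \<in> ?A" using that(2) coeff [of ?n m] by simp
        then show ?thesis using fin by simp
      qed
      then show "\<exists>d. \<forall>m. ks m \<subseteq> {..<n} \<longrightarrow> mcoeff f m \<noteq> 0 \<longrightarrow> mdeg m \<le> d" by blast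
    qed
  qed
  moreover have "mcoeff f m = mcoeff (schur p) m" if "mdeg m \<le> seq_size p" for m
    using P(4) [of "bd m" m] bd [of m] that by (simp add: f_def)
  ultimately show ?thesis using P(1) fv by (intro bexI [of _ f]) auto
qed

text \<open>Stability supplies the series and cancellation of the Vandermonde product its
  uniqueness, so the definite description is resolved.\<close>

lemma Groth_props:
  assumes p: "is_partition p"
  shows Groth_Lam_hat: "Groth p \<in> Lam_hat"
    and first_vars_Groth: "part_length p \<le> n \<Longrightarrow> first_vars n (Groth p) * vandermonde n = groth_num n p"
    and mcoeff_Groth_low: "mdeg m \<le> seq_size p \<Longrightarrow> mcoeff (Groth p) m = mcoeff (schur p) m"
proof -
  obtain f where f: "f \<in> Lam_hat" "\<forall>n\<ge>part_length p. first_vars n f * vandermonde n = groth_num n p"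
    "\<forall>m. mdeg m \<le> seq_size p \<longrightarrow> mcoeff f m = mcoeff (schur p) m"
    using Groth_exists [OF p] by blast
  have "Groth p = f" unfolding Groth_def
  proof (rule the_equality)
    fix g assume g: "g \<in> Lam_hat \<and> (\<forall>n\<ge>part_length p. first_vars n g * vandermonde n = groth_num n p)"
    show "g = f"
    proof (rule first_vars_eqI [of "part_length p"])
      fix n assume "part_length p \<le> n"
      then have "first_vars n g * vandermonde n = first_vars n f * vandermonde n"
        using f g by simp
      then show "first_vars n g = first_vars n f" by (rule vandermonde_cancel)
    qed
  qed (use f in blast)
  then show "Groth p \<in> Lam_hat" "part_length p \<le> n \<Longrightarrow> first_vars n (Groth p) * vandermonde n = groth_num n p"
    "mdeg m \<le> seq_size p \<Longrightarrow> mcoeff (Groth p) m = mcoeff (schur p) m"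
    using f by auto
qed

lemma schur_scf_Groth:
  assumes p: "is_partition p" and q: "seq_size q \<le> seq_size p"
  shows "schur_scf (Groth p) q = (if q = p then 1 else 0)"
proof -
  have "schur_scf (Groth p) q = schur_scf (schur p) q"
    using q by (intro schur_scf_cong_degree mcoeff_Groth_low [OF p]) simp
  then show ?thesis by (simp add: schur_scf_schur [OF p])
qed

subsection \<open>The dual basis\<close>

text \<open>Back substitution: as \<open>Groth p\<close> is \<open>schur p\<close> plus terms of
  larger size, the prescribed pairing with \<open>Groth p\<close> determines the coefficient at p
  from those at larger partitions. Starting at size |q| keeps \<open>dual_Groth q\<close> of bounded
  degree.\<close>

function dual_coeff :: "shape \<Rightarrow> shape \<Rightarrow> K" where
  "dual_coeff q p = (if p \<in> parts_upto (seq_size q) then (if p = q then 1 else 0) -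
     (\<Sum>r\<in>{r \<in> parts_upto (seq_size q). seq_size p < seq_size r}. schur_scf (Groth p) r * dual_coeff q r) else 0)"
  by auto
termination
  by (relation "measure (\<lambda>(q, p). seq_size q - seq_size p)") (auto simp: parts_upto_def)

declare dual_coeff.simps [simp del]

text \<open>Descending induction on the size, from the degree bound of h downwards: in the pairing
  with \<open>Groth p\<close> only the coefficient of h at p is not yet known to vanish.\<close>

lemma Groth_pairing_unique:
  assumes h: "h \<in> Lam" and z: "\<And>p. is_partition p \<Longrightarrow> hall (Groth p) h = 0"
  shows "h = 0"
proof -
  obtain d where d: "\<And>m. mcoeff h m \<noteq> 0 \<Longrightarrow> mdeg m \<le> d" using h unfolding Lam_iff by blast
  have "schur_scf h p = 0" if "is_partition p" for p
    using that
  proof (induction "Suc d - seq_size p" arbitrary: p rule: less_induct)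
    case less
    show ?case
    proof (cases "p \<in> parts_upto d")
      case True
      have "0 = (\<Sum>r\<in>parts_upto d. schur_scf (Groth p) r * schur_scf h r)"
        using z [OF less.prems] hall_eq_parts [OF Groth_Lam_hat [OF less.prems] h d] by simp
      also have "\<dots> = (\<Sum>r\<in>parts_upto d. if r = p then schur_scf h r else 0)"
      proof (rule sum.cong [OF refl])
        fix r assume r: "r \<in> parts_upto d"
        show "schur_scf (Groth p) r * schur_scf h r = (if r = p then schur_scf h r else 0)"
        proof (cases "seq_size r \<le> seq_size p")
          case rp: True
          then show ?thesis by (simp add: schur_scf_Groth [OF less.prems rp])
        next
          case False
          then have "schur_scf h r = 0" using r True by (intro less.hyps) (auto simp: parts_upto_def)
          moreover have "r \<noteq> p" using False by auto
          ultimately show ?thesis by simp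
        qed
      qed
      also have "\<dots> = schur_scf h p" using True by simp
      finally show ?thesis by simp
    qed (use Lam_schur_scf_bounded [OF d] in blast)
  qed
  then show ?thesis
    using Lam_expand [OF h d] by (simp add: parts_upto_def)
qed

lemma dual_Groth_props:
  assumes q: "is_partition q"
  shows dual_Groth_Lam: "dual_Groth q \<in> Lam"
    and hall_Groth_dual: "is_partition p \<Longrightarrow> hall (Groth p) (dual_Groth q) = (if p = q then 1 else 0)"
proof -
  let ?A = "parts_upto (seq_size q)"
  define g where "g = (\<Sum>p\<in>?A. mconst (dual_coeff q p) * schur p)"
  have g: "g \<in> Lam" unfolding g_def
    by (intro Lam_sum Lam_mconst_mult schur_Lam) (auto simp: parts_upto_def)
  have hg: "hall (Groth p) g = (if p = q then 1 else 0)" if p: "is_partition p" for p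
  proof -
    have G: "Groth p \<in> Lam_hat" by (rule Groth_Lam_hat [OF p])
    have "hall (Groth p) g = (\<Sum>r\<in>?A. dual_coeff q r * hall (Groth p) (schur r))"
      unfolding g_def by (rule hall_sum_right [OF G]) (auto simp: parts_upto_def schur_Lam)
    also have "\<dots> = (\<Sum>r\<in>?A. schur_scf (Groth p) r * dual_coeff q r)"
      by (rule sum.cong) (auto simp: parts_upto_def hall_schur [OF G] mult.commute)
    finally have eq: "hall (Groth p) g = (\<Sum>r\<in>?A. schur_scf (Groth p) r * dual_coeff q r)" .
    show ?thesis
    proof (cases "p \<in> ?A")
      case True
      let ?B = "{r \<in> ?A. seq_size p < seq_size r}"
      have "(\<Sum>r\<in>?A. schur_scf (Groth p) r * dual_coeff q r) = (\<Sum>r\<in>insert p ?B. schur_scf (Groth p) r * dual_coeff q r)"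
      proof (rule sum.mono_neutral_right)
        show "insert p ?B \<subseteq> ?A" using True by blast
        show "\<forall>r\<in>?A - insert p ?B. schur_scf (Groth p) r * dual_coeff q r = 0"
          using schur_scf_Groth [OF p] by (auto simp: not_less)
      qed simp
      also have "\<dots> = schur_scf (Groth p) p * dual_coeff q p + (\<Sum>r\<in>?B. schur_scf (Groth p) r * dual_coeff q r)"
        by (rule sum.insert) auto
      also have "\<dots> = (if p = q then 1 else 0)"
        using True schur_scf_Groth [OF p order_refl] by (simp add: dual_coeff.simps [of q p])
      finally show ?thesis using eq by simp
    next
      case False
      then have "seq_size q < seq_size p" using p by (auto simp: parts_upto_def)
      then have "schur_scf (Groth p) r * dual_coeff q r = 0" if "r \<in> ?A" for r
        using that False schur_scf_Groth [OF p, of r] by (auto simp: parts_upto_def)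
      then show ?thesis using eq \<open>seq_size q < seq_size p\<close> by (auto simp: sum.neutral)
    qed
  qed
  have "dual_Groth q = g" unfolding dual_Groth_def
  proof (rule the_equality)
    fix h assume h: "h \<in> Lam \<and> (\<forall>p. is_partition p \<longrightarrow> hall (Groth p) h = (if p = q then 1 else 0))"
    have "hall (Groth p) (h + mconst (- 1) * g) = 0" if "is_partition p" for p
      using h hg [OF that] that g Groth_Lam_hat [OF that]
      by (simp add: hall_add_right hall_mconst_right Lam_mconst_mult)
    then have "h + mconst (- 1) * g = 0"
      using h g by (intro Groth_pairing_unique Lam_add Lam_mconst_mult) auto
    then show "h = g" by (simp add: mconst_uminus)
  qed (use g hg in blast)
  then show "dual_Groth q \<in> Lam" "is_partition p \<Longrightarrow> hall (Groth p) (dual_Groth q) = (if p = q then 1 else 0)"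
    using g hg by auto
qed

text \<open>Both sides have the same pairing with each \<open>Groth p\<close>; for |p| > d both
  pairings are zero, since \<open>Groth p\<close> starts in degree |p|.\<close>

lemma dual_Groth_expand:
  assumes h: "h \<in> Lam" and d: "\<And>m. mcoeff h m \<noteq> 0 \<Longrightarrow> mdeg m \<le> d"
  shows "h = (\<Sum>q\<in>parts_upto d. mconst (hall (Groth q) h) * dual_Groth q)"
proof -
  let ?R = "\<Sum>q\<in>parts_upto d. mconst (hall (Groth q) h) * dual_Groth q"
  have R: "?R \<in> Lam"
    by (intro Lam_sum Lam_mconst_mult dual_Groth_Lam) (simp add: parts_upto_def)
  have "hall (Groth p) (h + mconst (- 1) * ?R) = 0" if p: "is_partition p" for p
  proof -
    have G: "Groth p \<in> Lam_hat" by (rule Groth_Lam_hat [OF p])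
    have "hall (Groth p) ?R = (\<Sum>q\<in>parts_upto d. hall (Groth q) h * hall (Groth p) (dual_Groth q))"
      by (rule hall_sum_right [OF G]) (simp add: parts_upto_def dual_Groth_Lam)
    also have "\<dots> = (\<Sum>q\<in>parts_upto d. if q = p then hall (Groth q) h else 0)"
      by (rule sum.cong) (auto simp: parts_upto_def hall_Groth_dual p)
    also have "\<dots> = hall (Groth p) h"
    proof (cases "p \<in> parts_upto d")
      case False
      then have "d < seq_size p" using p by (simp add: parts_upto_def)
      have "hall (Groth p) h = (\<Sum>r\<in>parts_upto d. schur_scf (Groth p) r * schur_scf h r)"
        by (rule hall_eq_parts [OF G h d])
      also have "\<dots> = 0"
      proof (rule sum.neutral, rule ballI)
        fix r assume "r \<in> parts_upto d"
        then have "seq_size r \<le> seq_size p" "r \<noteq> p" using \<open>d < seq_size p\<close> by (auto simp: parts_upto_def)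
        then show "schur_scf (Groth p) r * schur_scf h r = 0" by (simp add: schur_scf_Groth [OF p])
      qed
      finally show ?thesis using False by simp
    qed simp
    finally show ?thesis
      using h R G by (simp add: hall_add_right hall_mconst_right Lam_mconst_mult)
  qed
  then have "h + mconst (- 1) * ?R = 0"
    using h R by (intro Groth_pairing_unique Lam_add Lam_mconst_mult) auto
  then show ?thesis by (simp add: mconst_uminus)
qed

text \<open>The coproduct formula \<open>G\<^sub>p(x, y) = \<Sum> G\<^bsub>p//q\<^esub>(x) G\<^sub>q(y)\<close>, one coefficient at a time.\<close>

lemma Groth_coproduct:
  assumes p: "is_partition p"
  shows "mcoeff (Groth p) (mon (a @ c))
    = (\<Sum>q\<in>parts_upto (sum_list c). mcoeff (Groth_dskew p q) (mon a) * mcoeff (Groth q) (mon c))"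
proof -
  have G: "Groth p \<in> Lam_hat" by (rule Groth_Lam_hat [OF p])
  have bound: "mdeg m \<le> sum_list c" if nz: "mcoeff (hom_prod c) m \<noteq> 0" for m
  proof -
    obtain q where "q \<in> parts (sum_list c)" "mcoeff (schur q) m \<noteq> 0"
    proof -
      have "(\<Sum>q\<in>parts (sum_list c). mcoeff (mconst (mcoeff (schur q) (mon c)) * schur q) m) \<noteq> 0"
        using nz unfolding hom_prod_expansion mcoeff_sum .
      then obtain q where "q \<in> parts (sum_list c)" "mcoeff (mconst (mcoeff (schur q) (mon c)) * schur q) m \<noteq> 0"
        by (meson sum.neutral)
      then show thesis using that [of q] by auto
    qed
    then show ?thesis using schur_homogeneous [of q m] by (auto simp: parts_def)
  qed
  have "mcoeff (Groth p) (mon (a @ c)) = hall (Groth p) (hom_prod c * hom_prod a)"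
    by (simp add: hall_hom_prod [OF G, symmetric] hom_prod_append mult.commute)
  \<comment> \<open>In the dual basis the coefficients of h_c are those of x^c in the
    \<open>Groth q\<close>, and the degree of h_c bounds the size of q.\<close>
  also have "hom_prod c = (\<Sum>q\<in>parts_upto (sum_list c). mconst (mcoeff (Groth q) (mon c)) * dual_Groth q)"
  proof -
    have "hom_prod c = (\<Sum>q\<in>parts_upto (sum_list c). mconst (hall (Groth q) (hom_prod c)) * dual_Groth q)"
      by (rule dual_Groth_expand [OF hom_prod_Lam bound])
    also have "\<dots> = (\<Sum>q\<in>parts_upto (sum_list c). mconst (mcoeff (Groth q) (mon c)) * dual_Groth q)"
      by (rule sum.cong) (auto simp: parts_upto_def hall_hom_prod Groth_Lam_hat)
    finally show ?thesis .
  qed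
  also have "\<dots> * hom_prod a = (\<Sum>q\<in>parts_upto (sum_list c). mconst (mcoeff (Groth q) (mon c)) * (dual_Groth q * hom_prod a))"
    by (simp add: sum_distrib_right mult.assoc)
  also have "hall (Groth p) \<dots> = (\<Sum>q\<in>parts_upto (sum_list c). mcoeff (Groth q) (mon c) * hall (Groth p) (dual_Groth q * hom_prod a))"
    by (rule hall_sum_right [OF G]) (simp add: parts_upto_def dual_Groth_Lam Lam_mult hom_prod_Lam)
  also have "\<dots> = (\<Sum>q\<in>parts_upto (sum_list c). mcoeff (Groth_dskew p q) (mon a) * mcoeff (Groth q) (mon c))"
    by (rule sum.cong) (auto simp: parts_upto_def Groth_dskew_def mcoeff_perp dual_Groth_Lam G)
  finally show ?thesis .
qed

lemma Groth_dskew_Lam_hat: "is_partition p \<Longrightarrow> is_partition q \<Longrightarrow> Groth_dskew p q \<in> Lam_hat"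
  unfolding Groth_dskew_def by (intro perp_props dual_Groth_Lam Groth_Lam_hat)

subsection \<open>Skew stable Grothendieck polynomials\<close>

lemma rook_strip_refl: "is_partition q \<Longrightarrow> rook_strip q q"
  by (auto simp: rook_strip_def skew_diagram_def)

lemma rook_stripD: "rook_strip q r \<Longrightarrow> is_partition q \<and> is_partition r \<and> r \<le> q"
  by (simp add: rook_strip_def)

lemma finite_rook_strips: "finite {r. rook_strip q r}"
proof (cases "is_partition q")
  case True
  then show ?thesis
    by (intro finite_subset [OF _ finite_partitions_le [OF True]]) (auto dest: rook_stripD)
next
  case False
  then have "{r. rook_strip q r} = {}" by (auto dest: rook_stripD)
  then show ?thesis by simp
qed

text \<open>The defining relation is unitriangular along rook strips, so it can be solved for the
  term \<sigma> = \<mu>; this recursion is the family that \<open>Groth_skew\<close>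
  describes.\<close>

function skew_sol :: "shape \<Rightarrow> shape \<Rightarrow> K mfps" where
  "skew_sol p q = (if is_partition p \<and> is_partition q \<and> q \<le> p then Groth_dskew p q -
     (\<Sum>r\<in>{r. rook_strip q r \<and> r \<noteq> q}. mconst (beta ^ skew_size q r) * skew_sol p r) else 0)"
  by auto
termination
  by (relation "measure (\<lambda>(p, q). seq_size q)") (auto dest: rook_stripD intro: seq_size_strict_mono)

declare skew_sol.simps [simp del]

lemma sum_rook_strips:
  assumes "is_partition q"
  shows "(\<Sum>r | rook_strip q r. mconst (beta ^ skew_size q r) * F r)
    = F q + (\<Sum>r\<in>{r. rook_strip q r \<and> r \<noteq> q}. mconst (beta ^ skew_size q r) * F r)"
proof -
  have "{r. rook_strip q r} = insert q {r. rook_strip q r \<and> r \<noteq> q}"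
    using rook_strip_refl [OF assms] by auto
  moreover have "finite {r. rook_strip q r \<and> r \<noteq> q}"
    by (rule finite_subset [OF _ finite_rook_strips]) auto
  moreover have "skew_size q q = 0" using skew_size_eq [OF assms assms] by simp
  ultimately show ?thesis by simp
qed

lemma skew_sol_Lam_hat: "skew_sol p q \<in> Lam_hat"
proof (induction p q rule: skew_sol.induct)
  case (1 p q)
  then show ?case
    by (subst skew_sol.simps) (auto intro!: Lam_hat_diff Lam_hat_sum Lam_hat_mconst_mult Groth_dskew_Lam_hat Lam_hat_0)
qed

lemma Groth_skew_eq: "Groth_skew = skew_sol"
  unfolding Groth_skew_def
proof (rule the_equality)
  have eq: "Groth_dskew p q = (\<Sum>r | rook_strip q r. mconst (beta ^ skew_size q r) * skew_sol p r)"
    if "is_partition p" "is_partition q" "q \<le> p" for p q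
    unfolding sum_rook_strips [OF that(2)] using that by (simp add: skew_sol.simps [of p q])
  show "(\<forall>p q. is_partition p \<and> is_partition q \<and> q \<le> p \<longrightarrow> skew_sol p q \<in> Lam_hat \<and>
        Groth_dskew p q = (\<Sum>\<sigma> | rook_strip q \<sigma>. mconst (beta ^ skew_size q \<sigma>) * skew_sol p \<sigma>)) \<and>
     (\<forall>p q. \<not> (is_partition p \<and> is_partition q \<and> q \<le> p) \<longrightarrow> skew_sol p q = 0)"
    using eq skew_sol_Lam_hat skew_sol.simps by (intro conjI allI impI) (blast, blast, metis)
next
  fix F :: "shape \<Rightarrow> shape \<Rightarrow> K mfps"
  assume F: "(\<forall>p q. is_partition p \<and> is_partition q \<and> q \<le> p \<longrightarrow> F p q \<in> Lam_hat \<and>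
        Groth_dskew p q = (\<Sum>\<sigma> | rook_strip q \<sigma>. mconst (beta ^ skew_size q \<sigma>) * F p \<sigma>)) \<and>
     (\<forall>p q. \<not> (is_partition p \<and> is_partition q \<and> q \<le> p) \<longrightarrow> F p q = 0)"
  have "F p q = skew_sol p q" for p q
  proof (induction p q rule: skew_sol.induct)
    case (1 p q)
    show ?case
    proof (cases "is_partition p \<and> is_partition q \<and> q \<le> p")
      case True
      then have "Groth_dskew p q = F p q + (\<Sum>r\<in>{r. rook_strip q r \<and> r \<noteq> q}. mconst (beta ^ skew_size q r) * F p r)"
        using F sum_rook_strips [of q "F p"] by simp
      moreover have "(\<Sum>r\<in>{r. rook_strip q r \<and> r \<noteq> q}. mconst (beta ^ skew_size q r) * F p r)
          = (\<Sum>r\<in>{r. rook_strip q r \<and> r \<noteq> q}. mconst (beta ^ skew_size q r) * skew_sol p r)"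
        by (rule sum.cong) (use 1 True in auto)
      moreover have "skew_sol p q = Groth_dskew p q -
          (\<Sum>r\<in>{r. rook_strip q r \<and> r \<noteq> q}. mconst (beta ^ skew_size q r) * skew_sol p r)"
        using True by (subst skew_sol.simps) (simp only: simp_thms if_True)
      ultimately show ?thesis by simp
    next
      case False
      then have "F p q = 0" using F by blast
      then show ?thesis using False by (subst skew_sol.simps) (simp only: if_False)
    qed
  qed
  then show "F = skew_sol" by (intro ext)
qed

lemma Groth_skew_Lam_hat: "Groth_skew p q \<in> Lam_hat"
  by (simp add: Groth_skew_eq skew_sol_Lam_hat)

lemma Groth_dskew_rook:
  assumes "is_partition p" "is_partition q" "q \<le> p"
  shows "Groth_dskew p q = (\<Sum>r | rook_strip q r. mconst (beta ^ skew_size q r) * Groth_skew p r)"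
  unfolding sum_rook_strips [OF assms(2)] Groth_skew_eq using assms by (simp add: skew_sol.simps [of p q])

subsection \<open>The supersymmetric expansion\<close>

lemma conj_part_iff:
  assumes p: "is_partition p"
  shows "i < conj_part p j \<longleftrightarrow> j < p i"
proof -
  have fin: "finite {i. j < p i}"
    by (rule finite_subset [OF _ partition_finite [OF p]]) auto
  have down: "j < p i'" if "j < p i" "i' \<le> i" for i i'
    using that partition_antimono [OF p, of i' i] by simp
  have "{i. j < p i} = {..<conj_part p j}"
  proof (cases "{i. j < p i} = {}")
    case False
    have "{i. j < p i} = {..Max {i. j < p i}}"
    proof (intro equalityI subsetI)
      fix i assume "i \<in> {i. j < p i}"
      then show "i \<in> {..Max {i. j < p i}}" using Max_ge [OF fin] by blast
    next
      fix i assume "i \<in> {..Max {i. j < p i}}"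
      then show "i \<in> {i. j < p i}" using Max_in [OF fin False] down by blast
    qed
    then show ?thesis unfolding conj_part_def by (metis card_atMost lessThan_Suc_atMost)
  qed (simp add: conj_part_def)
  then show ?thesis by blast
qed

lemma partition_conj_part:
  assumes p: "is_partition p"
  shows "is_partition (conj_part p)"
proof (rule is_partitionI [where p = "conj_part p" and n = "p 0"])
  fix i show "conj_part p (Suc i) \<le> conj_part p i"
  proof (rule leI, rule notI)
    assume "conj_part p i < conj_part p (Suc i)"
    then have "i < p (conj_part p i)" using conj_part_iff [OF p] by auto
    then have "conj_part p i < conj_part p i" using conj_part_iff [OF p] by auto
    then show False by simp
  qed
next
  show "conj_part p (p 0) = 0"
    using conj_part_iff [OF p, of 0 "p 0"] by simp
qed

lemma skew_diagram_conj:
  "is_partition p \<Longrightarrow> is_partition q \<Longrightarrow>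
    (j, i) \<in> skew_diagram (conj_part p) (conj_part q) \<longleftrightarrow> q i \<le> j \<and> j < p i"
  using conj_part_iff [of q i j] conj_part_iff [of p i j] by (auto simp: skew_diagram_def not_less [symmetric])

lemma seq_size_upd:
  assumes "is_partition p" "is_partition (p(i := Suc (p i)))"
  shows "seq_size (p(i := Suc (p i))) = Suc (seq_size p)"
proof -
  let ?n = "max (Suc i) (part_length (p(i := Suc (p i))))"
  have le: "p \<le> p(i := Suc (p i))" by (simp add: le_fun_def)
  have len: "part_length p \<le> ?n" using partition_le_length [OF assms(2,1) le] by simp
  have "(\<Sum>k<?n. (p(i := Suc (p i))) k) = Suc (\<Sum>k<?n. p k)"
    by (simp add: sum.remove [of "{..<?n}" i])
  then show ?thesis
    using assms len by (simp add: seq_size_lessThan [of "p(i := Suc (p i))" ?n] seq_size_lessThan [of p ?n])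
qed

text \<open>
  \<open>superfill N r v\<close> consists of the fillings of the diagram of \<open>v\<close>, semistandard on a subdiagram
  \<open>k\<close> and transposed semistandard, for the reversed alphabet \<open>{N..<r}\<close>, on the complement.
\<close>

definition superfill :: "nat \<Rightarrow> nat \<Rightarrow> shape \<Rightarrow> (shape \<times> (nat \<times> nat \<Rightarrow> nat)) set" where
  "superfill N r v = {(k, f). is_partition k \<and> k \<le> v \<and> f \<in> diag v \<rightarrow>\<^sub>E {..<r} \<and>
     (\<forall>i j j'. j < j' \<and> j' < k i \<longrightarrow> f (i, j) \<le> f (i, j')) \<and>
     (\<forall>i i' j. i < i' \<and> j < k i' \<longrightarrow> f (i, j) < f (i', j)) \<and>
     (\<forall>i j. k i \<le> j \<and> j < v i \<longrightarrow> N \<le> f (i, j)) \<and>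
     (\<forall>i j j'. k i \<le> j \<and> j < j' \<and> j' < v i \<longrightarrow> f (i, j') < f (i, j)) \<and>
     (\<forall>i i' j. k i \<le> j \<and> i < i' \<and> j < v i' \<longrightarrow> f (i', j) \<le> f (i, j))}"

lemma superfillD:
  assumes "(k, f) \<in> superfill N r v"
  shows "is_partition k" "k \<le> v" "f \<in> diag v \<rightarrow>\<^sub>E {..<r}"
    "\<And>i j j'. j < j' \<Longrightarrow> j' < k i \<Longrightarrow> f (i, j) \<le> f (i, j')"
    "\<And>i i' j. i < i' \<Longrightarrow> j < k i' \<Longrightarrow> f (i, j) < f (i', j)"
    "\<And>i j. k i \<le> j \<Longrightarrow> j < v i \<Longrightarrow> N \<le> f (i, j)"
    "\<And>i j j'. k i \<le> j \<Longrightarrow> j < j' \<Longrightarrow> j' < v i \<Longrightarrow> f (i, j') < f (i, j)"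
    "\<And>i i' j. k i \<le> j \<Longrightarrow> i < i' \<Longrightarrow> j < v i' \<Longrightarrow> f (i', j) \<le> f (i, j)"
  using assms unfolding superfill_def by auto

definition pivot_row :: "shape \<Rightarrow> (nat \<times> nat \<Rightarrow> nat) \<Rightarrow> nat" where
  "pivot_row v f = (LEAST i. \<exists>j. (i, j) \<in> diag v \<and> f (i, j) = Max (f ` diag v))"

definition pivot_col :: "shape \<Rightarrow> (nat \<times> nat \<Rightarrow> nat) \<Rightarrow> nat" where
  "pivot_col v f = Max {j. (pivot_row v f, j) \<in> diag v \<and> f (pivot_row v f, j) = Max (f ` diag v)}"

text \<open>Among the boxes with maximal entry, the topmost rightmost one can change sides.\<close>

definition flip_pivot :: "shape \<Rightarrow> shape \<times> (nat \<times> nat \<Rightarrow> nat) \<Rightarrow> shape \<times> (nat \<times> nat \<Rightarrow> nat)" where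
  "flip_pivot v = (\<lambda>(k, f). (k(pivot_row v f :=
     if pivot_col v f < k (pivot_row v f) then pivot_col v f else Suc (pivot_col v f)), f))"

lemma pivot:
  assumes v: "is_partition v" and ne: "diag v \<noteq> {}"
  shows "(pivot_row v f, pivot_col v f) \<in> diag v"
    and "f (pivot_row v f, pivot_col v f) = Max (f ` diag v)"
    and "\<And>b. b \<in> diag v \<Longrightarrow> f b \<le> Max (f ` diag v)"
    and "\<And>j. pivot_col v f < j \<Longrightarrow> (pivot_row v f, j) \<in> diag v \<Longrightarrow> f (pivot_row v f, j) < Max (f ` diag v)"
    and "\<And>i j. i < pivot_row v f \<Longrightarrow> (i, j) \<in> diag v \<Longrightarrow> f (i, j) < Max (f ` diag v)"
proof -
  let ?m = "Max (f ` diag v)" and ?i = "pivot_row v f" and ?j = "pivot_col v f"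
  let ?J = "{j. (?i, j) \<in> diag v \<and> f (?i, j) = ?m}"
  have fin: "finite (diag v)" by (rule finite_diag [OF v])
  show le: "f b \<le> ?m" if "b \<in> diag v" for b using that fin by simp
  have "?m \<in> f ` diag v" using fin ne by (intro Max_in) auto
  then obtain b where "b \<in> diag v" "f b = ?m" by auto
  then have "\<exists>i j. (i, j) \<in> diag v \<and> f (i, j) = ?m" by (cases b) blast
  then have ex: "\<exists>j. (?i, j) \<in> diag v \<and> f (?i, j) = ?m"
    unfolding pivot_row_def by (rule LeastI_ex)
  have finJ: "finite ?J"
    by (rule finite_subset [of _ "{..<v ?i}"]) (auto simp: mem_diag)
  have "?j \<in> ?J" unfolding pivot_col_def using finJ ex by (intro Max_in) auto
  then show "(?i, ?j) \<in> diag v" "f (?i, ?j) = ?m" by auto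
  show "f (?i, j) < ?m" if "?j < j" "(?i, j) \<in> diag v" for j
  proof -
    have "j \<notin> ?J" using that(1) Max_ge [OF finJ, of j] unfolding pivot_col_def [symmetric] by auto
    then show ?thesis using that(2) le [OF that(2)] by auto
  qed
  show "f (i, j) < ?m" if "i < ?i" "(i, j) \<in> diag v" for i j
  proof -
    have "\<not> (\<exists>j. (i, j) \<in> diag v \<and> f (i, j) = ?m)"
      using that(1) not_less_Least unfolding pivot_row_def by blast
    then show ?thesis using that(2) le [OF that(2)] by fastforce
  qed
qed

text \<open>The pivot sits on the border between the two parts. If it lies in \<open>k\<close>, a
  box of \<open>k\<close> to its right would again be maximal and one below it larger; if it lies
  outside, a box of the complement to its left would be larger and one above it again maximal. Each
  contradicts maximality or the choice of the topmost row and rightmost column.\<close>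

lemma flip_pivot_cases:
  assumes v: "is_partition v" and Z: "(k, f) \<in> superfill N r v"
    and nt: "\<not> (k = v \<and> (\<forall>b\<in>diag v. f b < N))"
  defines "i \<equiv> pivot_row v f" and "j \<equiv> pivot_col v f"
  shows "diag v \<noteq> {}" "N \<le> Max (f ` diag v)"
    and "j < k i \<Longrightarrow> k i = Suc j \<and> (k(i := j), f) \<in> superfill N r v"
    and "\<not> j < k i \<Longrightarrow> k i = j \<and> (k(i := Suc j), f) \<in> superfill N r v"
proof -
  note D = superfillD [OF Z]
  let ?m = "Max (f ` diag v)"
  have ex: "\<exists>b\<in>diag v. N \<le> f b"
  proof (cases "k = v")
    case True
    then show ?thesis using nt by (auto simp: not_less)
  next
    case False
    then obtain a where "k a \<noteq> v a" by auto
    then have "k a < v a" using le_funD [OF D(2), of a] by simp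
    then show ?thesis using D(6) [of a "k a"] by (intro bexI [of _ "(a, k a)"]) (auto simp: mem_diag)
  qed
  then show ne: "diag v \<noteq> {}" by auto
  note pv = pivot [where f = f, OF v ne, folded i_def j_def]
  show Nm: "N \<le> ?m" using ex pv(3) le_trans by blast
  have jv: "j < v i" using pv(1) by (simp add: mem_diag)
  have kv: "k a \<le> v a" for a using D(2) by (simp add: le_fun_def)
  have kd: "k b \<le> k a" if "a \<le> b" for a b using partition_antimono [OF D(1) that] .
  have vd: "v b \<le> v a" if "a \<le> b" for a b using partition_antimono [OF v that] .
  have le: "f (a, b) \<le> ?m" if "b < v a" for a b using pv(3) that by (simp add: mem_diag)
  have right: "f (i, b) < ?m" if "j < b" "b < v i" for b using pv(4) that by (simp add: mem_diag)
  have above: "f (a, b) < ?m" if "a < i" "b < v a" for a b using pv(5) that by (simp add: mem_diag)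
  show "k i = Suc j \<and> (k(i := j), f) \<in> superfill N r v" if jk: "j < k i"
  proof
    show kij: "k i = Suc j"
    proof (rule ccontr)
      assume "k i \<noteq> Suc j"
      then have "Suc j < k i" using jk by simp
      then have "?m \<le> f (i, Suc j)" "Suc j < v i" using D(4) [of j "Suc j" i] pv(2) kv [of i] by auto
      then show False using right [of "Suc j"] by simp
    qed
    have next_le: "k (Suc i) \<le> j"
    proof (rule leI, rule notI)
      assume a: "j < k (Suc i)"
      then have "f (i, j) < f (Suc i, j)" using D(5) [of i "Suc i" j] by simp
      moreover have "f (Suc i, j) \<le> ?m" using a kv [of "Suc i"] by (intro le) simp
      ultimately show False using pv(2) by simp
    qed
    have part: "is_partition (k(i := j))"
    proof (rule is_partitionI [where p = "k(i := j)" and n = "max (Suc i) (part_length k)"])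
      fix a show "(k(i := j)) (Suc a) \<le> (k(i := j)) a"
        using kd [of a "Suc a"] next_le jk by auto
    next
      show "(k(i := j)) (max (Suc i) (part_length k)) = 0"
        using partition_beyond [OF D(1), of "part_length k" "max (Suc i) (part_length k)"] by auto
    qed
    have below: "(k(i := j)) a \<le> k a" for a using jk by simp
    show "(k(i := j), f) \<in> superfill N r v"
      unfolding superfill_def
    proof (intro CollectI case_prodI conjI allI impI; (elim conjE)?)
      show "is_partition (k(i := j))" by (rule part)
      show "k(i := j) \<le> v" using below kv le_trans unfolding le_fun_def by blast
      show "f \<in> diag v \<rightarrow>\<^sub>E {..<r}" by (rule D(3))
    next
      fix a b b' assume "b < b'" "b' < (k(i := j)) a"
      then show "f (a, b) \<le> f (a, b')" using D(4) below less_le_trans by blast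
    next
      fix a a' b assume "a < a'" "b < (k(i := j)) a'"
      then show "f (a, b) < f (a', b)" using D(5) below less_le_trans by blast
    next
      fix a b assume a: "(k(i := j)) a \<le> b" "b < v a"
      show "N \<le> f (a, b)"
      proof (cases "a = i \<and> b = j")
        case True
        then show ?thesis using pv(2) Nm by simp
      next
        case False
        then have "k a \<le> b" using a kij by (auto split: if_splits)
        then show ?thesis using D(6) a by blast
      qed
    next
      fix a b b' assume a: "(k(i := j)) a \<le> b" "b < b'" "b' < v a"
      show "f (a, b') < f (a, b)"
      proof (cases "a = i \<and> b = j")
        case True
        then show ?thesis using pv(2) right a by simp
      next
        case False
        then have "k a \<le> b" using a kij by (auto split: if_splits)
        then show ?thesis using D(7) a by blast
      qed
    next
      fix a a' b assume a: "(k(i := j)) a \<le> b" "a < a'" "b < v a'"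
      show "f (a', b) \<le> f (a, b)"
      proof (cases "a = i \<and> b = j")
        case True
        then show ?thesis using pv(2) le a by simp
      next
        case False
        then have "k a \<le> b" using a kij by (auto split: if_splits)
        then show ?thesis using D(8) a by blast
      qed
    qed
  qed
  show "k i = j \<and> (k(i := Suc j), f) \<in> superfill N r v" if njk: "\<not> j < k i"
  proof
    show kij: "k i = j"
    proof (rule ccontr)
      assume "k i \<noteq> j"
      then have "k i < j" using njk by simp
      then have "f (i, j) < f (i, k i)" using D(7) [of i "k i" j] jv by simp
      moreover have "f (i, k i) \<le> ?m" using \<open>k i < j\<close> jv by (intro le) simp
      ultimately show False using pv(2) by simp
    qed
    have prev: "Suc j \<le> k a" if "Suc a = i" for a
    proof (rule ccontr)
      assume "\<not> Suc j \<le> k a"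
      then have ka: "k a \<le> j" by simp
      then have "f (i, j) \<le> f (a, j)" using D(8) [of a j i] that jv by simp
      moreover have "f (a, j) < ?m" using that jv vd [of a i] by (intro above) auto
      ultimately show False using pv(2) by simp
    qed
    have part: "is_partition (k(i := Suc j))"
    proof (rule is_partitionI [where p = "k(i := Suc j)" and n = "max (Suc i) (part_length k)"])
      fix a show "(k(i := Suc j)) (Suc a) \<le> (k(i := Suc j)) a"
        using kd [of a "Suc a"] prev [of a] kij by auto
    next
      show "(k(i := Suc j)) (max (Suc i) (part_length k)) = 0"
        using partition_beyond [OF D(1), of "part_length k" "max (Suc i) (part_length k)"] by auto
    qed
    have below: "k a \<le> (k(i := Suc j)) a" for a using kij by simp
    have inside: "b < k a \<or> a = i \<and> b = j" if "b < (k(i := Suc j)) a" for a b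
      using that kij by (auto split: if_splits simp: less_Suc_eq)
    show "(k(i := Suc j), f) \<in> superfill N r v"
      unfolding superfill_def
    proof (intro CollectI case_prodI conjI allI impI; (elim conjE)?)
      show "is_partition (k(i := Suc j))" by (rule part)
      show "k(i := Suc j) \<le> v" using kv jv by (simp add: le_fun_def)
      show "f \<in> diag v \<rightarrow>\<^sub>E {..<r}" by (rule D(3))
    next
      fix a b b' assume a: "b < b'" "b' < (k(i := Suc j)) a"
      show "f (a, b) \<le> f (a, b')"
        using inside [OF a(2)] D(4) [OF a(1)] le [of b i] pv(2) a(1) jv by auto
    next
      fix a a' b assume a: "a < a'" "b < (k(i := Suc j)) a'"
      show "f (a, b) < f (a', b)"
        using inside [OF a(2)] D(5) [OF a(1)] above [of a j] pv(2) a(1) jv vd [of a i] by auto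
    next
      fix a b assume a: "(k(i := Suc j)) a \<le> b" "b < v a"
      then show "N \<le> f (a, b)" using D(6) below le_trans by blast
    next
      fix a b b' assume a: "(k(i := Suc j)) a \<le> b" "b < b'" "b' < v a"
      then show "f (a, b') < f (a, b)" using D(7) below le_trans by blast
    next
      fix a a' b assume a: "(k(i := Suc j)) a \<le> b" "a < a'" "b < v a'"
      then show "f (a', b) \<le> f (a, b)" using D(8) below le_trans by blast
    qed
  qed
qed

definition super_weight :: "shape \<Rightarrow> shape \<times> (nat \<times> nat \<Rightarrow> nat) \<Rightarrow> K mfps" where
  "super_weight v = (\<lambda>(k, f). mconst ((-1) ^ skew_size v k) * xpow (content (diag v) f))"

lemma finite_superfill: "is_partition v \<Longrightarrow> finite (superfill N r v)"
proof -
  assume v: "is_partition v"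
  have "superfill N r v \<subseteq> {k. is_partition k \<and> k \<le> v} \<times> (diag v \<rightarrow>\<^sub>E {..<r})"
    by (auto dest: superfillD)
  moreover have "finite ({k. is_partition k \<and> k \<le> v} \<times> (diag v \<rightarrow>\<^sub>E {..<r}))"
    using v by (intro finite_cartesian_product finite_partitions_le finite_PiE finite_diag) auto
  ultimately show ?thesis by (rule finite_subset)
qed

text \<open>The pivot depends only on the filling, which the flip leaves unchanged, so flipping
  twice restores \<open>k\<close>; the size of \<open>k\<close> changes by one, which reverses the
  sign.\<close>

lemma flip_pivot:
  assumes v: "is_partition v" and x: "x \<in> superfill N r v"
    and nt: "\<not> (fst x = v \<and> (\<forall>b\<in>diag v. snd x b < N))"
  shows "flip_pivot v x \<in> superfill N r v"
    and "\<not> (fst (flip_pivot v x) = v \<and> (\<forall>b\<in>diag v. snd (flip_pivot v x) b < N))"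
    and "flip_pivot v (flip_pivot v x) = x"
    and "super_weight v (flip_pivot v x) = - super_weight v x"
proof -
  obtain k f where xe: "x = (k, f)" by (cases x)
  let ?i = "pivot_row v f" and ?j = "pivot_col v f"
  have Z: "(k, f) \<in> superfill N r v" and nt': "\<not> (k = v \<and> (\<forall>b\<in>diag v. f b < N))"
    using x nt xe by auto
  note C = flip_pivot_cases [OF v Z nt']
  have "N \<le> f (?i, ?j)" "(?i, ?j) \<in> diag v" using C(2) pivot(1,2) [OF v C(1), of f] by auto
  then have big: "\<not> (\<forall>b\<in>diag v. f b < N)" by (meson not_less)
  have sn: "snd (flip_pivot v x) = f" by (simp add: xe flip_pivot_def)
  show "\<not> (fst (flip_pivot v x) = v \<and> (\<forall>b\<in>diag v. snd (flip_pivot v x) b < N))"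
    using big by (simp add: sn)
  have kp: "is_partition k" "k \<le> v" using superfillD(1,2) [OF Z] .
  have "flip_pivot v x \<in> superfill N r v \<and> flip_pivot v (flip_pivot v x) = x \<and>
    super_weight v (flip_pivot v x) = - super_weight v x"
  proof (cases "?j < k ?i")
    case True
    let ?k = "k(?i := ?j)"
    have fl: "flip_pivot v (k, f) = (?k, f)" using True by (simp add: flip_pivot_def)
    have c: "k ?i = Suc ?j" "(?k, f) \<in> superfill N r v" using C(3) True by auto
    have kp': "is_partition ?k" "?k \<le> v" using superfillD(1,2) [OF c(2)] .
    have kk: "k = ?k(?i := Suc (?k ?i))" using c(1) by (auto simp: fun_eq_iff)
    have "seq_size (?k(?i := Suc (?k ?i))) = Suc (seq_size ?k)"
      by (rule seq_size_upd [OF kp'(1)]) (use kk kp in simp)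
    then have size: "seq_size k = Suc (seq_size ?k)" using kk by simp
    have "seq_size k \<le> seq_size v" by (rule seq_size_mono [OF v kp])
    then have "skew_size v ?k = Suc (skew_size v k)"
      using size by (simp add: skew_size_eq v kp kp')
    moreover have "flip_pivot v (?k, f) = (k, f)"
      using c(1) by (auto simp: flip_pivot_def fun_eq_iff)
    ultimately show ?thesis using c(2) by (simp add: fl xe super_weight_def mconst_uminus)
  next
    case False
    let ?k = "k(?i := Suc ?j)"
    have fl: "flip_pivot v (k, f) = (?k, f)" using False by (simp add: flip_pivot_def)
    have c: "k ?i = ?j" "(?k, f) \<in> superfill N r v" using C(4) False by auto
    have kp': "is_partition ?k" "?k \<le> v" using superfillD(1,2) [OF c(2)] .
    have kk: "?k = k(?i := Suc (k ?i))" using c(1) by simp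
    have size: "seq_size ?k = Suc (seq_size k)"
      unfolding kk by (rule seq_size_upd [OF kp(1)]) (use kk kp' in simp)
    have "seq_size ?k \<le> seq_size v" by (rule seq_size_mono [OF v kp'])
    then have "skew_size v k = Suc (skew_size v ?k)"
      using size by (simp add: skew_size_eq v kp kp')
    moreover have "flip_pivot v (?k, f) = (k, f)"
      using c(1) by (auto simp: flip_pivot_def fun_eq_iff)
    ultimately show ?thesis using c(2) by (simp add: fl xe super_weight_def mconst_uminus)
  qed
  then show "flip_pivot v x \<in> superfill N r v" "flip_pivot v (flip_pivot v x) = x"
    "super_weight v (flip_pivot v x) = - super_weight v x" by auto
qed

text \<open>A nonempty complement always contains a letter N or more, and any filling with such a
  letter can be toggled at its maximal entry. What survives are the semistandard fillings of the
  whole diagram with letters below N.\<close>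

lemma sum_superfill:
  assumes v: "is_partition v" and Nr: "N \<le> r"
  shows "(\<Sum>x\<in>superfill N r v. super_weight v x) = tab_poly N (diag v)"
proof -
  let ?Z = "superfill N r v"
  let ?F = "{x \<in> ?Z. fst x = v \<and> (\<forall>b\<in>diag v. snd x b < N)}"
  let ?R = "{x \<in> ?Z. \<not> (fst x = v \<and> (\<forall>b\<in>diag v. snd x b < N))}"
  have fin: "finite ?Z" by (rule finite_superfill [OF v])
  have RR: "flip_pivot v x \<in> ?R" "flip_pivot v (flip_pivot v x) = x" "super_weight v (flip_pivot v x) = - super_weight v x"
    if "x \<in> ?R" for x
  proof -
    have x: "x \<in> ?Z" "\<not> (fst x = v \<and> (\<forall>b\<in>diag v. snd x b < N))" using that by blast+
    show "flip_pivot v x \<in> ?R" using flip_pivot(1,2) [OF v x] by blast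
    show "flip_pivot v (flip_pivot v x) = x" "super_weight v (flip_pivot v x) = - super_weight v x"
      by (rule flip_pivot(3,4) [OF v x])+
  qed
  have "bij_betw (flip_pivot v) ?R ?R"
  proof (rule bij_betw_byWitness [where f' = "flip_pivot v"])
    show img: "flip_pivot v ` ?R \<subseteq> ?R" using RR(1) by (rule image_subsetI)
    show "flip_pivot v ` ?R \<subseteq> ?R" by (rule img)
  qed (use RR(2) in blast)+
  then have "(\<Sum>x\<in>?R. super_weight v x) = (\<Sum>x\<in>?R. super_weight v (flip_pivot v x))"
    by (rule sum.reindex_bij_betw [symmetric])
  also have "\<dots> = (\<Sum>x\<in>?R. - super_weight v x)"
    by (rule sum.cong [OF refl]) (rule RR(3))
  also have "\<dots> = - (\<Sum>x\<in>?R. super_weight v x)" by (rule sum_negf)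
  finally have R: "(\<Sum>x\<in>?R. super_weight v x) = 0" by (rule mfps_eq_neg_self)
  have "?Z = ?F \<union> ?R" by auto
  then have "(\<Sum>x\<in>?Z. super_weight v x) = (\<Sum>x\<in>?F \<union> ?R. super_weight v x)" by simp
  also have "\<dots> = (\<Sum>x\<in>?F. super_weight v x) + (\<Sum>x\<in>?R. super_weight v x)"
    by (rule sum.union_disjoint) (use fin in auto)
  also have "\<dots> = (\<Sum>x\<in>?F. super_weight v x)" using R by simp
  also have "?F = Pair v ` tab {..<N} (diag v)"
  proof (intro equalityI subsetI)
    fix x assume "x \<in> ?F"
    then obtain f where x: "x = (v, f)" "(v, f) \<in> ?Z" "\<forall>b\<in>diag v. f b < N" by (cases x) auto
    note D = superfillD [OF x(2)]
    have "f \<in> tab {..<N} (diag v)"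
    proof (rule tabI)
      show "f \<in> diag v \<rightarrow>\<^sub>E {..<N}" using D(3) x(3) by (auto simp: PiE_def)
    qed (use D(4,5) in \<open>auto simp: mem_diag\<close>)
    then show "x \<in> Pair v ` tab {..<N} (diag v)" using x by simp
  next
    fix x assume "x \<in> Pair v ` tab {..<N} (diag v)"
    then obtain f where x: "x = (v, f)" and f: "f \<in> tab {..<N} (diag v)" by auto
    have lt: "f b < N" if "b \<in> diag v" for b using tab_in [OF f that] by simp
    have "f \<in> diag v \<rightarrow>\<^sub>E {..<r}"
    proof (rule PiE_I)
      fix b assume "b \<in> diag v" then show "f b \<in> {..<r}" using lt Nr by fastforce
    qed (rule tab_undefined [OF f])
    moreover have "f (i, j) \<le> f (i, j')" if "j < j'" "j' < v i" for i j j'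
      using that by (intro tab_row [OF f]) (auto simp: mem_diag)
    moreover have "f (i, j) < f (i', j)" if "i < i'" "j < v i'" for i i' j
      using that partition_antimono [OF v, of i i'] by (intro tab_col [OF f]) (auto simp: mem_diag)
    moreover have "\<not> (v i \<le> j \<and> i < i' \<and> j < v i')" for i i' j
      using partition_antimono [OF v, of i i'] by auto
    ultimately have "(v, f) \<in> ?Z" using v unfolding superfill_def by auto
    then show "x \<in> ?F" using x lt by simp
  qed
  also have "(\<Sum>x\<in>Pair v ` tab {..<N} (diag v). super_weight v x) = (\<Sum>T\<in>tab {..<N} (diag v). xpow (content (diag v) T))"
  proof -
    have "skew_size v v = 0" using skew_size_eq [OF v v] by simp
    then show ?thesis by (subst sum.reindex) (auto simp: inj_on_def super_weight_def)
  qed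
  finally show ?thesis by (simp add: tab_poly_def)
qed

section \<open>Tableaux for the reversed alphabet\<close>

definition tab_rev :: "nat \<Rightarrow> (nat \<times> nat) set \<Rightarrow> (nat \<times> nat \<Rightarrow> nat) set" where
  "tab_rev s D = {T \<in> D \<rightarrow>\<^sub>E {..<s}.
     (\<forall>i j j'. (i, j) \<in> D \<and> (i, j') \<in> D \<and> j < j' \<longrightarrow> T (i, j') \<le> T (i, j)) \<and>
     (\<forall>i i' j. (i, j) \<in> D \<and> (i', j) \<in> D \<and> i < i' \<longrightarrow> T (i', j) < T (i, j))}"

lemma ssyt_greater_eq_tab_rev: "ssyt (>) {..<s} p q = tab_rev s (skew_diagram p q)"
  unfolding ssyt_def tab_rev_def le_less by (intro Collect_cong conj_cong refl) metis+

lemma shiftm_sum: "shiftm N (sum f A) = (\<Sum>a\<in>A. shiftm N (f a))"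
proof (induction A rule: infinite_finite_induct)
  case empty
  show ?case by (rule poly_mapping_eqI) (simp add: lookup_shiftm)
next
  case (infinite A)
  then show ?case by (intro poly_mapping_eqI) (simp add: lookup_shiftm)
qed (simp add: shiftm_add)

lemma shiftm_single: "shiftm N (sg i k) = sg (N + i) k"
  by (rule poly_mapping_eqI) (auto simp: lookup_shiftm lookup_single when_def)

text \<open>For fixed \<open>k\<close> a filling is a pair of independent tableaux. Transposing the
  complement turns its strict rows into strict columns, and subtracting N brings its letters into
  the alphabet of the y.\<close>

lemma sum_superfill_fibre:
  assumes v: "is_partition v" and k: "is_partition k" "k \<le> v" and r: "r = N + s"
  defines "D \<equiv> skew_diagram (conj_part v) (conj_part k)"
  shows "(\<Sum>f\<in>{f. (k, f) \<in> superfill N r v}. xpow (content (diag v) f))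
    = tab_poly r (diag k) * (\<Sum>T\<in>tab_rev s D. xpow (shiftm N (content D T)) :: K mfps)"
proof -
  let ?F = "{f. (k, f) \<in> superfill N r v}"
  let ?P = "tab {..<r} (diag k) \<times> tab_rev s D"
  let ?i = "\<lambda>(S, T) (i, j). if j < k i then S (i, j) else if j < v i then N + T (j, i) else undefined"
  let ?j = "\<lambda>f. (restrict f (diag k), restrict (\<lambda>(j, i). f (i, j) - N) D)"
  have D: "(j, i) \<in> D \<longleftrightarrow> k i \<le> j \<and> j < v i" for i j
    unfolding D_def by (rule skew_diagram_conj [OF v k(1)])
  have kv: "k i \<le> v i" for i using k(2) by (simp add: le_fun_def)
  have finD: "finite D"
    unfolding D_def by (intro finite_skew_diagram partition_conj_part v)
  have fw: "?j f \<in> ?P" "?i (?j f) = f" if "f \<in> ?F" for f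
  proof -
    have Z: "(k, f) \<in> superfill N r v" using that by simp
    note Z = superfillD [OF this]
    have lt: "f (i, j) < r" if "j < v i" for i j using Z(3) that by (auto simp: mem_diag)
    have "restrict f (diag k) \<in> tab {..<r} (diag k)"
    proof (rule tabI)
      show "restrict f (diag k) \<in> diag k \<rightarrow>\<^sub>E {..<r}"
      proof (rule PiE_I)
        fix b assume b: "b \<in> diag k"
        obtain i j where bij: "b = (i, j)" by (cases b)
        then have "j < v i" using b kv [of i] by (simp add: mem_diag)
        then show "restrict f (diag k) b \<in> {..<r}" using lt b bij by simp
      qed simp
    qed (use Z(4,5) in \<open>auto simp: mem_diag\<close>)
    moreover have "restrict (\<lambda>(j, i). f (i, j) - N) D \<in> tab_rev s D"
      unfolding tab_rev_def
    proof (intro CollectI conjI allI impI; (elim conjE)?)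
      show "restrict (\<lambda>(j, i). f (i, j) - N) D \<in> D \<rightarrow>\<^sub>E {..<s}"
      proof (rule PiE_I)
        fix b assume b: "b \<in> D"
        obtain j i where bij: "b = (j, i)" by (cases b)
        then have "k i \<le> j" "j < v i" using b D by auto
        then show "restrict (\<lambda>(j, i). f (i, j) - N) D b \<in> {..<s}"
          using lt [of j i] Z(6) [of i j] b bij r by simp
      qed simp
    next
      fix j i i' assume a: "(j, i) \<in> D" "(j, i') \<in> D" "i < i'"
      then show "restrict (\<lambda>(j, i). f (i, j) - N) D (j, i') \<le> restrict (\<lambda>(j, i). f (i, j) - N) D (j, i)"
        using Z(8) [of i j i'] D by auto
    next
      fix j j' i assume a: "(j, i) \<in> D" "(j', i) \<in> D" "j < j'"
      then have "f (i, j') < f (i, j)" "N \<le> f (i, j')" using Z(7) [of i j j'] Z(6) [of i j'] D by auto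
      then show "restrict (\<lambda>(j, i). f (i, j) - N) D (j', i) < restrict (\<lambda>(j, i). f (i, j) - N) D (j, i)"
        using a by auto
    qed
    ultimately show "?j f \<in> ?P" by simp
    have "f b = undefined" if "b \<notin> diag v" for b using PiE_arb [OF Z(3) that] .
    then show "?i (?j f) = f"
      using Z(6) D by (auto simp: fun_eq_iff mem_diag not_less)
  qed
  have bw: "?i x \<in> ?F" "?j (?i x) = x" if xP: "x \<in> ?P" for x
  proof -
    obtain S T where x: "x = (S, T)" and S: "S \<in> tab {..<r} (diag k)" and T: "T \<in> tab_rev s D"
      using xP by auto
    have T0: "T \<in> D \<rightarrow>\<^sub>E {..<s}"
      and T1: "\<forall>i j j'. (i, j) \<in> D \<and> (i, j') \<in> D \<and> j < j' \<longrightarrow> T (i, j') \<le> T (i, j)"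
      and T2: "\<forall>i i' j. (i, j) \<in> D \<and> (i', j) \<in> D \<and> i < i' \<longrightarrow> T (i', j) < T (i, j)"
      using T unfolding tab_rev_def by simp_all
    have Ts: "T (j, i) < s" if "k i \<le> j" "j < v i" for i j
      using PiE_mem [OF T0, of "(j, i)"] that D by simp
    have Trow: "T (j, i') \<le> T (j, i)" if "k i \<le> j" "j < v i" "k i' \<le> j" "j < v i'" "i < i'" for i i' j
      using T1 [rule_format, of j i i'] that D by simp
    have Tcol: "T (j', i) < T (j, i)" if "k i \<le> j" "j < j'" "j' < v i" for i j j'
      using T2 [rule_format, of j i j'] that D by simp
    let ?f = "?i (S, T)"
    have f: "?f (i, j) = (if j < k i then S (i, j) else if j < v i then N + T (j, i) else undefined)" for i j
      by simp
    have "(k, ?f) \<in> superfill N r v"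
      unfolding superfill_def
    proof (intro CollectI case_prodI conjI allI impI; (elim conjE)?)
      show "is_partition k" "k \<le> v" by (fact k)+
      show "?f \<in> diag v \<rightarrow>\<^sub>E {..<r}"
      proof (rule PiE_I)
        fix b assume b: "b \<in> diag v"
        obtain i j where bij: "b = (i, j)" by (cases b)
        then have jv: "j < v i" using b by (simp add: mem_diag)
        show "?f b \<in> {..<r}"
        proof (cases "j < k i")
          case True
          then show ?thesis using tab_in [OF S, of "(i, j)"] by (simp add: bij mem_diag)
        next
          case False
          then show ?thesis using Ts [of i j] jv by (simp add: bij r)
        qed
      next
        fix b assume "b \<notin> diag v"
        then show "?f b = undefined" using kv [of "fst b"] by (cases b) (auto simp: mem_diag)
      qed
    next
      fix i j j' assume "j < j'" "j' < k i"
      then show "?f (i, j) \<le> ?f (i, j')" using tab_row [OF S, of i j j'] by (simp add: mem_diag)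
    next
      fix i i' j assume a: "i < i'" "j < k i'"
      then show "?f (i, j) < ?f (i', j)"
        using tab_col [OF S, of i j i'] partition_antimono [OF k(1), of i i'] by (simp add: mem_diag)
    next
      fix i j assume "k i \<le> j" "j < v i"
      then show "N \<le> ?f (i, j)" by simp
    next
      fix i j j' assume "k i \<le> j" "j < j'" "j' < v i"
      then show "?f (i, j') < ?f (i, j)" using Tcol by simp
    next
      fix i i' j assume a: "k i \<le> j" "i < i'" "j < v i'"
      then show "?f (i', j) \<le> ?f (i, j)"
        using Trow [of i j i'] partition_antimono [OF k(1), of i i'] partition_antimono [OF v, of i i'] by simp
    qed
    then show "?i x \<in> ?F" using x by simp
    have "restrict ?f (diag k) = S"
      using tab_undefined [OF S] by (auto simp: fun_eq_iff mem_diag)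
    moreover have "restrict (\<lambda>(j, i). ?f (i, j) - N) D = T"
    proof
      fix b :: "nat \<times> nat"
      obtain j i where b: "b = (j, i)" by (cases b)
      show "restrict (\<lambda>(j, i). ?f (i, j) - N) D b = T b"
      proof (cases "(j, i) \<in> D")
        case True
        then show ?thesis using D by (auto simp: b)
      next
        case False
        then show ?thesis using PiE_arb [OF T0 False] by (simp add: b)
      qed
    qed
    ultimately show "?j (?i x) = x" using x by simp
  qed
  have "tab_poly r (diag k) * (\<Sum>T\<in>tab_rev s D. xpow (shiftm N (content D T)))
      = (\<Sum>(S, T)\<in>?P. xpow (content (diag k) S) * xpow (shiftm N (content D T)) :: K mfps)"
    unfolding tab_poly_def sum_product by (rule sum.cartesian_product)
  also have "\<dots> = (\<Sum>f\<in>?F. xpow (content (diag v) f))"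
  proof (rule sum.reindex_bij_witness [where i = ?j and j = ?i])
    fix x assume x: "x \<in> ?P"
    show "?j (?i x) = x" "?i x \<in> ?F" using bw [OF x] by simp_all
    obtain S T where xe: "x = (S, T)" by (cases x)
    have "content (diag v) (?i x) = (\<Sum>b\<in>diag k. sg (?i x b) 1) + (\<Sum>b\<in>diag v - diag k. sg (?i x b) 1)"
    proof -
      have sub: "diag k \<subseteq> diag v" using kv by (auto simp: skew_diagram_def intro: less_le_trans)
      show ?thesis
        unfolding content_def by (subst add.commute) (rule sum.subset_diff [OF sub finite_diag [OF v]])
    qed
    also have "(\<Sum>b\<in>diag k. sg (?i x b) 1) = content (diag k) S"
      unfolding content_def by (rule sum.cong) (auto simp: xe mem_diag)
    also have "(\<Sum>b\<in>diag v - diag k. sg (?i x b) 1) = (\<Sum>b\<in>D. sg (N + T b) 1)"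
      by (rule sum.reindex_bij_witness [where i = prod.swap and j = prod.swap])
        (auto simp: D mem_diag xe not_less)
    also have "\<dots> = shiftm N (content D T)"
      by (simp add: content_def shiftm_sum shiftm_single)
    finally show "(xpow (content (diag v) (?i x)) :: K mfps) = (case x of (S, T) \<Rightarrow> xpow (content (diag k) S) * xpow (shiftm N (content D T)))"
      by (simp add: xe xpow_add)
  next
    fix f assume "f \<in> ?F"
    then show "?i (?j f) = f" "?j f \<in> ?P" using fw by simp_all
  qed
  finally show ?thesis by simp
qed

theorem super_expansion:
  assumes v: "is_partition v" and r: "r = N + s"
  shows "tab_poly N (diag v) = (\<Sum>k | is_partition k \<and> k \<le> v. mconst ((-1) ^ skew_size v k) *
    (tab_poly r (diag k) * (\<Sum>T\<in>tab_rev s (skew_diagram (conj_part v) (conj_part k)).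
      xpow (shiftm N (content (skew_diagram (conj_part v) (conj_part k)) T)))))"
proof -
  let ?K = "{k. is_partition k \<and> k \<le> v}"
  have fin: "finite {f. (k, f) \<in> superfill N r v}" for k
  proof (rule finite_subset)
    show "{f. (k, f) \<in> superfill N r v} \<subseteq> snd ` superfill N r v" by force
  qed (use finite_superfill [OF v] in simp)
  have "superfill N r v = Sigma ?K (\<lambda>k. {f. (k, f) \<in> superfill N r v})"
    by (auto dest: superfillD)
  then have "tab_poly N (diag v) = (\<Sum>x\<in>Sigma ?K (\<lambda>k. {f. (k, f) \<in> superfill N r v}). super_weight v x)"
    using sum_superfill [OF v, of N r] r by simp
  also have "\<dots> = (\<Sum>k\<in>?K. \<Sum>f\<in>{f. (k, f) \<in> superfill N r v}. super_weight v (k, f))"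
    by (subst sum.Sigma) (use finite_partitions_le [OF v] fin in auto)
  also have "\<dots> = (\<Sum>k\<in>?K. mconst ((-1) ^ skew_size v k) * (\<Sum>f\<in>{f. (k, f) \<in> superfill N r v}. xpow (content (diag v) f)))"
    by (simp add: super_weight_def sum_distrib_left)
  finally show ?thesis
    using v r by (simp add: sum_superfill_fibre)
qed

subsection \<open>Conjugation by rook strips\<close>

definition drop_boxes :: "nat set \<Rightarrow> shape \<Rightarrow> shape" where
  "drop_boxes S p = (\<lambda>k. p k - (if k \<in> S then 1 else 0))"

text \<open>
  With \<open>A p\<close> in the role of \<open>G\<^bsub>l/p\<^esub>\<close>, \<open>rook_sum beta A\<close> is \<open>G\<^bsub>l//p\<^esub>\<close>, \<open>down beta i\<close> is the operator
  \<open>U\<^sub>i\<close>, and \<open>up_adj beta i\<close> is the transpose of the operator \<open>u\<^sub>i\<close>.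
\<close>

definition corners :: "shape \<Rightarrow> nat set" where
  "corners p = {k. p (Suc k) < p k}"

definition rook_sum :: "K \<Rightarrow> (shape \<Rightarrow> K) \<Rightarrow> shape \<Rightarrow> K" where
  "rook_sum b A p = (\<Sum>S\<in>Pow (corners p). b ^ card S * A (drop_boxes S p))"

definition up_adj :: "K \<Rightarrow> nat \<Rightarrow> (shape \<Rightarrow> K) \<Rightarrow> shape \<Rightarrow> K" where
  "up_adj b i A p = (if p (Suc i) < p i then \<Sum>j\<in>{j. j \<le> i \<and> p j = p i}. (- b) ^ (i - j) * A (drop_boxes {j..i} p) else 0)"

definition down :: "K \<Rightarrow> nat \<Rightarrow> (shape \<Rightarrow> K) \<Rightarrow> shape \<Rightarrow> K" where
  "down b i A p = (if p i = 0 then 0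
     else (- b) ^ card {k. i < k \<and> p k = p i} * A (drop_boxes {k. i \<le> k \<and> p k = p i} p))"

lemma sum_Pow_insert:
  assumes "finite C" "t \<notin> C"
  shows "(\<Sum>S\<in>Pow (insert t C). g S) = (\<Sum>S\<in>Pow C. g S + g (insert t S) :: K)"
proof -
  have "(\<Sum>S\<in>Pow (insert t C). g S) = (\<Sum>S\<in>Pow C. g S) + (\<Sum>S\<in>insert t ` Pow C. g S)"
    unfolding Pow_insert using assms by (intro sum.union_disjoint) auto
  also have "(\<Sum>S\<in>insert t ` Pow C. g S) = (\<Sum>S\<in>Pow C. g (insert t S))"
    using assms(2) by (subst sum.reindex) (auto simp: inj_on_def)
  finally show ?thesis by (simp add: sum.distrib)
qed

lemma corners_subset: "is_partition p \<Longrightarrow> corners p \<subseteq> {..<part_length p}"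
proof
  fix k assume p: "is_partition p" and "k \<in> corners p"
  then have "p k \<noteq> 0" by (auto simp: corners_def)
  then show "k \<in> {..<part_length p}" using partition_nonzero_iff [OF p, of k] by simp
qed

lemma finite_corners: "is_partition p \<Longrightarrow> finite (corners p)"
  using finite_subset [OF corners_subset] by simp

text \<open>Rows i to t have equal length c. Lowering them all at the cost (- b)^(t - i), or
  lowering row t beforehand and then the others at the cost (- b)^(t - i - 1), leads to the same
  shape; with weight b on the second the two cancel.\<close>

lemma down_pair:
  assumes it: "i < t" and L: "\<And>k. i \<le> k \<Longrightarrow> k \<le> t \<Longrightarrow> L k = c" and c: "0 < c" and Lt: "\<And>k. t < k \<Longrightarrow> L k < c"
  shows "down b i A L + b * down b i A (L(t := c - 1)) = 0"
proof -
  let ?L = "L(t := c - 1)"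
  have Li: "L i = c" "?L i = c" using L it by auto
  have cl: "L k = c \<longleftrightarrow> k \<le> t" if "i \<le> k" for k
    using L [OF that] Lt [of k] by (cases "k \<le> t") auto
  have cl': "?L k = c \<longleftrightarrow> k < t" if "i \<le> k" for k
    using cl [OF that] c by (cases "k = t") auto
  have 1: "{k. i \<le> k \<and> L k = L i} = {i..t}" "{k. i < k \<and> L k = L i} = {Suc i..t}"
    unfolding Li using cl [OF less_imp_le] cl
    by (simp_all add: atLeastAtMost_def atLeast_def atMost_def Collect_conj_eq [symmetric] Suc_le_eq
        cong: conj_cong)
  have 2: "{k. i \<le> k \<and> ?L k = ?L i} = {i..<t}" "{k. i < k \<and> ?L k = ?L i} = {Suc i..<t}"
    unfolding Li using cl' by (auto simp del: fun_upd_apply)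
  have "drop_boxes {i..<t} ?L = drop_boxes {i..t} L"
    using it L [of t] by (auto simp: drop_boxes_def fun_eq_iff)
  moreover have "(- b) ^ (t - i) = - b * (- b) ^ (t - Suc i)"
    using it by (metis Suc_diff_Suc power_Suc)
  ultimately show ?thesis
    using Li c unfolding down_def 1 2 by simp
qed

lemma block_end:
  assumes p: "is_partition p" and i: "0 < p i"
  shows "\<exists>t\<ge>i. (\<forall>k. i \<le> k \<and> k \<le> t \<longrightarrow> p k = p i) \<and> (\<forall>k>t. p k < p i)"
proof -
  let ?P = "\<lambda>k. i \<le> k \<and> p (Suc k) < p i"
  define t where "t = (LEAST k. ?P k)"
  have ex: "\<exists>k. ?P k"
    using partition_beyond [OF p order_refl, of "Suc (max i (part_length p))"] i
    by (intro exI [of _ "max i (part_length p)"]) simp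
  have t: "i \<le> t" "p (Suc t) < p i" using LeastI_ex [OF ex] unfolding t_def by auto
  have "p k = p i" if "i \<le> k" "k \<le> t" for k
    using that
  proof (induction k rule: dec_induct)
    case (step k)
    have "\<not> ?P k" using step(4) not_less_Least [of k ?P] by (simp add: t_def Suc_le_eq)
    then have "\<not> p (Suc k) < p i" using step(1) by simp
    then show ?case using step(1) partition_antimono [OF p, of i "Suc k"] by simp
  qed simp
  moreover have "p k < p i" if "t < k" for k
    using partition_antimono [OF p, of "Suc t" k] t that by simp
  ultimately show ?thesis using t(1) by blast
qed

text \<open>Toggling t in S pairs the summands as in \<open>down_pair\<close>; \<open>I\<close>
  holds the rows whose boxes have been removed in advance and do not vary.\<close>

lemma sum_down_block:
  assumes p: "is_partition p" and C: "C \<subseteq> corners p" and t: "t \<in> C" "i < t"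
    and I: "finite I" "I \<inter> C = {}"
    and v: "\<And>k. i \<le> k \<Longrightarrow> k \<le> t \<Longrightarrow> drop_boxes I p k = c" "0 < c" "\<And>k. t < k \<Longrightarrow> drop_boxes I p k < c"
    and free: "\<And>k. i \<le> k \<Longrightarrow> k < t \<Longrightarrow> k \<notin> C"
  shows "(\<Sum>S\<in>Pow C. b ^ card (I \<union> S) * down b i A (drop_boxes (I \<union> S) p)) = 0"
proof -
  have finC: "finite C" using C finite_corners [OF p] finite_subset by blast
  have Ct: "C = insert t (C - {t})" using t by blast
  have "(\<Sum>S\<in>Pow (insert t (C - {t})). b ^ card (I \<union> S) * down b i A (drop_boxes (I \<union> S) p))
    = (\<Sum>S\<in>Pow (C - {t}). b ^ card (I \<union> S) * down b i A (drop_boxes (I \<union> S) p) +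
        b ^ card (I \<union> insert t S) * down b i A (drop_boxes (I \<union> insert t S) p))"
    using finC by (intro sum_Pow_insert) auto
  also have "\<dots> = 0"
  proof (rule sum.neutral, rule ballI)
    fix S assume S: "S \<in> Pow (C - {t})"
    let ?L = "drop_boxes (I \<union> S) p"
    have finS: "finite S" using S finC finite_subset by blast
    have tI: "t \<notin> I \<union> S" using S t I by blast
    have L1: "?L k = c" if "i \<le> k" "k \<le> t" for k
    proof -
      have "k \<notin> S" using free [of k] S that by (cases "k = t") auto
      then show ?thesis using v(1) [OF that] by (simp add: drop_boxes_def)
    qed
    have L2: "?L k < c" if "t < k" for k
      using v(3) [OF that] by (auto simp: drop_boxes_def split: if_splits)
    have "drop_boxes (I \<union> insert t S) p = ?L(t := c - 1)"
    proof
      fix k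
      have "p t = c" using L1 [of t] t tI by (simp add: drop_boxes_def)
      then show "drop_boxes (I \<union> insert t S) p k = (?L(t := c - 1)) k" by (simp add: drop_boxes_def)
    qed
    moreover have "card (I \<union> insert t S) = Suc (card (I \<union> S))"
      using tI finS I by simp
    ultimately have "b ^ card (I \<union> S) * down b i A ?L + b ^ card (I \<union> insert t S) * down b i A (drop_boxes (I \<union> insert t S) p)
      = b ^ card (I \<union> S) * (down b i A ?L + b * down b i A (?L(t := c - 1)))"
      by (simp add: distrib_left mult_ac)
    also have "\<dots> = 0" using down_pair [OF t(2), of ?L c b A] L1 L2 v(2) by simp
    finally show "b ^ card (I \<union> S) * down b i A ?L + b ^ card (I \<union> insert t S) * down b i A (drop_boxes (I \<union> insert t S) p) = 0" .
  qed
  finally show ?thesis using Ct by simp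
qed

lemma down_single:
  assumes "0 < L i" "\<And>k. i < k \<Longrightarrow> L k < L i"
  shows "down b i A L = A (drop_boxes {i} L)"
proof -
  have "L k \<noteq> L i" if "i < k" for k using assms(2) [OF that] by simp
  then have e: "{k. i < k \<and> L k = L i} = {}" "{k. i \<le> k \<and> L k = L i} = {i}"
    by (auto simp: le_less)
  show ?thesis using assms(1) unfolding down_def e by simp
qed

lemma drop_boxes_commute: "drop_boxes S (drop_boxes S' p) = drop_boxes S' (drop_boxes S p)"
  by (auto simp: drop_boxes_def fun_eq_iff)

text \<open>If row i stays nonempty and strictly longer than the next, U_i removes just its last
  box. The remaining case is that S contains i and row i then ties with row i + 1; those summands
  vanish by toggling the end of the tied block, or because row i has become empty.\<close>

lemma rook_sum_down:
  assumes p: "is_partition p" and i: "i \<in> corners p"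
  defines "C \<equiv> corners p - {i}"
  defines "E \<equiv> (if p (Suc i) < p i - 1 then insert i C else C)"
  shows "rook_sum b (down b i A) p = (\<Sum>S\<in>Pow E. b ^ card S * A (drop_boxes S (drop_boxes {i} p)))"
proof -
  have finC: "finite C" using finite_corners [OF p] by (simp add: C_def)
  have iC: "i \<notin> C" by (simp add: C_def)
  have ci: "p (Suc i) < p i" using i by (simp add: corners_def)
  have lt: "p k \<le> p (Suc i)" if "i < k" for k using partition_antimono [OF p, of "Suc i" k] that by simp
  have "corners p = insert i C" using i by (auto simp: C_def)
  then have "rook_sum b (down b i A) p = (\<Sum>S\<in>Pow (insert i C). b ^ card S * down b i A (drop_boxes S p))"
    by (simp add: rook_sum_def)
  also have "\<dots> = (\<Sum>S\<in>Pow C. b ^ card S * down b i A (drop_boxes S p)) +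
      (\<Sum>S\<in>Pow C. b ^ card (insert i S) * down b i A (drop_boxes (insert i S) p))"
    by (subst sum_Pow_insert [OF finC iC]) (simp add: sum.distrib)
  also have "(\<Sum>S\<in>Pow C. b ^ card S * down b i A (drop_boxes S p)) = (\<Sum>S\<in>Pow C. b ^ card S * A (drop_boxes S (drop_boxes {i} p)))"
  proof (rule sum.cong [OF refl])
    fix S assume "S \<in> Pow C"
    then have "i \<notin> S" using iC by blast
    then have v: "drop_boxes S p i = p i" by (simp add: drop_boxes_def)
    have "down b i A (drop_boxes S p) = A (drop_boxes {i} (drop_boxes S p))"
    proof (rule down_single)
      show "0 < drop_boxes S p i" using v ci by simp
      fix k assume "i < k"
      then show "drop_boxes S p k < drop_boxes S p i" unfolding v using lt [of k] ci by (simp add: drop_boxes_def)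
    qed
    then show "b ^ card S * down b i A (drop_boxes S p) = b ^ card S * A (drop_boxes S (drop_boxes {i} p))"
      by (simp add: drop_boxes_commute)
  qed
  also have "(\<Sum>S\<in>Pow C. b ^ card (insert i S) * down b i A (drop_boxes (insert i S) p))
    = (if p (Suc i) < p i - 1 then \<Sum>S\<in>Pow C. b ^ card (insert i S) * A (drop_boxes (insert i S) (drop_boxes {i} p)) else 0)"
  proof (cases "p (Suc i) < p i - 1")
    case True
    have "b ^ card (insert i S) * down b i A (drop_boxes (insert i S) p) = b ^ card (insert i S) * A (drop_boxes (insert i S) (drop_boxes {i} p))" for S
    proof -
      have v: "drop_boxes (insert i S) p i = p i - 1" by (simp add: drop_boxes_def)
      have "down b i A (drop_boxes (insert i S) p) = A (drop_boxes {i} (drop_boxes (insert i S) p))"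
      proof (rule down_single)
        show "0 < drop_boxes (insert i S) p i" using v True by simp
        fix k assume "i < k"
        then have "p k < p i - 1" using lt [of k] True by simp
        then show "drop_boxes (insert i S) p k < drop_boxes (insert i S) p i" unfolding v by (simp add: drop_boxes_def)
      qed
      then show ?thesis by (simp add: drop_boxes_commute)
    qed
    then show ?thesis using True by (simp only: if_True)
  next
    case False
    then have n: "p (Suc i) = p i - 1" using ci by simp
    have "(\<Sum>S\<in>Pow C. b ^ card (insert i S) * down b i A (drop_boxes (insert i S) p)) = 0"
    proof (cases "p (Suc i) = 0")
      case True
      have "down b i A (drop_boxes (insert i S) p) = 0" for S using n True by (simp add: down_def drop_boxes_def)
      then show ?thesis by simp
    next
      case False
      then have pos: "0 < p (Suc i)" by simp
      obtain t where t': "t \<ge> Suc i" "\<forall>k. Suc i \<le> k \<and> k \<le> t \<longrightarrow> p k = p (Suc i)" "\<forall>k>t. p k < p (Suc i)"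
        using block_end [OF p pos] by blast
      have t: "Suc i \<le> t" "\<And>k. Suc i \<le> k \<Longrightarrow> k \<le> t \<Longrightarrow> p k = p (Suc i)" "\<And>k. t < k \<Longrightarrow> p k < p (Suc i)"
        using t' by blast+
      have "(\<Sum>S\<in>Pow C. b ^ card ({i} \<union> S) * down b i A (drop_boxes ({i} \<union> S) p)) = 0"
      proof (rule sum_down_block [OF p])
        show "C \<subseteq> corners p" "{i} \<inter> C = {}" by (auto simp: C_def)
        show "i < t" using t(1) by simp
        have "p (Suc t) < p t" using t(2) [of t] t(3) [of "Suc t"] t(1) by simp
        then show "t \<in> C" using t(1) by (simp add: C_def corners_def)
        show "0 < p (Suc i)" using False by simp
        show "drop_boxes {i} p k = p (Suc i)" if "i \<le> k" "k \<le> t" for k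
          using that t(2) [of k] n by (cases "k = i") (auto simp: drop_boxes_def)
        show "drop_boxes {i} p k < p (Suc i)" if "t < k" for k
          using t(3) [OF that] by (simp add: drop_boxes_def)
        show "k \<notin> C" if "i \<le> k" "k < t" for k
        proof (cases "k = i")
          case False
          then show ?thesis using that t(2) [of k] t(2) [of "Suc k"] by (simp add: C_def corners_def)
        qed (simp add: C_def)
      qed simp
      then show ?thesis by simp
    qed
    then show ?thesis using False by simp
  qed
  also have "(\<Sum>S\<in>Pow C. b ^ card S * A (drop_boxes S (drop_boxes {i} p))) +
    (if p (Suc i) < p i - 1 then \<Sum>S\<in>Pow C. b ^ card (insert i S) * A (drop_boxes (insert i S) (drop_boxes {i} p)) else 0)
    = (\<Sum>S\<in>Pow E. b ^ card S * A (drop_boxes S (drop_boxes {i} p)))"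
    unfolding E_def using sum_Pow_insert [OF finC iC, of "\<lambda>S. b ^ card S * A (drop_boxes S (drop_boxes {i} p))"]
    by (simp add: sum.distrib)
  finally show ?thesis .
qed

text \<open>Shortening rows j to i of a block of equal rows creates a new corner at j - 1, unless j
  = \<open>j0\<close> is the top of the block. Not taking or taking this corner gives X j and - X (j
  - 1), so the sum over j telescopes to X i, where a single box has been removed. \<open>E\<close>
  collects the corners other than the new one.\<close>

lemma up_adj_rook_sum_corner:
  assumes p: "is_partition p" and i: "i \<in> corners p"
  defines "C \<equiv> corners p - {i}"
  defines "E \<equiv> (if p (Suc i) < p i - 1 then insert i C else C)"
  shows "up_adj b i (rook_sum b A) p = (\<Sum>S\<in>Pow E. b ^ card S * A (drop_boxes S (drop_boxes {i} p)))"
proof -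
  have ci: "p (Suc i) < p i" using i by (simp add: corners_def)
  have finE: "finite E" using finite_corners [OF p] by (simp add: E_def C_def)
  define J where "J = {j. j \<le> i \<and> p j = p i}"
  define j0 where "j0 = Min J"
  have finJ: "finite J" by (simp add: J_def)
  have iJ: "i \<in> J" by (simp add: J_def)
  have j0: "j0 \<in> J" "j0 \<le> i" unfolding j0_def using finJ iJ by (auto intro: Min_in Min_le)
  have J: "J = {j0..i}"
  proof (intro equalityI subsetI)
    fix j assume "j \<in> J" then show "j \<in> {j0..i}" using finJ by (auto simp: j0_def J_def)
  next
    fix j assume j: "j \<in> {j0..i}"
    then have "p j = p i"
      using partition_antimono [OF p, of j0 j] partition_antimono [OF p, of j i] j0 by (simp add: J_def)
    then show "j \<in> J" using j by (simp add: J_def)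
  qed
  have val: "p j = p i" if "j0 \<le> j" "j \<le> i" for j
  proof -
    have "j \<in> J" using that J by simp
    then show ?thesis by (simp add: J_def)
  qed
  have before: "p i < p (j0 - 1)" if "0 < j0"
  proof -
    have "j0 - 1 \<notin> J" using that Min_le [OF finJ, of "j0 - 1"] by (auto simp: j0_def [symmetric])
    then have "p (j0 - 1) \<noteq> p i" using j0 by (auto simp: J_def)
    moreover have "j0 - 1 \<le> i" using j0 by simp
    ultimately show ?thesis using partition_antimono [OF p, of "j0 - 1" i] by simp
  qed
  have E_notin: "j \<notin> E" if "j0 \<le> j" "j < i" for j
    using that val [of j] val [of "Suc j"] by (auto simp: E_def C_def corners_def)
  have mem: "k \<in> corners (drop_boxes {j..i} p) \<longleftrightarrow> k \<in> E \<or> (j0 < j \<and> Suc k = j)" if j: "j0 \<le> j" "j \<le> i" for j k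
  proof -
    consider "Suc k < j" | "i < k" | "k = i" | "j \<le> k" "k < i" | "Suc k = j" by linarith
    then show ?thesis
    proof cases
      case 1
      then show ?thesis using j by (auto simp: E_def C_def corners_def drop_boxes_def)
    next
      case 2
      then show ?thesis using j by (auto simp: E_def C_def corners_def drop_boxes_def)
    next
      case 3
      then show ?thesis using j by (auto simp: E_def C_def corners_def drop_boxes_def)
    next
      case 4
      then show ?thesis using j val [of k] val [of "Suc k"] E_notin [of k] by (auto simp: corners_def drop_boxes_def)
    next
      case 5
      have "p (Suc k) = p i" using val [of j] 5 j by simp
      moreover have "p i \<le> p k" using partition_antimono [OF p, of k i] 5 j by simp
      ultimately have "k \<in> corners (drop_boxes {j..i} p)" using ci 5 j by (auto simp: corners_def drop_boxes_def)
      moreover have "k \<in> E" if "\<not> j0 < j"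
      proof -
        have "j0 = j" using that j by simp
        then have "p (Suc k) < p k" using before 5 val [of j] j by auto
        then show ?thesis using 5 j by (auto simp: E_def C_def corners_def)
      qed
      ultimately show ?thesis using 5 by auto
    qed
  qed
  define X where "X j = (- b) ^ (i - j) * (\<Sum>S\<in>Pow E. b ^ card S * A (drop_boxes S (drop_boxes {j..i} p)))" for j
  have first: "(- b) ^ (i - j0) * rook_sum b A (drop_boxes {j0..i} p) = X j0"
  proof -
    have "corners (drop_boxes {j0..i} p) = E" using mem [of j0] j0 by auto
    then show ?thesis by (simp add: X_def rook_sum_def)
  qed
  have later: "(- b) ^ (i - j) * rook_sum b A (drop_boxes {j..i} p) = X j - X (j - 1)" if j: "j \<in> {Suc j0..i}" for j
  proof -
    let ?k = "j - 1"
    have kE: "?k \<notin> E" using j by (intro E_notin) auto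
    have "corners (drop_boxes {j..i} p) = insert ?k E"
    proof (rule Set.set_eqI)
      fix l
      have "j0 < j \<and> Suc l = j \<longleftrightarrow> l = ?k" using j by auto
      moreover have "j0 \<le> j" "j \<le> i" using j by auto
      ultimately show "l \<in> corners (drop_boxes {j..i} p) \<longleftrightarrow> l \<in> insert ?k E" using mem [of j l] by blast
    qed
    then have "rook_sum b A (drop_boxes {j..i} p) = (\<Sum>S\<in>Pow E. b ^ card S * A (drop_boxes S (drop_boxes {j..i} p))) +
        (\<Sum>S\<in>Pow E. b ^ card (insert ?k S) * A (drop_boxes (insert ?k S) (drop_boxes {j..i} p)))"
      unfolding rook_sum_def using sum_Pow_insert [OF finE kE, of "\<lambda>S. b ^ card S * A (drop_boxes S (drop_boxes {j..i} p))"]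
      by (simp add: sum.distrib)
    also have "(\<Sum>S\<in>Pow E. b ^ card (insert ?k S) * A (drop_boxes (insert ?k S) (drop_boxes {j..i} p)))
      = b * (\<Sum>S\<in>Pow E. b ^ card S * A (drop_boxes S (drop_boxes {?k..i} p)))"
      unfolding sum_distrib_left
    proof (rule sum.cong [OF refl])
      fix S assume S: "S \<in> Pow E"
      then have kS: "?k \<notin> S" and finS: "finite S" using kE finE finite_subset by blast+
      have "drop_boxes (insert ?k S) (drop_boxes {j..i} p) = drop_boxes S (drop_boxes {?k..i} p)"
        using kS j by (auto simp: drop_boxes_def fun_eq_iff)
      then show "b ^ card (insert ?k S) * A (drop_boxes (insert ?k S) (drop_boxes {j..i} p)) = b * (b ^ card S * A (drop_boxes S (drop_boxes {?k..i} p)))"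
        using kS finS by simp
    qed
    finally have "(- b) ^ (i - j) * rook_sum b A (drop_boxes {j..i} p)
      = X j + (- b) ^ (i - j) * b * (\<Sum>S\<in>Pow E. b ^ card S * A (drop_boxes S (drop_boxes {?k..i} p)))"
      by (simp add: X_def distrib_left mult.assoc)
    moreover have "i - ?k = Suc (i - j)" using j by auto
    ultimately show ?thesis by (simp add: X_def)
  qed
  have "up_adj b i (rook_sum b A) p = (\<Sum>j\<in>{j0..i}. (- b) ^ (i - j) * rook_sum b A (drop_boxes {j..i} p))"
    using ci J by (simp add: up_adj_def J_def)
  also have "{j0..i} = insert j0 {Suc j0..i}" using j0 by auto
  also have "(\<Sum>j\<in>insert j0 {Suc j0..i}. (- b) ^ (i - j) * rook_sum b A (drop_boxes {j..i} p))
    = X j0 + (\<Sum>j\<in>{Suc j0..i}. (- b) ^ (i - j) * rook_sum b A (drop_boxes {j..i} p))"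
    by (subst sum.insert) (auto simp: first)
  also have "(\<Sum>j\<in>{Suc j0..i}. (- b) ^ (i - j) * rook_sum b A (drop_boxes {j..i} p)) = (\<Sum>j\<in>{Suc j0..i}. X j - X (j - 1))"
    by (rule sum.cong [OF refl later])
  also have "\<dots> = X i - X j0" using j0 by (intro sum_telescope'')
  finally show ?thesis by (simp add: X_def)
qed

text \<open>At a corner both sides reduce to the same sum over sets of remaining corners. Elsewhere
  the transpose of u_i gives zero, and the rook sum of U_i cancels by toggling the end of the block
  of row i, or vanishes termwise when row i is empty.\<close>

theorem up_adj_rook_sum:
  assumes p: "is_partition p"
  shows "up_adj b i (rook_sum b A) p = rook_sum b (down b i A) p"
proof (cases "i \<in> corners p")
  case True
  then show ?thesis using up_adj_rook_sum_corner [OF p True] rook_sum_down [OF p True] by simp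
next
  case False
  then have "up_adj b i (rook_sum b A) p = 0" by (simp add: up_adj_def corners_def)
  moreover have "rook_sum b (down b i A) p = 0"
  proof (cases "p i = 0")
    case True
    then have "down b i A (drop_boxes S p) = 0" for S by (simp add: down_def drop_boxes_def)
    then show ?thesis by (simp add: rook_sum_def)
  next
    case pos: False
    then have pos': "0 < p i" by simp
    obtain t where t': "t \<ge> i" "\<forall>k. i \<le> k \<and> k \<le> t \<longrightarrow> p k = p i" "\<forall>k>t. p k < p i"
      using block_end [OF p pos'] by blast
    have t: "i \<le> t" "\<And>k. i \<le> k \<Longrightarrow> k \<le> t \<Longrightarrow> p k = p i" "\<And>k. t < k \<Longrightarrow> p k < p i"
      using t' by blast+
    have "p (Suc t) < p t" using t(2) [of t] t(3) [of "Suc t"] t(1) by simp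
    then have tc: "t \<in> corners p" by (simp add: corners_def)
    have "(\<Sum>S\<in>Pow (corners p). b ^ card ({} \<union> S) * down b i A (drop_boxes ({} \<union> S) p)) = 0"
    proof (rule sum_down_block [OF p order_refl tc])
      show "i < t" using t(1) tc False by (cases "i = t") auto
      show "0 < p i" using pos by simp
      show "k \<notin> corners p" if "i \<le> k" "k < t" for k
        using that t(2) [of k] t(2) [of "Suc k"] by (simp add: corners_def)
      show "drop_boxes {} p k = p i" if "i \<le> k" "k \<le> t" for k
        using t(2) [OF that] by (simp add: drop_boxes_def)
      show "drop_boxes {} p k < p i" if "t < k" for k
        using t(3) [OF that] by (simp add: drop_boxes_def)
    qed simp_all
    then show ?thesis by (simp add: rook_sum_def)
  qed
  ultimately show ?thesis by simp
qed

section \<open>Rook strips as sets of corners\<close>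

lemma partition_drop_boxes_corners:
  assumes p: "is_partition p" and S: "S \<subseteq> corners p"
  shows "is_partition (drop_boxes S p)"
proof (rule is_partitionI [where p = "drop_boxes S p" and n = "part_length p"])
  fix k show "drop_boxes S p (Suc k) \<le> drop_boxes S p k"
    using S partition_antimono [OF p, of k "Suc k"] by (auto simp: drop_boxes_def corners_def)
  show "drop_boxes S p (part_length p) = 0"
    using partition_beyond [OF p order_refl order_refl] by (simp add: drop_boxes_def)
qed

lemma drop_boxes_le: "drop_boxes S p \<le> p"
  by (simp add: drop_boxes_def le_fun_def)

lemma seq_size_drop_boxes:
  assumes p: "is_partition p" and q: "is_partition (drop_boxes S p)" and S: "\<And>k. k \<in> S \<Longrightarrow> 0 < p k"
  shows "seq_size p = seq_size (drop_boxes S p) + card S"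
proof -
  let ?n = "part_length p"
  have Sn: "S \<subseteq> {..<?n}" using S partition_nonzero_iff [OF p] by (metis lessThan_iff neq0_conv subsetI)
  have "(\<Sum>k<?n. p k) = (\<Sum>k<?n. drop_boxes S p k + (if k \<in> S then 1 else 0))"
    by (rule sum.cong) (use S in \<open>auto simp: drop_boxes_def\<close>)
  also have "\<dots> = (\<Sum>k<?n. drop_boxes S p k) + card ({..<?n} \<inter> S)"
    by (simp add: sum.distrib sum.If_cases Int_def)
  also have "{..<?n} \<inter> S = S" using Sn by blast
  finally show ?thesis
    using p q partition_le_length [OF p q drop_boxes_le] by (simp add: seq_size_lessThan [of _ ?n])
qed

text \<open>Two boxes removed from one row, or a box removed from a row that is not longer than the
  next, would break the rook condition. What remains is a free choice of corners, so corners can be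
  toggled one at a time.\<close>

lemma rook_strips_eq:
  assumes p: "is_partition p"
  shows "{r. rook_strip p r} = (\<lambda>S. drop_boxes S p) ` Pow (corners p)"
proof (intro equalityI subsetI)
  fix r assume "r \<in> {r. rook_strip p r}"
  then have r: "is_partition r" "r \<le> p"
    and rook: "\<And>a c. a \<in> skew_diagram p r \<Longrightarrow> c \<in> skew_diagram p r \<Longrightarrow> a \<noteq> c \<Longrightarrow> fst a \<noteq> fst c \<and> snd a \<noteq> snd c"
    by (auto simp: rook_strip_def)
  let ?S = "{k. r k < p k}"
  have le: "r k \<le> p k" for k using r(2) by (simp add: le_fun_def)
  have one: "p k \<le> Suc (r k)" for k
  proof (rule ccontr)
    assume "\<not> p k \<le> Suc (r k)"
    then have "(k, r k) \<in> skew_diagram p r" "(k, Suc (r k)) \<in> skew_diagram p r" by (auto simp: skew_diagram_def)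
    then show False using rook by fastforce
  qed
  have "r = drop_boxes ?S p"
  proof
    fix k show "r k = drop_boxes ?S p k" using le [of k] one [of k] by (auto simp: drop_boxes_def)
  qed
  moreover have "?S \<subseteq> corners p"
  proof
    fix k assume "k \<in> ?S"
    then have k: "p k = Suc (r k)" using one [of k] by simp
    show "k \<in> corners p"
    proof (rule ccontr)
      assume "k \<notin> corners p"
      then have "p (Suc k) = p k" using partition_antimono [OF p, of k "Suc k"] by (simp add: corners_def)
      moreover have "r (Suc k) \<le> r k" using partition_antimono [OF r(1), of k "Suc k"] by simp
      ultimately have "(k, r k) \<in> skew_diagram p r" "(Suc k, r k) \<in> skew_diagram p r"
        using k by (auto simp: skew_diagram_def)
      then show False using rook by fastforce
    qed
  qed
  ultimately show "r \<in> (\<lambda>S. drop_boxes S p) ` Pow (corners p)" by blast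
next
  fix r assume "r \<in> (\<lambda>S. drop_boxes S p) ` Pow (corners p)"
  then obtain S where S: "S \<subseteq> corners p" "r = drop_boxes S p" by blast
  have box: "i \<in> S \<and> j = p i - 1 \<and> 0 < p i" if "(i, j) \<in> skew_diagram p r" for i j
    using that S by (auto simp: skew_diagram_def drop_boxes_def split: if_splits)
  have cols: "p k' < p k" if "k \<in> S" "k < k'" for k k'
    using that S partition_antimono [OF p, of "Suc k" k'] by (auto simp: corners_def)
  have "fst a \<noteq> fst c \<and> snd a \<noteq> snd c"
    if ac: "a \<in> skew_diagram p r" "c \<in> skew_diagram p r" "a \<noteq> c" for a c
  proof -
    obtain i j i' j' where e: "a = (i, j)" "c = (i', j')" by (cases a, cases c)
    have b: "i \<in> S" "j = p i - 1" "0 < p i" "i' \<in> S" "j' = p i' - 1" "0 < p i'"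
      using box ac e by blast+
    then have "i \<noteq> i'" using ac(3) e by auto
    then have "p i \<noteq> p i'" using cols [of i i'] cols [of i' i] b by (cases i i' rule: linorder_cases) auto
    then show ?thesis using b e \<open>i \<noteq> i'\<close> by auto
  qed
  then show "r \<in> {r. rook_strip p r}"
    using p partition_drop_boxes_corners [OF p S(1)] drop_boxes_le S(2) by (simp add: rook_strip_def)
qed

lemma corners_pos: "S \<subseteq> corners p \<Longrightarrow> k \<in> S \<Longrightarrow> 0 < p k"
  by (auto simp: corners_def)

lemma rook_sum_eq:
  assumes p: "is_partition p"
  shows "rook_sum b A p = (\<Sum>r | rook_strip p r. b ^ skew_size p r * A r)"
proof -
  have inj: "inj_on (\<lambda>S. drop_boxes S p) (Pow (corners p))"
  proof (rule inj_onI)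
    fix S S' assume a: "S \<in> Pow (corners p)" "S' \<in> Pow (corners p)" "drop_boxes S p = drop_boxes S' p"
    have "k \<in> S \<longleftrightarrow> k \<in> S'" for k
      using fun_cong [OF a(3), of k] corners_pos [of S p k] corners_pos [of S' p k] a(1,2)
      by (cases "k \<in> S"; cases "k \<in> S'") (auto simp: drop_boxes_def)
    then show "S = S'" by blast
  qed
  have "skew_size p (drop_boxes S p) = card S" if "S \<in> Pow (corners p)" for S
  proof -
    have S: "S \<subseteq> corners p" using that by simp
    have q: "is_partition (drop_boxes S p)" by (rule partition_drop_boxes_corners [OF p S])
    show ?thesis using seq_size_drop_boxes [OF p q corners_pos [OF S]] skew_size_eq [OF p q drop_boxes_le] by simp
  qed
  then show ?thesis
    unfolding rook_strips_eq [OF p] rook_sum_def by (subst sum.reindex [OF inj]) simp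
qed

text \<open>Rook sums are unitriangular in the size of the partition. Only q below p enter, which
  matters because the rook expansion of \<open>Groth_dskew\<close> is available only for indices
  contained in the first partition.\<close>

lemma rook_sum_inject:
  assumes eq: "\<And>q. is_partition q \<Longrightarrow> q \<le> p \<Longrightarrow> rook_sum b X q = rook_sum b Y q" and p: "is_partition p"
  shows "X p = Y p"
proof -
  have "X q = Y q" if "is_partition q" "q \<le> p" for q
    using that
  proof (induction q rule: measure_induct_rule [of seq_size])
    case (less q)
    have sp: "(\<Sum>r | rook_strip q r. b ^ skew_size q r * A r) = A q + (\<Sum>r\<in>{r. rook_strip q r \<and> r \<noteq> q}. b ^ skew_size q r * A r)" for A
    proof -
      have "{r. rook_strip q r} = insert q {r. rook_strip q r \<and> r \<noteq> q}"
        using rook_strip_refl [OF less.prems(1)] by auto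
      moreover have "finite {r. rook_strip q r \<and> r \<noteq> q}"
        by (rule finite_subset [OF _ finite_rook_strips [of q]]) auto
      moreover have "skew_size q q = 0" using skew_size_eq [OF less.prems(1,1)] by simp
      ultimately show ?thesis by simp
    qed
    have "(\<Sum>r\<in>{r. rook_strip q r \<and> r \<noteq> q}. b ^ skew_size q r * X r)
      = (\<Sum>r\<in>{r. rook_strip q r \<and> r \<noteq> q}. b ^ skew_size q r * Y r)"
    proof (rule sum.cong [OF refl])
      fix r assume "r \<in> {r. rook_strip q r \<and> r \<noteq> q}"
      then have r: "is_partition r" "r \<le> q" "r \<noteq> q" by (auto dest: rook_stripD)
      then have "X r = Y r"
        using less by (intro less.IH seq_size_strict_mono order_trans [OF r(2)]) auto
      then show "b ^ skew_size q r * X r = b ^ skew_size q r * Y r" by simp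
    qed
    moreover have "rook_sum b X q = rook_sum b Y q" using eq less.prems by blast
    ultimately show ?case using sp [of X] sp [of Y] rook_sum_eq [OF less.prems(1), of b] by simp
  qed
  then show ?thesis using p by simp
qed

subsection \<open>Words in the raising operators and their adjoints\<close>

lemma foldr_up_props:
  assumes l: "is_partition l"
  shows "is_partition (foldr up w l) \<and> seq_size l + length w \<le> seq_size (foldr up w l) \<and> l \<le> foldr up w l"
proof -
  obtain n where n: "set w \<subseteq> {..<n}" using finite_nat_bounded [of "set w"] by auto
  let ?n = "max n (part_length l)"
  have "set w \<subseteq> {..<?n}" using n by fastforce
  then show ?thesis using foldr_up_partition [OF l, of ?n w] by simp
qed

text \<open>u_i raises an interval of rows ending at i, so a preimage is determined by the first row
  j of that interval. This identifies \<open>up_adj\<close> as the transpose of u_i.\<close>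

lemma up_fibre:
  assumes p: "is_partition p"
  shows "{q. is_partition q \<and> up i q = p} = (if p (Suc i) < p i then (\<lambda>j. drop_boxes {j..i} p) ` {j. j \<le> i \<and> p j = p i} else {})"
proof (intro equalityI subsetI)
  fix q assume "q \<in> {q. is_partition q \<and> up i q = p}"
  then have q: "is_partition q" "p = up i q" by auto
  let ?J = "{k. k \<le> i \<and> q k = q i}"
  have pk: "p k = q k + (if k \<le> i \<and> q k = q i then 1 else 0)" for k
    by (simp add: q(2) raise_def raised_def)
  define j where "j = Min ?J"
  have finJ: "finite ?J" by simp
  have jJ: "j \<in> ?J" unfolding j_def by (rule Min_in [OF finJ]) auto
  have J: "k \<le> i \<and> q k = q i \<longleftrightarrow> j \<le> k \<and> k \<le> i" for k
  proof
    assume "k \<le> i \<and> q k = q i" then show "j \<le> k \<and> k \<le> i" using Min_le [OF finJ, of k] by (simp add: j_def)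
  next
    assume k: "j \<le> k \<and> k \<le> i"
    then show "k \<le> i \<and> q k = q i"
      using partition_antimono [OF q(1), of j k] partition_antimono [OF q(1), of k i] jJ by auto
  qed
  have "p (Suc i) < p i" using pk [of i] pk [of "Suc i"] partition_antimono [OF q(1), of i "Suc i"] by simp
  moreover have "q = drop_boxes {j..i} p" using pk J by (auto simp: drop_boxes_def fun_eq_iff)
  moreover have "j \<le> i" "p j = p i" using jJ pk [of j] pk [of i] by auto
  ultimately show "q \<in> (if p (Suc i) < p i then (\<lambda>j. drop_boxes {j..i} p) ` {j. j \<le> i \<and> p j = p i} else {})"
    by auto
next
  fix q assume "q \<in> (if p (Suc i) < p i then (\<lambda>j. drop_boxes {j..i} p) ` {j. j \<le> i \<and> p j = p i} else {})"
  then obtain j where j: "p (Suc i) < p i" "j \<le> i" "p j = p i" "q = drop_boxes {j..i} p"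
    by (auto split: if_splits)
  have val: "p k = p i" if "j \<le> k" "k \<le> i" for k
    using partition_antimono [OF p that(1)] partition_antimono [OF p that(2)] j(3) by simp
  have "is_partition (drop_boxes {j..i} p)"
  proof (rule is_partitionI [where p = "drop_boxes {j..i} p" and n = "part_length p"])
    fix k
    have le: "p (Suc k) \<le> p k" using partition_antimono [OF p, of k "Suc k"] by simp
    show "drop_boxes {j..i} p (Suc k) \<le> drop_boxes {j..i} p k"
    proof (cases "j \<le> k \<and> k \<le> i")
      case True
      then show ?thesis using val [of k] val [of "Suc k"] j(1) by (cases "k = i") (auto simp: drop_boxes_def)
    next
      case False
      then show ?thesis using le by (auto simp: drop_boxes_def)
    qed
  next
    show "drop_boxes {j..i} p (part_length p) = 0"
      using partition_beyond [OF p order_refl order_refl] by (simp add: drop_boxes_def)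
  qed
  moreover have "up i q = p"
  proof
    fix k
    have qi: "q i = p i - 1" using j by (simp add: drop_boxes_def)
    have "k \<le> i \<and> q k = q i \<longleftrightarrow> j \<le> k \<and> k \<le> i"
    proof
      assume a: "k \<le> i \<and> q k = q i"
      show "j \<le> k \<and> k \<le> i"
      proof (rule ccontr)
        assume "\<not> (j \<le> k \<and> k \<le> i)"
        then have "q k = p k" using a j(4) by (simp add: drop_boxes_def)
        moreover have "p i \<le> p k" using partition_antimono [OF p, of k i] a by simp
        ultimately show False using a qi j(1) by simp
      qed
    next
      assume "j \<le> k \<and> k \<le> i" then show "k \<le> i \<and> q k = q i" using val [of k] qi j(4) by (simp add: drop_boxes_def)
    qed
    then show "up i q k = p k"
      using val [of k] j(1,4) by (auto simp: raise_def raised_def drop_boxes_def)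
  qed
  ultimately show "q \<in> {q. is_partition q \<and> up i q = p}" using j(4) by simp
qed

lemma up_adj_eq:
  assumes p: "is_partition p"
  shows "up_adj b i A p = (\<Sum>q\<in>{q. is_partition q \<and> up i q = p}. (- b) ^ (seq_size p - seq_size q - 1) * A q)"
proof (cases "p (Suc i) < p i")
  case True
  let ?J = "{j. j \<le> i \<and> p j = p i}"
  have val: "0 < p k" if "k \<le> i" for k using partition_antimono [OF p that] True by simp
  have inj: "inj_on (\<lambda>j. drop_boxes {j..i} p) ?J"
  proof (rule inj_onI)
    fix j j' assume a: "j \<in> ?J" "j' \<in> ?J" "drop_boxes {j..i} p = drop_boxes {j'..i} p"
    have "\<not> l < l'" if "l \<le> i" "l' \<le> i" "drop_boxes {l..i} p = drop_boxes {l'..i} p" for l l'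
      using fun_cong [OF that(3), of l] val [OF that(1)] that(1) by (auto simp: drop_boxes_def)
    then show "j = j'" using a by (metis (mono_tags, lifting) linorder_neqE_nat mem_Collect_eq)
  qed
  have fib: "{q. is_partition q \<and> up i q = p} = (\<lambda>j. drop_boxes {j..i} p) ` ?J" using up_fibre [OF p, of i] True by simp
  have size: "seq_size p - seq_size (drop_boxes {j..i} p) - 1 = i - j" if "j \<in> ?J" for j
  proof -
    have "drop_boxes {j..i} p \<in> {q. is_partition q \<and> up i q = p}" unfolding fib using that by blast
    then have "seq_size p = seq_size (drop_boxes {j..i} p) + card {j..i}"
      using val by (intro seq_size_drop_boxes [OF p]) auto
    then show ?thesis using that by simp
  qed
  show ?thesis
    unfolding fib sum.reindex [OF inj] up_adj_def using True size by simp
next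
  case False
  then have "{q. is_partition q \<and> up i q = p} = {}" using up_fibre [OF p, of i] by simp
  then show ?thesis using False unfolding up_adj_def by (simp only: if_False sum.empty)
qed

text \<open>The transpose of a word in the u. The sum is finite for a partition p because the
  operators only add boxes.\<close>

definition up_word_adj :: "K \<Rightarrow> nat list \<Rightarrow> (shape \<Rightarrow> K) \<Rightarrow> shape \<Rightarrow> K" where
  "up_word_adj b w A p = (\<Sum>q\<in>{q. is_partition q \<and> foldr up w q = p}. (- b) ^ (seq_size p - seq_size q - length w) * A q)"

lemma finite_up_fibre: "is_partition p \<Longrightarrow> finite {q. is_partition q \<and> foldr up w q = p}"
  by (rule finite_subset [OF _ finite_partitions_le]) (use foldr_up_props in auto)

lemma up_word_adj_cong: "(\<And>q. is_partition q \<Longrightarrow> q \<le> p \<Longrightarrow> A q = B q) \<Longrightarrow> up_word_adj b w A p = up_word_adj b w B p"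
  unfolding up_word_adj_def by (rule sum.cong) (use foldr_up_props in auto)

lemma up_adj_cong: "is_partition p \<Longrightarrow> (\<And>q. is_partition q \<Longrightarrow> A q = B q) \<Longrightarrow> up_adj b i A p = up_adj b i B p"
  by (simp add: up_adj_eq)

lemma up_word_adj_Nil: "is_partition p \<Longrightarrow> up_word_adj b [] A p = A p"
proof -
  assume "is_partition p"
  then have "{q. is_partition q \<and> foldr up [] q = p} = {p}" by auto
  then show ?thesis by (simp add: up_word_adj_def)
qed

lemma up_word_adj_Cons:
  assumes p: "is_partition p"
  shows "up_word_adj b (i # w) A p = up_adj b i (up_word_adj b w A) p"
proof -
  let ?Q = "{q. is_partition q \<and> up i q = p}"
  let ?R = "\<lambda>q. {r. is_partition r \<and> foldr up w r = q}"
  have finQ: "finite ?Q" using finite_up_fibre [OF p, of "[i]"] by simp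
  have "up_adj b i (up_word_adj b w A) p = (\<Sum>q\<in>?Q. \<Sum>r\<in>?R q. (- b) ^ (seq_size p - seq_size q - 1) *
      ((- b) ^ (seq_size q - seq_size r - length w) * A r))"
    unfolding up_adj_eq [OF p] up_word_adj_def sum_distrib_left ..
  also have "\<dots> = (\<Sum>q\<in>?Q. \<Sum>r\<in>?R q. (- b) ^ (seq_size p - seq_size r - length (i # w)) * A r)"
  proof (intro sum.cong refl)
    fix q r assume q: "q \<in> ?Q" and r: "r \<in> ?R q"
    have "seq_size q + 1 \<le> seq_size p" using foldr_up_props [of q "[i]"] q by simp
    moreover have "seq_size r + length w \<le> seq_size q" using foldr_up_props [of r w] r by auto
    ultimately have "(seq_size p - seq_size q - 1) + (seq_size q - seq_size r - length w) = seq_size p - seq_size r - length (i # w)"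
      by simp
    then show "(- b) ^ (seq_size p - seq_size q - 1) * ((- b) ^ (seq_size q - seq_size r - length w) * A r)
      = (- b) ^ (seq_size p - seq_size r - length (i # w)) * A r"
      by (simp only: mult.assoc [symmetric] power_add [symmetric])
  qed
  also have "\<dots> = (\<Sum>r\<in>(\<Union>q\<in>?Q. ?R q). (- b) ^ (seq_size p - seq_size r - length (i # w)) * A r)"
    by (rule sum.UNION_disjoint [symmetric]) (use finQ finite_up_fibre in auto)
  also have "(\<Union>q\<in>?Q. ?R q) = {r. is_partition r \<and> foldr up (i # w) r = p}"
    using foldr_up_props by auto
  finally show ?thesis by (simp only: up_word_adj_def [of b "i # w" A p])
qed

theorem up_word_adj_rook_sum:
  assumes "is_partition p"
  shows "up_word_adj b w (rook_sum b A) p = rook_sum b (foldr (down b) w A) p"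
  using assms
proof (induction w arbitrary: p)
  case Nil
  then show ?case by (simp add: up_word_adj_Nil)
next
  case (Cons i w)
  have "up_word_adj b (i # w) (rook_sum b A) p = up_adj b i (rook_sum b (foldr (down b) w A)) p"
    unfolding up_word_adj_Cons [OF Cons.prems] by (rule up_adj_cong [OF Cons.prems Cons.IH])
  also have "\<dots> = rook_sum b (down b i (foldr (down b) w A)) p" by (rule up_adj_rook_sum [OF Cons.prems])
  finally show ?case by simp
qed

subsection \<open>Multiplication by Schur polynomials\<close>

text \<open>The scalar with which the word \<open>w\<close> in the operators \<open>u\<close> acts on \<open>l\<close>.\<close>

definition word_coeff :: "K \<Rightarrow> nat list \<Rightarrow> shape \<Rightarrow> K" where
  "word_coeff b w l = (- b) ^ (seq_size (foldr up w l) - seq_size l - length w)"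

lemma up_word_adj_word_coeff: "up_word_adj b w A p = (\<Sum>q\<in>{q. is_partition q \<and> foldr up w q = p}. word_coeff b w q * A q)"
  unfolding up_word_adj_def word_coeff_def by (rule sum.cong) auto

lemma length_cword:
  assumes "D \<subseteq> {..<L} \<times> {..<c}"
  shows "length (cword L c D T) = card D"
proof -
  have len: "length (filter P [0..<n]) = card {i. i < n \<and> P i}" for P and n :: nat
  proof -
    have "set (filter P [0..<n]) = {i. i < n \<and> P i}" by auto
    then show ?thesis using distinct_card [OF distinct_filter [OF distinct_upt]] by metis
  qed
  have D: "D = prod.swap ` (SIGMA j:{..<c}. {i. i < L \<and> (i, j) \<in> D})"
    using assms by (auto simp: image_iff)
  have "card D = card (SIGMA j:{..<c}. {i. i < L \<and> (i, j) \<in> D})"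
    by (subst D, rule card_image) (auto simp: inj_on_def)
  also have "\<dots> = (\<Sum>j<c. card {i. i < L \<and> (i, j) \<in> D})" by simp
  also have "\<dots> = length (cword L c D T)"
    unfolding cword_def length_concat
    by (simp add: comp_def len interv_sum_list_conv_sum_set_nat atLeast0LessThan)
  finally show ?thesis by simp
qed

lemma set_cword: "set (cword L c D T) \<subseteq> T ` D"
  by (auto simp: cword_def)

text \<open>The defining quotient starts only at as many variables as p has parts. There every
  exponent of the numerator is positive, so setting the last variable to zero kills it, while the
  Vandermonde product keeps a factor that can be cancelled.\<close>

lemma mcoeff_Groth_long:
  assumes p: "is_partition p" and n: "n < part_length p" and m: "ks m \<subseteq> {..<n}"
  shows "mcoeff (Groth p) m = 0"
proof -
  obtain k where k: "part_length p = Suc k" using n by (cases "part_length p") auto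
  have v: "first_vars k (vandermonde (Suc k)) = (\<Prod>i<k. mX i) * vandermonde k"
    unfolding vandermonde_eq_alt by (rule first_vars_alt_Suc) simp
  have pos: "0 < p j" if "j < Suc k" for j using partition_nonzero_iff [OF p, of j] that k by simp
  have van: "first_vars k (permvars \<pi> (groth_mon beta (Suc k) p)) = 0" if \<pi>: "\<pi> permutes {..<Suc k}" for \<pi>
  proof -
    let ?g = "\<lambda>j. mX (\<pi> j) ^ (p j + (Suc k - 1 - j)) * (1 + mconst beta * mX (\<pi> j)) ^ j :: K mfps"
    have fac: "permvars \<pi> (groth_mon beta (Suc k) p) = (\<Prod>j<Suc k. ?g j)"
      using permutes_bij [OF \<pi>] by (simp add: groth_mon_def permvars_prod permvars_mult permvars_power permvars_add
          permvars_1 permvars_mconst permvars_mX del: prod.lessThan_Suc)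
    have "k \<in> \<pi> ` {..<Suc k}" using permutes_image [OF \<pi>] by simp
    then obtain j where j: "j < Suc k" "\<pi> j = k" by auto
    have "p j + (Suc k - 1 - j) \<noteq> 0" using pos [OF j(1)] by simp
    then have z: "first_vars k (?g j) = 0"
      by (simp only: first_vars_mult first_vars_power j(2) first_vars_mX less_irrefl if_False
          power_0_left mult_zero_left)
    have "(\<Prod>j<Suc k. first_vars k (?g j)) = 0"
      by (rule prod_zero) (use j z in blast)+
    then show ?thesis unfolding fac first_vars_prod .
  qed
  have fint: "first_vars k (of_int c * f) = of_int c * first_vars k (f :: K mfps)" for c f
    unfolding mconst_of_int [symmetric] by (simp add: first_vars_mult)
  have "first_vars k (groth_num (Suc k) p) = 0"
    unfolding groth_num_eq_alt alt_def first_vars_sum fint by (rule sum.neutral) (simp add: van)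
  then have "first_vars k (first_vars (Suc k) (Groth p) * vandermonde (Suc k)) = 0"
    by (simp only: first_vars_Groth [OF p eq_imp_le [OF k]])
  then have "xpow (\<Sum>i<k. sg i 1) * (first_vars k (Groth p) * vandermonde k) = xpow (\<Sum>i<k. sg i 1) * 0"
    by (simp add: first_vars_mult v first_vars_first_vars xpow_sum mX_eq_xpow mult_ac)
  then have "first_vars k (Groth p) * vandermonde k = 0 * vandermonde k"
    by (simp only: mult_zero_left) (rule xpow_cancel)
  then have "first_vars k (Groth p) = 0" by (rule vandermonde_cancel)
  then have "mcoeff (first_vars k (Groth p)) m = 0" by simp
  moreover have "ks m \<subseteq> {..<k}" using m n k by fastforce
  ultimately show ?thesis by (simp add: mcoeff_first_vars)
qed

lemma first_vars_Groth_eq_0: "is_partition p \<Longrightarrow> n < part_length p \<Longrightarrow> first_vars n (Groth p) = 0"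
  by (rule mfps_eqI) (simp add: mcoeff_first_vars mcoeff_Groth_long)

lemma part_length_mono:
  assumes "is_partition p" "is_partition q" "p \<le> q"
  shows "part_length p \<le> part_length q"
proof -
  have "q (part_length q) = 0" using partition_beyond [OF assms(2) order_refl order_refl] .
  then have "p (part_length q) = 0" using assms(3) by (metis le_funD le_zero_eq)
  then show ?thesis using part_length_le_iff [OF assms(1)] by blast
qed

lemma tab_poly_Groth:
  assumes D: "convex_diag D" "D \<subseteq> {..<L} \<times> {..<c}" and l: "is_partition l"
  shows "tab_poly n D * first_vars n (Groth l) = (\<Sum>T\<in>tab {..<n} D.
    mconst (word_coeff beta (cword L c D T) l) * first_vars n (Groth (foldr up (cword L c D T) l)))"
proof (cases "part_length l \<le> n")
  case True
  let ?w = "\<lambda>T. cword L c D T"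
  have len: "length (?w T) = card D" for T by (rule length_cword [OF D(2)])
  have up: "is_partition (foldr up (?w T) l) \<and> part_length (foldr up (?w T) l) \<le> n" if "T \<in> tab {..<n} D" for T
  proof -
    have "set (?w T) \<subseteq> {..<n}" using set_cword [of L c D T] tab_in [OF that] by blast
    then show ?thesis using foldr_up_partition [OF l True] by blast
  qed
  have "tab_poly n D * first_vars n (Groth l) * vandermonde n = tab_poly n D * alt n (groth_mon beta n l)"
    using first_vars_Groth [OF l True] by (simp add: groth_num_eq_alt mult.assoc)
  also have "\<dots> = (\<Sum>T\<in>tab {..<n} D. mconst (word_coeff beta (?w T) l) * alt n (groth_mon beta n (foldr up (?w T) l)))"
    unfolding word_coeff_def len by (rule alt_tab_poly [OF D(1) l True D(2)])
  also have "\<dots> = (\<Sum>T\<in>tab {..<n} D. mconst (word_coeff beta (?w T) l) * (first_vars n (Groth (foldr up (?w T) l)) * vandermonde n))"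
    by (rule sum.cong [OF refl]) (simp add: first_vars_Groth up groth_num_eq_alt)
  also have "\<dots> = (\<Sum>T\<in>tab {..<n} D. mconst (word_coeff beta (?w T) l) * first_vars n (Groth (foldr up (?w T) l))) * vandermonde n"
    by (simp add: sum_distrib_right mult.assoc)
  finally show ?thesis by (rule vandermonde_cancel)
next
  case False
  have "first_vars n (Groth (foldr up w l)) = 0" for w
    using foldr_up_props [OF l, of w] part_length_mono [OF l, of "foldr up w l"] False
    by (intro first_vars_Groth_eq_0) auto
  then show ?thesis using False by (simp add: first_vars_Groth_eq_0 [OF l])
qed

subsection \<open>Rotation of tableaux\<close>

lemma rev_upt_0: "rev [0..<n] = map (\<lambda>i. n - 1 - i) [0..<n]"
  by (rule nth_equalityI) (simp_all add: rev_nth)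

definition rot :: "nat \<Rightarrow> nat \<Rightarrow> nat \<times> nat \<Rightarrow> nat \<times> nat" where
  "rot L c = (\<lambda>(i, j). (L - 1 - i, c - 1 - j))"

lemma rot_rot: "x \<in> {..<L} \<times> {..<c} \<Longrightarrow> rot L c (rot L c x) = x"
  by (auto simp: rot_def)

lemma mem_rot_image:
  assumes "D \<subseteq> {..<L} \<times> {..<c}"
  shows "x \<in> rot L c ` D \<longleftrightarrow> x \<in> {..<L} \<times> {..<c} \<and> rot L c x \<in> D"
proof
  assume "x \<in> rot L c ` D"
  then obtain y where y: "y \<in> D" "x = rot L c y" by blast
  then have "y \<in> {..<L} \<times> {..<c}" using assms by blast
  then show "x \<in> {..<L} \<times> {..<c} \<and> rot L c x \<in> D" using y rot_rot [of y L c] by (auto simp: rot_def)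
next
  assume "x \<in> {..<L} \<times> {..<c} \<and> rot L c x \<in> D"
  then show "x \<in> rot L c ` D" using rot_rot [of x L c] by force
qed

lemma convex_rot:
  assumes D: "convex_diag D" "D \<subseteq> {..<L} \<times> {..<c}"
  shows "convex_diag (rot L c ` D)"
proof (rule convex_diagI)
  show "finite (rot L c ` D)" using convex_diag_finite [OF D(1)] by simp
  fix i j i' j' a b
  assume m: "(i, j) \<in> rot L c ` D" "(i', j') \<in> rot L c ` D" and le: "i \<le> a" "a \<le> i'" "j \<le> b" "b \<le> j'"
  from m have "i' < L" "j' < c" "(L - 1 - i, c - 1 - j) \<in> D" "(L - 1 - i', c - 1 - j') \<in> D"
    unfolding mem_rot_image [OF D(2)] by (auto simp: rot_def)
  then show "(a, b) \<in> rot L c ` D"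
    unfolding mem_rot_image [OF D(2)]
    using le convex_diagD [OF D(1), of "L - 1 - i'" "c - 1 - j'" "L - 1 - i" "c - 1 - j" "L - 1 - a" "c - 1 - b"]
    by (auto simp: rot_def)
qed

text \<open>A half-turn reverses both the order of the columns and the reading direction within each
  of them.\<close>

lemma cword_rot:
  assumes D: "D \<subseteq> {..<L} \<times> {..<c}"
  shows "cword L c (rot L c ` D) (restrict (T \<circ> rot L c) (rot L c ` D)) = rev (cword L c D T)"
proof -
  have "rev (cword L c D T) = concat (map (\<lambda>j. map (\<lambda>i. T (i, j)) (filter (\<lambda>i. (i, j) \<in> D) [0..<L])) (rev [0..<c]))"
    unfolding cword_def by (simp add: rev_concat rev_map comp_def)
  also have "\<dots> = concat (map (\<lambda>j. map (\<lambda>i. T (i, c - 1 - j)) (filter (\<lambda>i. (i, c - 1 - j) \<in> D) [0..<L])) [0..<c])"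
    unfolding rev_upt_0 by (simp add: comp_def)
  also have "\<dots> = cword L c (rot L c ` D) (restrict (T \<circ> rot L c) (rot L c ` D))"
    unfolding cword_def rev_filter rev_upt_0 filter_map map_map comp_def
  proof (rule arg_cong [of _ _ concat], rule map_cong [OF refl])
    fix j assume "j \<in> set [0..<c]"
    then have j: "j < c" by simp
    have mem: "(L - 1 - i, j) \<in> rot L c ` D \<longleftrightarrow> (i, c - 1 - j) \<in> D" if "i < L" for i
      unfolding mem_rot_image [OF D] using that j by (auto simp: rot_def)
    have "filter (\<lambda>i. (i, c - 1 - j) \<in> D) [0..<L] = filter (\<lambda>i. (L - 1 - i, j) \<in> rot L c ` D) [0..<L]"
    proof (rule filter_cong [OF refl])
      fix i assume "i \<in> set [0..<L]"
      then show "(i, c - 1 - j) \<in> D \<longleftrightarrow> (L - 1 - i, j) \<in> rot L c ` D" using mem [of i] by simp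
    qed
    then show "map (\<lambda>i. T (i, c - 1 - j)) (filter (\<lambda>i. (i, c - 1 - j) \<in> D) [0..<L])
      = map (\<lambda>i. restrict (\<lambda>x. T (rot L c x)) (rot L c ` D) (L - 1 - i, j)) (filter (\<lambda>i. (L - 1 - i, j) \<in> rot L c ` D) [0..<L])"
      by (auto simp: rot_def)
  qed
  finally show ?thesis by simp
qed

lemma restrict_restrict_rot:
  assumes D: "D \<subseteq> {..<L} \<times> {..<c}" and T: "T \<in> extensional D"
  shows "restrict (restrict (T \<circ> rot L c) (rot L c ` D) \<circ> rot L c) D = T"
proof (rule extensionalityI [OF restrict_extensional T])
  fix x assume x: "x \<in> D"
  then have "rot L c (rot L c x) = x" using D rot_rot by blast
  then show "restrict (restrict (T \<circ> rot L c) (rot L c ` D) \<circ> rot L c) D x = T x" using x by simp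
qed

lemma tab_rot:
  assumes D: "D \<subseteq> {..<L} \<times> {..<c}" and T: "T \<in> tab_rev s D"
  shows "restrict (T \<circ> rot L c) (rot L c ` D) \<in> tab {..<s} (rot L c ` D)"
proof -
  have T': "\<And>x. x \<in> D \<Longrightarrow> T x < s" "\<And>i j j'. (i, j) \<in> D \<Longrightarrow> (i, j') \<in> D \<Longrightarrow> j < j' \<Longrightarrow> T (i, j') \<le> T (i, j)"
    "\<And>i i' j. (i, j) \<in> D \<Longrightarrow> (i', j) \<in> D \<Longrightarrow> i < i' \<Longrightarrow> T (i', j) < T (i, j)"
    using T by (auto simp: tab_rev_def)
  show ?thesis
  proof (rule tabI)
    show "restrict (T \<circ> rot L c) (rot L c ` D) \<in> rot L c ` D \<rightarrow>\<^sub>E {..<s}"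
      using T'(1) mem_rot_image [OF D] by auto
  next
    fix i j j' assume m: "(i, j) \<in> rot L c ` D" "(i, j') \<in> rot L c ` D" "j < j'"
    from m have "j' < c" "(L - 1 - i, c - 1 - j) \<in> D" "(L - 1 - i, c - 1 - j') \<in> D"
      unfolding mem_rot_image [OF D] by (auto simp: rot_def)
    with m T'(2) [of "L - 1 - i" "c - 1 - j'" "c - 1 - j"]
    show "restrict (T \<circ> rot L c) (rot L c ` D) (i, j) \<le> restrict (T \<circ> rot L c) (rot L c ` D) (i, j')"
      by (simp add: rot_def)
  next
    fix i i' j assume m: "(i, j) \<in> rot L c ` D" "(i', j) \<in> rot L c ` D" "i < i'"
    from m have "i' < L" "(L - 1 - i, c - 1 - j) \<in> D" "(L - 1 - i', c - 1 - j) \<in> D"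
      unfolding mem_rot_image [OF D] by (auto simp: rot_def)
    with m T'(3) [of "L - 1 - i'" "c - 1 - j" "L - 1 - i"]
    show "restrict (T \<circ> rot L c) (rot L c ` D) (i, j) < restrict (T \<circ> rot L c) (rot L c ` D) (i', j)"
      by (simp add: rot_def)
  qed
qed

lemma tab_rev_rot:
  assumes D: "D \<subseteq> {..<L} \<times> {..<c}" and T: "T \<in> tab {..<s} (rot L c ` D)"
  shows "restrict (T \<circ> rot L c) D \<in> tab_rev s D"
proof -
  have r: "rot L c (i, j) = (L - 1 - i, c - 1 - j)" for i j by (simp add: rot_def)
  have b: "i < L \<and> j < c" if "(i, j) \<in> D" for i j using D that by blast
  have m: "(L - 1 - i, c - 1 - j) \<in> rot L c ` D" if "(i, j) \<in> D" for i j
    using that by (force simp: rot_def)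
  have "T (L - 1 - i, c - 1 - j') \<le> T (L - 1 - i, c - 1 - j)" if "(i, j) \<in> D" "(i, j') \<in> D" "j < j'" for i j j'
    using tab_row [OF T m [OF that(2)] m [OF that(1)]] that(3) by simp
  moreover have "T (L - 1 - i', c - 1 - j) < T (L - 1 - i, c - 1 - j)" if "(i, j) \<in> D" "(i', j) \<in> D" "i < i'" for i i' j
  proof -
    have "L - 1 - i' < L - 1 - i" using that(3) b [OF that(2)] by linarith
    then show ?thesis by (rule tab_col [OF T m [OF that(2)] m [OF that(1)]])
  qed
  moreover have "T (L - 1 - i, c - 1 - j) < s" if "(i, j) \<in> D" for i j
    using tab_in [OF T m [OF that]] by simp
  ultimately show ?thesis by (auto simp: tab_rev_def r)
qed

lemma content_rot:
  assumes D: "D \<subseteq> {..<L} \<times> {..<c}"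
  shows "content (rot L c ` D) (restrict (T \<circ> rot L c) (rot L c ` D)) = content D T"
proof -
  have inj: "inj_on (rot L c) D" using D rot_rot by (intro inj_on_inverseI [where g = "rot L c"]) blast
  show ?thesis unfolding content_def sum.reindex [OF inj]
  proof (rule sum.cong [OF refl])
    fix x assume x: "x \<in> D"
    then have "rot L c (rot L c x) = x" using D rot_rot by blast
    then show "((\<lambda>b. sg (restrict (T \<circ> rot L c) (rot L c ` D) b) 1) \<circ> rot L c) x = sg (T x) 1" using x by simp
  qed
qed

text \<open>A half-turn makes the tableaux ordinary without changing their contents, so only the
  words of operators notice it, by being reversed.\<close>

lemma tab_rev_Groth:
  assumes p: "is_partition p" "is_partition q" and l: "is_partition l"
  shows "(\<Sum>T\<in>tab_rev s (skew_diagram p q). xpow (content (skew_diagram p q) T)) * first_vars s (Groth l)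
    = (\<Sum>T\<in>tab_rev s (skew_diagram p q). mconst (word_coeff beta (rev (column_word p q T)) l) *
        first_vars s (Groth (foldr up (rev (column_word p q T)) l)))"
proof -
  define L c D where "L = part_length p" and "c = p 0" and "D = skew_diagram p q"
  have D: "D \<subseteq> {..<L} \<times> {..<c}" "convex_diag D"
    unfolding L_def c_def D_def by (rule skew_diagram_subset [OF p(1)], rule convex_skew_diagram [OF p])
  have sub: "rot L c ` D \<subseteq> {..<L} \<times> {..<c}" using mem_rot_image [OF D(1)] by blast
  have twice: "rot L c ` rot L c ` D = D"
  proof -
    have "rot L c (rot L c x) = x" if "x \<in> D" for x using D(1) rot_rot that by blast
    then show ?thesis unfolding image_image by simp
  qed
  have bij: "sum f (tab {..<s} (rot L c ` D)) = (\<Sum>T\<in>tab_rev s D. f (restrict (T \<circ> rot L c) (rot L c ` D)))" for f :: "_ \<Rightarrow> K mfps"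
  proof (rule sum.reindex_bij_witness [where i = "\<lambda>T. restrict (T \<circ> rot L c) (rot L c ` D)" and j = "\<lambda>T. restrict (T \<circ> rot L c) D"])
    fix T assume T: "T \<in> tab {..<s} (rot L c ` D)"
    show "restrict (T \<circ> rot L c) D \<in> tab_rev s D" by (rule tab_rev_rot [OF D(1) T])
    show e: "restrict (restrict (T \<circ> rot L c) D \<circ> rot L c) (rot L c ` D) = T"
      using restrict_restrict_rot [OF sub tab_extensional [OF T]] unfolding twice .
    show "f (restrict (restrict (T \<circ> rot L c) D \<circ> rot L c) (rot L c ` D)) = f T" unfolding e ..
  next
    fix T assume T: "T \<in> tab_rev s D"
    show "restrict (T \<circ> rot L c) (rot L c ` D) \<in> tab {..<s} (rot L c ` D)" by (rule tab_rot [OF D(1) T])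
    have "T \<in> extensional D" using T by (auto simp: tab_rev_def PiE_def)
    then show "restrict (restrict (T \<circ> rot L c) (rot L c ` D) \<circ> rot L c) D = T"
      by (rule restrict_restrict_rot [OF D(1)])
  qed
  have "tab_poly s (rot L c ` D) = (\<Sum>T\<in>tab_rev s D. xpow (content D T))"
    unfolding tab_poly_def bij content_rot [OF D(1)] ..
  moreover have "column_word p q T = cword L c D T" for T
    unfolding L_def c_def D_def by (rule column_word_eq_cword)
  ultimately show ?thesis
    using tab_poly_Groth [OF convex_rot [OF D(2) D(1)] sub l, of s] unfolding bij cword_rot [OF D(1)] D_def [symmetric]
    by simp
qed

subsection \<open>Slices\<close>

text \<open>
  The coefficient of \<open>x\<^sup>\<alpha>\<close> in a series in \<open>x\<^sub>0, \<dots>, x\<^bsub>N-1\<^esub>\<close> and \<open>y\<^sub>i = x\<^bsub>N+i\<^esub>\<close>, as a series in \<open>y\<close>.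
\<close>

definition slice :: "nat \<Rightarrow> (nat \<Rightarrow>\<^sub>0 nat) \<Rightarrow> K mfps \<Rightarrow> K mfps" where
  "slice N \<alpha> f = Abs_mfps (\<lambda>\<gamma>. mcoeff f (\<alpha> + shiftm N \<gamma>))"

lemma mcoeff_slice: "mcoeff (slice N \<alpha> f) \<gamma> = mcoeff f (\<alpha> + shiftm N \<gamma>)"
  by (simp add: slice_def)

lemma slice_sum: "slice N \<alpha> (sum f A) = (\<Sum>a\<in>A. slice N \<alpha> (f a))"
  by (rule mfps_eqI) (simp add: mcoeff_slice mcoeff_sum)

lemma slice_mconst: "slice N \<alpha> (mconst c * f) = mconst c * slice N \<alpha> f"
  by (rule mfps_eqI) (simp add: mcoeff_slice mcoeff_mconst_mult)

text \<open>Monomials in y alone commute with taking the coefficient of x^\<alpha>, since \<alpha>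
  involves no y.\<close>

lemma slice_xpow:
  assumes \<alpha>: "ks \<alpha> \<subseteq> {..<N}"
  shows "slice N \<alpha> (xpow (shiftm N m) * f) = xpow m * slice N \<alpha> f"
proof (rule mfps_eqI)
  fix \<gamma>
  show "mcoeff (slice N \<alpha> (xpow (shiftm N m) * f)) \<gamma> = mcoeff (xpow m * slice N \<alpha> f) \<gamma>"
  proof (cases "\<exists>k. \<gamma> = m + k")
    case True
    then obtain k where k: "\<gamma> = m + k" by blast
    have "\<alpha> + shiftm N \<gamma> = shiftm N m + (\<alpha> + shiftm N k)" unfolding k shiftm_add by (simp add: add_ac)
    then show ?thesis by (simp add: mcoeff_slice k)
  next
    case False
    have "\<alpha> + shiftm N \<gamma> \<noteq> shiftm N m + k" for k
    proof
      assume e: "\<alpha> + shiftm N \<gamma> = shiftm N m + k"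
      have "lk m i \<le> lk \<gamma> i" for i
      proof -
        have "lk \<alpha> (N + i) = 0" using \<alpha> by (auto simp: in_keys_iff)
        then show ?thesis using arg_cong [OF e, of "\<lambda>x. lk x (N + i)"] by (simp add: lookup_add lookup_shiftm)
      qed
      then have "\<gamma> = m + (\<gamma> - m)" by (intro poly_mapping_eqI) (simp add: lookup_add lookup_minus)
      then show False using False by blast
    qed
    then have "mcoeff (xpow (shiftm N m) * f) (\<alpha> + shiftm N \<gamma>) = 0" by (rule mcoeff_xpow_mult_eq_0)
    moreover have "mcoeff (xpow m * slice N \<alpha> f) \<gamma> = 0"
      by (rule mcoeff_xpow_mult_eq_0) (use False in blast)
    ultimately show ?thesis by (simp add: mcoeff_slice)
  qed
qed

lemma mcoeff_slice_mult:
  assumes f: "\<And>m. mcoeff f m \<noteq> 0 \<Longrightarrow> ks m \<subseteq> {..<N}" and \<alpha>: "ks \<alpha> \<subseteq> {..<N}"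
  shows "mcoeff (slice N \<alpha> (f * g)) \<gamma> = (\<Sum>(a, b)\<in>splits \<alpha>. mcoeff f a * mcoeff g (b + shiftm N \<gamma>))"
proof -
  have "mcoeff (slice N \<alpha> (f * g)) \<gamma> = (\<Sum>(a, b)\<in>splits (\<alpha> + shiftm N \<gamma>). mcoeff f a * mcoeff g b)"
    by (simp add: mcoeff_slice mcoeff_mult)
  also have "\<dots> = (\<Sum>(a, b)\<in>(\<lambda>(a, b). (a, b + shiftm N \<gamma>)) ` splits \<alpha>. mcoeff f a * mcoeff g b)"
  proof (rule sum.mono_neutral_right [OF finite_splits])
    show "(\<lambda>(a, b). (a, b + shiftm N \<gamma>)) ` splits \<alpha> \<subseteq> splits (\<alpha> + shiftm N \<gamma>)"
      by (auto simp: splits_def add_ac)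
    show "\<forall>x\<in>splits (\<alpha> + shiftm N \<gamma>) - (\<lambda>(a, b). (a, b + shiftm N \<gamma>)) ` splits \<alpha>.
        (case x of (a, b) \<Rightarrow> mcoeff f a * mcoeff g b) = 0"
    proof (rule ballI, rule ccontr)
      fix x assume x: "x \<in> splits (\<alpha> + shiftm N \<gamma>) - (\<lambda>(a, b). (a, b + shiftm N \<gamma>)) ` splits \<alpha>"
        and nz: "(case x of (a, b) \<Rightarrow> mcoeff f a * mcoeff g b) \<noteq> 0"
      obtain a b where xab: "x = (a, b)" by (cases x)
      have ab: "a + b = \<alpha> + shiftm N \<gamma>" using x xab by (simp add: splits_def)
      have "mcoeff f a \<noteq> 0" using nz xab by auto
      then have a: "ks a \<subseteq> {..<N}" by (rule f)
      have lab: "lk a i + lk b i = lk \<alpha> i + lk (shiftm N \<gamma>) i" for i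
        using arg_cong [OF ab, of "\<lambda>x. lk x i"] by (simp add: lookup_add)
      have ale: "lk a i \<le> lk \<alpha> i" for i
      proof (cases "i < N")
        case True
        then show ?thesis using lab [of i] by (simp add: lookup_shiftm)
      next
        case False
        then have "lk a i = 0" using a by (auto simp: in_keys_iff)
        then show ?thesis by simp
      qed
      have "b = (\<alpha> - a) + shiftm N \<gamma>"
      proof (rule poly_mapping_eqI)
        fix i show "lk b i = lk (\<alpha> - a + shiftm N \<gamma>) i"
          using lab [of i] ale [of i] by (simp add: lookup_add lookup_minus)
      qed
      moreover have "a + (\<alpha> - a) = \<alpha>"
        using ale by (intro poly_mapping_eqI) (simp add: lookup_add lookup_minus)
      ultimately have "x \<in> (\<lambda>(a, b). (a, b + shiftm N \<gamma>)) ` splits \<alpha>"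
        unfolding xab by (intro image_eqI [of _ _ "(a, \<alpha> - a)"]) (auto simp: splits_def)
      then show False using x by blast
    qed
  qed
  also have "\<dots> = (\<Sum>(a, b)\<in>splits \<alpha>. mcoeff f a * mcoeff g (b + shiftm N \<gamma>))"
    by (subst sum.reindex) (auto simp: inj_on_def comp_def case_prod_unfold prod_eq_iff)
  finally show ?thesis .
qed

text \<open>Allows a factor to be replaced by a truncation that is correct only up to the degree
  under consideration.\<close>

lemma mcoeff_mult_cong:
  assumes "\<And>k. mdeg k \<le> mdeg m \<Longrightarrow> mcoeff g k = mcoeff h k"
  shows "mcoeff (f * g) m = mcoeff (f * h :: K mfps) m"
  unfolding mcoeff_mult by (rule sum.cong [OF refl]) (auto simp: splits_def assms)

subsection \<open>Coefficient comparison\<close>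

text \<open>\<open>Groth q\<close> has no terms below degree |q|, so enlarging the range of q beyond
  the degree of \<gamma> adds zeros. A uniform bound d is wanted because \<gamma> varies inside a
  product.\<close>

lemma Groth_coproduct_slice:
  assumes p: "is_partition p" and \<alpha>: "ks \<alpha> \<subseteq> {..<N}" and \<gamma>: "ks \<gamma> \<subseteq> {..<s}" "mdeg \<gamma> \<le> d"
  shows "mcoeff (Groth p) (\<alpha> + shiftm N \<gamma>)
    = (\<Sum>q\<in>parts_upto d. mcoeff (Groth_dskew p q) \<alpha> * mcoeff (Groth q) \<gamma>)"
proof -
  let ?a = "map (lk \<alpha>) [0..<N]" and ?c = "map (lk \<gamma>) [0..<s]"
  have mon_map: "mon (map (lk m) [0..<k]) = m" if "ks m \<subseteq> {..<k}" for m :: "nat \<Rightarrow>\<^sub>0 nat" and k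
    using that by (intro poly_mapping_eqI) (auto simp: lookup_mon in_keys_iff)
  have a: "mon ?a = \<alpha>" and c: "mon ?c = \<gamma>" using mon_map \<alpha> \<gamma> by auto
  have sc: "sum_list ?c = mdeg \<gamma>" using mdeg_mon [of ?c] unfolding c by simp
  have "mcoeff (Groth p) (\<alpha> + shiftm N \<gamma>) = mcoeff (Groth p) (mon (?a @ ?c))"
    unfolding mon_append a c by simp
  also have "\<dots> = (\<Sum>q\<in>parts_upto (mdeg \<gamma>). mcoeff (Groth_dskew p q) \<alpha> * mcoeff (Groth q) \<gamma>)"
    unfolding Groth_coproduct [OF p] sc a c ..
  also have "\<dots> = (\<Sum>q\<in>parts_upto d. mcoeff (Groth_dskew p q) \<alpha> * mcoeff (Groth q) \<gamma>)"
  proof (rule sum.mono_neutral_left [OF finite_parts_upto])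
    show "parts_upto (mdeg \<gamma>) \<subseteq> parts_upto d" using \<gamma>(2) by (auto simp: parts_upto_def)
    show "\<forall>q\<in>parts_upto d - parts_upto (mdeg \<gamma>). mcoeff (Groth_dskew p q) \<alpha> * mcoeff (Groth q) \<gamma> = 0"
    proof
      fix q assume "q \<in> parts_upto d - parts_upto (mdeg \<gamma>)"
      then have q: "is_partition q" "mdeg \<gamma> < seq_size q" by (auto simp: parts_upto_def)
      then have "mcoeff (Groth q) \<gamma> = mcoeff (schur q) \<gamma>" by (intro mcoeff_Groth_low) auto
      also have "\<dots> = 0" using schur_homogeneous [OF q(1), of \<gamma>] q(2) by (metis less_irrefl)
      finally show "mcoeff (Groth_dskew p q) \<alpha> * mcoeff (Groth q) \<gamma> = 0" by simp
    qed
  qed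
  finally show ?thesis .
qed

text \<open>
  Unitriangularity: in degree \<open>seq_size q\<close> and below, \<open>Groth q\<close> agrees with \<open>schur q\<close>.
\<close>

lemma Groth_coeffs_independent:
  assumes eq: "\<And>\<gamma>. ks \<gamma> \<subseteq> {..<s} \<Longrightarrow>
      (\<Sum>q\<in>parts_upto (mdeg \<gamma>). E q * mcoeff (Groth q) \<gamma>) = 0"
    and p: "is_partition p" "part_length p \<le> s"
  shows "E p = 0"
  using p
\<comment> \<open>The size separates the lowest degrees of the \<open>Groth q\<close>; within one
  degree \<open>pstat\<close> gives the triangularity of the Schur functions.\<close>
proof (induction "(seq_size p, pstat p)" arbitrary: p rule: wf_induct_rule [OF wf_lex_prod [OF wf_less_than wf_less_than]])
  case 1
  note p = 1(2, 3)
  let ?g = "part_mon p"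
  have IH: "E q = 0" if "is_partition q" "part_length q \<le> s"
    "seq_size q < seq_size p \<or> seq_size q = seq_size p \<and> pstat q < pstat p" for q
    using 1(1) [of q] that by auto
  have z: "E q * mcoeff (Groth q) ?g = 0" if q: "q \<in> parts_upto (seq_size p) - {p}" for q
  proof -
    have q': "is_partition q" "seq_size q \<le> seq_size p" "q \<noteq> p" using q by (auto simp: parts_upto_def)
    consider "s < part_length q" | "part_length q \<le> s" "seq_size q < seq_size p \<or> seq_size q = seq_size p \<and> pstat q < pstat p"
      | "seq_size q = seq_size p" "pstat p \<le> pstat q" using q'(2) by fastforce
    then show ?thesis
    proof cases
      case 1
      then show ?thesis using mcoeff_Groth_long [OF q'(1) 1] keys_part_mon [OF p(1)] p(2) by simp
    next
      case 2
      then show ?thesis using IH [OF q'(1)] by simp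
    next
      case 3
      have "mcoeff (Groth q) ?g = mcoeff (schur q) ?g"
        by (rule mcoeff_Groth_low [OF q'(1)]) (simp add: mdeg_part_mon [OF p(1)] 3)
      also have "\<dots> = 0" by (rule schur_part_mon_eq_0 [OF p(1) q'(1) q'(3) [symmetric] 3(2)])
      finally show ?thesis by simp
    qed
  qed
  have "p \<in> parts_upto (seq_size p)" using p by (simp add: parts_upto_def)
  then have "(\<Sum>q\<in>parts_upto (seq_size p). E q * mcoeff (Groth q) ?g)
    = E p * mcoeff (Groth p) ?g + (\<Sum>q\<in>parts_upto (seq_size p) - {p}. E q * mcoeff (Groth q) ?g)"
    by (intro sum.remove finite_parts_upto)
  also have "\<dots> = E p * mcoeff (Groth p) ?g" by (simp only: sum.neutral [OF ballI [OF z]] add_0_right)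
  also have "mcoeff (Groth p) ?g = 1"
    using mcoeff_Groth_low [OF p(1), of ?g] by (simp add: mdeg_part_mon [OF p(1)] schur_leading [OF p(1)])
  finally have "E p = (\<Sum>q\<in>parts_upto (mdeg ?g). E q * mcoeff (Groth q) ?g)"
    by (simp add: mdeg_part_mon [OF p(1)])
  also have "\<dots> = 0" by (rule eq) (use keys_part_mon [OF p(1)] p(2) in simp)
  finally show ?case .
qed

text \<open>The y-part of G_l(x, y) is a combination of the G_q(y). Multiplying by the Schur
  polynomial in the reversed alphabet sends q to \<open>foldr up w q\<close>; regrouping by the
  image p moves the operators from the basis to the coefficients, that is, replaces them by their
  transposes.\<close>

lemma tab_rev_slice:
  assumes v: "is_partition v" and k: "is_partition k" and l: "is_partition l"
    and \<alpha>: "ks \<alpha> \<subseteq> {..<N}" and \<gamma>: "mdeg \<gamma> \<le> d"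
  defines "D \<equiv> skew_diagram (conj_part v) (conj_part k)"
  shows "mcoeff ((\<Sum>T\<in>tab_rev s D. xpow (content D T)) * slice N \<alpha> (first_vars (N + s) (Groth l))) \<gamma>
    = (\<Sum>T\<in>tab_rev s D. \<Sum>p\<in>parts_upto d.
        up_word_adj beta (rev (column_word (conj_part v) (conj_part k) T)) (\<lambda>q. mcoeff (Groth_dskew l q) \<alpha>) p *
        mcoeff (first_vars s (Groth p)) \<gamma>)"
proof -
  let ?w = "\<lambda>T. rev (column_word (conj_part v) (conj_part k) T)"
  let ?A = "\<lambda>q. mcoeff (Groth_dskew l q) \<alpha>"
  let ?H = "\<Sum>q\<in>parts_upto d. mconst (?A q) * first_vars s (Groth q)"
  let ?Q = "\<Sum>T\<in>tab_rev s D. xpow (content D T)"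
  have H: "mcoeff (slice N \<alpha> (first_vars (N + s) (Groth l))) k = mcoeff ?H k" if "mdeg k \<le> mdeg \<gamma>" for k
  proof -
    have kk: "ks (\<alpha> + shiftm N k) \<subseteq> {..<N + s} \<longleftrightarrow> ks k \<subseteq> {..<s}"
      using \<alpha> by (auto simp: keys_add_nat keys_shiftm)
    have "mcoeff (slice N \<alpha> (first_vars (N + s) (Groth l))) k
      = (if ks k \<subseteq> {..<s} then mcoeff (Groth l) (\<alpha> + shiftm N k) else 0)"
      by (simp only: mcoeff_slice mcoeff_first_vars kk)
    also have "\<dots> = (if ks k \<subseteq> {..<s} then \<Sum>q\<in>parts_upto d. ?A q * mcoeff (Groth q) k else 0)"
      using Groth_coproduct_slice [OF l \<alpha>, of k s d] that \<gamma> by simp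
    also have "\<dots> = mcoeff ?H k"
      by (simp add: mcoeff_sum mcoeff_mconst_mult mcoeff_first_vars)
    finally show ?thesis .
  qed
  have "mcoeff (?Q * slice N \<alpha> (first_vars (N + s) (Groth l))) \<gamma> = mcoeff (?Q * ?H) \<gamma>"
    by (rule mcoeff_mult_cong) (rule H)
  also have "?Q * ?H = (\<Sum>q\<in>parts_upto d. mconst (?A q) * (?Q * first_vars s (Groth q)))"
    unfolding sum_distrib_left by (rule sum.cong [OF refl]) (simp only: mult_ac)
  also have "mcoeff \<dots> \<gamma> = (\<Sum>q\<in>parts_upto d. ?A q * (\<Sum>T\<in>tab_rev s D. word_coeff beta (?w T) q * mcoeff (first_vars s (Groth (foldr up (?w T) q))) \<gamma>))"
    unfolding mcoeff_sum mcoeff_mconst_mult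
  proof (rule sum.cong [OF refl])
    fix q assume "q \<in> parts_upto d"
    then have q: "is_partition q" by (simp add: parts_upto_def)
    show "?A q * mcoeff (?Q * first_vars s (Groth q)) \<gamma>
      = ?A q * (\<Sum>T\<in>tab_rev s D. word_coeff beta (?w T) q * mcoeff (first_vars s (Groth (foldr up (?w T) q))) \<gamma>)"
      unfolding D_def tab_rev_Groth [OF partition_conj_part [OF v] partition_conj_part [OF k] q]
      by (simp only: mcoeff_sum mcoeff_mconst_mult)
  qed
  also have "\<dots> = (\<Sum>T\<in>tab_rev s D. \<Sum>q\<in>parts_upto d. word_coeff beta (?w T) q * ?A q * mcoeff (first_vars s (Groth (foldr up (?w T) q))) \<gamma>)"
    unfolding sum_distrib_left by (subst sum.swap) (simp only: mult_ac)
  also have "\<dots> = (\<Sum>T\<in>tab_rev s D. \<Sum>p\<in>parts_upto d. up_word_adj beta (?w T) ?A p * mcoeff (first_vars s (Groth p)) \<gamma>)"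
  proof (rule sum.cong [OF refl])
    fix T
    let ?f = "\<lambda>q. word_coeff beta (?w T) q * ?A q * mcoeff (first_vars s (Groth (foldr up (?w T) q))) \<gamma>"
    \<comment> \<open>A q whose image exceeds size d contributes only above the degree of \<gamma>,
      so the regrouping can stay inside \<open>parts_upto d\<close>.\<close>
    let ?S = "{q \<in> parts_upto d. foldr up (?w T) q \<in> parts_upto d}"
    have big: "?f q = 0" if "q \<in> parts_upto d - ?S" for q
    proof -
      let ?p = "foldr up (?w T) q"
      have "is_partition q" using that by (simp add: parts_upto_def)
      then have p: "is_partition ?p" using foldr_up_props by blast
      then have s: "mdeg \<gamma> < seq_size ?p" using that \<gamma> by (auto simp: parts_upto_def)
      then have "mcoeff (Groth ?p) \<gamma> = mcoeff (schur ?p) \<gamma>" by (intro mcoeff_Groth_low p) simp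
      also have "\<dots> = 0" using schur_homogeneous [OF p, of \<gamma>] s by (metis less_irrefl)
      finally show ?thesis by (simp add: mcoeff_first_vars)
    qed
    have "sum ?f (parts_upto d) = sum ?f ?S"
      by (rule sum.mono_neutral_right) (use big in auto)
    also have "\<dots> = (\<Sum>p\<in>parts_upto d. \<Sum>q\<in>{q \<in> ?S. foldr up (?w T) q = p}. ?f q)"
      by (rule sum.group [symmetric]) auto
    also have "\<dots> = (\<Sum>p\<in>parts_upto d. up_word_adj beta (?w T) ?A p * mcoeff (first_vars s (Groth p)) \<gamma>)"
    proof (rule sum.cong [OF refl])
      fix p assume p: "p \<in> parts_upto d"
      have "{q \<in> ?S. foldr up (?w T) q = p} = {q. is_partition q \<and> foldr up (?w T) q = p}"
      proof (intro equalityI subsetI)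
        fix q assume "q \<in> {q. is_partition q \<and> foldr up (?w T) q = p}"
        then have q: "is_partition q" "foldr up (?w T) q = p" by auto
        have "seq_size q \<le> seq_size p" using foldr_up_props [OF q(1), of "?w T"] q(2) by simp
        then show "q \<in> {q \<in> ?S. foldr up (?w T) q = p}" using q p by (auto simp: parts_upto_def)
      qed (auto simp: parts_upto_def)
      then show "(\<Sum>q\<in>{q \<in> ?S. foldr up (?w T) q = p}. ?f q) = up_word_adj beta (?w T) ?A p * mcoeff (first_vars s (Groth p)) \<gamma>"
        unfolding up_word_adj_word_coeff sum_distrib_right by (intro sum.cong) auto
    qed
    finally show "sum ?f (parts_upto d) = (\<Sum>p\<in>parts_upto d. up_word_adj beta (?w T) ?A p * mcoeff (first_vars s (Groth p)) \<gamma>)" .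
  qed
  finally show ?thesis .
qed

abbreviation diag_word :: "shape \<Rightarrow> (nat \<times> nat \<Rightarrow> nat) \<Rightarrow> nat list" where
  "diag_word k T \<equiv> column_word k (\<lambda>_. 0) T"

abbreviation conj_tabs :: "nat \<Rightarrow> shape \<Rightarrow> shape \<Rightarrow> (nat \<times> nat \<Rightarrow> nat) set" where
  "conj_tabs s v k \<equiv> tab_rev s (skew_diagram (conj_part v) (conj_part k))"

abbreviation conj_word :: "shape \<Rightarrow> shape \<Rightarrow> (nat \<times> nat \<Rightarrow> nat) \<Rightarrow> nat list" where
  "conj_word v k T \<equiv> column_word (conj_part v) (conj_part k) T"

text \<open>The expansion of \<open>super_schur\<close> with its second half left open:
  \<open>F\<close> receives the raised partition and the word meant for \<mu>. The same sum then
  serves transposed words, rook sums and words in the U.\<close>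

definition super_terms ::
  "nat \<Rightarrow> nat \<Rightarrow> shape \<Rightarrow> shape \<Rightarrow> (shape \<Rightarrow> nat list \<Rightarrow> K) \<Rightarrow> K" where
  "super_terms r s v l F = (\<Sum>k | is_partition k \<and> k \<le> v. (-1) ^ skew_size v k *
     (\<Sum>T\<in>tab {..<r} (diag k). word_coeff beta (diag_word k T) l *
       (\<Sum>T'\<in>conj_tabs s v k. F (foldr up (diag_word k T) l) (conj_word v k T'))))"

lemma super_terms_cong:
  assumes l: "is_partition l" and "\<And>l' w. is_partition l' \<Longrightarrow> l \<le> l' \<Longrightarrow> F l' w = G l' w"
  shows "super_terms r s v l F = super_terms r s v l G"
  unfolding super_terms_def by (simp only: assms(2) foldr_up_props [OF l])

text \<open>Linearity in \<open>F\<close>, applied to sums over the index q of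
  \<open>Groth q\<close> and over sets of corners.\<close>

lemma super_terms_sum: "(\<Sum>a\<in>A. c a * super_terms r s v l (F a)) = super_terms r s v l (\<lambda>l' w. \<Sum>a\<in>A. c a * F a l' w)"
proof -
  have swap: "(\<Sum>a\<in>A. \<Sum>x\<in>X. h a x) = (\<Sum>x\<in>X. \<Sum>a\<in>A. h a x)" for X :: "'x set" and h :: "_ \<Rightarrow> 'x \<Rightarrow> K"
    by (rule sum.swap)
  have "(\<Sum>a\<in>A. c a * super_terms r s v l (F a)) = (\<Sum>k | is_partition k \<and> k \<le> v. \<Sum>a\<in>A. c a * ((-1) ^ skew_size v k *
     (\<Sum>T\<in>tab {..<r} (diag k). word_coeff beta (diag_word k T) l *
       (\<Sum>T'\<in>conj_tabs s v k. F a (foldr up (diag_word k T) l) (conj_word v k T')))))"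
    unfolding super_terms_def sum_distrib_left [of "c _" _ "{k. is_partition k \<and> k \<le> v}"] by (rule sum.swap)
  also have "\<dots> = super_terms r s v l (\<lambda>l' w. \<Sum>a\<in>A. c a * F a l' w)"
    unfolding super_terms_def
  proof (rule sum.cong [OF refl])
    fix k
    let ?W = "\<lambda>T. word_coeff beta (diag_word k T) l" and ?l = "\<lambda>T. foldr up (diag_word k T) l"
    have "(\<Sum>a\<in>A. c a * ((-1) ^ skew_size v k * (\<Sum>T\<in>tab {..<r} (diag k). ?W T * (\<Sum>T'\<in>conj_tabs s v k. F a (?l T) (conj_word v k T')))))
      = (-1) ^ skew_size v k * (\<Sum>a\<in>A. \<Sum>T\<in>tab {..<r} (diag k). ?W T * (\<Sum>T'\<in>conj_tabs s v k. c a * F a (?l T) (conj_word v k T')))"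
      unfolding sum_distrib_left by (simp only: mult_ac)
    also have "(\<Sum>a\<in>A. \<Sum>T\<in>tab {..<r} (diag k). ?W T * (\<Sum>T'\<in>conj_tabs s v k. c a * F a (?l T) (conj_word v k T')))
      = (\<Sum>T\<in>tab {..<r} (diag k). \<Sum>a\<in>A. ?W T * (\<Sum>T'\<in>conj_tabs s v k. c a * F a (?l T) (conj_word v k T')))"
      by (rule swap)
    also have "\<dots> = (\<Sum>T\<in>tab {..<r} (diag k). ?W T * (\<Sum>T'\<in>conj_tabs s v k. \<Sum>a\<in>A. c a * F a (?l T) (conj_word v k T')))"
      by (rule sum.cong [OF refl], subst sum_distrib_left [symmetric], subst swap, rule refl)
    finally show "(\<Sum>a\<in>A. c a * ((-1) ^ skew_size v k * (\<Sum>T\<in>tab {..<r} (diag k). ?W T * (\<Sum>T'\<in>conj_tabs s v k. F a (?l T) (conj_word v k T')))))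
      = (-1) ^ skew_size v k * (\<Sum>T\<in>tab {..<r} (diag k). ?W T * (\<Sum>T'\<in>conj_tabs s v k. \<Sum>a\<in>A. c a * F a (?l T) (conj_word v k T')))" .
  qed
  finally show ?thesis .
qed

text \<open>The coefficient of x^\<alpha> y^\<gamma> in s_v(x) G_l(x, y) is computed twice: by the
  coproduct, leaving s_v(x) alone, and by the supersymmetric expansion, which acts on l and on the
  index q. In s variables y only the G_q(y) with q of length at most s are nonzero, hence the
  condition on p.\<close>

lemma schur_Groth_dskew:
  assumes v: "is_partition v" and l: "is_partition l" and p: "is_partition p" "part_length p \<le> s"
    and \<alpha>: "ks \<alpha> \<subseteq> {..<N}"
  shows "mcoeff (schur v * Groth_dskew l p) \<alpha> = super_terms (N + s) s v l
    (\<lambda>l' w. up_word_adj beta (rev w) (\<lambda>q. mcoeff (Groth_dskew l' q) \<alpha>) p)"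
proof -
  define C where "C p = mcoeff (schur v * Groth_dskew l p) \<alpha>" for p
  define B where "B p = super_terms (N + s) s v l (\<lambda>l' w. up_word_adj beta (rev w) (\<lambda>q. mcoeff (Groth_dskew l' q) \<alpha>) p)" for p
  let ?K = "{k. is_partition k \<and> k \<le> v}"
  let ?D = "\<lambda>k. skew_diagram (conj_part v) (conj_part k)"
  let ?l = "\<lambda>k T. foldr up (diag_word k T) l"
  have "(\<Sum>q\<in>parts_upto (mdeg \<gamma>). (C q - B q) * mcoeff (Groth q) \<gamma>) = 0" if \<gamma>: "ks \<gamma> \<subseteq> {..<s}" for \<gamma>
  proof -
    let ?X = "mcoeff (slice N \<alpha> (tab_poly N (diag v) * first_vars (N + s) (Groth l))) \<gamma>"
    have f0: "mcoeff (schur v) a = mcoeff (tab_poly N (diag v)) a" if "ks a \<subseteq> {..<N}" for a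
      using that by (simp add: first_vars_schur [OF v, symmetric] mcoeff_first_vars)
    have "?X = (\<Sum>(a, b)\<in>splits \<alpha>. mcoeff (tab_poly N (diag v)) a * mcoeff (first_vars (N + s) (Groth l)) (b + shiftm N \<gamma>))"
    proof (rule mcoeff_slice_mult [OF _ \<alpha>])
      fix m assume "mcoeff (tab_poly N (diag v)) m \<noteq> 0"
      then show "ks m \<subseteq> {..<N}" by (auto simp: first_vars_schur [OF v, symmetric] mcoeff_first_vars split: if_splits)
    qed
    also have "\<dots> = (\<Sum>(a, b)\<in>splits \<alpha>. mcoeff (schur v) a * (\<Sum>q\<in>parts_upto (mdeg \<gamma>). mcoeff (Groth_dskew l q) b * mcoeff (Groth q) \<gamma>))"
    proof (rule sum.cong [OF refl], clarify)
      fix a b assume "(a, b) \<in> splits \<alpha>"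
      then have ab: "ks a \<subseteq> {..<N}" "ks b \<subseteq> {..<N}" using \<alpha> by (auto simp: splits_def keys_add_nat)
      then have "ks (b + shiftm N \<gamma>) \<subseteq> {..<N + s}" using \<gamma> by (auto simp: keys_add_nat keys_shiftm)
      then show "mcoeff (tab_poly N (diag v)) a * mcoeff (first_vars (N + s) (Groth l)) (b + shiftm N \<gamma>)
        = mcoeff (schur v) a * (\<Sum>q\<in>parts_upto (mdeg \<gamma>). mcoeff (Groth_dskew l q) b * mcoeff (Groth q) \<gamma>)"
        by (simp add: f0 [OF ab(1)] mcoeff_first_vars Groth_coproduct_slice [OF l ab(2) \<gamma> order_refl])
    qed
    also have "\<dots> = (\<Sum>q\<in>parts_upto (mdeg \<gamma>). C q * mcoeff (Groth q) \<gamma>)"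
      unfolding C_def mcoeff_mult sum_distrib_left sum_distrib_right case_prod_unfold
      by (subst sum.swap) (simp only: mult.assoc)
    finally have X: "?X = (\<Sum>q\<in>parts_upto (mdeg \<gamma>). C q * mcoeff (Groth q) \<gamma>)" .
    have "tab_poly N (diag v) * first_vars (N + s) (Groth l)
      = (\<Sum>k\<in>?K. mconst ((-1) ^ skew_size v k) * (\<Sum>T'\<in>conj_tabs s v k. xpow (shiftm N (content (?D k) T')) *
          (tab_poly (N + s) (diag k) * first_vars (N + s) (Groth l))))"
      unfolding super_expansion [OF v refl, of N s] sum_distrib_right
      by (rule sum.cong [OF refl]) (simp only: sum_distrib_left sum_distrib_right mult_ac)
    also have "\<dots> = (\<Sum>k\<in>?K. mconst ((-1) ^ skew_size v k) * (\<Sum>T'\<in>conj_tabs s v k. xpow (shiftm N (content (?D k) T')) *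
          (\<Sum>T\<in>tab {..<N + s} (diag k). mconst (word_coeff beta (diag_word k T) l) * first_vars (N + s) (Groth (?l k T)))))"
    proof (rule sum.cong [OF refl])
      fix k assume "k \<in> ?K"
      then have k: "is_partition k" by simp
      show "mconst ((-1) ^ skew_size v k) * (\<Sum>T'\<in>conj_tabs s v k. xpow (shiftm N (content (?D k) T')) *
          (tab_poly (N + s) (diag k) * first_vars (N + s) (Groth l))) = mconst ((-1) ^ skew_size v k) *
          (\<Sum>T'\<in>conj_tabs s v k. xpow (shiftm N (content (?D k) T')) *
          (\<Sum>T\<in>tab {..<N + s} (diag k). mconst (word_coeff beta (diag_word k T) l) * first_vars (N + s) (Groth (?l k T))))"
        unfolding column_word_eq_cword
        unfolding tab_poly_Groth [OF convex_diag_diag [OF k] skew_diagram_subset [OF k] l] ..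
    qed
    finally have SPG: "tab_poly N (diag v) * first_vars (N + s) (Groth l)
      = (\<Sum>k\<in>?K. mconst ((-1) ^ skew_size v k) * (\<Sum>T'\<in>conj_tabs s v k. xpow (shiftm N (content (?D k) T')) *
          (\<Sum>T\<in>tab {..<N + s} (diag k). mconst (word_coeff beta (diag_word k T) l) * first_vars (N + s) (Groth (?l k T)))))" .
    have "slice N \<alpha> (tab_poly N (diag v) * first_vars (N + s) (Groth l)) = (\<Sum>k\<in>?K. mconst ((-1) ^ skew_size v k) * (\<Sum>T'\<in>conj_tabs s v k. xpow (content (?D k) T') *
          (\<Sum>T\<in>tab {..<N + s} (diag k). mconst (word_coeff beta (diag_word k T) l) * slice N \<alpha> (first_vars (N + s) (Groth (?l k T))))))"
      unfolding SPG by (simp only: slice_sum slice_mconst slice_xpow [OF \<alpha>])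
    also have "\<dots> = (\<Sum>k\<in>?K. mconst ((-1) ^ skew_size v k) * (\<Sum>T\<in>tab {..<N + s} (diag k). mconst (word_coeff beta (diag_word k T) l) *
          ((\<Sum>T'\<in>conj_tabs s v k. xpow (content (?D k) T')) * slice N \<alpha> (first_vars (N + s) (Groth (?l k T))))))"
    proof (rule sum.cong [OF refl], rule arg_cong [of _ _ "(*) _"])
      fix k
      show "(\<Sum>T'\<in>conj_tabs s v k. xpow (content (?D k) T') * (\<Sum>T\<in>tab {..<N + s} (diag k).
          mconst (word_coeff beta (diag_word k T) l) * slice N \<alpha> (first_vars (N + s) (Groth (?l k T)))))
        = (\<Sum>T\<in>tab {..<N + s} (diag k). mconst (word_coeff beta (diag_word k T) l) *
          ((\<Sum>T'\<in>conj_tabs s v k. xpow (content (?D k) T')) * slice N \<alpha> (first_vars (N + s) (Groth (?l k T)))))"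
        unfolding sum_distrib_left sum_distrib_right by (subst sum.swap) (simp only: mult_ac)
    qed
    finally have sl: "slice N \<alpha> (tab_poly N (diag v) * first_vars (N + s) (Groth l))
      = (\<Sum>k\<in>?K. mconst ((-1) ^ skew_size v k) * (\<Sum>T\<in>tab {..<N + s} (diag k). mconst (word_coeff beta (diag_word k T) l) *
          ((\<Sum>T'\<in>conj_tabs s v k. xpow (content (?D k) T')) * slice N \<alpha> (first_vars (N + s) (Groth (?l k T))))))" .
    have "?X = super_terms (N + s) s v l (\<lambda>l' w. \<Sum>q\<in>parts_upto (mdeg \<gamma>).
        mcoeff (Groth q) \<gamma> * up_word_adj beta (rev w) (\<lambda>q. mcoeff (Groth_dskew l' q) \<alpha>) q)"
      unfolding sl mcoeff_sum mcoeff_mconst_mult super_terms_def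
    proof (rule sum.cong [OF refl])
      fix k assume "k \<in> ?K"
      then have k: "is_partition k" by simp
      show "(-1) ^ skew_size v k * (\<Sum>T\<in>tab {..<N + s} (diag k). word_coeff beta (diag_word k T) l *
          mcoeff ((\<Sum>T'\<in>conj_tabs s v k. xpow (content (?D k) T')) * slice N \<alpha> (first_vars (N + s) (Groth (?l k T)))) \<gamma>)
        = (-1) ^ skew_size v k * (\<Sum>T\<in>tab {..<N + s} (diag k). word_coeff beta (diag_word k T) l *
          (\<Sum>T'\<in>conj_tabs s v k. \<Sum>q\<in>parts_upto (mdeg \<gamma>).
            mcoeff (Groth q) \<gamma> * up_word_adj beta (rev (conj_word v k T')) (\<lambda>q. mcoeff (Groth_dskew (?l k T) q) \<alpha>) q))"
      proof (rule arg_cong [of _ _ "(*) _"], rule sum.cong [OF refl], rule arg_cong [of _ _ "(*) _"])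
        fix T
        have "is_partition (?l k T)" using foldr_up_props [OF l] by blast
        then show "mcoeff ((\<Sum>T'\<in>conj_tabs s v k. xpow (content (?D k) T')) * slice N \<alpha> (first_vars (N + s) (Groth (?l k T)))) \<gamma>
          = (\<Sum>T'\<in>conj_tabs s v k. \<Sum>q\<in>parts_upto (mdeg \<gamma>).
            mcoeff (Groth q) \<gamma> * up_word_adj beta (rev (conj_word v k T')) (\<lambda>q. mcoeff (Groth_dskew (?l k T) q) \<alpha>) q)"
          using \<gamma> by (simp only: tab_rev_slice [OF v k _ \<alpha> order_refl] mcoeff_first_vars if_True mult.commute)
      qed
    qed
    also have "\<dots> = (\<Sum>q\<in>parts_upto (mdeg \<gamma>). mcoeff (Groth q) \<gamma> * B q)"
      unfolding B_def by (rule super_terms_sum [symmetric])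
    finally show ?thesis using X by (simp add: left_diff_distrib right_diff_distrib sum_subtractf mult.commute)
  qed
  from Groth_coeffs_independent [OF this p] show ?thesis by (simp add: B_def C_def)
qed

text \<open>Both sides have the same rook sums at every p \<le> m: there the double-slash identity
  applies, and transposed words pass through the rook sum as words in \<open>down\<close>. All
  indices satisfy q \<le> p \<le> m \<le> l \<le> l', so the rook expansion of
  \<open>Groth_dskew\<close> is always at hand.\<close>

lemma schur_Groth_skew:
  assumes v: "is_partition v" and l: "is_partition l" and m: "is_partition m" "part_length m \<le> s" "m \<le> l"
    and \<alpha>: "ks \<alpha> \<subseteq> {..<N}"
  shows "mcoeff (schur v * Groth_skew l m) \<alpha> = super_terms (N + s) s v l
    (\<lambda>l' w. foldr (down beta) (rev w) (\<lambda>q. mcoeff (Groth_skew l' q) \<alpha>) m)"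
proof (rule rook_sum_inject [where b = beta and X = "\<lambda>m. mcoeff (schur v * Groth_skew l m) \<alpha>", OF _ m(1)])
  fix p assume p: "is_partition p" "p \<le> m"
  have dsk: "mcoeff (Groth_dskew l' q) \<alpha> = rook_sum beta (\<lambda>q. mcoeff (Groth_skew l' q) \<alpha>) q"
    if "is_partition l'" "is_partition q" "q \<le> l'" for l' q \<alpha>
    unfolding Groth_dskew_rook [OF that] rook_sum_eq [OF that(2)] by (simp add: mcoeff_sum mcoeff_mconst_mult)
  have ps: "part_length p \<le> s" using part_length_mono [OF p(1) m(1) p(2)] m(2) by simp
  have pl: "p \<le> l" using p(2) m(3) by (rule order_trans)
  have "rook_sum beta (\<lambda>m. mcoeff (schur v * Groth_skew l m) \<alpha>) p = mcoeff (schur v * Groth_dskew l p) \<alpha>"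
    unfolding rook_sum_eq [OF p(1)] Groth_dskew_rook [OF l p(1) pl] sum_distrib_left
    by (simp add: mcoeff_sum mult.left_commute [of "schur v"] mcoeff_mconst_mult)
  also have "\<dots> = super_terms (N + s) s v l (\<lambda>l' w. up_word_adj beta (rev w) (\<lambda>q. mcoeff (Groth_dskew l' q) \<alpha>) p)"
    by (rule schur_Groth_dskew [OF v l p(1) ps \<alpha>])
  also have "\<dots> = super_terms (N + s) s v l
      (\<lambda>l' w. rook_sum beta (foldr (down beta) (rev w) (\<lambda>q. mcoeff (Groth_skew l' q) \<alpha>)) p)"
  proof (rule super_terms_cong [OF l])
    fix l' :: shape and w :: "nat list" assume l': "is_partition l'" "l \<le> l'"
    have "up_word_adj beta (rev w) (\<lambda>q. mcoeff (Groth_dskew l' q) \<alpha>) p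
      = up_word_adj beta (rev w) (rook_sum beta (\<lambda>q. mcoeff (Groth_skew l' q) \<alpha>)) p"
    proof (rule up_word_adj_cong)
      fix q assume q: "is_partition q" "q \<le> p"
      have "q \<le> l'" using q(2) pl l'(2) by (meson order_trans)
      then show "mcoeff (Groth_dskew l' q) \<alpha> = rook_sum beta (\<lambda>q. mcoeff (Groth_skew l' q) \<alpha>) q"
        by (rule dsk [OF l'(1) q(1)])
    qed
    also have "\<dots> = rook_sum beta (foldr (down beta) (rev w) (\<lambda>q. mcoeff (Groth_skew l' q) \<alpha>)) p"
      by (rule up_word_adj_rook_sum [OF p(1)])
    finally show "up_word_adj beta (rev w) (\<lambda>q. mcoeff (Groth_dskew l' q) \<alpha>) p
      = rook_sum beta (foldr (down beta) (rev w) (\<lambda>q. mcoeff (Groth_skew l' q) \<alpha>)) p" .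
  qed
  also have "\<dots> = rook_sum beta (\<lambda>m. super_terms (N + s) s v l
    (\<lambda>l' w. foldr (down beta) (rev w) (\<lambda>q. mcoeff (Groth_skew l' q) \<alpha>) m)) p"
    unfolding rook_sum_def super_terms_sum ..
  finally show "rook_sum beta (\<lambda>m. mcoeff (schur v * Groth_skew l m) \<alpha>) p
    = rook_sum beta (\<lambda>m. super_terms (N + s) s v l
    (\<lambda>l' w. foldr (down beta) (rev w) (\<lambda>q. mcoeff (Groth_skew l' q) \<alpha>) m)) p" .
qed

subsection \<open>The operators on pairs of partitions\<close>

lemma lookup_scale: "lk (scale c v) a = c * lk v a"
  by (simp add: scale_def Poly_Mapping.map.rep_eq when_def)

lemma scale_single: "scale c (sg a d) = sg a (c * d)"
  by (rule poly_mapping_eqI) (simp add: lookup_scale lookup_single when_def)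

lemma scale_0: "scale c 0 = 0"
  by (rule poly_mapping_eqI) (simp add: lookup_scale)

lemma lin_ext_superset:
  assumes "finite A" "ks v \<subseteq> A"
  shows "lin_ext f v = (\<Sum>a\<in>A. scale (lk v a) (f a))"
  unfolding lin_ext_def
proof (rule sum.mono_neutral_left [OF assms], rule ballI)
  fix a assume "a \<in> A - ks v"
  then have "lk v a = 0" by (simp add: in_keys_iff)
  then show "scale (lk v a) (f a) = 0" by (intro poly_mapping_eqI) (simp add: lookup_scale)
qed

lemma lin_ext_single: "lin_ext f (sg a c) = scale c (f a)"
  by (subst lin_ext_superset [of "{a}"]) auto

lemma lin_ext_0: "lin_ext f 0 = 0"
  by (simp add: lin_ext_def)

lemma lin_ext_add: "lin_ext f (v + w) = lin_ext f v + lin_ext f w"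
proof -
  let ?A = "ks v \<union> ks w"
  have "lin_ext f (v + w) = (\<Sum>a\<in>?A. scale (lk (v + w) a) (f a))"
    using Poly_Mapping.keys_add [of v w] by (intro lin_ext_superset) simp_all
  also have "\<dots> = (\<Sum>a\<in>?A. scale (lk v a) (f a) + scale (lk w a) (f a))"
    by (rule sum.cong [OF refl], rule poly_mapping_eqI) (simp add: lookup_scale lookup_add distrib_right)
  also have "\<dots> = lin_ext f v + lin_ext f w"
    by (simp add: sum.distrib lin_ext_superset [of ?A])
  finally show ?thesis .
qed

text \<open>A suffix maximum sees the new box of row i only in those earlier rows that had the
  length of row i.\<close>

lemma over_seq_eq_up:
  assumes p: "is_partition p"
  shows "over_seq (p(i := p i + 1)) = up i p"
proof
  fix k
  let ?a = "p(i := p i + 1)"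
  have ub: "?a j \<le> p k + 1" if "k \<le> j" for j
  proof (cases "j = i")
    case True
    then show ?thesis using partition_antimono [OF p that] by simp
  next
    case False
    then show ?thesis using partition_antimono [OF p that] by simp
  qed
  have "?a ` {k..} \<subseteq> {..p k + 1}"
  proof (rule image_subsetI)
    fix j assume "j \<in> {k..}"
    then have "?a j \<le> p k + 1" by (intro ub) simp
    then show "?a j \<in> {..p k + 1}" by (simp only: atMost_iff)
  qed
  then have fin: "finite (?a ` {k..})" by (rule finite_subset) simp
  have "Max (?a ` {k..}) = up i p k"
  proof (cases "k \<le> i \<and> p k = p i")
    case True
    then have "up i p k = ?a i" by (auto simp: raise_def raised_def)
    moreover have "?a i \<in> ?a ` {k..}" using True by blast
    moreover have "y \<le> ?a i" if "y \<in> ?a ` {k..}" for y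
    proof -
      from that obtain j where "y = ?a j" "j \<in> {k..}" by (rule imageE)
      moreover have "?a i = p k + 1" using True by simp
      ultimately show ?thesis using ub [of j] by (simp only: atLeast_iff)
    qed
    ultimately show ?thesis using fin by (metis Max_eqI)
  next
    case False
    then have v: "up i p k = ?a k" by (auto simp: raise_def raised_def)
    have le: "?a j \<le> ?a k" if "k \<le> j" for j
    proof (cases "j = i")
      case True
      then have "p i < p k" using False that partition_antimono [OF p, of k i] by auto
      then show ?thesis using True by auto
    qed (use partition_antimono [OF p that] in auto)
    then have "y \<le> ?a k" if "y \<in> ?a ` {k..}" for y using that by blast
    moreover have "?a k \<in> ?a ` {k..}" by blast
    ultimately have "Max (?a ` {k..}) = ?a k" by (intro Max_eqI [OF fin])
    then show ?thesis using v by simp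
  qed
  then show "over_seq ?a k = up i p k" by (simp only: over_seq_def)
qed

lemma seq_size_incr:
  assumes p: "is_partition p"
  shows "seq_size (p(i := p i + 1)) = seq_size p + 1"
proof -
  let ?A = "{..<max (Suc i) (part_length p)}" and ?a = "p(i := p i + 1)"
  have "{k. ?a k \<noteq> 0} \<subseteq> insert i {k. p k \<noteq> 0}" by auto
  then have sub: "{k. p k \<noteq> 0} \<subseteq> ?A" "{k. ?a k \<noteq> 0} \<subseteq> ?A"
    unfolding partition_support [OF p] by auto
  have "sum ?a ?A = ?a i + sum ?a (?A - {i})" "sum p ?A = p i + sum p (?A - {i})"
    by (rule sum.remove; simp)+
  moreover have "sum ?a (?A - {i}) = sum p (?A - {i})" by (rule sum.cong) auto
  ultimately have "sum ?a ?A = sum p ?A + 1" by simp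
  then show ?thesis
    using seq_size_superset [OF _ sub(1)] seq_size_superset [OF _ sub(2)] by (simp del: fun_upd_apply)
qed

lemma u_op_single:
  assumes p: "is_partition p"
  shows "u_op i (sg (p, q) c) = sg (up i p, q) (c * neg_beta_pow (seq_size (up i p) - seq_size p - 1))"
proof -
  have "u_part i p = sg (up i p) (neg_beta_pow (seq_size (up i p) - seq_size p - 1))"
    unfolding u_part_def Let_def over_seq_eq_up [OF p] seq_size_incr [OF p] by simp
  then show ?thesis by (simp add: u_op_def lin_ext_single scale_single)
qed

lemma neg_beta_pow_add: "neg_beta_pow (d + e) = neg_beta_pow d * neg_beta_pow e"
  by (simp only: neg_beta_pow_def power_add)

lemma word_op_u_single:
  assumes p: "is_partition p"
  shows "word_op u_op w (sg (p, q) c) = sg (foldr up w p, q) (c * neg_beta_pow (seq_size (foldr up w p) - seq_size p - length w))"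
proof (induction w)
  case Nil
  show ?case by (simp add: word_op_def neg_beta_pow_def)
next
  case (Cons i w)
  let ?p = "foldr up w p"
  have p': "is_partition ?p" "seq_size p + length w \<le> seq_size ?p" using foldr_up_props [OF p, of w] by auto
  have "seq_size ?p + 1 \<le> seq_size (up i ?p)" using foldr_up_props [OF p'(1), of "[i]"] by simp
  then have e: "seq_size (foldr up (i # w) p) - seq_size p - length (i # w)
    = (seq_size ?p - seq_size p - length w) + (seq_size (up i ?p) - seq_size ?p - 1)"
    using p'(2) by simp
  have "word_op u_op (i # w) (sg (p, q) c) = u_op i (word_op u_op w (sg (p, q) c))" by (simp add: word_op_def)
  also have "\<dots> = sg (up i ?p, q) (c * neg_beta_pow (seq_size ?p - seq_size p - length w) *
      neg_beta_pow (seq_size (up i ?p) - seq_size ?p - 1))"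
    unfolding Cons.IH by (rule u_op_single [OF p'(1)])
  also have "\<dots> = sg (foldr up (i # w) p, q) (c * neg_beta_pow (seq_size (foldr up (i # w) p) - seq_size p - length (i # w)))"
    unfolding e neg_beta_pow_add by (simp only: mult.assoc foldr.simps comp_apply)
  finally show ?case .
qed

text \<open>Dually to \<open>over_seq_eq_up\<close>, a prefix minimum passes the loss of a box on to
  the later rows of the same length.\<close>

lemma under_seq_eq_drop_boxes:
  assumes q: "is_partition q" and i: "0 < q i"
  shows "under_seq (q(i := q i - 1)) = drop_boxes {k. i \<le> k \<and> q k = q i} q"
proof
  fix k
  let ?a = "q(i := q i - 1)"
  let ?R = "drop_boxes {k. i \<le> k \<and> q k = q i} q"
  have fin: "finite (?a ` {..k})" by simp
  have lb: "q k \<le> q j" if "j \<le> k" for j by (rule partition_antimono [OF q that])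
  have "Min (?a ` {..k}) = ?R k"
  proof (cases "i \<le> k \<and> q k = q i")
    case True
    then have v: "?R k = ?a i" unfolding drop_boxes_def by simp
    have "?a i \<le> y" if "y \<in> ?a ` {..k}" for y
    proof -
      from that obtain j where yj: "y = ?a j" and "j \<in> {..k}" by (rule imageE)
      then have j: "j \<le> k" "y = ?a j" by simp_all
      have "q i \<le> q j" using lb [OF j(1)] True by simp
      then show ?thesis unfolding j(2) by auto
    qed
    moreover have "?a i \<in> ?a ` {..k}" using True by blast
    ultimately have "Min (?a ` {..k}) = ?a i" by (intro Min_eqI [OF fin])
    then show ?thesis using v by simp
  next
    case False
    then have v: "?R k = ?a k" by (auto simp: drop_boxes_def)
    have "?a k \<le> y" if "y \<in> ?a ` {..k}" for y
    proof -
      from that obtain j where yj: "y = ?a j" and "j \<in> {..k}" by (rule imageE)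
      then have j: "j \<le> k" "y = ?a j" by simp_all
      have ki: "k \<noteq> i" using False by blast
      show ?thesis
      proof (cases "j = i")
        case True
        then have "q k < q i" using False lb [OF j(1)] j(1) by auto
        then show ?thesis using True ki j by simp
      qed (use lb [OF j(1)] ki j in simp)
    qed
    moreover have "?a k \<in> ?a ` {..k}" by blast
    ultimately have "Min (?a ` {..k}) = ?a k" by (intro Min_eqI [OF fin])
    then show ?thesis using v by simp
  qed
  then show "under_seq ?a k = ?R k" by (simp only: under_seq_def)
qed

lemma partition_drop_boxes_block:
  assumes q: "is_partition q" and i: "0 < q i"
  shows "is_partition (drop_boxes {k. i \<le> k \<and> q k = q i} q)"
proof (rule is_partitionI)
  fix k
  show "drop_boxes {k. i \<le> k \<and> q k = q i} q (Suc k) \<le> drop_boxes {k. i \<le> k \<and> q k = q i} q k"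
    using partition_antimono [OF q, of k "Suc k"] by (auto simp: drop_boxes_def)
next
  show "drop_boxes {k. i \<le> k \<and> q k = q i} q (part_length q) = 0"
    using partition_beyond [OF q order_refl order_refl] by (simp add: drop_boxes_def)
qed

lemma seq_size_under:
  assumes q: "is_partition q" and i: "0 < q i"
  shows "seq_size (q(i := q i - 1)) - seq_size (drop_boxes {k. i \<le> k \<and> q k = q i} q) = card {k. i < k \<and> q k = q i}"
proof -
  let ?A = "{..<part_length q}" and ?a = "q(i := q i - 1)" and ?S = "{k. i \<le> k \<and> q k = q i}"
  have sub: "{k. q k \<noteq> 0} \<subseteq> ?A" unfolding partition_support [OF q] ..
  have "{k. ?a k \<noteq> 0} \<subseteq> {k. q k \<noteq> 0}" using i by auto
  then have sub': "{k. ?a k \<noteq> 0} \<subseteq> ?A" unfolding partition_support [OF q] .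
  have iA: "i \<in> ?A" using i partition_nonzero_iff [OF q, of i] by simp
  have "sum ?a ?A = ?a i + sum ?a (?A - {i})" "sum q ?A = q i + sum q (?A - {i})"
    by (rule sum.remove; use iA in simp)+
  moreover have "sum ?a (?A - {i}) = sum q (?A - {i})" by (rule sum.cong) auto
  ultimately have "sum ?a ?A + 1 = sum q ?A" using i by simp
  then have 1: "seq_size ?a + 1 = seq_size q"
    using seq_size_superset [OF _ sub] seq_size_superset [OF _ sub'] by (simp del: fun_upd_apply)
  have 2: "seq_size q = seq_size (drop_boxes ?S q) + card ?S"
    by (rule seq_size_drop_boxes [OF q partition_drop_boxes_block [of q i, OF q i]]) (use i in auto)
  have "?S = insert i {k. i < k \<and> q k = q i}" by auto
  moreover have "finite {k. i < k \<and> q k = q i}"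
    by (rule finite_subset [OF _ partition_finite [OF q]]) (use i in auto)
  ultimately have "card ?S = Suc (card {k. i < k \<and> q k = q i})" by simp
  then show ?thesis using 1 2 by simp
qed

lemma U_op_single:
  assumes q: "is_partition q"
  shows "U_op i (sg (p, q) c) = (if q i = 0 then 0 else
    sg (p, drop_boxes {k. i \<le> k \<and> q k = q i} q) (c * neg_beta_pow (card {k. i < k \<and> q k = q i})))"
proof (cases "q i = 0")
  case True
  then show ?thesis by (simp add: U_op_def U_part_def lin_ext_single lin_ext_0 scale_0)
next
  case False
  then have i: "0 < q i" by simp
  have "U_part i q = sg (drop_boxes {k. i \<le> k \<and> q k = q i} q) (neg_beta_pow (card {k. i < k \<and> q k = q i}))"
    unfolding U_part_def Let_def under_seq_eq_drop_boxes [of q i, OF q i] seq_size_under [of q i, OF q i] using i by simp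
  then show ?thesis using i by (simp add: U_op_def lin_ext_single scale_single)
qed

lemma word_op_U_0: "word_op U_op w 0 = 0"
  by (induction w) (simp_all add: word_op_def U_op_def lin_ext_0)

lemma word_op_U_add: "word_op U_op w (x + y) = word_op U_op w x + word_op U_op w y"
  by (induction w) (simp_all add: word_op_def U_op_def lin_ext_add)

lemma word_op_U_sum: "word_op U_op w (sum f A) = (\<Sum>a\<in>A. word_op U_op w (f a))"
  by (induction A rule: infinite_finite_induct) (simp_all add: word_op_U_0 word_op_U_add)

section \<open>Scalars and the map \<open>G_map\<close>\<close>

lemma scalar_emb_0: "scalar_emb 0 = 0"
  by (simp add: scalar_emb_def Zero_fract_def)

lemma scalar_emb_1: "scalar_emb 1 = 1"
  by (simp add: scalar_emb_def One_fract_def)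

lemma scalar_emb_add: "scalar_emb (a + b) = scalar_emb a + scalar_emb b"
proof -
  have "map_poly of_rat (a + b) = map_poly of_rat a + (map_poly of_rat b :: complex poly)"
    by (rule poly_eqI) (simp add: coeff_map_poly of_rat_add)
  then show ?thesis by (simp add: scalar_emb_def)
qed

lemma scalar_emb_mult: "scalar_emb (a * b) = scalar_emb a * scalar_emb b"
proof -
  have "map_poly of_rat (a * b) = map_poly of_rat a * (map_poly of_rat b :: complex poly)"
    by (rule poly_eqI) (simp add: coeff_map_poly coeff_mult of_rat_sum of_rat_mult)
  then show ?thesis by (simp add: scalar_emb_def)
qed

lemma scalar_emb_neg_one_power: "scalar_emb ((-1) ^ d) = (-1) ^ d"
proof (induction d)
  case (Suc d)
  have "scalar_emb (-1) + scalar_emb 1 = 0" unfolding scalar_emb_add [symmetric] by (simp add: scalar_emb_0)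
  then have "scalar_emb (-1) = -1" by (simp add: scalar_emb_1 eq_neg_iff_add_eq_0)
  then show ?case by (simp only: power_Suc scalar_emb_mult Suc.IH)
qed (simp add: scalar_emb_1)

lemma scalar_emb_neg_beta_pow: "scalar_emb (neg_beta_pow d) = (- beta) ^ d"
proof -
  have "scalar_emb (- [:0, 1:]) = - beta"
    by (simp add: scalar_emb_def beta_def map_poly_pCons)
  then show ?thesis
    unfolding neg_beta_pow_def by (induction d) (simp_all only: power_0 power_Suc scalar_emb_1 scalar_emb_mult)
qed

lemma mcoeff_G_map_superset:
  assumes "finite A" "ks v \<subseteq> A"
  shows "mcoeff (G_map v) \<alpha> = (\<Sum>x\<in>A. scalar_emb (lk v x) * mcoeff (Groth_skew (fst x) (snd x)) \<alpha>)"
proof -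
  have "mcoeff (G_map v) \<alpha> = (\<Sum>x\<in>ks v. scalar_emb (lk v x) * mcoeff (Groth_skew (fst x) (snd x)) \<alpha>)"
    by (simp add: G_map_def mcoeff_sum mcoeff_mconst_mult case_prod_unfold)
  also have "\<dots> = (\<Sum>x\<in>A. scalar_emb (lk v x) * mcoeff (Groth_skew (fst x) (snd x)) \<alpha>)"
    by (rule sum.mono_neutral_left [OF assms]) (auto simp: in_keys_iff scalar_emb_0)
  finally show ?thesis .
qed

lemma mcoeff_G_map_single: "mcoeff (G_map (sg (p, q) c)) \<alpha> = scalar_emb c * mcoeff (Groth_skew p q) \<alpha>"
  by (subst mcoeff_G_map_superset [of "{(p, q)}"]) auto

lemma mcoeff_G_map_add: "mcoeff (G_map (v + w)) \<alpha> = mcoeff (G_map v) \<alpha> + mcoeff (G_map w) \<alpha>"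
proof -
  let ?A = "ks v \<union> ks w"
  have "ks (v + w) \<subseteq> ?A" by (rule Poly_Mapping.keys_add)
  then show ?thesis
    by (simp add: mcoeff_G_map_superset [of ?A] lookup_add scalar_emb_add distrib_right sum.distrib)
qed

lemma G_map_0: "G_map 0 = 0"
  by (simp add: G_map_def)

lemma mcoeff_G_map_sum: "mcoeff (G_map (sum f A)) \<alpha> = (\<Sum>a\<in>A. mcoeff (G_map (f a)) \<alpha>)"
  by (induction A rule: infinite_finite_induct) (simp_all add: G_map_0 mcoeff_G_map_add)

lemma mcoeff_G_map_scale: "mcoeff (G_map (scale c v)) \<alpha> = scalar_emb c * mcoeff (G_map v) \<alpha>"
proof -
  have "ks (scale c v) \<subseteq> ks v" by (auto simp: in_keys_iff lookup_scale)
  then show ?thesis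
    by (simp add: mcoeff_G_map_superset [of "ks v"] lookup_scale scalar_emb_mult mult.assoc sum_distrib_left)
qed

text \<open>\<open>U_op\<close> moves basis vectors and \<open>down\<close> moves functions on them,
  so composition runs in the opposite order and the word is reversed. The induction removes the last
  letter, the one that acts first.\<close>

lemma mcoeff_G_map_word_op_U:
  assumes "is_partition q"
  shows "mcoeff (G_map (word_op U_op w (sg (p, q) c))) \<alpha>
    = scalar_emb c * foldr (down beta) (rev w) (\<lambda>q. mcoeff (Groth_skew p q) \<alpha>) q"
  using assms
proof (induction w arbitrary: q c rule: rev_induct)
  case Nil
  show ?case by (simp add: word_op_def mcoeff_G_map_single)
next
  case (snoc i w)
  let ?A = "\<lambda>q. mcoeff (Groth_skew p q) \<alpha>" and ?q = "drop_boxes {k. i \<le> k \<and> q k = q i} q" and ?n = "card {k. i < k \<and> q k = q i}"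
  have step: "word_op U_op (w @ [i]) (sg (p, q) c) = word_op U_op w (U_op i (sg (p, q) c))"
    by (simp add: word_op_def)
  have dn: "foldr (down beta) (rev (w @ [i])) ?A q = down beta i (foldr (down beta) (rev w) ?A) q" by simp
  show ?case
  proof (cases "q i = 0")
    case True
    then have "U_op i (sg (p, q) c) = 0" by (simp add: U_op_single [OF snoc.prems])
    then have "mcoeff (G_map (word_op U_op (w @ [i]) (sg (p, q) c))) \<alpha> = 0"
      by (simp only: step word_op_U_0 G_map_0) simp
    moreover have "down beta i (foldr (down beta) (rev w) ?A) q = 0" using True by (simp add: down_def)
    ultimately show ?thesis by (simp only: dn mult_zero_right)
  next
    case False
    then have U: "U_op i (sg (p, q) c) = sg (p, ?q) (c * neg_beta_pow ?n)" by (simp add: U_op_single [OF snoc.prems])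
    have "is_partition ?q" by (rule partition_drop_boxes_block [OF snoc.prems]) (use False in simp)
    then have "mcoeff (G_map (word_op U_op (w @ [i]) (sg (p, q) c))) \<alpha>
      = scalar_emb (c * neg_beta_pow ?n) * foldr (down beta) (rev w) ?A ?q"
      unfolding step U by (rule snoc.IH)
    moreover have "down beta i (foldr (down beta) (rev w) ?A) q = (- beta) ^ ?n * foldr (down beta) (rev w) ?A ?q"
      using False unfolding down_def by simp
    ultimately show ?thesis by (simp only: dn scalar_emb_mult scalar_emb_neg_beta_pow mult.assoc)
  qed
qed

text \<open>The operators u act first and on the first index only, so each tableau yields a multiple
  of one basis vector, to which the words in the U then apply.\<close>

lemma mcoeff_G_map_super_schur:
  assumes v: "is_partition v" and l: "is_partition l" and m: "is_partition m"
  shows "mcoeff (G_map (super_schur r s v (sg (l, m) 1))) \<alpha> = super_terms r s v l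
    (\<lambda>l' w. foldr (down beta) (rev w) (\<lambda>q. mcoeff (Groth_skew l' q) \<alpha>) m)"
proof -
  have u: "schur_u r k (\<lambda>_. 0) (sg (l, m) 1) = (\<Sum>T\<in>tab {..<r} (diag k).
    sg (foldr up (diag_word k T) l, m) (neg_beta_pow (seq_size (foldr up (diag_word k T) l) - seq_size l - length (diag_word k T))))" for k
    unfolding schur_u_def ssyt_less_eq_tab word_op_u_single [OF l] by simp
  show ?thesis
    unfolding super_schur_def schur_U_def ssyt_greater_eq_tab_rev u super_terms_def word_op_U_sum mcoeff_G_map_sum
      mcoeff_G_map_scale scalar_emb_neg_one_power mcoeff_G_map_word_op_U [OF m] scalar_emb_neg_beta_pow word_coeff_def
      sum_distrib_left
    by (rule sum.cong [OF refl], subst sum.swap, rule refl)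
qed

theorem proposition7p5:
  fixes lam mu nu :: shape and r s :: nat
  assumes "is_partition lam" and "is_partition mu" and "is_partition nu"
    and "mu \<le> lam"
    and "part_length lam \<le> r" and "part_length mu \<le> s"
  shows "schur nu * Groth_skew lam mu
           - G_map (super_schur r s nu (Poly_Mapping.single (lam, mu) 1))
         \<in> I_hat (int r - int s)"
proof -
  let ?f = "schur nu * Groth_skew lam mu - G_map (super_schur r s nu (sg (lam, mu) 1))"
  have G: "G_map v \<in> Lam_hat" for v
    unfolding G_map_def case_prod_unfold by (intro Lam_hat_sum Lam_hat_mconst_mult Groth_skew_Lam_hat)
  have "?f \<in> Lam_hat"
    by (intro Lam_hat_diff Lam_hat_mult Groth_skew_Lam_hat Lam_subset [OF schur_Lam] assms(3) G)
  \<comment> \<open>The r - s surviving variables are the alphabet x, so N = r - s and N + s = r;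
    for r < s the vanishing condition in \<open>I_hat\<close> is empty.\<close>
  moreover have "first_vars (nat (int r - int s)) ?f = 0" if "0 \<le> int r - int s"
  proof (rule mfps_eqI)
    fix \<alpha>
    have r: "r = nat (int r - int s) + s" using that by simp
    show "mcoeff (first_vars (nat (int r - int s)) ?f) \<alpha> = mcoeff 0 \<alpha>"
    proof (cases "ks \<alpha> \<subseteq> {..<nat (int r - int s)}")
      case True
      have "mcoeff (schur nu * Groth_skew lam mu) \<alpha> = super_terms r s nu lam
          (\<lambda>l' w. foldr (down beta) (rev w) (\<lambda>q. mcoeff (Groth_skew l' q) \<alpha>) mu)"
        using schur_Groth_skew [OF assms(3,1,2,6,4) True] unfolding r [symmetric] .
      then show ?thesis
        by (simp add: mcoeff_first_vars mcoeff_G_map_super_schur [OF assms(3,1,2)])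
    qed (simp add: mcoeff_first_vars)
  qed
  ultimately show ?thesis by (simp add: I_hat_def)
qed

end
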